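(* Let $\Omega\subset\mathbb{R}^d$ be a nonempty open set and let the coefficients $A=(a^{ij})$, $b=(b^i)$, $G=(g^{ij})$, $h=(h^i)$ on $\Omega$ satisfy conditions (H1), (H2), (H3) listed in the context, with some $p>d$ and $p'=p/(p-1)$. Suppose in addition that all functions $g^{ij}$ are continuous on $\Omega$, and let $D$ be a bounded domain with boundary $\partial D$ of class $C^2$ and $\overline{D}\subset\Omega$. Assume also that $\varrho\in L^{p'}(D)$ is a solution to the equation $$ {\rm div}^2(\varrho A)-{\rm div}(\varrho b)={\rm div}^2G-{\rm div}\,h $$ on $D$ (not on all of $\Omega$) and $\varrho(x)\ge 0$ for almost all $x\in D$. Then there exists a bounded (possibly signed) Borel measure $\eta$ on $\partial D$ such that $\varrho$ is a solution to the Dirichlet problem on $D$ for this equation with boundary condition $\varrho|_{\partial D}=\eta+\kappa\sigma_{d-1}$ (in the sense of the integral identity in the context). If it is given in advance that $\varrho\in L^\infty(D)$, then the assumption of nonnegativity of $\varrho$ can be omitted.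
   Context: $A=(a^{ij})_{i,j\le d}$ and $G=(g^{ij})_{i,j\le d}$ are mappings from $\Omega$ to symmetric $d\times d$ matrices and $b=(b^i)$, $h=(h^i)$ are vector fields on $\Omega$, all with Borel components ($G$ need not be nonnegative definite). For such a pair, $$ L_{A,b}u={\rm trace}(A D^2u)+\langle b,\nabla u\rangle,\qquad L_{G,h}u={\rm trace}(G D^2u)+\langle h,\nabla u\rangle . $$ Conditions: (H1) all $a^{ij}$ are continuous on $\Omega$ and there is a nondecreasing continuous function $\omega$ on $[0,+\infty)$ with $\omega(0)=0$ and $\|A(x)-A(y)\|\le\omega(|x-y|)$ for all $x,y\in\Omega$; (H2) there is $\theta>0$ such that $\theta\,{\rm I}\le A(x)\le\theta^{-1}{\rm I}$ for all $x\in\Omega$, where ${\rm I}$ is the unit matrix; (H3) for some $p>d$ one has $b^i\in L^p_{loc}(\Omega)$, $h^i\in L^1_{loc}(\Omega)$, $g^{ij}\in L^{p'}_{loc}(\Omega)$, where $p'=p/(p-1)$ and $L^q_{loc}(\Omega)$ is the class of measurable functions integrable to power $q$ on compact subsets of $\Omega$. Solution of the equation: for an open set $U\subset\Omega$, $\varrho\in L^1_{loc}(U)$ is a solution to ${\rm div}^2(\varrho A)-{\rm div}(\varrho b)={\rm div}^2G-{\rm div}\,h$ on $U$ if $a^{ij}\varrho,\ b^i\varrho,\ h^i,\ g^{ij}\in L^1_{loc}(U)$ and $\int_U L_{A,b}u\,\varrho\,dx=\int_U L_{G,h}u\,dx$ for every $u\in C_0^\infty(U)$. Dirichlet problem: for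 a bounded Borel measure $\eta$ (possibly signed) on $\partial D$, a function $\varrho\in L^{p'}(D)$ is a solution to the Dirichlet problem for this equation on $D$ with boundary condition $\varrho|_{\partial D}=\eta+\kappa\sigma_{d-1}$ if for every $u\in W^{p,2}(D)\cap C^1(\overline{D})$ vanishing on $\partial D$ one has $$ \int_D L_{A,b}u\,\varrho\,dx=\int_D L_{G,h}u\,dx+\int_{\partial D}\langle A(x)\nabla u(x),\nu(x)\rangle\,\eta(dx). $$ Here $W^{p,2}(D)$ is the Sobolev space of functions in $L^p(D)$ whose first and second order generalized derivatives are in $L^p(D)$, $\nu(x)$ is the unit outer normal to $\partial D$, $\sigma_{d-1}$ is the standard surface measure on $\partial D$, and $\kappa(x)=\langle G(x)\nu(x),\nu(x)\rangle/\langle A(x)\nu(x),\nu(x)\rangle$. The term $\kappa\sigma_{d-1}$ does not enter the defining identity. *)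

theory Defs
  imports "HOL-Analysis.Analysis"
begin

section \<open>Classical derivatives and test functions\<close>

definition partial_deriv :: "'n::finite \<Rightarrow> (real^'n \<Rightarrow> real) \<Rightarrow> real^'n \<Rightarrow> real" where
  "partial_deriv i u x = frechet_derivative u (at x) (axis i 1)"

primrec iter_partial :: "'n::finite list \<Rightarrow> (real^'n \<Rightarrow> real) \<Rightarrow> real^'n \<Rightarrow> real" where
  "iter_partial [] u = u"
| "iter_partial (i # ks) u = partial_deriv i (iter_partial ks u)"

text \<open>
  Meant for open \<open>U\<close>. The differentiability clause guarantees that the iterated derivatives,
  which are total functions in HOL, are genuine ones; it costs nothing because
  continuous first order partial derivatives imply differentiability.
\<close>
definition Ck_on :: "nat \<Rightarrow> (real^'n::finite) set \<Rightarrow> (real^'n \<Rightarrow> real) \<Rightarrow> bool" where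
  "Ck_on k U u \<longleftrightarrow>
     (\<forall>ks. length ks \<le> k \<longrightarrow> continuous_on U (iter_partial ks u)) \<and>
     (\<forall>ks. length ks < k \<longrightarrow> (\<forall>x\<in>U. iter_partial ks u differentiable (at x)))"

definition gradient :: "(real^'n::finite \<Rightarrow> real) \<Rightarrow> real^'n \<Rightarrow> real^'n" where
  "gradient u x = (\<chi> i. partial_deriv i u x)"

definition hessian :: "(real^'n::finite \<Rightarrow> real) \<Rightarrow> real^'n \<Rightarrow> real^'n^'n" where
  "hessian u x = (\<chi> i j. iter_partial [i, j] u x)"

text \<open>The class \<open>C\<^sub>0\<^sup>\<infinity>(U)\<close>, its members being extended by zero to the whole space.\<close>
definition test_fun :: "(real^'n::finite) set \<Rightarrow> (real^'n \<Rightarrow> real) \<Rightarrow> bool" where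
  "test_fun U u \<longleftrightarrow> (\<forall>k. Ck_on k UNIV u) \<and>
     compact (closure {x. u x \<noteq> 0}) \<and> closure {x. u x \<noteq> 0} \<subseteq> U"

section \<open>Lebesgue and Sobolev spaces\<close>

definition Lp :: "real \<Rightarrow> (real^'n::finite) set \<Rightarrow> (real^'n \<Rightarrow> real) set" where
  "Lp q S = {f. f \<in> borel_measurable (lebesgue_on S) \<and>
                integrable (lebesgue_on S) (\<lambda>x. \<bar>f x\<bar> powr q)}"

definition Lp_loc :: "real \<Rightarrow> (real^'n::finite) set \<Rightarrow> (real^'n \<Rightarrow> real) set" where
  "Lp_loc q U = {f. f \<in> borel_measurable (lebesgue_on U) \<and>
                    (\<forall>K. compact K \<and> K \<subseteq> U \<longrightarrow> f \<in> Lp q K)}"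

definition Linfty :: "(real^'n::finite) set \<Rightarrow> (real^'n \<Rightarrow> real) set" where
  "Linfty S = {f. f \<in> borel_measurable (lebesgue_on S) \<and>
                  (\<exists>C. AE x in lebesgue_on S. \<bar>f x\<bar> \<le> C)}"

text \<open>\<open>v\<close> is (a representative of) the generalized derivative of \<open>u\<close> on \<open>U\<close>
  with respect to the variables listed in \<open>ks\<close>.\<close>
definition weak_deriv ::
  "(real^'n::finite) set \<Rightarrow> 'n list \<Rightarrow> (real^'n \<Rightarrow> real) \<Rightarrow> (real^'n \<Rightarrow> real) \<Rightarrow> bool" where
  "weak_deriv U ks u v \<longleftrightarrow> u \<in> Lp_loc 1 U \<and> v \<in> Lp_loc 1 U \<and>
     (\<forall>f. test_fun U f \<longrightarrow>
        integral\<^sup>L (lebesgue_on U) (\<lambda>x. u x * iter_partial ks f x)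
          = (-1) ^ length ks * integral\<^sup>L (lebesgue_on U) (\<lambda>x. v x * f x))"

text \<open>The space \<open>W\<^sup>p\<^sup>,\<^sup>2(D)\<close> (integrability exponent \<open>p\<close>, two derivatives).\<close>
definition sobolev_Wp2 :: "real \<Rightarrow> (real^'n::finite) set \<Rightarrow> (real^'n \<Rightarrow> real) set" where
  "sobolev_Wp2 p D = {u. u \<in> Lp p D \<and>
     (\<forall>ks. length ks = 1 \<or> length ks = 2 \<longrightarrow> (\<exists>v \<in> Lp p D. weak_deriv D ks u v))}"

definition weak_hessian ::
  "(real^'n::finite) set \<Rightarrow> (real^'n \<Rightarrow> real) \<Rightarrow> (real^'n \<Rightarrow> real^'n^'n) \<Rightarrow> bool" where
  "weak_hessian D u H \<longleftrightarrow> (\<forall>i j. weak_deriv D [i, j] u (\<lambda>x. H x $ i $ j))"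

text \<open>\<open>u \<in> C\<^sup>1\<close> on the closure of \<open>D\<close>: \<open>Du\<close> is the continuous extension of the
  gradient of \<open>u\<close> to the closure. It is determined there by \<open>u\<close>.\<close>
definition C1_closure ::
  "(real^'n::finite) set \<Rightarrow> (real^'n \<Rightarrow> real) \<Rightarrow> (real^'n \<Rightarrow> real^'n) \<Rightarrow> bool" where
  "C1_closure D u Du \<longleftrightarrow> continuous_on (closure D) u \<and> continuous_on (closure D) Du \<and>
     (\<forall>x\<in>D. (u has_derivative (\<lambda>v. Du x \<bullet> v)) (at x))"

section \<open>Domains of class \<open>C\<^sup>2\<close>\<close>

text \<open>
  In the ball of radius \<open>r\<close> about \<open>x\<close>, the set \<open>D\<close> is the part lying above the graph of a
  \<open>C\<^sup>2\<close> function, the unit vector \<open>e\<close> being the vertical direction. A function of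
  \<open>d - 1\<close> variables in rotated coordinates is represented by a function \<open>\<gamma>\<close> on the whole space
  that is invariant under translations along \<open>e\<close>.
\<close>
definition C2_graph_near ::
  "(real^'n::finite) set \<Rightarrow> real^'n \<Rightarrow> real \<Rightarrow> real^'n \<Rightarrow> (real^'n \<Rightarrow> real) \<Rightarrow> bool" where
  "C2_graph_near D x r e \<gamma> \<longleftrightarrow> 0 < r \<and> norm e = 1 \<and> Ck_on 2 UNIV \<gamma> \<and>
     (\<forall>y t. \<gamma> (y + t *\<^sub>R e) = \<gamma> y) \<and>
     D \<inter> ball x r = {y \<in> ball x r. \<gamma> y < e \<bullet> y}"

definition C2_boundary :: "(real^'n::finite) set \<Rightarrow> bool" where
  "C2_boundary D \<longleftrightarrow> (\<forall>x \<in> frontier D. \<exists>r e \<gamma>. C2_graph_near D x r e \<gamma>)"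

text \<open>
  Near \<open>x\<close> the boundary is the zero set of \<open>\<gamma> y - e \<bullet> y\<close>, which is negative in \<open>D\<close>; the
  outer normal is its normalized gradient (nonzero, since \<open>gradient \<gamma> x\<close> is orthogonal to \<open>e\<close>)
  and does not depend on the choice of the graph.
\<close>
definition outer_unit_normal :: "(real^'n::finite) set \<Rightarrow> real^'n \<Rightarrow> real^'n" where
  "outer_unit_normal D x =
     (THE n. \<exists>r e \<gamma>. C2_graph_near D x r e \<gamma> \<and> n = sgn (gradient \<gamma> x - e))"

section \<open>Signed measures\<close>

text \<open>A real-valued countably additive set function on the \<open>\<sigma>\<close>-algebra of \<open>M\<close>; it is
  automatically bounded. Only \<open>space M\<close> and \<open>sets M\<close> matter.\<close>
definition signed_measure_on :: "'a measure \<Rightarrow> ('a set \<Rightarrow> real) \<Rightarrow> bool" where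
  "signed_measure_on M \<eta> \<longleftrightarrow> \<eta> {} = 0 \<and>
     (\<forall>F :: nat \<Rightarrow> 'a set. range F \<subseteq> sets M \<and> disjoint_family F \<longrightarrow>
        (\<lambda>n. \<eta> (F n)) sums \<eta> (\<Union>n. F n))"

text \<open>The positive part of the Jordan decomposition. Negative values of \<open>\<eta>\<close> are truncated by
  \<open>ennreal\<close>, which is harmless since the empty set contributes \<open>0\<close> anyway.\<close>
definition upper_variation :: "'a measure \<Rightarrow> ('a set \<Rightarrow> real) \<Rightarrow> 'a measure" where
  "upper_variation M \<eta> =
     measure_of (space M) (sets M) (\<lambda>S. SUP T \<in> {T \<in> sets M. T \<subseteq> S}. ennreal (\<eta> T))"

definition signed_integral :: "'a measure \<Rightarrow> ('a set \<Rightarrow> real) \<Rightarrow> ('a \<Rightarrow> real) \<Rightarrow> real" where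
  "signed_integral M \<eta> f =
     integral\<^sup>L (upper_variation M \<eta>) f - integral\<^sup>L (upper_variation M (\<lambda>S. - \<eta> S)) f"

section \<open>Coefficients\<close>

definition admissible_coeffs :: "(real^'n::finite) set \<Rightarrow>
    (real^'n \<Rightarrow> real^'n^'n) \<Rightarrow> (real^'n \<Rightarrow> real^'n) \<Rightarrow> bool" where
  "admissible_coeffs \<Omega> A b \<longleftrightarrow>
     (\<forall>x\<in>\<Omega>. transpose (A x) = A x) \<and>
     (\<forall>i j. (\<lambda>x. A x $ i $ j) \<in> borel_measurable (restrict_space borel \<Omega>)) \<and>
     (\<forall>i. (\<lambda>x. b x $ i) \<in> borel_measurable (restrict_space borel \<Omega>))"

definition cond_H1 :: "(real^'n::finite) set \<Rightarrow> (real^'n \<Rightarrow> real^'n^'n) \<Rightarrow> bool" where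
  "cond_H1 \<Omega> A \<longleftrightarrow>
     (\<forall>i j. continuous_on \<Omega> (\<lambda>x. A x $ i $ j)) \<and>
     (\<exists>\<omega> :: real \<Rightarrow> real. mono_on {0..} \<omega> \<and> continuous_on {0..} \<omega> \<and> \<omega> 0 = 0 \<and>
        (\<forall>x\<in>\<Omega>. \<forall>y\<in>\<Omega>. norm (A x - A y) \<le> \<omega> (norm (x - y))))"

definition matrix_le :: "real^'n::finite^'n \<Rightarrow> real^'n^'n \<Rightarrow> bool" where
  "matrix_le S T \<longleftrightarrow> (\<forall>v. v \<bullet> (S *v v) \<le> v \<bullet> (T *v v))"

definition cond_H2 :: "(real^'n::finite) set \<Rightarrow> (real^'n \<Rightarrow> real^'n^'n) \<Rightarrow> bool" where
  "cond_H2 \<Omega> A \<longleftrightarrow>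
     (\<exists>\<theta>>0. \<forall>x\<in>\<Omega>. matrix_le (mat \<theta>) (A x) \<and> matrix_le (A x) (mat (inverse \<theta>)))"

definition cond_H3 :: "real \<Rightarrow> (real^'n::finite) set \<Rightarrow> (real^'n \<Rightarrow> real^'n) \<Rightarrow>
    (real^'n \<Rightarrow> real^'n^'n) \<Rightarrow> (real^'n \<Rightarrow> real^'n) \<Rightarrow> bool" where
  "cond_H3 p \<Omega> b G h \<longleftrightarrow>
     (\<forall>i. (\<lambda>x. b x $ i) \<in> Lp_loc p \<Omega>) \<and>
     (\<forall>i. (\<lambda>x. h x $ i) \<in> Lp_loc 1 \<Omega>) \<and>
     (\<forall>i j. (\<lambda>x. G x $ i $ j) \<in> Lp_loc (p / (p - 1)) \<Omega>)"

section \<open>The equation and the Dirichlet problem\<close>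

text \<open>The operator \<open>L\<^sub>A\<^sub>,\<^sub>b\<close> applied to a function with second derivatives \<open>H\<close>
  and gradient \<open>v\<close>, which may be classical or generalized.\<close>
definition L_op :: "(real^'n::finite \<Rightarrow> real^'n^'n) \<Rightarrow> (real^'n \<Rightarrow> real^'n) \<Rightarrow>
    (real^'n \<Rightarrow> real^'n^'n) \<Rightarrow> (real^'n \<Rightarrow> real^'n) \<Rightarrow> real^'n \<Rightarrow> real" where
  "L_op A b H v x = trace (A x ** H x) + b x \<bullet> v x"

definition solves_equation :: "(real^'n::finite) set \<Rightarrow>
    (real^'n \<Rightarrow> real^'n^'n) \<Rightarrow> (real^'n \<Rightarrow> real^'n) \<Rightarrow>
    (real^'n \<Rightarrow> real^'n^'n) \<Rightarrow> (real^'n \<Rightarrow> real^'n) \<Rightarrow> (real^'n \<Rightarrow> real) \<Rightarrow> bool" where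
  "solves_equation U A b G h \<rho> \<longleftrightarrow>
     \<rho> \<in> Lp_loc 1 U \<and>
     (\<forall>i j. (\<lambda>x. A x $ i $ j * \<rho> x) \<in> Lp_loc 1 U) \<and>
     (\<forall>i. (\<lambda>x. b x $ i * \<rho> x) \<in> Lp_loc 1 U) \<and>
     (\<forall>i. (\<lambda>x. h x $ i) \<in> Lp_loc 1 U) \<and>
     (\<forall>i j. (\<lambda>x. G x $ i $ j) \<in> Lp_loc 1 U) \<and>
     (\<forall>u. test_fun U u \<longrightarrow>
        integral\<^sup>L (lebesgue_on U) (\<lambda>x. L_op A b (hessian u) (gradient u) x * \<rho> x)
          = integral\<^sup>L (lebesgue_on U) (L_op G h (hessian u) (gradient u)))"

text \<open>
  \<open>\<rho>\<close> solves the Dirichlet problem on \<open>D\<close> with boundary condition \<open>\<rho> = \<eta> + \<kappa>\<sigma>\<close> on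
  \<open>frontier D\<close>, where \<open>\<kappa> = \<langle>G\<nu>,\<nu>\<rangle> / \<langle>A\<nu>,\<nu>\<rangle>\<close> and \<open>\<sigma>\<close> is the surface measure.
  By convention only \<open>\<eta>\<close> appears in the defining identity; the term \<open>\<kappa>\<sigma>\<close> is determined by the
  data and does not enter.
\<close>
definition solves_dirichlet :: "real \<Rightarrow> (real^'n::finite) set \<Rightarrow>
    (real^'n \<Rightarrow> real^'n^'n) \<Rightarrow> (real^'n \<Rightarrow> real^'n) \<Rightarrow>
    (real^'n \<Rightarrow> real^'n^'n) \<Rightarrow> (real^'n \<Rightarrow> real^'n) \<Rightarrow>
    ((real^'n) set \<Rightarrow> real) \<Rightarrow> (real^'n \<Rightarrow> real) \<Rightarrow> bool" where
  "solves_dirichlet p D A b G h \<eta> \<rho> \<longleftrightarrow>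
     \<rho> \<in> Lp (p / (p - 1)) D \<and>
     (\<forall>u Du H. u \<in> sobolev_Wp2 p D \<and> weak_hessian D u H \<and> C1_closure D u Du \<and>
          (\<forall>x \<in> frontier D. u x = 0) \<longrightarrow>
        integral\<^sup>L (lebesgue_on D) (\<lambda>x. L_op A b H Du x * \<rho> x)
          = integral\<^sup>L (lebesgue_on D) (L_op G h H Du)
            + signed_integral (restrict_space borel (frontier D)) \<eta>
                (\<lambda>x. (A x *v Du x) \<bullet> outer_unit_normal D x))"

end

theory Submission
  imports Defs "HOL-Probability.Probability"
begin

text \<open>
  Put \<open>K = \<rho> A - G\<close> and \<open>\<beta> = \<rho> b - h\<close>, and let \<open>F u\<close> be the integral over \<open>D\<close> of
  \<open>trace (K D\<^sup>2u) + \<beta> \<bullet> \<nabla>u\<close>. The equation says that \<open>F u = 0\<close> for compactly supported \<open>u\<close>.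
  When \<open>u\<close> merely vanishes on the boundary, \<open>F u\<close> should only see the gradient of \<open>u\<close> on the
  boundary, which is normal to it; the claim is that it sees it through a measure.

  Let \<open>\<psi>\<close> be a twice continuously differentiable function that is positive in \<open>D\<close> and vanishes on
  the boundary with nonzero gradient (\<open>defining_function_exists\<close>). Multiplying \<open>u\<close> by
  \<open>\<zeta> = cut (\<psi> / \<epsilon>)\<close>, which is zero near the boundary and tends to one as \<open>\<epsilon>\<close> tends to zero,
  gives an admissible test function (\<open>weak_equation_cutoff\<close>, by mollification), and the product rule turns
  \<open>F (\<zeta> u) = 0\<close> into
  \<open>\<integral> \<zeta> L u + \<integral> (u L \<zeta> + 2 (K \<nabla>\<zeta>) \<bullet> \<nabla>u) = 0\<close>. The first integral tends to \<open>F u\<close>. The second one is taken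
  over the strip \<open>2 \<epsilon> \<le> \<psi> \<le> 5 \<epsilon>\<close>. On the boundary \<open>\<nabla>u = Q \<nabla>\<psi>\<close> with a continuous \<open>Q\<close>, and in the
  strip \<open>u = Q \<psi> + o(\<psi>)\<close> (\<open>boundary_expansion\<close>); hence, up to a small error, the second integral is
  that of \<open>Q\<close> times the function \<open>layer_density\<close>, which does not depend on \<open>u\<close>. This is
  \<open>boundary_layer_limit\<close>.

  The error is small, and \<open>layer_density\<close> is bounded in \<open>L\<^sup>1\<close>, if the integral of \<open>\<bar>\<rho>\<bar>\<close> over the strip
  is \<open>O(\<epsilon>)\<close>. For bounded \<open>\<rho>\<close> that is a bound for the volume of the strip (\<open>strip_volume\<close>). For
  nonnegative \<open>\<rho>\<close> the equation is tested with \<open>ramp (\<psi> / \<epsilon>)\<close>, where \<open>ramp\<close> is convex: its second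
  derivative dominates the indicator of the strip, and ellipticity bounds the corresponding term from
  below by the integral in question, while the remaining terms are controlled by the integrability of
  \<open>K\<close> and \<open>\<beta>\<close> and the boundedness of \<open>G\<close> (\<open>strip_nonneg_density\<close>).

  Finally the positive and the negative parts of \<open>layer_density\<close> converge weakly along a common
  subsequence to finite measures \<open>N1\<close> and \<open>N2\<close> on the boundary (\<open>boundary_limit_measures\<close>), so that
  \<open>F u = - (\<integral> Q dN1 - \<integral> Q dN2)\<close>. Since \<open>(A \<nabla>u) \<bullet> \<nu> = - Q a\<close> with the positive continuous function
  \<open>a = ((A \<nabla>\<psi>) \<bullet> \<nabla>\<psi>) / norm (\<nabla>\<psi>)\<close>, the measure \<open>\<eta> = (N1 - N2) / a\<close> is as required
  (\<open>dirichlet_solution\<close>).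
\<close>

section \<open>Functions with two continuous derivatives\<close>

lemma continuous_on_of_derivative:
  "(\<And>x. (f has_derivative f' x) (at x)) \<Longrightarrow> continuous_on S f"
  by (intro continuous_at_imp_continuous_on ballI has_derivative_continuous)

lemma frechet_gradient:
  fixes f :: "real^'n::finite \<Rightarrow> real"
  assumes "(f has_derivative (\<lambda>h. g \<bullet> h)) (at x)"
  shows "partial_deriv i f x = g $ i"
proof -
  have "frechet_derivative f (at x) = (\<lambda>h. g \<bullet> h)"
    using frechet_derivative_at[OF assms] by simp
  then show ?thesis by (simp add: partial_deriv_def inner_axis)
qed

text \<open>Passing the gradient and the second derivatives as arguments lets the calculus below produce
  them explicitly. The matrix is a genuine derivative of the vector field, column by column, so its
  continuity is all that is left to require.\<close>
definition C2_with :: "(real^'n::finite \<Rightarrow> real) \<Rightarrow> (real^'n \<Rightarrow> real^'n) \<Rightarrow> (real^'n \<Rightarrow> real^'n^'n) \<Rightarrow> bool" where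
  "C2_with f g h \<longleftrightarrow> (\<forall>x. (f has_derivative (\<lambda>v. g x \<bullet> v)) (at x)) \<and>
     (\<forall>x j. ((\<lambda>x. g x $ j) has_derivative (\<lambda>v. (\<chi> i. h x $ i $ j) \<bullet> v)) (at x)) \<and>
     continuous_on UNIV h"

definition outer :: "real^'n::finite \<Rightarrow> real^'n \<Rightarrow> real^'n^'n" where
  "outer a b = (\<chi> i j. a $ i * b $ j)"

lemma outer_nth [simp]: "outer a b $ i $ j = a $ i * b $ j"
  by (simp add: outer_def)

lemma continuous_on_outer [continuous_intros]:
  "continuous_on S f \<Longrightarrow> continuous_on S g \<Longrightarrow> continuous_on S (\<lambda>x. outer (f x) (g x))"
  unfolding outer_def by (intro continuous_intros)

lemma C2_with_cont:
  assumes "C2_with f g h"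
  shows "continuous_on S f" "continuous_on S g" "continuous_on S h"
proof -
  have "continuous_on UNIV f"
    using assms unfolding C2_with_def by (intro continuous_on_of_derivative) blast
  moreover have "continuous_on UNIV (\<lambda>x. \<chi> j. g x $ j)"
    using assms unfolding C2_with_def
    by (intro continuous_on_vec_lambda continuous_on_of_derivative) blast
  ultimately show "continuous_on S f" "continuous_on S g" "continuous_on S h"
    using assms continuous_on_subset[of UNIV _ S] by (auto simp: C2_with_def)
qed

lemma C2_with_deriv: "C2_with f g h \<Longrightarrow> (f has_derivative (\<lambda>v. g x \<bullet> v)) (at x within S)"
  by (auto simp: C2_with_def intro: has_derivative_at_withinI)

lemma C2_with_const: "C2_with (\<lambda>x. c) (\<lambda>x. 0) (\<lambda>x. 0)"
  by (auto simp: C2_with_def inner_vec_def)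

lemma C2_with_inner: "C2_with (\<lambda>x. e \<bullet> x) (\<lambda>x. e) (\<lambda>x. 0)"
  by (auto simp: C2_with_def zero_vec_def[symmetric] intro!: derivative_eq_intros)

lemma C2_with_add:
  assumes "C2_with f1 g1 h1" "C2_with f2 g2 h2"
  shows "C2_with (\<lambda>x. f1 x + f2 x) (\<lambda>x. g1 x + g2 x) (\<lambda>x. h1 x + h2 x)"
proof -
  note d = assms[unfolded C2_with_def]
  have d1: "(f1 has_derivative (\<lambda>v. g1 x \<bullet> v)) (at x)" "(f2 has_derivative (\<lambda>v. g2 x \<bullet> v)) (at x)" for x
    using d by auto
  have d2: "((\<lambda>x. g1 x $ j) has_derivative (\<lambda>v. (\<chi> i. h1 x $ i $ j) \<bullet> v)) (at x)"
    "((\<lambda>x. g2 x $ j) has_derivative (\<lambda>v. (\<chi> i. h2 x $ i $ j) \<bullet> v)) (at x)" for x j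
    using d by auto
  have e: "(\<chi> i. (h1 x + h2 x) $ i $ j) = (\<chi> i. h1 x $ i $ j) + (\<chi> i. h2 x $ i $ j)" for x j
    by (simp add: vec_eq_iff)
  show ?thesis unfolding C2_with_def e
  proof (intro conjI allI)
    fix x
    show "((\<lambda>x. f1 x + f2 x) has_derivative (\<lambda>v. (g1 x + g2 x) \<bullet> v)) (at x)"
      by (rule has_derivative_eq_rhs[OF has_derivative_add[OF d1]]) (auto simp: inner_add_left)
    fix j
    have "((\<lambda>x. g1 x $ j + g2 x $ j) has_derivative (\<lambda>v. ((\<chi> i. h1 x $ i $ j) + (\<chi> i. h2 x $ i $ j)) \<bullet> v)) (at x)"
      by (rule has_derivative_eq_rhs[OF has_derivative_add[OF d2]]) (auto simp: inner_add_left)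
    then show "((\<lambda>x. (g1 x + g2 x) $ j) has_derivative (\<lambda>v. ((\<chi> i. h1 x $ i $ j) + (\<chi> i. h2 x $ i $ j)) \<bullet> v)) (at x)"
      by simp
  qed (intro continuous_intros C2_with_cont[OF assms(1)] C2_with_cont[OF assms(2)])
qed

lemma C2_with_mult:
  assumes "C2_with f1 g1 h1" "C2_with f2 g2 h2"
  shows "C2_with (\<lambda>x. f1 x * f2 x) (\<lambda>x. f1 x *\<^sub>R g2 x + f2 x *\<^sub>R g1 x)
     (\<lambda>x. f1 x *\<^sub>R h2 x + f2 x *\<^sub>R h1 x + outer (g1 x) (g2 x) + outer (g2 x) (g1 x))"
proof -
  note d = assms[unfolded C2_with_def]
  have d1: "(f1 has_derivative (\<lambda>v. g1 x \<bullet> v)) (at x)" "(f2 has_derivative (\<lambda>v. g2 x \<bullet> v)) (at x)" for x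
    using d by auto
  have d2: "((\<lambda>x. g1 x $ j) has_derivative (\<lambda>v. (\<chi> i. h1 x $ i $ j) \<bullet> v)) (at x)"
    "((\<lambda>x. g2 x $ j) has_derivative (\<lambda>v. (\<chi> i. h2 x $ i $ j) \<bullet> v)) (at x)" for x j
    using d by auto
  have e: "(\<chi> i. (f1 x *\<^sub>R h2 x + f2 x *\<^sub>R h1 x + outer (g1 x) (g2 x) + outer (g2 x) (g1 x)) $ i $ j)
     = f1 x *\<^sub>R (\<chi> i. h2 x $ i $ j) + f2 x *\<^sub>R (\<chi> i. h1 x $ i $ j) + g2 x $ j *\<^sub>R g1 x + g1 x $ j *\<^sub>R g2 x" for x j
    by (simp add: vec_eq_iff)
  show ?thesis unfolding C2_with_def
  proof (intro conjI allI)
    fix x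
    show "((\<lambda>x. f1 x * f2 x) has_derivative (\<lambda>v. (f1 x *\<^sub>R g2 x + f2 x *\<^sub>R g1 x) \<bullet> v)) (at x)"
      by (rule has_derivative_eq_rhs[OF has_derivative_mult[OF d1]]) (auto simp: inner_add_left algebra_simps)
    fix j
    have "((\<lambda>x. f1 x * g2 x $ j + f2 x * g1 x $ j) has_derivative
       (\<lambda>v. (\<chi> i. (f1 x *\<^sub>R h2 x + f2 x *\<^sub>R h1 x + outer (g1 x) (g2 x) + outer (g2 x) (g1 x)) $ i $ j) \<bullet> v)) (at x)"
      unfolding e
      by (rule has_derivative_eq_rhs[OF has_derivative_add[OF has_derivative_mult[OF d1(1) d2(2)] has_derivative_mult[OF d1(2) d2(1)]]])
        (auto simp: inner_add_left algebra_simps)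
    then show "((\<lambda>x. (f1 x *\<^sub>R g2 x + f2 x *\<^sub>R g1 x) $ j) has_derivative
       (\<lambda>v. (\<chi> i. (f1 x *\<^sub>R h2 x + f2 x *\<^sub>R h1 x + outer (g1 x) (g2 x) + outer (g2 x) (g1 x)) $ i $ j) \<bullet> v)) (at x)"
      by simp
  next
    show "continuous_on UNIV (\<lambda>x. f1 x *\<^sub>R h2 x + f2 x *\<^sub>R h1 x + outer (g1 x) (g2 x) + outer (g2 x) (g1 x))"
      by (intro continuous_intros C2_with_cont[OF assms(1)] C2_with_cont[OF assms(2)])
  qed
qed

lemma C2_with_compose:
  assumes f: "C2_with f g h" and q: "\<And>t. (q has_real_derivative q1 t) (at t)" "\<And>t. (q1 has_real_derivative q2 t) (at t)"
    "continuous_on UNIV q2"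
  shows "C2_with (\<lambda>x. q (f x)) (\<lambda>x. q1 (f x) *\<^sub>R g x) (\<lambda>x. q1 (f x) *\<^sub>R h x + q2 (f x) *\<^sub>R outer (g x) (g x))"
proof -
  note d = f[unfolded C2_with_def]
  have d1: "(f has_derivative (\<lambda>v. g x \<bullet> v)) (at x)" for x
    using d by auto
  have d2: "((\<lambda>x. g x $ j) has_derivative (\<lambda>v. (\<chi> i. h x $ i $ j) \<bullet> v)) (at x)" for x j
    using d by auto
  have e: "(\<chi> i. (q1 (f x) *\<^sub>R h x + q2 (f x) *\<^sub>R outer (g x) (g x)) $ i $ j)
     = q1 (f x) *\<^sub>R (\<chi> i. h x $ i $ j) + (q2 (f x) * g x $ j) *\<^sub>R g x" for x j
    by (simp add: vec_eq_iff)
  note qd = has_derivative_compose[OF d1 q(1)[THEN has_field_derivative_imp_has_derivative]]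
    has_derivative_compose[OF d1 q(2)[THEN has_field_derivative_imp_has_derivative]]
  have c1: "continuous_on UNIV q1" using q(2) DERIV_continuous_on by blast
  show ?thesis unfolding C2_with_def
  proof (intro conjI allI)
    fix x
    show "((\<lambda>x. q (f x)) has_derivative (\<lambda>v. (q1 (f x) *\<^sub>R g x) \<bullet> v)) (at x)"
      by (rule has_derivative_eq_rhs[OF qd(1)]) auto
    fix j
    have "((\<lambda>x. q1 (f x) * g x $ j) has_derivative
       (\<lambda>v. (\<chi> i. (q1 (f x) *\<^sub>R h x + q2 (f x) *\<^sub>R outer (g x) (g x)) $ i $ j) \<bullet> v)) (at x)"
      unfolding e
      by (rule has_derivative_eq_rhs[OF has_derivative_mult[OF qd(2) d2]])
        (auto simp: inner_add_left algebra_simps)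
    then show "((\<lambda>x. (q1 (f x) *\<^sub>R g x) $ j) has_derivative
       (\<lambda>v. (\<chi> i. (q1 (f x) *\<^sub>R h x + q2 (f x) *\<^sub>R outer (g x) (g x)) $ i $ j) \<bullet> v)) (at x)"
      by simp
  next
    show "continuous_on UNIV (\<lambda>x. q1 (f x) *\<^sub>R h x + q2 (f x) *\<^sub>R outer (g x) (g x))"
      by (intro continuous_intros C2_with_cont[OF f] continuous_on_compose2[OF c1] continuous_on_compose2[OF q(3)]) auto
  qed
qed

lemma C2_with_sum:
  assumes "finite F" "\<And>i. i \<in> F \<Longrightarrow> C2_with (f i) (g i) (h i)"
  shows "C2_with (\<lambda>x. \<Sum>i\<in>F. f i x) (\<lambda>x. \<Sum>i\<in>F. g i x) (\<lambda>x. \<Sum>i\<in>F. h i x)"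
  using assms by (induction F) (auto intro: C2_with_add C2_with_const)

lemma Ck_on_2_C2_with:
  assumes "Ck_on 2 UNIV f"
  shows "C2_with f (gradient f) (hessian f)"
proof -
  have d: "(F has_derivative (\<lambda>v. (\<chi> i. partial_deriv i F x) \<bullet> v)) (at x)" if "F differentiable (at x)" for F :: "real^'n \<Rightarrow> real" and x
  proof -
    let ?L = "frechet_derivative F (at x)"
    have L: "(F has_derivative ?L) (at x)" using that by (rule frechet_derivative_works[THEN iffD1])
    then have lin: "linear ?L" by (rule has_derivative_linear)
    have "?L v = (\<chi> i. partial_deriv i F x) \<bullet> v" for v
    proof -
      have "?L v = ?L (\<Sum>i\<in>UNIV. (v $ i) *\<^sub>R axis i 1)"
        by (simp add: basis_expansion scalar_mult_eq_scaleR[symmetric])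
      also have "\<dots> = (\<Sum>i\<in>UNIV. v $ i * ?L (axis i 1))"
        by (simp add: linear_sum[OF lin] linear_cmul[OF lin])
      finally show ?thesis by (simp add: inner_vec_def partial_deriv_def mult.commute)
    qed
    then show ?thesis using L by (metis (no_types, lifting) ext)
  qed
  note C = assms[unfolded Ck_on_def]
  have "f differentiable (at x)" for x using C[THEN conjunct2, rule_format, of "[]" x] by simp
  moreover have "partial_deriv j f differentiable (at x)" for x j
    using C[THEN conjunct2, rule_format, of "[j]" x] by simp
  moreover have "continuous_on UNIV (iter_partial [i, j] f)" for i j
    using C[THEN conjunct1, rule_format, of "[i,j]"] by simp
  ultimately show ?thesis unfolding C2_with_def
    using d[of f] d[of "partial_deriv _ f"]
    by (auto simp: gradient_def hessian_def intro!: continuous_on_vec_lambda)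
qed

text \<open>The truncated cube is the simplest twice continuously differentiable function that vanishes
  on a half-line; the bump functions and cut-off profiles below are built from it.\<close>
lemma cube_pos_derivs:
  shows "((\<lambda>t::real. (max 0 t) ^ 3) has_real_derivative 3 * (max 0 t)\<^sup>2) (at t)"
    and "((\<lambda>t::real. 3 * (max 0 t)\<^sup>2) has_real_derivative 6 * max 0 t) (at t)"
proof -
  have key: "((\<lambda>t::real. (max 0 t) ^ Suc (Suc k)) has_real_derivative real (k+2) * (max 0 t) ^ Suc k) (at t)" for k
  proof -
    consider "t > 0" | "t < 0" | "t = 0" by linarith
    then show ?thesis
    proof cases
      case 1
      have "((\<lambda>t::real. t ^ Suc (Suc k)) has_real_derivative real (k+2) * (max 0 t) ^ Suc k) (at t)"
        using DERIV_pow[of "Suc (Suc k)" t UNIV] 1 by simp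
      then show ?thesis
        by (rule has_field_derivative_transform_within[where d=t]) (use 1 in \<open>auto simp: dist_real_def max_def\<close>)
    next
      case 2
      have "((\<lambda>t::real. 0) has_real_derivative real (k+2) * (max 0 t) ^ Suc k) (at t)" using 2 by simp
      then show ?thesis
        by (rule has_field_derivative_transform_within[where d="-t"]) (use 2 in \<open>auto simp: dist_real_def max_def\<close>)
    next
      case 3
      have "((\<lambda>h::real. (max 0 h) ^ Suc k) \<longlongrightarrow> 0) (at 0)"
        by (rule tendsto_eq_intros | simp)+
      then have "((\<lambda>h::real. (max 0 (0 + h) ^ Suc (Suc k) - max 0 0 ^ Suc (Suc k)) / h) \<longlongrightarrow> 0) (at 0)"
        by (rule Lim_transform_eventually) (auto simp: eventually_at_filter max_def field_simps)
      then show ?thesis using 3 by (simp add: has_field_derivative_iff)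
    qed
  qed
  show "((\<lambda>t::real. (max 0 t) ^ 3) has_real_derivative 3 * (max 0 t)\<^sup>2) (at t)"
    using key[of 1] by (simp add: numeral_eq_Suc)
  show "((\<lambda>t::real. 3 * (max 0 t)\<^sup>2) has_real_derivative 6 * max 0 t) (at t)"
    using DERIV_cmult[OF key[of 0], of 3] by (simp add: numeral_eq_Suc algebra_simps)
qed

section \<open>Domains with boundary of class C2\<close>

text \<open>A graph description turned into a function \<open>w\<close> with \<open>D = {w > 0}\<close> and frontier \<open>{w = 0}\<close> locally.
  Moving along \<open>e\<close> increases \<open>w\<close> at unit speed, so \<open>y - w y *\<^sub>R e\<close> is the projection onto the boundary.\<close>
definition local_graph :: "(real^'n::finite) set \<Rightarrow> real^'n \<Rightarrow> real \<Rightarrow> real^'n \<Rightarrow>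
    (real^'n \<Rightarrow> real) \<Rightarrow> (real^'n \<Rightarrow> real^'n) \<Rightarrow> (real^'n \<Rightarrow> real^'n^'n) \<Rightarrow> bool" where
  "local_graph D x r e w g h \<longleftrightarrow> 0 < r \<and> norm e = 1 \<and> C2_with w g h \<and> (\<forall>y. g y \<bullet> e = 1) \<and>
     (\<forall>y t. w (y + t *\<^sub>R e) = w y + t) \<and>
     (\<forall>y\<in>ball x r. (y \<in> D \<longleftrightarrow> 0 < w y) \<and> (y \<in> frontier D \<longleftrightarrow> w y = 0))"

lemma line_DERIV:
  assumes "(f has_derivative (\<lambda>v. G \<bullet> v)) (at (y + t *\<^sub>R e))"
  shows "((\<lambda>t. f (y + t *\<^sub>R e)) has_real_derivative (G \<bullet> e)) (at t)"
proof -
  have "((\<lambda>t. y + t *\<^sub>R e) has_derivative (\<lambda>s. s *\<^sub>R e)) (at t)"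
    by (auto intro!: derivative_eq_intros)
  from has_derivative_compose[OF this assms] show ?thesis
    by (simp add: has_field_derivative_def mult.commute[of "G \<bullet> e"] mult_commute_abs)
qed

lemma graph_near_local_graph:
  assumes D: "open D" and G: "C2_graph_near D x r e \<gamma>"
  obtains w g h where "local_graph D x r e w g h" "\<And>y. gradient \<gamma> y - e = - g y"
proof -
  note G' = G[unfolded C2_graph_near_def]
  have e: "norm e = 1" "e \<bullet> e = 1" and r: "0 < r" using G' by (auto simp: norm_eq_1)
  define w g h where "w y = e \<bullet> y + (- 1) * \<gamma> y" and "g y = e + ((-1) *\<^sub>R gradient \<gamma> y + \<gamma> y *\<^sub>R 0)"
    and "h y = 0 + ((-1) *\<^sub>R hessian \<gamma> y + \<gamma> y *\<^sub>R 0 + outer 0 (gradient \<gamma> y) + outer (gradient \<gamma> y) 0)" for y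
  have C2: "C2_with w g h" unfolding w_def g_def h_def
    using G' by (intro C2_with_add C2_with_mult C2_with_inner C2_with_const Ck_on_2_C2_with) auto
  have shift: "w (y + t *\<^sub>R e) = w y + t" for y t
    using G' e by (auto simp: w_def inner_add_right)
  have ge: "g y \<bullet> e = 1" for y
  proof -
    have "((\<lambda>t. w (y + t *\<^sub>R e)) has_real_derivative g y \<bullet> e) (at 0)"
      using line_DERIV[of w "g y" y 0 e] C2 by (auto simp: C2_with_def)
    moreover have "((\<lambda>t. w y + t) has_real_derivative 1) (at 0)" by (auto intro!: derivative_eq_intros)
    ultimately show ?thesis unfolding shift by (rule DERIV_unique)
  qed
  have inD: "y \<in> D \<longleftrightarrow> 0 < w y" if "y \<in> ball x r" for y
    using G' that by (auto simp: w_def)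
  have "y \<in> frontier D \<longleftrightarrow> w y = 0" if y: "y \<in> ball x r" for y
  proof
    assume f: "y \<in> frontier D"
    then have "y \<notin> D" using D by (auto simp: frontier_def interior_open)
    then have "w y \<le> 0" using inD[OF y] by auto
    moreover have "\<not> w y < 0"
    proof
      assume "w y < 0"
      have "open (ball x r \<inter> w -` {..<0})"
        using C2_with_cont(1)[OF C2, of UNIV] by (intro open_Int open_ball open_vimage open_lessThan)
      moreover have "y \<in> ball x r \<inter> w -` {..<0}" using y \<open>w y < 0\<close> by auto
      moreover have "y \<in> closure D" using f by (auto simp: frontier_def)
      ultimately obtain z where "z \<in> D" "z \<in> ball x r \<inter> w -` {..<0}"
        by (meson closure_iff_nhds_not_empty disjoint_iff order_refl)
      then show False using inD[of z] by auto
    qed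
    ultimately show "w y = 0" by simp
  next
    assume w0: "w y = 0"
    then have "y \<notin> D" using inD[OF y] by simp
    moreover have "y \<in> closure D"
      unfolding closure_approachable
    proof (intro allI impI)
      fix \<epsilon> :: real assume "\<epsilon> > 0"
      obtain s where s: "s > 0" "ball y s \<subseteq> ball x r"
        using y openE[OF open_ball, of y x r] by metis
      let ?t = "min \<epsilon> s / 2"
      have t: "0 < ?t" "?t < \<epsilon>" "?t < s" using \<open>\<epsilon> > 0\<close> s(1) by auto
      have "dist y (y + ?t *\<^sub>R e) = ?t" using t e by (simp add: dist_norm)
      then have "y + ?t *\<^sub>R e \<in> D" using inD[of "y + ?t *\<^sub>R e"] s t shift w0 by (auto simp: subset_iff)
      then show "\<exists>z\<in>D. dist z y < \<epsilon>" using \<open>dist y (y + ?t *\<^sub>R e) = ?t\<close> t by (metis dist_commute)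
    qed
    ultimately show "y \<in> frontier D" using D by (auto simp: frontier_def interior_open)
  qed
  then show thesis using that[of w g h] inD C2 shift ge e r
    by (auto simp: local_graph_def g_def)
qed

text \<open>\<open>\<psi>\<close> behaves like the distance to the boundary: it serves as the depth in all estimates.\<close>
definition defining_function :: "(real^'n::finite) set \<Rightarrow>
    (real^'n \<Rightarrow> real) \<Rightarrow> (real^'n \<Rightarrow> real^'n) \<Rightarrow> (real^'n \<Rightarrow> real^'n^'n) \<Rightarrow> bool" where
  "defining_function D \<psi> g h \<longleftrightarrow> C2_with \<psi> g h \<and> (\<forall>x\<in>D. 0 < \<psi> x) \<and>
     (\<forall>x\<in>frontier D. \<psi> x = 0 \<and> g x \<noteq> 0)"

lemma closure_Un_frontier': "closure D = D \<union> frontier D"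
  using closure_subset interior_subset by (fastforce simp: frontier_def)

text \<open>A function that is nonnegative inside and zero at a boundary point cannot decrease in an
  inward direction.\<close>
lemma nonneg_derivative_inward:
  assumes f: "C2_with f g h" and 0: "f y = 0" and pos: "\<And>t. 0 < t \<Longrightarrow> t < s \<Longrightarrow> 0 \<le> f (y + t *\<^sub>R e)" and "s > 0"
  shows "0 \<le> g y \<bullet> e"
proof (rule ccontr)
  assume n: "\<not> 0 \<le> g y \<bullet> e"
  have "((\<lambda>t. f (y + t *\<^sub>R e)) has_real_derivative g y \<bullet> e) (at 0)"
    using line_DERIV[of f "g y" y 0 e] f by (auto simp: C2_with_def)
  from DERIV_neg_dec_right[OF this] n obtain d where "d > 0" "\<And>k. 0 < k \<Longrightarrow> k < d \<Longrightarrow> f (y + k *\<^sub>R e) < 0"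
    using 0 by auto
  then show False using pos[of "min s d / 2"] \<open>s > 0\<close> by (smt (verit) field_sum_of_halves)
qed

text \<open>Local graph functions are glued by finitely many nonnegative bump functions. At a frontier point
  \<open>y\<close> all of them vanish, so the gradient of the sum is the weighted sum of their gradients. Its
  component along an inward direction \<open>e\<close> that works for one of them is positive: that one contributes
  a positive amount and no other a negative one, by \<open>nonneg_derivative_inward\<close>.\<close>
theorem defining_function_exists:
  fixes D :: "(real^'n::finite) set"
  assumes D: "open D" "bounded D" "C2_boundary D"
  obtains \<psi> g h where "defining_function D \<psi> g h"
proof -
  (* The last clause records an inward direction along which f increases; it is what keeps
     the gradient of the sum from cancelling. *)
  let ?P = "\<lambda>x r f g h. 0 < r \<and> C2_with f g h \<and> (\<forall>y\<in>D \<inter> ball x r. f y > 0) \<and> (\<forall>y\<in>frontier D \<inter> ball x r. f y = 0) \<and>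
     (\<forall>y\<in>frontier D \<inter> ball x r. \<exists>e s. s > 0 \<and> g y \<bullet> e > 0 \<and> (\<forall>t. 0 < t \<longrightarrow> t < s \<longrightarrow> y + t *\<^sub>R e \<in> D))"
  have "\<exists>r f g h. ?P x r f g h" if x: "x \<in> closure D" for x
  proof (cases "x \<in> D")
    case True
    then obtain r where r: "r > 0" "ball x r \<subseteq> D" using D(1) openE by metis
    have "frontier D \<inter> ball x r = {}" using r D(1) by (auto simp: frontier_def interior_open)
    then show ?thesis using r(1) C2_with_const[of 1]
      by (intro exI[of _ r] exI[of _ "\<lambda>x. 1"] exI[of _ "\<lambda>x. 0"]) auto
  next
    case False
    then have "x \<in> frontier D" using x D(1) by (auto simp: frontier_def interior_open)
    then obtain r e \<gamma> where "C2_graph_near D x r e \<gamma>" using D(3) by (auto simp: C2_boundary_def)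
    then obtain w g h where G: "local_graph D x r e w g h" using graph_near_local_graph[OF D(1)] by metis
    note G' = G[unfolded local_graph_def]
    have "?P x r w g h"
    proof (intro conjI ballI)
      fix y assume y: "y \<in> frontier D \<inter> ball x r"
      then obtain s where s: "s > 0" "ball y s \<subseteq> ball x r"
        using openE[OF open_ball, of y x r] by (metis IntD2)
      have "y + t *\<^sub>R e \<in> D" if t: "0 < t" "t < s" for t
      proof -
        have "y + t *\<^sub>R e \<in> ball y s" using t G' by (auto simp: dist_norm)
        moreover have "w y = 0" using G' y by auto
        ultimately show ?thesis using G' s t by (auto simp: subset_iff)
      qed
      then show "\<exists>e s. s > 0 \<and> g y \<bullet> e > 0 \<and> (\<forall>t. 0 < t \<longrightarrow> t < s \<longrightarrow> y + t *\<^sub>R e \<in> D)"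
        using s(1) G' by (intro exI[of _ e] exI[of _ s]) auto
    qed (use G' in auto)
    then show ?thesis by blast
  qed
  then have "\<forall>x\<in>closure D. \<exists>q. ?P x (fst q) (fst (snd q)) (fst (snd (snd q))) (snd (snd (snd q)))"
    by (simp only: split_paired_Ex fst_conv snd_conv) blast
  then obtain q where "\<forall>x\<in>closure D. ?P x (fst (q x)) (fst (snd (q x))) (fst (snd (snd (q x)))) (snd (snd (snd (q x))))"
    by (rule bchoice[elim_format]) blast
  then obtain r f g h where P: "\<And>x. x \<in> closure D \<Longrightarrow> ?P x (r x) (f x) (g x) (h x)"
    by (rule_tac that[of "\<lambda>x. fst (q x)" "\<lambda>x. fst (snd (q x))" "\<lambda>x. fst (snd (snd (q x)))" "\<lambda>x. snd (snd (snd (q x)))"]) blast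
  have "compact (closure D)" using D(2) by simp
  moreover have "closure D \<subseteq> (\<Union>x\<in>closure D. ball x (r x))" using P by fastforce
  ultimately obtain F where F: "F \<subseteq> closure D" "finite F" "closure D \<subseteq> (\<Union>x\<in>F. ball x (r x))"
    using compactE_image[of "closure D" "closure D" "\<lambda>x. ball x (r x)"] by auto
  (* A bump supported in the closed ball of radius r x about x, with gradient zero where it vanishes. *)
  define \<phi> where "\<phi> x y = (max 0 ((r x)\<^sup>2 - (y - x) \<bullet> (y - x))) ^ 3" for x y :: "real^'n"
  have "\<exists>g h. C2_with (\<phi> x) g h \<and> (\<forall>y. \<phi> x y = 0 \<longrightarrow> g y = 0)" for x
  proof -
    have "C2_with (\<lambda>y. (r x)\<^sup>2 - (y - x) \<bullet> (y - x)) (\<lambda>y. (-2) *\<^sub>R (y - x)) (\<lambda>y. (-2) *\<^sub>R mat 1)"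
    proof -
      have e: "(\<chi> i. ((-2) *\<^sub>R mat 1 :: real^'n^'n) $ i $ j) = (-2) *\<^sub>R axis j 1" for j
        by (simp add: vec_eq_iff mat_def axis_def)
      have n: "((\<lambda>y. ((-2) *\<^sub>R (y - x)) $ j) has_derivative (\<lambda>v. ((-2) *\<^sub>R axis j 1) \<bullet> v)) (at y)" for j y
      proof -
        have "((\<lambda>y. ((-2) *\<^sub>R (y - x)) $ j) has_derivative (\<lambda>v. ((-2) *\<^sub>R v) $ j)) (at y)"
          by (intro bounded_linear.has_derivative[OF bounded_linear_vec_nth]) (auto intro!: derivative_eq_intros)
        then show ?thesis by (rule has_derivative_eq_rhs) (auto simp: inner_axis')
      qed
      show ?thesis unfolding C2_with_def e
      proof (intro conjI allI n)
        show "((\<lambda>y. (r x)\<^sup>2 - (y - x) \<bullet> (y - x)) has_derivative (\<lambda>v. ((-2) *\<^sub>R (y - x)) \<bullet> v)) (at y)" for y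
          by (auto intro!: derivative_eq_intros simp: inner_commute algebra_simps)
      qed (intro continuous_intros)
    qed
    from C2_with_compose[OF this cube_pos_derivs continuous_on_mult_left[OF continuous_on_max[OF continuous_on_const continuous_on_id]]]
    have "C2_with (\<phi> x) (\<lambda>y. (3 * (max 0 ((r x)\<^sup>2 - (y - x) \<bullet> (y - x)))\<^sup>2) *\<^sub>R (-2) *\<^sub>R (y - x)) 
      (\<lambda>y. (3 * (max 0 ((r x)\<^sup>2 - (y - x) \<bullet> (y - x)))\<^sup>2) *\<^sub>R (-2) *\<^sub>R mat 1 +
           (6 * max 0 ((r x)\<^sup>2 - (y - x) \<bullet> (y - x))) *\<^sub>R outer ((-2) *\<^sub>R (y - x)) ((-2) *\<^sub>R (y - x)))"
      unfolding \<phi>_def .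
    then show ?thesis by (intro exI conjI) (auto simp: \<phi>_def)
  qed
  then obtain G H where GH: "\<And>x. C2_with (\<phi> x) (G x) (H x)" "\<And>x y. \<phi> x y = 0 \<Longrightarrow> G x y = 0" by metis
  have phi: "0 \<le> \<phi> x y" "r x > 0 \<Longrightarrow> \<phi> x y > 0 \<longleftrightarrow> y \<in> ball x (r x)" for x y
  proof -
    show "0 \<le> \<phi> x y" by (simp add: \<phi>_def)
    assume "r x > 0"
    have "y \<in> ball x (r x) \<longleftrightarrow> (norm (y - x))\<^sup>2 < (r x)\<^sup>2"
      using \<open>r x > 0\<close> power_strict_mono[of "norm (y - x)" "r x" 2] power2_less_imp_less[of "norm (y - x)" "r x"]
      by (auto simp: dist_norm norm_minus_commute)
    then show "\<phi> x y > 0 \<longleftrightarrow> y \<in> ball x (r x)" by (auto simp: \<phi>_def power2_norm_eq_inner max_def)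
  qed
  define \<psi> where "\<psi> y = (\<Sum>x\<in>F. \<phi> x y * f x y)" for y
  define g' where "g' y = (\<Sum>x\<in>F. \<phi> x y *\<^sub>R g x y + f x y *\<^sub>R G x y)" for y
  have Pf: "C2_with (f x) (g x) (h x)" if "x \<in> F" for x
    using P[of x] F(1) that by blast
  have Ppos: "f x y > 0" if "x \<in> F" "y \<in> D" "y \<in> ball x (r x)" for x y
    using P[of x] F(1) that by blast
  have Pzero: "f x y = 0" if "x \<in> F" "y \<in> frontier D" "y \<in> ball x (r x)" for x y
    using P[of x] F(1) that by blast
  define h' where "h' y = (\<Sum>x\<in>F. \<phi> x y *\<^sub>R h x y + f x y *\<^sub>R H x y + outer (G x y) (g x y) + outer (g x y) (G x y))" for y
  have h': "C2_with \<psi> g' h'"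
    unfolding \<psi>_def[abs_def] g'_def[abs_def] h'_def[abs_def]
    by (rule C2_with_sum[OF F(2)], rule C2_with_mult[OF GH(1) Pf])
  have rF: "r x > 0" if "x \<in> F" for x using P F(1) that by blast
  have "defining_function D \<psi> g' h'"
    unfolding defining_function_def
  proof (intro conjI ballI h')
    fix y assume y: "y \<in> D"
    then obtain x where x: "x \<in> F" "y \<in> ball x (r x)" using F(3) closure_subset by blast
    have t: "0 \<le> \<phi> z y * f z y" if "z \<in> F" for z
    proof (cases "y \<in> ball z (r z)")
      case True then show ?thesis using phi(1) Ppos[OF that y] by (simp add: less_imp_le)
    next
      case False
      then have "\<phi> z y = 0" using phi(2)[OF rF[OF that], of y] phi(1)[of z y] by linarith
      then show ?thesis by simp
    qed
    have "0 < \<phi> x y" using phi(2)[OF rF[OF x(1)], of y] x(2) by blast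
    then have "0 < \<phi> x y * f x y" using Ppos[OF x(1) y x(2)] by (rule mult_pos_pos)
    then show "0 < \<psi> y" unfolding \<psi>_def using F(2) x(1) t by (intro sum_pos2[of F x]) auto
  next
    fix y assume y: "y \<in> frontier D"
    have t: "\<phi> z y * f z y = 0" if "z \<in> F" for z
    proof (cases "y \<in> ball z (r z)")
      case False
      then have "\<phi> z y = 0" using phi(2)[OF rF[OF that], of y] phi(1)[of z y] by linarith
      then show ?thesis by simp
    qed (use Pzero[OF that y] in simp)
    then show "\<psi> y = 0" unfolding \<psi>_def by (intro sum.neutral ballI t)
    obtain x where x: "x \<in> F" "y \<in> ball x (r x)" using F(3) y by (auto simp: frontier_def)
    obtain e s where es: "s > 0" "g x y \<bullet> e > 0" "\<And>t. 0 < t \<Longrightarrow> t < s \<Longrightarrow> y + t *\<^sub>R e \<in> D"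
      using P[of x] F(1) x y by blast
    have nn: "0 \<le> (\<phi> z y *\<^sub>R g z y + f z y *\<^sub>R G z y) \<bullet> e \<and> (z = x \<longrightarrow> 0 < (\<phi> z y *\<^sub>R g z y + f z y *\<^sub>R G z y) \<bullet> e)" if z: "z \<in> F" for z
    proof (cases "y \<in> ball z (r z)")
      case True
      have fz: "f z y = 0" by (rule Pzero[OF z y True])
      obtain s' where s': "s' > 0" "ball y s' \<subseteq> ball z (r z)"
        using True openE[OF open_ball, of y z "r z"] by metis
      (* Short enough to stay both in D and in the ball belonging to z; the 1 guards against e = 0. *)
      define s2 where "s2 = min s (s' / (norm e + 1))"
      have "s2 > 0" using es(1) s'(1) by (auto simp: s2_def intro!: divide_pos_pos add_nonneg_pos)
      have "0 \<le> g z y \<bullet> e"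
      proof (rule nonneg_derivative_inward[where s=s2 and f="f z" and g="g z" and h="h z"])
        show "C2_with (f z) (g z) (h z)" by (rule Pf[OF z])
        fix t assume t: "0 < t" "t < s2"
        have "t * norm e \<le> t * (norm e + 1)" using t by simp
        also have "\<dots> < s'"
          using t pos_less_divide_eq[of "norm e + 1" t s'] norm_ge_zero[of e] by (simp add: s2_def)
        finally have "y + t *\<^sub>R e \<in> ball y s'" using t by (simp add: dist_norm)
        moreover have "y + t *\<^sub>R e \<in> D" using es(3)[OF t(1)] t(2) by (simp add: s2_def)
        ultimately show "0 \<le> f z (y + t *\<^sub>R e)" using Ppos[OF z] s'(2) by (auto intro!: less_imp_le)
      qed (fact fz \<open>s2 > 0\<close>)+
      moreover have "\<phi> z y > 0" using phi(2)[OF rF[OF z]] True by blast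
      ultimately show ?thesis using es(2) fz by (auto simp: inner_add_left)
    next
      case False
      then have "\<phi> z y = 0" using phi(2)[OF rF[OF z], of y] phi(1)[of z y] by linarith
      then show ?thesis using GH(2) False x(2) by auto
    qed
    have "0 < g' y \<bullet> e" unfolding g'_def inner_sum_left using F(2) x(1) nn by (intro sum_pos2[of F x]) auto
    then show "g' y \<noteq> 0" by auto
  qed
  then show thesis by (rule that)
qed

text \<open>Small values of \<open>\<psi>\<close> occur only near the frontier: away from it \<open>\<psi>\<close> has a positive minimum,
  by compactness.\<close>
lemma near_frontier:
  assumes D: "open D" "bounded D" and psi: "defining_function D \<psi> g h" and W: "open W" "frontier D \<subseteq> W"
  obtains \<epsilon> where "\<epsilon> > 0" "\<And>x. x \<in> closure D \<Longrightarrow> \<psi> x < \<epsilon> \<Longrightarrow> x \<in> W"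
proof (cases "closure D - W = {}")
  case True then show thesis using that[of 1] by auto
next
  case False
  have "compact (closure D - W)" using D(2) W(1) by (simp add: compact_diff)
  moreover have "continuous_on (closure D - W) \<psi>"
    using psi C2_with_cont(1) by (auto simp: defining_function_def)
  ultimately obtain z where z: "z \<in> closure D - W" "\<And>x. x \<in> closure D - W \<Longrightarrow> \<psi> z \<le> \<psi> x"
    using continuous_attains_inf[OF _ False] by metis
  have "z \<in> D" using z(1) W(2) closure_Un_frontier' by blast
  then have "\<psi> z > 0" using psi by (auto simp: defining_function_def)
  then show thesis using that[of "\<psi> z"] z(2) by force
qed

lemma small_near_frontier:
  fixes f :: "real^'n::finite \<Rightarrow> real"
  assumes D: "open D" "bounded D" and psi: "defining_function D \<psi> g h"
    and f: "continuous_on (closure D) f" "\<And>x. x \<in> frontier D \<Longrightarrow> f x < c"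
  obtains \<epsilon> where "\<epsilon> > 0" "\<And>x. x \<in> closure D \<Longrightarrow> \<psi> x < \<epsilon> \<Longrightarrow> f x < c"
proof -
  obtain W where W0: "open W" "closure D \<inter> f -` {..<c} = closure D \<inter> W"
    using continuous_openin_preimage_gen[OF f(1) open_lessThan[of c]] openin_open by metis
  have W: "open W" "\<And>x. x \<in> closure D \<Longrightarrow> f x < c \<longleftrightarrow> x \<in> W"
    using W0(1) by (simp, use W0(2) in \<open>blast dest: equalityD1 equalityD2\<close>)
  have "frontier D \<subseteq> W" using W(2) f(2) by (auto simp: frontier_def)
  then obtain \<epsilon> where "\<epsilon> > 0" and W': "\<And>x. x \<in> closure D \<Longrightarrow> \<psi> x < \<epsilon> \<Longrightarrow> x \<in> W"
    using near_frontier[OF D psi W(1)] by metis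
  from this(1) show thesis
  proof (rule that)
    fix x assume "x \<in> closure D" "\<psi> x < \<epsilon>"
    then show "f x < c" using W' W(2) by simp
  qed
qed

section \<open>Behaviour near the boundary\<close>

lemma frontier_local_graph:
  assumes "open D" "C2_boundary D" "y \<in> frontier D"
  obtains r e w g h where "local_graph D y r e w g h"
  using assms graph_near_local_graph unfolding C2_boundary_def by metis

lemma mean_value_bound:
  fixes k :: "real \<Rightarrow> real"
  assumes "0 \<le> t" "continuous_on {0..t} k" "\<And>\<tau>. 0 < \<tau> \<Longrightarrow> \<tau> < t \<Longrightarrow> (k has_real_derivative k' \<tau>) (at \<tau>)"
    "\<And>\<tau>. 0 < \<tau> \<Longrightarrow> \<tau> < t \<Longrightarrow> \<bar>k' \<tau>\<bar> \<le> B"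
  shows "\<bar>k t - k 0\<bar> \<le> B * t"
proof (cases "t = 0")
  case False
  then have "0 < t" using assms(1) by simp
  from mvt[OF this assms(2), of "\<lambda>\<tau> h. h * k' \<tau>"] assms(3)
  obtain \<xi> where "0 < \<xi>" "\<xi> < t" "k t - k 0 = (t - 0) * k' \<xi>"
    by (auto simp: has_field_derivative_def mult_commute_abs)
  then show ?thesis using assms(4)[of \<xi>] \<open>0 < t\<close> by (simp add: abs_mult mult.commute)
qed simp

text \<open>The tangential part of \<open>Du\<close> vanishes at the boundary because \<open>u\<close> is zero along boundary curves.
  As \<open>u\<close> need not be differentiable on the closure in any other sense, the derivative along such a curve
  \<open>c\<close> is estimated along the shifted curves \<open>c + s *\<^sub>R e\<close> inside \<open>D\<close>, and \<open>s\<close> tends to zero.\<close>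
proposition boundary_gradient_normal:
  assumes D: "open D" and G: "local_graph D y r e w g h" and y: "y \<in> frontier D"
    and u: "C1_closure D u Du" "\<And>x. x \<in> frontier D \<Longrightarrow> u x = 0"
  shows "Du y \<bullet> a = (g y \<bullet> a) * (Du y \<bullet> e)"
proof -
  note G' = G[unfolded local_graph_def]
  have C2: "C2_with w g h" and e: "norm e = 1" and shift: "\<And>y t. w (y + t *\<^sub>R e) = w y + t" and r: "r > 0"
    using G' by auto
  have w0: "w y = 0" using G' y by auto
  have inD: "z \<in> D" if "z \<in> ball y r" "w z > 0" for z using G' that by auto
  have inF: "z \<in> frontier D" if "z \<in> ball y r" "w z = 0" for z using G' that by auto
  have ycl: "y \<in> closure D" using y by (auto simp: frontier_def)
  (* The line through y in direction a, projected to the boundary along e; c' is its velocity. *)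
  define c where "c \<tau> = y + \<tau> *\<^sub>R a - w (y + \<tau> *\<^sub>R a) *\<^sub>R e" for \<tau>
  define c' where "c' \<tau> = a - (g (y + \<tau> *\<^sub>R a) \<bullet> a) *\<^sub>R e" for \<tau>
  have wc: "w (c \<tau> + s *\<^sub>R e) = s" for \<tau> s
    using shift[of "y + \<tau> *\<^sub>R a" "s - w (y + \<tau> *\<^sub>R a)"] by (simp add: c_def algebra_simps)
  have c0: "c 0 = y" by (simp add: c_def w0)
  have cd: "(c has_derivative (\<lambda>s. s *\<^sub>R c' \<tau>)) (at \<tau>)" for \<tau>
  proof -
    have "((\<lambda>\<tau>. w (y + \<tau> *\<^sub>R a)) has_derivative (\<lambda>s. s * (g (y + \<tau> *\<^sub>R a) \<bullet> a))) (at \<tau>)"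
      using line_DERIV[of w "g (y + \<tau> *\<^sub>R a)" y \<tau> a] C2
      by (auto simp: C2_with_def has_field_derivative_def mult_commute_abs)
    note w' = this
    have "((\<lambda>\<tau>. y + \<tau> *\<^sub>R a) has_derivative (\<lambda>s. s *\<^sub>R a)) (at \<tau>)"
      by (auto intro!: derivative_eq_intros)
    from has_derivative_diff[OF this has_derivative_scaleR_left[OF w', of e]]
    show ?thesis unfolding c_def[abs_def] c'_def
      by (rule has_derivative_eq_rhs) (simp add: fun_eq_iff scaleR_diff_right)
  qed
  have cc: "continuous_on S c" for S
    by (rule continuous_on_of_derivative[OF cd])
  have c'c: "continuous_on UNIV c'"
    unfolding c'_def[abs_def] by (intro continuous_intros continuous_on_compose2[OF C2_with_cont(2)[OF C2, of UNIV]]) auto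
  have "bounded (c' ` {0..1})"
    by (intro compact_imp_bounded compact_continuous_image continuous_on_subset[OF c'c]) auto
  then obtain M where M: "M > 0" "\<And>\<tau>. 0 \<le> \<tau> \<Longrightarrow> \<tau> \<le> 1 \<Longrightarrow> norm (c' \<tau>) \<le> M"
    by (auto simp: bounded_pos)
  have cM: "norm (c \<tau> - y) \<le> M * \<tau>" if "0 \<le> \<tau>" "\<tau> \<le> 1" for \<tau>
  proof -
    have "norm (c \<tau> - c 0) \<le> M * norm (\<tau> - 0)"
    proof (rule differentiable_bound[of "{0..1}" c "\<lambda>\<tau> s. s *\<^sub>R c' \<tau>"])
      show "onorm (\<lambda>s. s *\<^sub>R c' x) \<le> M" if "x \<in> {0..1}" for x
        using M(2)[of x] that by (intro onorm_le) (auto simp: mult.commute[of M] intro: mult_left_mono)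
    qed (use cd that in \<open>auto intro: has_derivative_at_withinI\<close>)
    then show ?thesis using that by (simp add: c0)
  qed
  (* It remains to show that Du y is orthogonal to c' 0. The function ?U below removes the
     linear part Du y, so its derivative along the shifted curve is at most \<epsilon> * M by
     continuity of Du. *)
  have key: "\<bar>Du y \<bullet> c' 0\<bar> \<le> \<epsilon> * M" if \<epsilon>: "\<epsilon> > 0" for \<epsilon>
  proof -
    have "continuous_on (closure D) Du" using u(1) by (simp add: C1_closure_def)
    then obtain \<delta>0 where \<delta>0: "\<delta>0 > 0" "\<And>z. z \<in> closure D \<Longrightarrow> dist z y < \<delta>0 \<Longrightarrow> dist (Du z) (Du y) < \<epsilon>"
      using ycl \<epsilon> unfolding continuous_on_iff by blast
    define \<delta> where "\<delta> = min \<delta>0 r"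
    have \<delta>: "\<delta> > 0" "\<delta> \<le> r" "\<And>z. z \<in> D \<Longrightarrow> dist z y < \<delta> \<Longrightarrow> dist (Du z) (Du y) < \<epsilon>"
      using \<delta>0 r closure_subset[of D] by (auto simp: \<delta>_def)
    define t0 where "t0 = min 1 (\<delta> / (2 * M))"
    have t0: "0 < t0" "t0 \<le> 1" using \<delta> M by (auto simp: t0_def)
    have near: "c \<tau> \<in> ball y (\<delta>/2)" if "0 \<le> \<tau>" "\<tau> < t0" for \<tau>
    proof -
      have "M * \<tau> < \<delta> / 2" using that M(1) by (simp add: t0_def field_simps)
      then show ?thesis using cM[of \<tau>] that t0 by (simp add: dist_norm norm_minus_commute)
    qed
    have near2: "c \<tau> + s *\<^sub>R e \<in> ball y \<delta>" if "0 \<le> \<tau>" "\<tau> < t0" "0 \<le> s" "s < \<delta>/2" for \<tau> s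
    proof -
      have "dist y (c \<tau> + s *\<^sub>R e) \<le> dist y (c \<tau>) + dist (c \<tau>) (c \<tau> + s *\<^sub>R e)" by (rule dist_triangle)
      also have "dist (c \<tau>) (c \<tau> + s *\<^sub>R e) = s" using that e by (simp add: dist_norm)
      finally show ?thesis using near[OF that(1,2)] that(4) by simp
    qed
    have bound: "\<bar>Du y \<bullet> (c t - y)\<bar> \<le> \<epsilon> * M * t" if t: "0 < t" "t < t0" for t
    proof -
      let ?U = "\<lambda>z. u z - Du y \<bullet> z"
      have step: "\<bar>?U (c t + s *\<^sub>R e) - ?U (c 0 + s *\<^sub>R e)\<bar> \<le> \<epsilon> * M * t" if s: "0 < s" "s < \<delta>/2" for s
      proof -
        have inDs: "c \<tau> + s *\<^sub>R e \<in> D" if "0 \<le> \<tau>" "\<tau> \<le> t" for \<tau>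
        proof (rule inD)
          show "c \<tau> + s *\<^sub>R e \<in> ball y r" using near2[of \<tau> s] that t s \<delta>(2) by auto
        qed (simp add: wc s)
        have dU: "((\<lambda>\<tau>. ?U (c \<tau> + s *\<^sub>R e)) has_real_derivative ((Du (c \<tau> + s *\<^sub>R e) - Du y) \<bullet> c' \<tau>)) (at \<tau>)" if "0 \<le> \<tau>" "\<tau> \<le> t" for \<tau>
        proof -
          have "(u has_derivative (\<lambda>v. Du (c \<tau> + s *\<^sub>R e) \<bullet> v)) (at (c \<tau> + s *\<^sub>R e))"
            using u(1) inDs[OF that] by (auto simp: C1_closure_def)
          then have "(?U has_derivative (\<lambda>v. Du (c \<tau> + s *\<^sub>R e) \<bullet> v - Du y \<bullet> v)) (at (c \<tau> + s *\<^sub>R e))"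
            by (auto intro!: derivative_eq_intros)
          from has_derivative_compose[OF has_derivative_add[OF cd has_derivative_const[of "s *\<^sub>R e"]], of ?U _ \<tau>, OF this]
          show ?thesis unfolding has_field_derivative_def
            by (rule has_derivative_eq_rhs) (simp add: fun_eq_iff inner_diff_left algebra_simps)
        qed
        show ?thesis
        proof (rule mean_value_bound[of t "\<lambda>\<tau>. ?U (c \<tau> + s *\<^sub>R e)" "\<lambda>\<tau>. (Du (c \<tau> + s *\<^sub>R e) - Du y) \<bullet> c' \<tau>"])
          show "continuous_on {0..t} (\<lambda>\<tau>. ?U (c \<tau> + s *\<^sub>R e))"
            using dU by (intro DERIV_continuous_on) (auto intro: has_field_derivative_at_within)
          fix \<tau> assume \<tau>: "0 < \<tau>" "\<tau> < t"
          have "\<bar>(Du (c \<tau> + s *\<^sub>R e) - Du y) \<bullet> c' \<tau>\<bar> \<le> norm (Du (c \<tau> + s *\<^sub>R e) - Du y) * norm (c' \<tau>)"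
            by (rule Cauchy_Schwarz_ineq2)
          also have "\<dots> \<le> \<epsilon> * M"
            using \<delta>(3)[OF inDs[of \<tau>]] near2[of \<tau> s] \<tau> t s t0 M \<epsilon>
            by (intro mult_mono) (auto simp: dist_norm dist_commute norm_minus_commute intro!: less_imp_le)
          finally show "\<bar>(Du (c \<tau> + s *\<^sub>R e) - Du y) \<bullet> c' \<tau>\<bar> \<le> \<epsilon> * M" .
        qed (use t dU in auto)
      qed
      have lim: "((\<lambda>s. ?U (c \<tau> + s *\<^sub>R e)) \<longlongrightarrow> ?U (c \<tau>)) (at_right 0)" if \<tau>: "0 \<le> \<tau>" "\<tau> < t0" for \<tau>
      proof -
        have cF: "c \<tau> \<in> frontier D" using inF[of "c \<tau>"] near[OF \<tau>] \<delta> wc[of \<tau> 0] by auto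
        have ct: "((\<lambda>s. c \<tau> + s *\<^sub>R e) \<longlongrightarrow> c \<tau>) (at_right 0)" by (auto intro!: tendsto_eq_intros)
        have "continuous_on (closure D) ?U" using u(1) by (auto simp: C1_closure_def intro!: continuous_intros)
        then have "(?U \<longlongrightarrow> ?U (c \<tau>)) (at (c \<tau>) within closure D)"
          using cF by (auto simp: continuous_on_def frontier_def)
        moreover have "filterlim (\<lambda>s. c \<tau> + s *\<^sub>R e) (at (c \<tau>) within closure D) (at_right 0)"
          unfolding filterlim_at
        proof (intro conjI ct)
          have "\<forall>\<^sub>F s in at_right 0. 0 < s \<and> s < \<delta>/2"
            using \<delta>(1) by (auto simp: eventually_at_right[of 0 1] intro!: exI[of _ "\<delta>/2"])
          then show "\<forall>\<^sub>F s in at_right 0. c \<tau> + s *\<^sub>R e \<in> closure D \<and> c \<tau> + s *\<^sub>R e \<noteq> c \<tau>"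
          proof eventually_elim
            case (elim s)
            have "c \<tau> + s *\<^sub>R e \<in> ball y r" using near2[of \<tau> s] \<tau> elim \<delta>(2) by auto
            then have "c \<tau> + s *\<^sub>R e \<in> D" by (rule inD) (simp add: wc elim)
            then show ?case using closure_subset[of D] elim e by auto
          qed
        qed
        ultimately show ?thesis by (rule filterlim_compose)
      qed
      have cF: "c t \<in> frontier D" using inF[of "c t"] near[of t] \<delta> wc[of t 0] t by auto
      have "((\<lambda>s. \<bar>?U (c t + s *\<^sub>R e) - ?U (c 0 + s *\<^sub>R e)\<bar>) \<longlongrightarrow> \<bar>?U (c t) - ?U (c 0)\<bar>) (at_right 0)"
        by (intro tendsto_rabs tendsto_diff[OF lim lim]) (use t t0 in auto)
      moreover have "\<forall>\<^sub>F s in at_right 0. \<bar>?U (c t + s *\<^sub>R e) - ?U (c 0 + s *\<^sub>R e)\<bar> \<le> \<epsilon> * M * t"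
        using \<delta>(1) step by (auto simp: eventually_at_right[of 0 1] intro!: exI[of _ "\<delta>/2"])
      ultimately have "\<bar>?U (c t) - ?U (c 0)\<bar> \<le> \<epsilon> * M * t"
        by (rule tendsto_upperbound) simp
      then show ?thesis using u(2)[OF cF] u(2)[OF y] by (simp add: c0 inner_diff_right abs_minus_commute)
    qed
    have "((\<lambda>t. Du y \<bullet> c t) has_real_derivative (Du y \<bullet> c' 0)) (at 0)"
      using has_derivative_inner_right[OF cd[of 0], of "Du y"]
      by (simp add: has_field_derivative_def mult_commute_abs)
    then have "((\<lambda>t. (Du y \<bullet> c t - Du y \<bullet> c 0) / t) \<longlongrightarrow> Du y \<bullet> c' 0) (at_right 0)"
      by (simp add: has_field_derivative_iff filterlim_at_split)
    then have "((\<lambda>t. \<bar>(Du y \<bullet> (c t - y)) / t\<bar>) \<longlongrightarrow> \<bar>Du y \<bullet> c' 0\<bar>) (at_right 0)"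
      by (intro tendsto_rabs) (simp add: c0 inner_diff_right)
    moreover have "\<forall>\<^sub>F t in at_right 0. \<bar>(Du y \<bullet> (c t - y)) / t\<bar> \<le> \<epsilon> * M"
      using t0(1) bound by (auto simp: eventually_at_right[of 0 1] field_simps intro!: exI[of _ t0])
    ultimately show ?thesis by (rule tendsto_upperbound) simp
  qed
  have "Du y \<bullet> c' 0 = 0"
  proof (rule ccontr)
    assume n: "Du y \<bullet> c' 0 \<noteq> 0"
    have "\<bar>Du y \<bullet> c' 0\<bar> \<le> \<bar>Du y \<bullet> c' 0\<bar> / (2 * M) * M" using n M(1) by (intro key) auto
    then show False using n M(1) by simp
  qed
  then show ?thesis by (simp add: c'_def inner_diff_right mult.commute)
qed

lemma defining_function_C1_closure:
  "defining_function D \<psi> g h \<Longrightarrow> C1_closure D \<psi> g"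
  by (auto simp: defining_function_def C1_closure_def C2_with_cont intro: C2_with_deriv)

text \<open>\<open>\<psi>\<close> itself vanishes on the frontier, so its gradient is a multiple of that of the graph
  function.\<close>
lemma graph_direction_positive:
  assumes D: "open D" and G: "local_graph D y r e w g' h'" and y: "y \<in> frontier D" and psi: "defining_function D \<psi> g h"
  shows "g y \<bullet> e > 0" and "g y = (g y \<bullet> e) *\<^sub>R g' y"
proof -
  note G' = G[unfolded local_graph_def]
  note psi' = psi[unfolded defining_function_def]
  show eq: "g y = (g y \<bullet> e) *\<^sub>R g' y"
  proof (rule vector_eq_rdot[THEN iffD1], rule allI)
    fix a show "g y \<bullet> a = ((g y \<bullet> e) *\<^sub>R g' y) \<bullet> a"
      using boundary_gradient_normal[OF D G y defining_function_C1_closure[OF psi], of a] psi' by simp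
  qed
  have "0 \<le> g y \<bullet> e"
  proof (rule nonneg_derivative_inward[where s=r and f=\<psi> and g=g and h=h])
    fix t :: real assume t: "0 < t" "t < r"
    have "w y = 0" using G' y by auto
    moreover have "y + t *\<^sub>R e \<in> ball y r" using t G' by (simp add: dist_norm)
    ultimately have "y + t *\<^sub>R e \<in> D" using G' t by auto
    then show "0 \<le> \<psi> (y + t *\<^sub>R e)" using psi' by (auto intro: less_imp_le)
  qed (use psi' y G' in auto)
  moreover have "g y \<bullet> e \<noteq> 0" using eq psi' y by auto
  ultimately show "g y \<bullet> e > 0" by simp
qed

lemma outer_unit_normal_eq:
  assumes D: "open D" "C2_boundary D" and y: "y \<in> frontier D" and psi: "defining_function D \<psi> g h"
  shows "outer_unit_normal D y = - sgn (g y)"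
proof -
  have *: "sgn (gradient \<gamma> y - e) = - sgn (g y)" if CG: "C2_graph_near D y r e \<gamma>" for r e \<gamma>
  proof -
    obtain w g' h' where G: "local_graph D y r e w g' h'" and eq: "\<And>z. gradient \<gamma> z - e = - g' z"
      by (rule graph_near_local_graph[OF D(1) CG], rule that)
    have "sgn (g y) = sgn (g' y)"
      using graph_direction_positive[OF D(1) G y psi] by (metis sgn_scaleR scaleR_one sgn_pos)
    then show ?thesis unfolding eq by (simp add: sgn_minus)
  qed
  obtain r e \<gamma> where r: "C2_graph_near D y r e \<gamma>" using D(2) y by (auto simp: C2_boundary_def)
  show ?thesis unfolding outer_unit_normal_def
  proof (rule the_equality)
    show "\<exists>r e \<gamma>. C2_graph_near D y r e \<gamma> \<and> - sgn (g y) = sgn (gradient \<gamma> y - e)"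
      using r *[OF r] by (intro exI conjI) auto
  qed (auto simp: *)
qed

lemma boundary_gradient_parallel:
  assumes D: "open D" "C2_boundary D" and y: "y \<in> frontier D" and psi: "defining_function D \<psi> g h"
    and u: "C1_closure D u Du" "\<And>x. x \<in> frontier D \<Longrightarrow> u x = 0"
  shows "Du y = ((Du y \<bullet> g y) / (g y \<bullet> g y)) *\<^sub>R g y"
proof -
  obtain r e w g' h' where G: "local_graph D y r e w g' h'" by (rule frontier_local_graph[OF D y])
  have "Du y = (Du y \<bullet> e) *\<^sub>R g' y"
  proof (rule vector_eq_rdot[THEN iffD1], rule allI)
    fix a show "Du y \<bullet> a = ((Du y \<bullet> e) *\<^sub>R g' y) \<bullet> a"
      using boundary_gradient_normal[OF D(1) G y u, of a] by simp
  qed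
  moreover have gp: "g y \<bullet> e > 0" "g y = (g y \<bullet> e) *\<^sub>R g' y"
    using graph_direction_positive[OF D(1) G y psi] by auto
  ultimately have "Du y = ((Du y \<bullet> e) / (g y \<bullet> e)) *\<^sub>R g y"
    by (metis (no_types, lifting) less_irrefl nonzero_eq_divide_eq scaleR_scaleR times_divide_eq_left)
  then obtain k where k: "Du y = k *\<^sub>R g y" by blast
  moreover have "g y \<noteq> 0" using gp(1) by auto
  ultimately show ?thesis by simp
qed

text \<open>From a point at depth \<open>w x\<close> descend along the graph direction to the boundary. The derivative of
  \<open>u - Q x * \<psi>\<close> on this segment is at most \<open>\<delta> * c\<close>, since \<open>Du = Q g\<close> on the frontier and everything
  is continuous, while that of \<open>\<psi>\<close> is at least \<open>c\<close>. Note that \<open>Q\<close> is frozen at \<open>x\<close>: it is only continuous.\<close>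
proposition boundary_expansion:
  fixes u :: "real^'n::finite \<Rightarrow> real"
  assumes D: "open D" "bounded D" "C2_boundary D" and psi: "defining_function D \<psi> g h"
    and u: "C1_closure D u Du" "\<And>x. x \<in> frontier D \<Longrightarrow> u x = 0"
    and Q: "continuous_on (closure D) Q" "\<And>x. x \<in> frontier D \<Longrightarrow> Du x = Q x *\<^sub>R g x"
    and \<delta>: "\<delta> > 0"
  obtains \<epsilon> where "\<epsilon> > 0" "\<And>x. x \<in> D \<Longrightarrow> \<psi> x < \<epsilon> \<Longrightarrow> \<bar>u x - Q x * \<psi> x\<bar> \<le> \<delta> * \<psi> x"
proof -
  note psi' = psi[unfolded defining_function_def]
  have C2: "C2_with \<psi> g h" using psi' by simp
  have loc: "\<exists>\<rho>>0. \<forall>x\<in>D \<inter> ball y \<rho>. \<bar>u x - Q x * \<psi> x\<bar> \<le> \<delta> * \<psi> x" if y: "y \<in> frontier D" for y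
  proof -
    obtain r e w g' h' where G: "local_graph D y r e w g' h'" by (rule frontier_local_graph[OF D(1,3) y])
    note G' = G[unfolded local_graph_def]
    have e: "norm e = 1" and r: "r > 0" and w0: "w y = 0" and shift: "\<And>y t. w (y + t *\<^sub>R e) = w y + t"
      using G' y by auto
    have ycl: "y \<in> closure D" using y by (auto simp: frontier_def)
    (* Half of the slope of \<psi> at y bounds the slope from below in a neighbourhood. *)
    define c where "c = (g y \<bullet> e) / 2"
    have c: "c > 0" using graph_direction_positive(1)[OF D(1) G y psi] by (simp add: c_def)
    have "continuous_on UNIV (\<lambda>x. g x \<bullet> e)" by (intro continuous_intros C2_with_cont[OF C2])
    then have "open {x. c < g x \<bullet> e}" by (rule open_Collect_less[OF continuous_on_const])
    moreover have "y \<in> {x. c < g x \<bullet> e}" using c by (simp add: c_def)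
    ultimately obtain r1 where r1: "r1 > 0" "\<And>x. x \<in> ball y r1 \<Longrightarrow> c < g x \<bullet> e"
      unfolding open_contains_ball by blast
    (* The derivative to be estimated, with the point where Q is frozen and the point where the
       gradients are taken as independent variables; it vanishes at (y, y). *)
    let ?V = "\<lambda>p. Du (snd p) \<bullet> e - Q (fst p) * (g (snd p) \<bullet> e)"
    have cDu: "continuous_on (closure D) Du" using u(1) by (simp add: C1_closure_def)
    have "continuous_on (closure D \<times> closure D) (\<lambda>p. Du (snd p))"
      by (rule continuous_on_compose2[OF cDu continuous_on_snd[OF continuous_on_id]]) auto
    moreover have "continuous_on (closure D \<times> closure D) (\<lambda>p. Q (fst p))"
      by (rule continuous_on_compose2[OF Q(1) continuous_on_fst[OF continuous_on_id]]) auto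
    moreover have "continuous_on (closure D \<times> closure D) (\<lambda>p. g (snd p))"
      by (rule continuous_on_compose2[OF C2_with_cont(2)[OF C2, of UNIV] continuous_on_snd[OF continuous_on_id]]) auto
    ultimately have "continuous_on (closure D \<times> closure D) ?V"
      by (intro continuous_on_diff continuous_on_mult continuous_on_inner continuous_on_const)
    have V0: "?V (y, y) = 0" using Q(2)[OF y] by simp
    have yy: "(y, y) \<in> closure D \<times> closure D" and dc: "0 < \<delta> * c" using ycl \<delta> c by auto
    obtain r2 where r2: "r2 > 0" 
      "\<And>p. p \<in> closure D \<times> closure D \<Longrightarrow> dist p (y, y) < r2 \<Longrightarrow> dist (?V p) (?V (y, y)) < \<delta> * c"
      using continuous_on_iff[THEN iffD1, OF \<open>continuous_on (closure D \<times> closure D) ?V\<close>, THEN bspec, OF yy, THEN spec, THEN mp, OF dc]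
      by (elim exE conjE) blast
    have V: "\<bar>Du z \<bullet> e - Q x * (g z \<bullet> e)\<bar> \<le> \<delta> * c" if "x \<in> D" "z \<in> D" "dist x y < r2/2" "dist z y < r2/2" for x z
    proof -
      have "dist (x, z) (y, y) \<le> dist x y + dist z y"
        unfolding dist_Pair_Pair by (rule sqrt_sum_squares_le_sum) auto
      then have "dist (x, z) (y, y) < r2" using that by linarith
      moreover have "(x, z) \<in> closure D \<times> closure D" using that closure_subset[of D] by auto
      ultimately have "dist (?V (x, z)) (?V (y, y)) < \<delta> * c" by (intro r2(2))
      then show ?thesis unfolding V0 by (simp add: dist_real_def)
    qed
    define \<rho>1 where "\<rho>1 = Min {r, r1, r2/2}"
    have \<rho>1: "0 < \<rho>1" "\<rho>1 \<le> r" "\<rho>1 \<le> r1" "\<rho>1 \<le> r2/2" using r r1 r2 by (auto simp: \<rho>1_def)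
    have "C2_with w g' h'" using G' by simp
    from C2_with_cont(1)[OF this, of UNIV] have "open {x. \<bar>w x\<bar> < \<rho>1/2}"
      by (intro open_Collect_less continuous_intros)
    moreover have "y \<in> {x. \<bar>w x\<bar> < \<rho>1/2}" using \<rho>1 w0 by simp
    ultimately obtain r3 where r3: "r3 > 0" "\<And>x. x \<in> ball y r3 \<Longrightarrow> \<bar>w x\<bar> < \<rho>1/2"
      unfolding open_contains_ball by blast
    show ?thesis
    proof (intro exI[of _ "min r3 (\<rho>1/2)"] conjI ballI)
      show "0 < min r3 (\<rho>1/2)" using r3 \<rho>1 by simp
      fix x assume "x \<in> D \<inter> ball y (min r3 (\<rho>1/2))"
      then have x: "x \<in> D" "dist y x < \<rho>1/2" "\<bar>w x\<bar> < \<rho>1/2" using r3(2)[of x] by auto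
      then have wx: "0 < w x" using G' \<rho>1 by auto
      (* Parametrised by depth: z 0 lies on the frontier and z (w x) is x. *)
      define z where "z t = (x - w x *\<^sub>R e) + t *\<^sub>R e" for t
      have zw: "w (z t) = t" for t
        unfolding z_def using shift[of x "- w x"] shift[of "x - w x *\<^sub>R e" t] by simp
      have zb: "dist y (z t) < \<rho>1" if "0 \<le> t" "t \<le> w x" for t
      proof -
        have "dist x (z t) = \<bar>w x - t\<bar>" using e by (simp add: z_def dist_norm scaleR_left_diff_distrib[symmetric])
        then show ?thesis using dist_triangle[of y "z t" x] x that by linarith
      qed
      have zD: "z t \<in> D" if "0 < t" "t \<le> w x" for t using G' zb[of t] that zw[of t] \<rho>1 by auto
      have zF: "z 0 \<in> frontier D" using G' zb[of 0] wx zw[of 0] \<rho>1 by auto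
      have zx: "z (w x) = x" by (simp add: z_def)
      have du: "((\<lambda>t. u (z t)) has_real_derivative (Du (z t) \<bullet> e)) (at t)" if "0 < t" "t \<le> w x" for t
        unfolding z_def by (rule line_DERIV) (use u(1) zD[OF that] in \<open>auto simp: C1_closure_def z_def\<close>)
      have dp: "((\<lambda>t. \<psi> (z t)) has_real_derivative (g (z t) \<bullet> e)) (at t)" for t
        unfolding z_def by (rule line_DERIV) (use C2 in \<open>auto simp: C2_with_def\<close>)
      have zcl: "z t \<in> closure D" if "0 \<le> t" "t \<le> w x" for t
        using that zD[of t] zF closure_subset[of D] by (cases "t = 0") (auto simp: frontier_def)
      have zc: "continuous_on S z" for S unfolding z_def[abs_def] by (intro continuous_intros)
      have cu: "continuous_on {0..w x} (\<lambda>t. u (z t) - Q x * \<psi> (z t))"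
        using u(1) zcl by (intro continuous_intros continuous_on_compose2[OF _ zc, of "closure D"] 
            continuous_on_compose2[OF C2_with_cont(1)[OF C2, of UNIV] zc]) (auto simp: C1_closure_def)
      have "\<bar>(u (z (w x)) - Q x * \<psi> (z (w x))) - (u (z 0) - Q x * \<psi> (z 0))\<bar> \<le> (\<delta> * c) * w x"
      proof (rule mean_value_bound[OF less_imp_le[OF wx] cu])
        fix t assume t: "0 < t" "t < w x"
        show "((\<lambda>t. u (z t) - Q x * \<psi> (z t)) has_real_derivative (Du (z t) \<bullet> e - Q x * (g (z t) \<bullet> e))) (at t)"
          using t by (intro DERIV_diff DERIV_cmult du dp) auto
        show "\<bar>Du (z t) \<bullet> e - Q x * (g (z t) \<bullet> e)\<bar> \<le> \<delta> * c"
          using zb[of t] zD[of t] t x \<rho>1 by (intro V) (auto simp: dist_commute)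
      qed
      then have 1: "\<bar>u x - Q x * \<psi> x\<bar> \<le> \<delta> * (c * w x)"
        using u(2)[OF zF] psi' zF by (simp add: zx mult.assoc)
      have "\<exists>t. 0 < t \<and> t < w x \<and> \<psi> (z (w x)) - \<psi> (z 0) = (w x - 0) * (g (z t) \<bullet> e)"
        using MVT2[OF wx, of "\<lambda>t. \<psi> (z t)" "\<lambda>t. g (z t) \<bullet> e"] dp by blast
      then obtain t where t: "0 < t" "t < w x" "\<psi> x = w x * (g (z t) \<bullet> e)"
        using psi' zF by (auto simp: zx)
      have "c \<le> g (z t) \<bullet> e" using r1(2)[of "z t"] zb[of t] t \<rho>1 by auto
      then have "c * w x \<le> \<psi> x" using wx by (simp add: t(3) mult.commute)
      then show "\<bar>u x - Q x * \<psi> x\<bar> \<le> \<delta> * \<psi> x" using 1 \<delta> mult_left_mono[of "c * w x" "\<psi> x" \<delta>] by linarith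
    qed
  qed
  then obtain \<rho> where \<rho>: "\<And>y. y \<in> frontier D \<Longrightarrow> \<rho> y > 0"
     "\<And>y x. y \<in> frontier D \<Longrightarrow> x \<in> D \<inter> ball y (\<rho> y) \<Longrightarrow> \<bar>u x - Q x * \<psi> x\<bar> \<le> \<delta> * \<psi> x" by metis
  define W where "W = (\<Union>y\<in>frontier D. ball y (\<rho> y))"
  have "open W" "frontier D \<subseteq> W" using \<rho>(1) by (auto simp: W_def)
  then obtain \<epsilon> where "\<epsilon> > 0" and E: "\<And>x. x \<in> closure D \<Longrightarrow> \<psi> x < \<epsilon> \<Longrightarrow> x \<in> W"
    using near_frontier[OF D(1,2) psi] by metis
  from this(1) show thesis
  proof (rule that)
    fix x assume x: "x \<in> D" "\<psi> x < \<epsilon>"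
    then have "x \<in> W" using E[of x] closure_subset[of D] by auto
    then show "\<bar>u x - Q x * \<psi> x\<bar> \<le> \<delta> * \<psi> x" using \<rho>(2) x(1) by (auto simp: W_def)
  qed
qed

text \<open>Near a frontier point \<open>\<psi>\<close> grows at rate at least \<open>c\<close> in the direction \<open>e\<close> of its gradient.
  Hence the translates of a piece of the strip by multiples of \<open>\<epsilon> / c\<close> in direction \<open>e\<close> are disjoint.
  About \<open>c / \<epsilon>\<close> of them fit into a ball of fixed size, so the piece has volume \<open>O(\<epsilon>)\<close>.\<close>
proposition strip_volume:
  fixes D :: "(real^'n::finite) set"
  assumes D: "open D" "bounded D" and psi: "defining_function D \<psi> g h"
  obtains C where "\<And>\<epsilon>. 0 < \<epsilon> \<Longrightarrow> measure lebesgue {x\<in>D. \<psi> x < \<epsilon>} \<le> C * \<epsilon>"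
proof -
  note psi' = psi[unfolded defining_function_def]
  have C2: "C2_with \<psi> g h" using psi' by simp
  have op: "open {x. \<psi> x < \<epsilon>}" for \<epsilon> 
    by (intro open_Collect_less continuous_intros C2_with_cont[OF C2])
  let ?S = "\<lambda>y r \<epsilon>. D \<inter> {x. \<psi> x < \<epsilon>} \<inter> ball y r"
  have Sm: "?S y r \<epsilon> \<in> lmeasurable" for y r \<epsilon>
  proof (rule lmeasurable_open)
    show "bounded (?S y r \<epsilon>)" using D(2) by (meson bounded_Int)
    show "open (?S y r \<epsilon>)" using D(1) op by auto
  qed
  have loc: "\<exists>r C. r > 0 \<and> (\<forall>\<epsilon>>0. measure lebesgue (?S y r \<epsilon>) \<le> C * \<epsilon>)" if y: "y \<in> closure D" for y
  proof (cases "y \<in> D")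
    case True
    define c where "c = \<psi> y / 2"
    have c: "c > 0" using psi' True by (auto simp: c_def)
    have "open {x. c < \<psi> x}" by (intro open_Collect_less continuous_intros C2_with_cont[OF C2])
    moreover have "y \<in> {x. c < \<psi> x}" using c by (simp add: c_def)
    ultimately obtain r where r: "r > 0" "\<And>x. x \<in> ball y r \<Longrightarrow> c < \<psi> x"
      unfolding open_contains_ball by blast
    let ?C = "measure lebesgue (ball y r) / c"
    have "measure lebesgue (?S y r \<epsilon>) \<le> ?C * \<epsilon>" if \<epsilon>: "\<epsilon> > 0" for \<epsilon>
    proof (cases "\<epsilon> \<le> c")
      case True
      then have "?S y r \<epsilon> = {}" using r(2) by fastforce
      then show ?thesis using c \<epsilon> by simp
    next
      case False
      have "measure lebesgue (?S y r \<epsilon>) \<le> measure lebesgue (ball y r) * 1"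
        unfolding mult_1_right by (rule measure_mono_fmeasurable) (use fmeasurableD[OF Sm] in auto)
      also have "\<dots> \<le> measure lebesgue (ball y r) * (\<epsilon> / c)" using False c by (intro mult_left_mono) auto
      finally show ?thesis by simp
    qed
    then show ?thesis using r(1) by blast
  next
    case False
    then have "y \<in> frontier D" using y D(1) by (auto simp: frontier_def interior_open)
    then have gy: "g y \<noteq> 0" using psi' by auto
    define e where "e = sgn (g y)"
    have e: "norm e = 1" using gy by (simp add: e_def norm_sgn)
    define c where "c = (g y \<bullet> e) / 2"
    have "g y \<bullet> e = norm (g y)" using gy by (simp add: e_def sgn_div_norm power2_norm_eq_inner[symmetric] power2_eq_square)
    then have c: "c > 0" using gy by (simp add: c_def)
    have "open {x. c < g x \<bullet> e}" by (intro open_Collect_less continuous_intros C2_with_cont[OF C2])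
    moreover have "y \<in> {x. c < g x \<bullet> e}" using c by (simp add: c_def)
    ultimately obtain r where r: "r > 0" "\<And>x. x \<in> ball y r \<Longrightarrow> c < g x \<bullet> e"
      unfolding open_contains_ball by blast
    have grow: "\<psi> x + c * t < \<psi> (x + t *\<^sub>R e)" if "x \<in> ball y r" "x + t *\<^sub>R e \<in> ball y r" "t > 0" for x t
    proof -
      have "((\<lambda>t. \<psi> (x + t *\<^sub>R e)) has_real_derivative (g (x + t *\<^sub>R e) \<bullet> e)) (at t)" for t
        by (rule line_DERIV) (use C2 in \<open>auto simp: C2_with_def\<close>)
      then obtain s where s: "0 < s" "s < t" "\<psi> (x + t *\<^sub>R e) - \<psi> (x + 0 *\<^sub>R e) = (t - 0) * (g (x + s *\<^sub>R e) \<bullet> e)"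
        using MVT2[OF \<open>t > 0\<close>, of "\<lambda>t. \<psi> (x + t *\<^sub>R e)" "\<lambda>t. g (x + t *\<^sub>R e) \<bullet> e"] by blast
      have "x + s *\<^sub>R e = (1 - s/t) *\<^sub>R x + (s/t) *\<^sub>R (x + t *\<^sub>R e)" using \<open>t > 0\<close> by (simp add: algebra_simps)
      then have "x + s *\<^sub>R e \<in> ball y r" using convexD[OF convex_ball that(1,2), of "1 - s/t" "s/t"] s by simp
      then have "t * c < t * (g (x + s *\<^sub>R e) \<bullet> e)" using r(2) \<open>t > 0\<close> by (intro mult_strict_left_mono) auto
      then show ?thesis using s(3) by (simp add: mult.commute)
    qed
    let ?B = "measure lebesgue (ball y (r + 1))"
    have "measure lebesgue (?S y r \<epsilon>) \<le> (2 * ?B / c) * \<epsilon>" if \<epsilon>: "\<epsilon> > 0" for \<epsilon>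
    proof (cases "\<epsilon> / c \<le> 1")
      case False
      then have "1 \<le> 2 * \<epsilon> / c" by simp
      have "measure lebesgue (?S y r \<epsilon>) \<le> ?B * 1"
        unfolding mult_1_right by (rule measure_mono_fmeasurable) (use fmeasurableD[OF Sm] in auto)
      also have "\<dots> \<le> ?B * (2 * \<epsilon> / c)" using \<open>1 \<le> 2 * \<epsilon> / c\<close> by (intro mult_left_mono) auto
      finally show ?thesis by (simp add: ac_simps)
    next
      case True
      define \<tau> where "\<tau> = \<epsilon> / c"
      have \<tau>: "0 < \<tau>" "\<tau> \<le> 1" "c * \<tau> = \<epsilon>" using True \<epsilon> c by (auto simp: \<tau>_def)
      (* The largest number of steps of length \<tau> with total length at most 1; then
         real N * \<tau> is at least 1/2 because \<tau> is at most 1. *)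
      define N where "N = nat \<lfloor>1 / \<tau>\<rfloor>"
      have N: "real N * \<tau> \<le> 1" "1 \<le> 2 * (real N * \<tau>)"
      proof -
        have ge: "1 \<le> 1 / \<tau>" using \<tau> by simp
        then have fl: "real N = of_int \<lfloor>1 / \<tau>\<rfloor>" unfolding N_def using \<tau>(1) by (intro of_nat_nat) simp
        then have "real N \<le> 1 / \<tau>" "1 / \<tau> < real N + 1" by linarith+
        moreover have "1 \<le> real N" using ge fl by (simp add: le_floor_iff) 
        ultimately have "real N * \<tau> \<le> 1" "1 < real N * \<tau> + \<tau>" "1 * \<tau> \<le> real N * \<tau>"
          using \<tau>(1) by (auto simp: field_simps)
        then show "real N * \<tau> \<le> 1" "1 \<le> 2 * (real N * \<tau>)" by linarith+
      qed
      let ?T = "\<lambda>k::nat. (+) ((real k * \<tau>) *\<^sub>R e) ` ?S y r \<epsilon>"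
      have disj0: False if "x \<in> ?T k" "x \<in> ?T l" "k < l" for x k l
      proof -
        obtain p q where p: "p \<in> ?S y r \<epsilon>" "x = (real k * \<tau>) *\<^sub>R e + p" and q: "q \<in> ?S y r \<epsilon>" "x = (real l * \<tau>) *\<^sub>R e + q"
          using \<open>x \<in> ?T k\<close> \<open>x \<in> ?T l\<close> by blast
        define t where "t = (real l - real k) * \<tau>"
        have "p = q + t *\<^sub>R e" using p(2) q(2) by (simp add: t_def algebra_simps)
        moreover have t: "\<tau> \<le> t" using \<open>k < l\<close> \<tau>(1) by (simp add: t_def)
        ultimately have "\<psi> q + c * t < \<psi> p" using grow[of q t] p(1) q(1) \<tau>(1) by auto
        moreover have "c * \<tau> \<le> c * t" using t c by simp
        moreover have "\<psi> q > 0" "\<psi> p < \<epsilon>" using psi' q(1) p(1) by auto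
        ultimately show False using \<tau>(3) by linarith
      qed
      have disj: "pairwise (\<lambda>k l. disjnt (?T k) (?T l)) {..<N}"
        unfolding pairwise_def disjnt_iff using disj0 by (metis linorder_neqE_nat)
      have "real N * measure lebesgue (?S y r \<epsilon>) = (\<Sum>k<N. measure lebesgue (?T k))"
        by (simp add: measure_translation)
      also have "\<dots> = measure lebesgue (\<Union>k<N. ?T k)"
      proof (rule measure_negligible_finite_Union_image[symmetric])
        show "?T k \<in> lmeasurable" for k by (rule measurable_translation[OF Sm])
        show "pairwise (\<lambda>k l. negligible (?T k \<inter> ?T l)) {..<N}"
          using disj by (rule pairwise_mono) (auto simp: disjnt_def)
      qed simp
      also have "\<dots> \<le> ?B"
      proof (rule measure_mono_fmeasurable)
        show "(\<Union>k<N. ?T k) \<subseteq> ball y (r + 1)"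
        proof safe
          fix k p assume k: "k < N" and p: "p \<in> ball y r"
          have "real k * \<tau> \<le> real N * \<tau>" using k \<tau>(1) by simp
          then have "real k * \<tau> \<le> 1" using N(1) by linarith
          then have "norm ((real k * \<tau>) *\<^sub>R e) \<le> 1" using e \<tau>(1) by simp
          moreover have "dist y ((real k * \<tau>) *\<^sub>R e + p) \<le> dist y p + norm ((real k * \<tau>) *\<^sub>R e)"
            using dist_triangle[of y "(real k * \<tau>) *\<^sub>R e + p" p] by (simp add: dist_norm)
          ultimately show "(real k * \<tau>) *\<^sub>R e + p \<in> ball y (r + 1)" using p by simp
        qed
        show "(\<Union>k<N. ?T k) \<in> sets lebesgue" using Sm by (auto intro!: sets.finite_UN measurable_translation fmeasurableD)
      qed simp
      finally have NB: "real N * measure lebesgue (?S y r \<epsilon>) \<le> ?B" .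
      have "measure lebesgue (?S y r \<epsilon>) * 1 \<le> measure lebesgue (?S y r \<epsilon>) * (2 * (real N * \<tau>))"
        using N(2) by (intro mult_left_mono) auto
      also have "\<dots> = (2 * \<tau>) * (real N * measure lebesgue (?S y r \<epsilon>))" by simp
      also have "\<dots> \<le> (2 * \<tau>) * ?B" using NB \<tau>(1) by (intro mult_left_mono) auto
      finally show ?thesis by (simp add: \<tau>_def ac_simps)
    qed
    then show ?thesis using r(1) by blast
  qed
  then obtain r C where rC: "\<And>y. y \<in> closure D \<Longrightarrow> r y > 0"
    "\<And>y \<epsilon>. y \<in> closure D \<Longrightarrow> 0 < \<epsilon> \<Longrightarrow> measure lebesgue (?S y (r y) \<epsilon>) \<le> C y * \<epsilon>" by metis
  have "compact (closure D)" using D(2) by simp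
  moreover have "closure D \<subseteq> (\<Union>x\<in>closure D. ball x (r x))" using rC(1) by fastforce
  ultimately obtain F where F: "F \<subseteq> closure D" "finite F" "closure D \<subseteq> (\<Union>x\<in>F. ball x (r x))"
    using compactE_image[of "closure D" "closure D" "\<lambda>x. ball x (r x)"] by auto
  show thesis
  proof (rule that[of "\<Sum>y\<in>F. C y"])
    fix \<epsilon> :: real assume \<epsilon>: "0 < \<epsilon>"
    have "{x\<in>D. \<psi> x < \<epsilon>} = (\<Union>y\<in>F. ?S y (r y) \<epsilon>)" using F(3) closure_subset[of D] by blast
    then have "measure lebesgue {x\<in>D. \<psi> x < \<epsilon>} \<le> (\<Sum>y\<in>F. measure lebesgue (?S y (r y) \<epsilon>))"
      using fmeasurableD[OF Sm] by (simp only:) (rule measure_UNION_le[OF F(2)])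
    also have "\<dots> \<le> (\<Sum>y\<in>F. C y * \<epsilon>)" using F(1) \<epsilon> by (intro sum_mono rC(2)) auto
    finally show "measure lebesgue {x\<in>D. \<psi> x < \<epsilon>} \<le> (\<Sum>y\<in>F. C y) * \<epsilon>" by (simp add: sum_distrib_right)
  qed
qed

section \<open>Mollification\<close>

text \<open>Membership in a class of functions that is closed under partial derivatives is how smoothness is
  proved below: induction over the list of derivatives then needs nothing about their form.\<close>
lemma iter_partial_closed:
  fixes S :: "(real^'n::finite \<Rightarrow> real) set"
  assumes S: "\<And>f. f \<in> S \<Longrightarrow> \<exists>g. (\<forall>i. g i \<in> S) \<and> (\<forall>x. (f has_derivative (\<lambda>h. (\<chi> i. g i x) \<bullet> h)) (at x))"
    and f: "f \<in> S"
  shows "iter_partial ks f \<in> S" and "Ck_on k UNIV f"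
proof -
  have *: "\<exists>g. (\<forall>i. g i \<in> S) \<and> (\<forall>i. partial_deriv i f = g i) \<and> (\<forall>x. f differentiable (at x))" if f: "f \<in> S" for f
  proof -
    obtain g where g: "\<forall>i. g i \<in> S" and d: "\<And>x. (f has_derivative (\<lambda>h. (\<chi> i. g i x) \<bullet> h)) (at x)"
      using S[OF f] by blast
    have "partial_deriv i f = g i" for i
      using frechet_gradient[OF d] by (auto simp: fun_eq_iff)
    then show ?thesis using g d by (intro exI[of _ g]) (auto simp: differentiable_def)
  qed
  have ip: "iter_partial ks f \<in> S" for ks
    by (induction ks) (use f * in force)+
  then show "iter_partial ks f \<in> S" .
  have "continuous_on UNIV (iter_partial ks f)" for ks
    using *[OF ip[of ks]] differentiable_imp_continuous_within
    by (metis continuous_at_imp_continuous_on)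
  then show "Ck_on k UNIV f" using *[OF ip] by (auto simp: Ck_on_def)
qed

text \<open>For \<open>k = 0\<close> the usual smooth function that is flat at zero. The factors \<open>inverse t ^ k\<close> make
  the family closed, up to linear combinations, under differentiation.\<close>
definition expk :: "nat \<Rightarrow> real \<Rightarrow> real" where
  "expk k t = (if t > 0 then exp (- inverse t) * inverse t ^ k else 0)"

lemma expk_tendsto_0: "((\<lambda>t. exp (- inverse t) * inverse t ^ k) \<longlongrightarrow> 0) (at_right (0::real))"
proof -
  have "((\<lambda>x. x ^ k / exp x) \<longlongrightarrow> (0::real)) at_top" by (rule tendsto_power_div_exp_0)
  from filterlim_compose[OF this filterlim_inverse_at_top_right]
  show ?thesis by (simp add: exp_minus field_simps)
qed

lemma expk_deriv: "(expk k has_real_derivative (expk (k+2) t - real k * expk (k+1) t)) (at t)"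
proof -
  consider "t > 0" | "t < 0" | "t = 0" by linarith
  then show ?thesis
  proof cases
    case 1
    have "((\<lambda>t. exp (- inverse t) * inverse t ^ k) has_real_derivative
       (expk (k+2) t - real k * expk (k+1) t)) (at t)"
      using 1
      apply (auto intro!: derivative_eq_intros simp: expk_def)
      apply (cases k; simp add: algebra_simps)
      done
    then show ?thesis
      by (rule has_field_derivative_transform_within[where d=t]) (use 1 in \<open>auto simp: expk_def dist_real_def\<close>)
  next
    case 2
    have "((\<lambda>t. 0) has_real_derivative 0) (at t)" by simp
    then have "(expk k has_real_derivative 0) (at t)"
      by (rule has_field_derivative_transform_within[where d="-t"]) (use 2 in \<open>auto simp: expk_def dist_real_def\<close>)
    then show ?thesis using 2 by (simp add: expk_def)
  next
    case 3
    have r: "((\<lambda>h. (expk k (0 + h) - expk k 0) / h) \<longlongrightarrow> 0) (at_right 0)"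
    proof (rule Lim_transform_eventually[OF expk_tendsto_0[of "Suc k"]])
      show "\<forall>\<^sub>F t in at_right 0. exp (- inverse t) * inverse t ^ Suc k = (expk k (0 + t) - expk k 0) / t"
        using eventually_at_right_less[of "0::real"]
        by eventually_elim (auto simp: expk_def field_simps)
    qed
    have l: "((\<lambda>h. (expk k (0 + h) - expk k 0) / h) \<longlongrightarrow> 0) (at_left 0)"
    proof (rule Lim_transform_eventually[OF tendsto_const[of 0]])
      show "\<forall>\<^sub>F t in at_left 0. 0 = (expk k (0 + t) - expk k 0) / t"
        by (auto simp: expk_def eventually_at_filter)
    qed
    have "((\<lambda>h. (expk k (0 + h) - expk k 0) / h) \<longlongrightarrow> 0) (at 0)"
      using l r by (simp add: filterlim_split_at)
    then show ?thesis using 3 by (simp add: has_field_derivative_iff expk_def)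
  qed
qed

text \<open>The algebra generated by the coordinates and the functions \<open>expk k (r - x \<bullet> x)\<close>. It contains the
  mollification kernel of radius \<open>sqrt r\<close> and is closed under partial derivatives.\<close>
inductive_set bump_algebra :: "real \<Rightarrow> (real^'n::finite \<Rightarrow> real) set" for r where
  const: "(\<lambda>x. c) \<in> bump_algebra r"
| coord: "(\<lambda>x. x $ i) \<in> bump_algebra r"
| bump: "(\<lambda>x. expk k (r - x \<bullet> x)) \<in> bump_algebra r"
| add: "f \<in> bump_algebra r \<Longrightarrow> g \<in> bump_algebra r \<Longrightarrow> (\<lambda>x. f x + g x) \<in> bump_algebra r"
| mult: "f \<in> bump_algebra r \<Longrightarrow> g \<in> bump_algebra r \<Longrightarrow> (\<lambda>x. f x * g x) \<in> bump_algebra r"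

lemma bump_algebra_deriv:
  fixes f :: "real^'n::finite \<Rightarrow> real"
  assumes "f \<in> bump_algebra r"
  shows "\<exists>g. (\<forall>i. g i \<in> bump_algebra r) \<and> (\<forall>x. (f has_derivative (\<lambda>h. (\<chi> i. g i x) \<bullet> h)) (at x))"
  using assms
proof induction
  case (const c)
  have "(\<lambda>x::real^'n. 0) \<in> bump_algebra r" by (rule bump_algebra.const)
  then show ?case
    by (intro exI[of _ "\<lambda>i x. 0"]) (auto simp: inner_vec_def intro!: derivative_eq_intros)
next
  case (coord j)
  have "(\<chi> i. if i = j then 1 else 0) = (axis j 1 :: real^'n)" by (simp add: axis_def vec_eq_iff)
  then have "((\<lambda>x. x $ j) has_derivative (\<lambda>h. (\<chi> i. if i = j then 1 else 0) \<bullet> h)) (at x)" for x :: "real^'n"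
    by (simp add: inner_axis' bounded_linear_imp_has_derivative bounded_linear_vec_nth)
  then show ?case
    by (intro exI[of _ "\<lambda>i x. if i = j then 1 else 0"]) (auto intro: bump_algebra.const)
next
  case (bump k)
  let ?g = "\<lambda>i (x::real^'n). (expk (k+2) (r - x \<bullet> x) + (- real k) * expk (k+1) (r - x \<bullet> x)) * ((-2) * x $ i)"
  have "?g i \<in> bump_algebra r" for i
    by (intro bump_algebra.intros)
  moreover have "((\<lambda>x. expk k (r - x \<bullet> x)) has_derivative (\<lambda>h. (\<chi> i. ?g i x) \<bullet> h)) (at x)" for x
  proof -
    have 1: "((\<lambda>x. r - x \<bullet> x) has_derivative (\<lambda>h. - 2 * (x \<bullet> h))) (at x)"
      by (auto intro!: derivative_eq_intros simp: inner_commute)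
    have e: "(\<chi> i. ?g i x) = (expk (k+2) (r - x \<bullet> x) - real k * expk (k+1) (r - x \<bullet> x)) *\<^sub>R ((-2) *\<^sub>R x)"
      by (simp add: vec_eq_iff)
    show ?thesis unfolding e
      by (rule has_derivative_eq_rhs[OF has_derivative_compose[OF 1 expk_deriv[THEN has_field_derivative_imp_has_derivative]]])
        (auto simp: algebra_simps)
  qed
  ultimately show ?case by (intro exI[of _ ?g]) auto
next
  case (add f1 f2)
  then obtain g1 g2 where
    "\<And>i. g1 i \<in> bump_algebra r" "\<And>x. (f1 has_derivative (\<lambda>h. (\<chi> i. g1 i x) \<bullet> h)) (at x)"
    "\<And>i. g2 i \<in> bump_algebra r" "\<And>x. (f2 has_derivative (\<lambda>h. (\<chi> i. g2 i x) \<bullet> h)) (at x)"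
    by blast
  then show ?case
    by (intro exI[of _ "\<lambda>i x. g1 i x + g2 i x"])
      (auto intro!: derivative_eq_intros bump_algebra.add simp: inner_vec_def sum.distrib algebra_simps)
next
  case (mult f1 f2)
  then obtain g1 g2 where
    g: "\<And>i. g1 i \<in> bump_algebra r" "\<And>i. g2 i \<in> bump_algebra r"
    and d: "\<And>x. (f1 has_derivative (\<lambda>h. (\<chi> i. g1 i x) \<bullet> h)) (at x)"
     "\<And>x. (f2 has_derivative (\<lambda>h. (\<chi> i. g2 i x) \<bullet> h)) (at x)"
    by blast
  have "((\<lambda>x. f1 x * f2 x) has_derivative (\<lambda>h. (\<chi> i. f1 x * g2 i x + g1 i x * f2 x) \<bullet> h)) (at x)" for x
  proof -
    have e: "(\<chi> i. f1 x * g2 i x + g1 i x * f2 x) = f1 x *\<^sub>R (\<chi> i. g2 i x) + f2 x *\<^sub>R (\<chi> i. g1 i x)"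
      by (simp add: vec_eq_iff)
    show ?thesis unfolding e
      by (rule has_derivative_eq_rhs[OF has_derivative_mult[OF d]])
        (auto simp: inner_add_left algebra_simps)
  qed
  then show ?case using g mult.hyps
    by (intro exI[of _ "\<lambda>i x. f1 x * g2 i x + g1 i x * f2 x"]) (auto intro!: bump_algebra.intros)
qed

lemma bump_algebra_continuous: "f \<in> bump_algebra r \<Longrightarrow> continuous_on UNIV f"
proof -
  assume "f \<in> bump_algebra r"
  then obtain g where "\<And>x. (f has_derivative (\<lambda>h. (\<chi> i. g i x) \<bullet> h)) (at x)" using bump_algebra_deriv by blast
  then show ?thesis by (rule continuous_on_of_derivative)
qed

definition conv :: "(real^'n::finite \<Rightarrow> real) \<Rightarrow> (real^'n \<Rightarrow> real) \<Rightarrow> real^'n \<Rightarrow> real" where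
  "conv v f x = (\<integral>y. v y * f (x - y) \<partial>lborel)"

lemma integrable_compact_support:
  fixes f :: "'a::euclidean_space \<Rightarrow> 'b::euclidean_space"
  assumes "continuous_on UNIV f" "compact K" "\<And>x. x \<notin> K \<Longrightarrow> f x = 0"
  shows "integrable lborel f"
proof -
  have "integrable lborel (\<lambda>x. if x \<in> K then f x else 0)"
    using borel_integrable_compact[OF assms(2) continuous_on_subset[OF assms(1) subset_UNIV]]
    by (simp add: indicator_scaleR_eq_if)
  moreover have "(\<lambda>x. if x \<in> K then f x else 0) = f" using assms(3) by auto
  ultimately show ?thesis by simp
qed

lemma lborel_integral_reflect:
  fixes f :: "'a::euclidean_space \<Rightarrow> real"
  assumes "f \<in> borel_measurable borel"
  shows "(\<integral>y. f (x - y) \<partial>lborel) = (\<integral>y. f y \<partial>lborel)"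
proof -
  have "lborel = distr lborel borel (\<lambda>y. x - y)"
    using lborel_affine[of "-1" x] by (simp add: density_1)
  then have "(\<integral>y. f y \<partial>lborel) = (\<integral>y. f y \<partial>(distr lborel borel (\<lambda>y. x - y)))" by simp
  also have "\<dots> = (\<integral>y. f (x - y) \<partial>lborel)"
    using assms by (subst integral_distr) auto
  finally show ?thesis by simp
qed

lemma conv_commute:
  assumes "continuous_on UNIV v" "continuous_on UNIV f"
  shows "conv v f = conv f v"
proof
  fix x
  have "(\<lambda>y. v y * f (x - y)) \<in> borel_measurable borel"
    by (intro borel_measurable_continuous_onI continuous_intros continuous_on_compose2[OF assms(2)] assms) auto
  from lborel_integral_reflect[OF this, of x]
  show "conv v f x = conv f v x" by (simp add: conv_def mult.commute)
qed

text \<open>Differentiation under the integral sign. The integral extends over a fixed box containing the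
  support of \<open>v\<close>, so the Leibniz rule for boxes applies.\<close>
lemma conv_deriv:
  fixes f :: "real^'n::finite \<Rightarrow> real"
  assumes v: "continuous_on UNIV v" "compact K" "\<And>x. x \<notin> K \<Longrightarrow> v x = 0"
    and d: "\<And>x. (f has_derivative (\<lambda>h. (\<chi> i. g i x) \<bullet> h)) (at x)"
    and g: "\<And>i. continuous_on UNIV (g i)"
  shows "(conv v f has_derivative (\<lambda>h. (\<chi> i. conv v (g i) x) \<bullet> h)) (at x)"
proof -
  obtain a b where ab: "K \<subseteq> cbox a b"
    using bounded_subset_cbox_symmetric[OF compact_imp_bounded[OF v(2)]] by metis
  have f: "continuous_on UNIV f"
    by (rule continuous_on_of_derivative[OF d])
  have gv: "continuous_on UNIV (\<lambda>x. \<chi> i. g i x)"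
    using g by (intro continuous_on_vec_lambda) auto
  have ci: "(\<integral>y. v y *\<^sub>R F (x - y) \<partial>lborel) = integral (cbox a b) (\<lambda>y. v y *\<^sub>R F (x - y))"
    if F: "continuous_on UNIV F" for F :: "real^'n \<Rightarrow> 'b::euclidean_space" and x
  proof -
    have "integrable lborel (\<lambda>y. v y *\<^sub>R F (x - y))"
      by (rule integrable_compact_support[OF _ v(2)])
        (auto intro!: continuous_intros continuous_on_compose2[OF F] v(1) simp: v(3))
    then have "(\<integral>y. v y *\<^sub>R F (x - y) \<partial>lborel) = integral UNIV (\<lambda>y. v y *\<^sub>R F (x - y))"
      by (simp add: integral_lborel)
    also have "\<dots> = integral (cbox a b) (\<lambda>y. v y *\<^sub>R F (x - y))"
      by (rule integral_spike_set) (use ab v(3) in \<open>auto intro!: negligible_subset[OF negligible_empty]\<close>)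
    finally show ?thesis .
  qed
  let ?G = "\<lambda>x y. v y *\<^sub>R (\<chi> i. g i (x - y))"
  have cont: "continuous_on (UNIV \<times> cbox a b) (\<lambda>(x, t). blinfun_inner_left (?G x t))"
    unfolding split_beta
    by (intro bounded_linear.continuous_on[OF bounded_linear_blinfun_inner_left] continuous_intros
        continuous_on_compose2[OF gv] continuous_on_compose2[OF v(1)]) auto
  have "((\<lambda>x. integral (cbox a b) (\<lambda>t. v t * f (x - t))) has_derivative
      integral (cbox a b) (\<lambda>t. blinfun_inner_left (?G x t))) (at x within UNIV)"
  proof (rule leibniz_rule[OF _ _ cont])
    fix x t
    have "((\<lambda>x. v t * f (x - t)) has_derivative (\<lambda>h. v t * ((\<chi> i. g i (x - t)) \<bullet> h))) (at x)"
    proof -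
      have "((\<lambda>x. x - t) has_derivative (\<lambda>h. h)) (at x)" by (auto intro!: derivative_eq_intros)
      from has_derivative_compose[OF this d] show ?thesis by (rule has_derivative_mult_right)
    qed
    then show "((\<lambda>x. v t * f (x - t)) has_derivative blinfun_apply (blinfun_inner_left (?G x t))) (at x within UNIV)"
      by (simp add: inner_commute)
  next
    fix x show "(\<lambda>t. v t * f (x - t)) integrable_on cbox a b"
      by (intro integrable_continuous continuous_intros continuous_on_compose2[OF f] continuous_on_compose2[OF v(1)]) auto
  qed auto
  moreover have "(\<lambda>x. integral (cbox a b) (\<lambda>t. v t * f (x - t))) = conv v f"
    using ci[OF f] by (auto simp: conv_def fun_eq_iff)
  moreover have "blinfun_apply (integral (cbox a b) (\<lambda>t. blinfun_inner_left (?G x t))) = (\<lambda>h. (\<chi> i. conv v (g i) x) \<bullet> h)"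
  proof -
    have int: "?G x integrable_on cbox a b"
      by (intro integrable_continuous continuous_intros continuous_on_compose2[OF gv] continuous_on_compose2[OF v(1)]) auto
    have "integral (cbox a b) (\<lambda>t. blinfun_inner_left (?G x t)) = blinfun_inner_left (integral (cbox a b) (?G x))"
      using integral_linear[OF int bounded_linear_blinfun_inner_left] by (simp add: o_def)
    moreover have "integral (cbox a b) (?G x) $ i = conv v (g i) x" for i
    proof -
      have "integral (cbox a b) (?G x) $ i = integral (cbox a b) (\<lambda>y. ?G x y $ i)"
        using integral_linear[OF int bounded_linear_vec_nth[of i]] by (simp add: o_def)
      then show ?thesis using ci[OF g[of i]] by (simp add: conv_def)
    qed
    then have "integral (cbox a b) (?G x) = (\<chi> i. conv v (g i) x)" by (simp add: vec_eq_iff)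
    ultimately show ?thesis by (auto simp: inner_commute)
  qed
  ultimately show ?thesis by simp
qed

definition kernel :: "real \<Rightarrow> real^'n::finite \<Rightarrow> real" where
  "kernel r x = inverse (\<integral>y. expk 0 (r\<^sup>2 - y \<bullet> (y::real^'n)) \<partial>lborel) * expk 0 (r\<^sup>2 - x \<bullet> x)"

lemma kernel_in_algebra: "kernel r \<in> bump_algebra (r\<^sup>2)"
  unfolding kernel_def[abs_def] by (intro bump_algebra.intros)

lemma kernel_continuous: "continuous_on UNIV (kernel r)"
  by (rule bump_algebra_continuous[OF kernel_in_algebra])

lemma expk_nonneg: "0 \<le> expk k t" by (simp add: expk_def)

lemma kernel_nonneg: "0 \<le> kernel r x"
  by (auto simp: kernel_def expk_nonneg intro!: mult_nonneg_nonneg integral_nonneg)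

lemma kernel_support: "0 \<le> r \<Longrightarrow> r \<le> norm x \<Longrightarrow> kernel r x = 0"
  using power_mono[of r "norm x" 2] by (auto simp: kernel_def expk_def power2_norm_eq_inner)

lemma kernel_integral:
  assumes "r > 0"
  shows "integrable lborel (kernel r :: real^'n::finite \<Rightarrow> real)" "(\<integral>x. kernel r (x::real^'n) \<partial>lborel) = 1"
proof -
  let ?e = "\<lambda>x::real^'n. expk 0 (r\<^sup>2 - x \<bullet> x)"
  have out: "?e x = 0" if "x \<notin> cball 0 r" for x
    using that power_mono[of r "norm x" 2] assms by (auto simp: expk_def power2_norm_eq_inner)
  have int: "integrable lborel ?e"
    by (rule integrable_compact_support[OF bump_algebra_continuous[OF bump_algebra.bump] compact_cball out])
  have "(\<integral>x. ?e x \<partial>lborel) \<noteq> 0"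
  proof
    assume "(\<integral>x. ?e x \<partial>lborel) = 0"
    then have "AE x in lborel. ?e x = 0"
      by (subst (asm) integral_nonneg_eq_0_iff_AE[OF int]) (auto simp: expk_nonneg)
    moreover have "?e x \<noteq> 0" if "x \<in> ball 0 r" for x
    proof -
      have "norm x < r" using that by simp
      then have "x \<bullet> x < r\<^sup>2" using power_strict_mono[of "norm x" r 2] by (simp add: power2_norm_eq_inner)
      then show ?thesis by (simp add: expk_def)
    qed
    ultimately have "AE x in lborel. x \<notin> ball (0::real^'n) r" by (auto elim!: eventually_mono)
    then have "ball (0::real^'n) r \<in> null_sets lborel"
      by (subst (asm) AE_iff_null_sets[symmetric]) auto
    then have "negligible (ball (0::real^'n) r)"
      by (simp add: negligible_iff_null_sets null_sets_completionI)
    then show False using assms open_not_negligible[of "ball (0::real^'n) r"] by auto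
  qed
  then show "integrable lborel (kernel r :: real^'n \<Rightarrow> real)" "(\<integral>x. kernel r (x::real^'n) \<partial>lborel) = 1"
    using int by (simp_all add: kernel_def[abs_def])
qed

lemma conv_smooth:
  fixes v :: "real^'n::finite \<Rightarrow> real"
  assumes v: "continuous_on UNIV v" "compact K" "\<And>x. x \<notin> K \<Longrightarrow> v x = 0"
    and f: "f \<in> bump_algebra r"
  shows "Ck_on k UNIV (conv v f)" 
    and "(conv v f has_derivative (\<lambda>h. (\<chi> i. conv v (partial_deriv i f) x) \<bullet> h)) (at x)"
    and "iter_partial ks (conv v f) = conv v (iter_partial ks f)"
proof -
  have d: "\<exists>g. (\<forall>i. g i \<in> bump_algebra r) \<and> (\<forall>i. partial_deriv i f = g i) \<and>
        (\<forall>x. (conv v f has_derivative (\<lambda>h. (\<chi> i. conv v (g i) x) \<bullet> h)) (at x))" if fr: "f \<in> bump_algebra r" for f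
  proof -
    obtain g where g: "\<forall>i. g i \<in> bump_algebra r" "\<And>x. (f has_derivative (\<lambda>h. (\<chi> i. g i x) \<bullet> h)) (at x)"
      using bump_algebra_deriv[OF fr] by blast
    have "partial_deriv i f = g i" for i using frechet_gradient[OF g(2)] by (auto simp: fun_eq_iff)
    moreover have "(conv v f has_derivative (\<lambda>h. (\<chi> i. conv v (g i) x) \<bullet> h)) (at x)" for x
      by (rule conv_deriv[OF v g(2)]) (use g(1) bump_algebra_continuous in auto)
    ultimately show ?thesis using g(1) by blast
  qed
  show "Ck_on k UNIV (conv v f)"
  proof (rule iter_partial_closed(2)[where S="conv v ` bump_algebra r"])
    fix F assume "F \<in> conv v ` bump_algebra r"
    then obtain f0 where f0: "f0 \<in> bump_algebra r" "F = conv v f0" by blast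
    obtain g where "\<forall>i. g i \<in> bump_algebra r" "\<forall>x. (conv v f0 has_derivative (\<lambda>h. (\<chi> i. conv v (g i) x) \<bullet> h)) (at x)"
      using d[OF f0(1)] by blast
    then show "\<exists>g. (\<forall>i. g i \<in> conv v ` bump_algebra r) \<and> (\<forall>x. (F has_derivative (\<lambda>h. (\<chi> i. g i x) \<bullet> h)) (at x))"
      unfolding f0(2) by (intro exI[of _ "\<lambda>i. conv v (g i)"]) simp
  qed (use f in simp)
  show "(conv v f has_derivative (\<lambda>h. (\<chi> i. conv v (partial_deriv i f) x) \<bullet> h)) (at x)"
  proof -
    obtain g where "\<forall>i. partial_deriv i f = g i" "\<forall>x. (conv v f has_derivative (\<lambda>h. (\<chi> i. conv v (g i) x) \<bullet> h)) (at x)"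
      using d[OF f] by blast
    then show ?thesis by simp
  qed
  have "iter_partial ks f \<in> bump_algebra r \<and> iter_partial ks (conv v f) = conv v (iter_partial ks f)" for ks
  proof (induction ks)
    case (Cons i ks)
    from d[of "iter_partial ks f"] Cons obtain g where g: "\<forall>i. g i \<in> bump_algebra r"
       "\<forall>i. partial_deriv i (iter_partial ks f) = g i"
       "\<And>x. (conv v (iter_partial ks f) has_derivative (\<lambda>h. (\<chi> i. conv v (g i) x) \<bullet> h)) (at x)" by blast
    then have "partial_deriv i (conv v (iter_partial ks f)) = conv v (g i)"
      using frechet_gradient[OF g(3)] by (auto simp: fun_eq_iff)
    then show ?case using g Cons by simp
  qed (use f in auto)
  then show "iter_partial ks (conv v f) = conv v (iter_partial ks f)" by blast
qed

section \<open>From smooth to twice differentiable test functions\<close>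

lemma kernel_compact: "0 \<le> r \<Longrightarrow> x \<notin> cball 0 r \<Longrightarrow> kernel r x = 0"
  by (rule kernel_support) auto

lemma conv_kernel_eq:
  assumes "continuous_on UNIV v"
  shows "conv v (kernel r) x = (\<integral>z. kernel r z * v (x - z) \<partial>lborel)"
  using conv_commute[OF assms kernel_continuous] by (simp add: conv_def)

lemma conv_kernel_integrable:
  fixes v :: "real^'n::finite \<Rightarrow> real"
  assumes "continuous_on UNIV v" "0 \<le> r"
  shows "integrable lborel (\<lambda>z. kernel r z * v (x - z))"
  by (rule integrable_compact_support[of _ "cball 0 r"])
    (auto intro!: continuous_intros kernel_continuous continuous_on_compose2[OF assms(1)] simp: kernel_support[OF assms(2)])

text \<open>\<open>conv v (kernel r) x\<close> is an average of the values of \<open>v\<close> in the ball of radius \<open>r\<close> about \<open>x\<close>;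
  all estimates of the mollification of continuous functions come from this.\<close>
lemma conv_kernel_diff_bound:
  fixes v :: "real^'n::finite \<Rightarrow> real"
  assumes v: "continuous_on UNIV v" and r: "0 < r" and B: "\<And>z. norm z < r \<Longrightarrow> \<bar>v (x - z) - c\<bar> \<le> B"
  shows "\<bar>conv v (kernel r) x - c\<bar> \<le> B"
proof -
  note k = kernel_integral[OF r, where 'n='n]
  have i: "integrable lborel (\<lambda>z. kernel r z * v (x - z))" by (rule conv_kernel_integrable[OF v]) (use r in simp)
  have i2: "integrable lborel (\<lambda>z. kernel r z * (v (x - z) - c))"
    using Bochner_Integration.integrable_diff[OF i integrable_mult_left[OF k(1), of c]] by (simp add: algebra_simps)
  have "conv v (kernel r) x - c = (\<integral>z. kernel r z * v (x - z) \<partial>lborel) - (\<integral>z. kernel r (z::real^'n) * c \<partial>lborel)"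
    using k by (simp add: conv_kernel_eq[OF v])
  also have "\<dots> = (\<integral>z. kernel r z * (v (x - z) - c) \<partial>lborel)"
    using Bochner_Integration.integral_diff[OF i integrable_mult_left[OF k(1), of c]] by (simp add: algebra_simps)
  finally have "\<bar>conv v (kernel r) x - c\<bar> \<le> (\<integral>z. \<bar>kernel r z * (v (x - z) - c)\<bar> \<partial>lborel)"
    by (metis integral_abs_bound)
  also have "\<dots> \<le> (\<integral>z. kernel r (z::real^'n) * B \<partial>lborel)"
  proof (rule integral_mono)
    fix z :: "real^'n"
    show "\<bar>kernel r z * (v (x - z) - c)\<bar> \<le> kernel r z * B"
      using B[of z] kernel_support[of r z] r
      by (cases "norm z < r") (auto simp: abs_mult kernel_nonneg intro!: mult_left_mono)
  qed (use i2 k in \<open>auto intro: integrable_abs\<close>)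
  also have "\<dots> = B" using k by simp
  finally show ?thesis .
qed

lemma conv_kernel_bound:
  assumes v: "continuous_on UNIV v" and r: "0 < r" and B: "\<And>z. \<bar>v z\<bar> \<le> B"
  shows "\<bar>conv v (kernel r) x\<bar> \<le> B"
  using conv_kernel_diff_bound[OF v r, of x 0 B] B by simp

lemma conv_kernel_tendsto:
  fixes v :: "real^'n::finite \<Rightarrow> real"
  assumes v: "continuous_on UNIV v" and r: "\<And>k. 0 < r k" "r \<longlonglongrightarrow> 0"
  shows "(\<lambda>k. conv v (kernel (r k)) x) \<longlonglongrightarrow> v x"
proof (rule LIMSEQ_I)
  fix e :: real assume "0 < e"
  then obtain d where d: "d > 0" "\<And>y. dist y x < d \<Longrightarrow> dist (v y) (v x) < e / 2"
    using v unfolding continuous_on_iff by (metis UNIV_I half_gt_zero)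
  obtain N where N: "\<And>k. k \<ge> N \<Longrightarrow> norm (r k - 0) < d" using LIMSEQ_D[OF r(2) d(1)] by blast
  show "\<exists>no. \<forall>n\<ge>no. norm (conv v (kernel (r n)) x - v x) < e"
  proof (intro exI[of _ N] allI impI)
    fix n assume n: "n \<ge> N"
    have "\<bar>conv v (kernel (r n)) x - v x\<bar> \<le> e / 2"
    proof (rule conv_kernel_diff_bound[OF v r(1)])
      fix z :: "real^'n" assume "norm z < r n"
      then have "dist (x - z) x < d" using N[OF n] r(1)[of n] by (simp add: dist_norm)
      then show "\<bar>v (x - z) - v x\<bar> \<le> e / 2" using d(2)[of "x - z"] by (simp add: dist_real_def less_imp_le)
    qed
    then show "norm (conv v (kernel (r n)) x - v x) < e" using \<open>0 < e\<close> by simp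
  qed
qed

lemma test_fun_conv_kernel:
  fixes v :: "real^'n::finite \<Rightarrow> real"
  assumes v: "continuous_on UNIV v" "compact S" "\<And>x. x \<notin> S \<Longrightarrow> v x = 0" and r: "0 < r"
    and U: "(\<Union>x\<in>S. cball x r) \<subseteq> U"
  shows "test_fun U (conv v (kernel r))"
proof -
  let ?T = "{x + y |x y. x \<in> S \<and> y \<in> cball 0 r}"
  have T: "compact ?T" by (rule compact_sums[OF v(2) compact_cball])
  have "conv v (kernel r) x = 0" if "x \<notin> ?T" for x
  proof -
    have zz: "v y * kernel r (x - y) = 0" for y
    proof (rule ccontr)
      assume n: "v y * kernel r (x - y) \<noteq> 0"
      then have "y \<in> S" "norm (x - y) < r" using v(3)[of y] kernel_support[of r "x - y"] r by force+
      then have "x = y + (x - y) \<and> y \<in> S \<and> x - y \<in> cball 0 r" by simp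
      then have "x \<in> ?T" by blast
      with that show False by (rule notE)
    qed
    show ?thesis unfolding conv_def zz by simp
  qed
  then have cl: "closure {x. conv v (kernel r) x \<noteq> 0} \<subseteq> ?T"
    by (intro closure_minimal compact_imp_closed[OF T]) blast
  then have "compact (closure {x. conv v (kernel r) x \<noteq> 0})"
    using T by (meson closed_closure compact_closure bounded_subset compact_imp_bounded compact_eq_bounded_closed)
  moreover have "?T \<subseteq> U"
  proof
    fix z assume "z \<in> ?T"
    then obtain x y where "z = x + y" "x \<in> S" "norm y \<le> r" by auto
    then show "z \<in> U" using U by (auto intro!: subsetD[OF U] bexI[of _ x] simp: dist_norm)
  qed
  ultimately show ?thesis unfolding test_fun_def
    using cl conv_smooth(1)[OF v kernel_in_algebra] by auto
qed

text \<open>The complement of \<open>S\<close> is open, so derivatives vanish there together with the function.\<close>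
lemma C2_with_zero_outside:
  assumes C: "C2_with f g h" and S: "closed S" "\<And>x. x \<notin> S \<Longrightarrow> f x = 0" and x: "x \<notin> S"
  shows "g x = 0" "h x = 0"
proof -
  have op: "open (- S)" using S(1) by auto
  have gx: "g x = 0" if "x \<notin> S" for x
  proof -
    have "(f has_derivative (\<lambda>v. g x \<bullet> v)) (at x)" using C by (simp add: C2_with_def)
    moreover have "((\<lambda>x. 0) has_derivative (\<lambda>v. 0)) (at x)" by simp
    then have "(f has_derivative (\<lambda>v. 0)) (at x)"
      by (rule has_derivative_transform_within_open[OF _ op]) (use S that in auto)
    ultimately have "(\<lambda>v. g x \<bullet> v) = (\<lambda>v. 0)" by (rule has_derivative_unique)
    then show ?thesis by (metis inner_eq_zero_iff)
  qed
  show "g x = 0" by (rule gx[OF x])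
  have "h x $ i $ j = 0" for i j
  proof -
    have "((\<lambda>x. g x $ j) has_derivative (\<lambda>v. (\<chi> i. h x $ i $ j) \<bullet> v)) (at x)" using C by (simp add: C2_with_def)
    moreover have "((\<lambda>x. 0) has_derivative (\<lambda>v. 0)) (at x)" by simp
    then have "((\<lambda>x. g x $ j) has_derivative (\<lambda>v. 0)) (at x)"
      by (rule has_derivative_transform_within_open[OF _ op]) (use gx x in auto)
    ultimately have "(\<lambda>v. (\<chi> i. h x $ i $ j) \<bullet> v) = (\<lambda>v. 0)" by (rule has_derivative_unique)
    then have "(\<chi> i. h x $ i $ j) \<bullet> axis i 1 = 0" by metis
    then show ?thesis by (simp add: inner_axis)
  qed
  then show "h x = 0" by (simp add: vec_eq_iff)
qed

lemma conv_C2: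
  fixes f :: "real^'n::finite \<Rightarrow> real"
  assumes C: "C2_with f g h" and S: "compact S" "\<And>x. x \<notin> S \<Longrightarrow> f x = 0" and r: "0 \<le> r"
  shows "gradient (conv f (kernel r)) x = (\<chi> i. conv (\<lambda>y. g y $ i) (kernel r) x)"
    and "hessian (conv f (kernel r)) x = (\<chi> i j. conv (\<lambda>y. h y $ i $ j) (kernel r) x)"
proof -
  note k = kernel_continuous compact_cball[of 0 r] kernel_compact[OF r]
  have cc: "continuous_on UNIV (\<lambda>y. g y $ i)" "continuous_on UNIV (\<lambda>y. h y $ i $ j)" for i j
    using C2_with_cont[OF C, of UNIV] by (intro continuous_intros; simp)+
  have cf: "continuous_on UNIV f" by (rule C2_with_cont[OF C])
  have d1: "(f has_derivative (\<lambda>v. (\<chi> i. g x $ i) \<bullet> v)) (at x)" for x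
    using C by (simp add: C2_with_def)
  have d2: "((\<lambda>x. g x $ j) has_derivative (\<lambda>v. (\<chi> i. h x $ i $ j) \<bullet> v)) (at x)" for x j
    using C by (simp add: C2_with_def)
  have p1: "partial_deriv i (conv f (kernel r)) = conv (\<lambda>y. g y $ i) (kernel r)" for i :: 'n
    using frechet_gradient[OF conv_deriv[OF k d1 cc(1)], where i=i] 
    by (simp add: fun_eq_iff conv_commute[OF cf kernel_continuous] conv_commute[OF cc(1) kernel_continuous])
  have p2: "partial_deriv i (conv (\<lambda>y. g y $ j) (kernel r)) = conv (\<lambda>y. h y $ i $ j) (kernel r)" for i j :: 'n
    using frechet_gradient[OF conv_deriv[OF k d2 cc(2)], where i=i] 
    by (simp add: fun_eq_iff conv_commute[OF cc(1) kernel_continuous] conv_commute[OF cc(2) kernel_continuous])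
  show "gradient (conv f (kernel r)) x = (\<chi> i. conv (\<lambda>y. g y $ i) (kernel r) x)"
    by (simp add: gradient_def p1)
  show "hessian (conv f (kernel r)) x = (\<chi> i j. conv (\<lambda>y. h y $ i $ j) (kernel r) x)"
    by (simp add: hessian_def p1 p2)
qed

lemma trace_mult: "trace (A ** (B::real^'n::finite^'n)) = (\<Sum>i\<in>UNIV. \<Sum>k\<in>UNIV. A $ i $ k * B $ k $ i)"
  by (simp add: trace_def matrix_matrix_mult_def)

lemma L_op_expand: "L_op K \<beta> H v x = (\<Sum>i\<in>UNIV. \<Sum>k\<in>UNIV. K x $ i $ k * H x $ k $ i) + (\<Sum>i\<in>UNIV. \<beta> x $ i * v x $ i)"
  by (simp add: L_op_def trace_mult inner_vec_def)

lemma L_op_expand': "L_op K \<beta> H v = (\<lambda>x. (\<Sum>i\<in>UNIV. \<Sum>k\<in>UNIV. K x $ i $ k * H x $ k $ i) + (\<Sum>i\<in>UNIV. \<beta> x $ i * v x $ i))"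
  by (rule ext) (rule L_op_expand)

lemma integrable_mult_bounded:
  fixes f g :: "'a \<Rightarrow> real"
  assumes "integrable M f" "g \<in> borel_measurable M" "AE x in M. \<bar>g x\<bar> \<le> B"
  shows "integrable M (\<lambda>x. f x * g x)"
proof (rule Bochner_Integration.integrable_bound[OF integrable_mult_right[OF assms(1), of B]])
  show "AE x in M. norm (f x * g x) \<le> norm (B * f x)"
    using assms(3) by eventually_elim (auto simp: abs_mult mult.commute[of B] intro!: mult_mono)
qed (use assms in auto)

lemma integral_mult_tendsto:
  fixes f :: "'a \<Rightarrow> real"
  assumes "integrable M f" "\<And>k. g k \<in> borel_measurable M" "g' \<in> borel_measurable M"
    "\<And>k x. x \<in> space M \<Longrightarrow> \<bar>g k x\<bar> \<le> B" "\<And>x. x \<in> space M \<Longrightarrow> (\<lambda>k. g k x) \<longlonglongrightarrow> g' x"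
  shows "(\<lambda>k. \<integral>x. f x * g k x \<partial>M) \<longlonglongrightarrow> (\<integral>x. f x * g' x \<partial>M)"
proof (rule integral_dominated_convergence[where w="\<lambda>x. B * \<bar>f x\<bar>"])
  show "integrable M (\<lambda>x. B * \<bar>f x\<bar>)" using assms(1) by auto
  show "AE x in M. (\<lambda>k. f x * g k x) \<longlonglongrightarrow> f x * g' x"
    using assms(5) by (auto intro!: tendsto_mult)
  show "AE x in M. norm (f x * g k x) \<le> B * \<bar>f x\<bar>" for k
    using assms(4)[of _ k] by (auto simp: abs_mult mult.commute[of B] intro!: mult_left_mono)
qed (use assms in auto)

lemma continuous_compact_support_bounded:
  fixes v :: "'a::euclidean_space \<Rightarrow> real"
  assumes "continuous_on UNIV v" "compact S" "\<And>x. x \<notin> S \<Longrightarrow> v x = 0"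
  obtains B where "B > 0" "\<And>x. \<bar>v x\<bar> \<le> B"
proof -
  have "bounded (v ` S)" using assms(1,2) by (meson compact_continuous_image compact_imp_bounded continuous_on_subset subset_UNIV)
  then obtain B where B: "B > 0" "\<And>x. x \<in> S \<Longrightarrow> \<bar>v x\<bar> \<le> B" by (auto simp: bounded_pos)
  then have "\<bar>v x\<bar> \<le> B" for x using assms(3)[of x] by (cases "x \<in> S") auto
  then show thesis using that B(1) by blast
qed

lemma continuous_imp_measurable_lebesgue_on [measurable (raw)]:
  fixes f :: "'a::euclidean_space \<Rightarrow> 'b::euclidean_space"
  shows "continuous_on UNIV f \<Longrightarrow> D \<in> sets lebesgue \<Longrightarrow> f \<in> borel_measurable (lebesgue_on D)"
  by (rule continuous_imp_measurable_on_sets_lebesgue) (auto intro: continuous_on_subset)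

lemma compact_inside_radius:
  assumes "compact S" "open U" "S \<subseteq> U"
  obtains r0 where "r0 > 0" "\<And>r. r < r0 \<Longrightarrow> (\<Union>x\<in>S. cball x r) \<subseteq> (U :: 'a::metric_space set)"
proof -
  obtain e where e: "e > 0" "(\<Union>x\<in>S. ball x e) \<subseteq> U"
    using compact_subset_open_imp_ball_epsilon_subset[OF assms] by metis
  show thesis
  proof (rule that[OF e(1)])
    fix r assume "r < e"
    then have "cball x r \<subseteq> ball x e" for x :: 'a by auto
    then show "(\<Union>x\<in>S. cball x r) \<subseteq> U" using e(2) by blast
  qed
qed

text \<open>The cut-off profiles are only twice continuously differentiable. Mollification yields smooth test
  functions with support in a fixed compact subset of \<open>D\<close>, whose derivatives up to order two converge
  boundedly; dominated convergence suffices because \<open>K\<close> and \<open>\<beta>\<close> are integrable.\<close>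
proposition weak_equation_C2:
  fixes D :: "(real^'n::finite) set"
  assumes D: "open D" 
    and K: "\<And>i j. integrable (lebesgue_on D) (\<lambda>x. K x $ i $ j)" and \<beta>: "\<And>i. integrable (lebesgue_on D) (\<lambda>x. \<beta> x $ i)"
    and eq: "\<And>u. test_fun D u \<Longrightarrow> integral\<^sup>L (lebesgue_on D) (L_op K \<beta> (hessian u) (gradient u)) = 0"
    and C: "C2_with f g h" and S: "compact S" "S \<subseteq> D" "\<And>x. x \<notin> S \<Longrightarrow> f x = 0"
  shows "integral\<^sup>L (lebesgue_on D) (L_op K \<beta> h g) = 0"
proof -
  have Dm: "D \<in> sets lebesgue" using D by simp
  obtain r0 where r0: "r0 > 0" "\<And>r. r < r0 \<Longrightarrow> (\<Union>x\<in>S. cball x r) \<subseteq> D"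
    using compact_inside_radius[OF S(1) D S(2)] by metis
  (* Any null sequence in (0, r0) would do; the 2 makes r 0 strictly smaller than r0. *)
  define r where "r k = r0 / (real k + 2)" for k
  have r: "0 < r k" "r k < r0" for k using r0(1) by (auto simp: r_def field_simps add_pos_nonneg)
  have rl: "r \<longlonglongrightarrow> 0" unfolding r_def using LIMSEQ_ignore_initial_segment[OF lim_const_over_n[of r0], of 2] by (simp add: add.commute)
  have zero: "g x = 0" "h x = 0" if "x \<notin> S" for x
    by (rule C2_with_zero_outside[OF C compact_imp_closed[OF S(1)] _ that], erule S(3))+
  have cc: "continuous_on UNIV (\<lambda>y. g y $ i)" "continuous_on UNIV (\<lambda>y. h y $ i $ j)" for i j
    using C2_with_cont[OF C, of UNIV] by (intro continuous_intros; simp)+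
  have cf: "continuous_on UNIV f" by (rule C2_with_cont[OF C])
  define u where "u k = conv f (kernel (r k))" for k
  have test: "test_fun D (u k)" for k
    unfolding u_def by (rule test_fun_conv_kernel[OF cf S(1,3) r(1) r0(2)[OF r(2)]])
  define P where "P k i = conv (\<lambda>y. g y $ i) (kernel (r k))" for k i
  define Q where "Q k i j = conv (\<lambda>y. h y $ i $ j) (kernel (r k))" for k i j
  have gu: "gradient (u k) x = (\<chi> i. P k i x)" and hu: "hessian (u k) x = (\<chi> i j. Q k i j x)" for k x
    unfolding u_def P_def Q_def using conv_C2[OF C S(1,3) less_imp_le[OF r(1)]] by auto
  have conv: "(\<lambda>k. \<integral>x. F x * conv v (kernel (r k)) x \<partial>lebesgue_on D) \<longlonglongrightarrow> (\<integral>x. F x * v x \<partial>lebesgue_on D)"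
    and int: "\<And>k. integrable (lebesgue_on D) (\<lambda>x. F x * conv v (kernel (r k)) x)" "integrable (lebesgue_on D) (\<lambda>x. F x * v x)"
    if F: "integrable (lebesgue_on D) F" and v: "continuous_on UNIV v" "\<And>x. x \<notin> S \<Longrightarrow> v x = 0" for F :: "real^'n \<Rightarrow> real" and v
  proof -
    obtain B where B: "B > 0" "\<And>x. \<bar>v x\<bar> \<le> B" using continuous_compact_support_bounded[OF v(1) S(1) v(2)] by metis
    have cm: "continuous_on UNIV (conv v (kernel (r k)))" for k
      by (rule has_derivative_continuous_on) (rule has_derivative_at_withinI[OF conv_smooth(2)[OF v(1) S(1) v(2) kernel_in_algebra]])
    have bd: "\<bar>conv v (kernel (r k)) x\<bar> \<le> B" for k x by (rule conv_kernel_bound[OF v(1) r(1) B(2)])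
    show "(\<lambda>k. \<integral>x. F x * conv v (kernel (r k)) x \<partial>lebesgue_on D) \<longlonglongrightarrow> (\<integral>x. F x * v x \<partial>lebesgue_on D)"
      by (rule integral_mult_tendsto[OF F _ _ bd conv_kernel_tendsto[OF v(1) r(1) rl]])
        (auto intro!: continuous_imp_measurable_lebesgue_on cm v Dm)
    show "integrable (lebesgue_on D) (\<lambda>x. F x * conv v (kernel (r k)) x)" for k
      by (rule integrable_mult_bounded[OF F, where B=B]) (auto intro!: continuous_imp_measurable_lebesgue_on cm Dm bd)
    show "integrable (lebesgue_on D) (\<lambda>x. F x * v x)"
      by (rule integrable_mult_bounded[OF F, where B=B]) (auto intro!: continuous_imp_measurable_lebesgue_on v Dm B)
  qed
  have z1: "g x $ i = 0" and z2: "h x $ i $ j = 0" if "x \<notin> S" for x i j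
    using zero[OF that] by simp_all
  have "(\<lambda>k. (\<Sum>i\<in>UNIV. \<Sum>j\<in>UNIV. \<integral>x. K x $ i $ j * Q k j i x \<partial>lebesgue_on D) + (\<Sum>i\<in>UNIV. \<integral>x. \<beta> x $ i * P k i x \<partial>lebesgue_on D))
     \<longlonglongrightarrow> (\<Sum>i\<in>UNIV. \<Sum>j\<in>UNIV. \<integral>x. K x $ i $ j * h x $ j $ i \<partial>lebesgue_on D) + (\<Sum>i\<in>UNIV. \<integral>x. \<beta> x $ i * g x $ i \<partial>lebesgue_on D)"
    unfolding P_def Q_def by (intro tendsto_add tendsto_sum conv K \<beta> cc z1 z2)
  moreover have "integral\<^sup>L (lebesgue_on D) (L_op K \<beta> (hessian (u k)) (gradient (u k)))
     = (\<Sum>i\<in>UNIV. \<Sum>j\<in>UNIV. \<integral>x. K x $ i $ j * Q k j i x \<partial>lebesgue_on D) + (\<Sum>i\<in>UNIV. \<integral>x. \<beta> x $ i * P k i x \<partial>lebesgue_on D)" for k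
  proof -
    have "integrable (lebesgue_on D) (\<lambda>x. K x $ i $ j * Q k j i x)" for i j
      unfolding Q_def by (rule int(1)[OF K cc(2) z2])
    moreover have "integrable (lebesgue_on D) (\<lambda>x. \<beta> x $ i * P k i x)" for i
      unfolding P_def by (rule int(1)[OF \<beta> cc(1) z1])
    ultimately show ?thesis by (simp add: L_op_expand' gu hu)
  qed
  ultimately have "(\<lambda>k. 0) \<longlonglongrightarrow> (\<Sum>i\<in>UNIV. \<Sum>j\<in>UNIV. \<integral>x. K x $ i $ j * h x $ j $ i \<partial>lebesgue_on D) + (\<Sum>i\<in>UNIV. \<integral>x. \<beta> x $ i * g x $ i \<partial>lebesgue_on D)"
    using eq[OF test] by simp
  from LIMSEQ_unique[OF tendsto_const this] have lim0: "(\<Sum>i\<in>UNIV. \<Sum>j\<in>UNIV. \<integral>x. K x $ i $ j * h x $ j $ i \<partial>lebesgue_on D) + (\<Sum>i\<in>UNIV. \<integral>x. \<beta> x $ i * g x $ i \<partial>lebesgue_on D) = 0"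
    by simp
  have "integrable (lebesgue_on D) (\<lambda>x. K x $ i $ j * h x $ j $ i)" for i j
    by (rule int(2)[OF K cc(2) z2])
  moreover have "integrable (lebesgue_on D) (\<lambda>x. \<beta> x $ i * g x $ i)" for i
    by (rule int(2)[OF \<beta> cc(1) z1])
  ultimately have "integral\<^sup>L (lebesgue_on D) (L_op K \<beta> h g)
    = (\<Sum>i\<in>UNIV. \<Sum>j\<in>UNIV. \<integral>x. K x $ i $ j * h x $ j $ i \<partial>lebesgue_on D) + (\<Sum>i\<in>UNIV. \<integral>x. \<beta> x $ i * g x $ i \<partial>lebesgue_on D)"
    by (simp add: L_op_expand')
  with lim0 show ?thesis by simp
qed

section \<open>Mollification of integrable functions\<close>

lemma powr_add_le:
  fixes a b p :: real
  assumes "0 \<le> p"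
  shows "\<bar>a + b\<bar> powr p \<le> 2 powr p * (\<bar>a\<bar> powr p + \<bar>b\<bar> powr p)"
proof -
  have "\<bar>a + b\<bar> powr p \<le> (2 * max \<bar>a\<bar> \<bar>b\<bar>) powr p" using assms by (intro powr_mono2) auto
  also have "\<dots> = 2 powr p * (max \<bar>a\<bar> \<bar>b\<bar>) powr p" by (simp add: powr_mult)
  also have "\<dots> \<le> 2 powr p * (\<bar>a\<bar> powr p + \<bar>b\<bar> powr p)"
    by (intro mult_left_mono) (auto simp: max_def)
  finally show ?thesis .
qed

lemma cutoff_continuous:
  fixes S U :: "'a::euclidean_space set"
  assumes "compact S" "open U" "S \<subseteq> U"
  obtains \<eta> :: "'a \<Rightarrow> real" and T where "continuous_on UNIV \<eta>" "compact T" "T \<subseteq> U" "\<And>x. x \<notin> T \<Longrightarrow> \<eta> x = 0"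
    "\<And>x. 0 \<le> \<eta> x \<and> \<eta> x \<le> 1" "\<And>x. x \<in> S \<Longrightarrow> \<eta> x = 1"
proof -
  obtain e where e: "e > 0" "(\<Union>x\<in>S. cball x e) \<subseteq> U"
  proof -
    obtain r0 where "r0 > 0" "\<And>r. r < r0 \<Longrightarrow> (\<Union>x\<in>S. cball x r) \<subseteq> U"
      using compact_inside_radius[OF assms] by metis
    then show thesis using that[of "r0/2"] by simp
  qed
  let ?T = "{x + y |x y. x \<in> S \<and> y \<in> cball 0 e}"
  have T: "compact ?T" by (rule compact_sums[OF assms(1) compact_cball])
  have TU: "?T \<subseteq> U"
  proof
    fix z assume "z \<in> ?T"
    then obtain x y where "z = x + y" "x \<in> S" "norm y \<le> e" by auto
    then show "z \<in> U" by (auto intro!: subsetD[OF e(2)] bexI[of _ x] simp: dist_norm)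
  qed
  define \<eta> where "\<eta> x = (if S = {} then 0 else max 0 (1 - setdist {x} S / e))" for x
  show thesis
  proof (rule that[OF _ T TU])
    show "continuous_on UNIV \<eta>" unfolding \<eta>_def[abs_def] using e(1)
      by (cases "S = {}") (simp_all, intro continuous_intros continuous_on_setdist, simp)
    show "\<eta> x = 0" if x: "x \<notin> ?T" for x
    proof (cases "S = {}")
      case False
      have "e \<le> setdist {x} S"
      proof (rule le_setdistI)
        fix a b assume "a \<in> {x}" "b \<in> S"
        show "e \<le> dist a b"
        proof (rule ccontr)
          assume "\<not> e \<le> dist a b"
          then have "x = b + (x - b) \<and> b \<in> S \<and> x - b \<in> cball 0 e" using \<open>a \<in> {x}\<close> \<open>b \<in> S\<close> by (simp add: dist_norm norm_minus_commute)
          then have "x \<in> ?T" by blast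
          with x show False by (rule notE)
        qed
      qed (use False in auto)
      then show ?thesis using e(1) False by (simp add: \<eta>_def max_def field_simps)
    qed (simp add: \<eta>_def)
    show "0 \<le> \<eta> x \<and> \<eta> x \<le> 1" for x using e(1) by (simp add: \<eta>_def setdist_pos_le)
    show "\<eta> x = 1" if "x \<in> S" for x using that by (auto simp: \<eta>_def setdist_sing_in_set)
  qed
qed

text \<open>Lebesgue measurability is equivalent to being a limit of continuous functions almost
  everywhere.\<close>
lemma measurable_approx:
  fixes H :: "'a::euclidean_space \<Rightarrow> real"
  assumes "H \<in> borel_measurable borel"
  obtains g where "\<And>n::nat. continuous_on UNIV (g n)" "AE x in lborel. (\<lambda>n. g n x) \<longlonglongrightarrow> H x"
proof -
  have "H \<in> borel_measurable lebesgue" using assms by (simp add: borel_measurable_if_D measurable_completion)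
  then have "H measurable_on UNIV" by (intro lebesgue_measurable_imp_measurable_on_real) auto
  then obtain N g where N: "negligible N" "\<And>n. continuous_on UNIV (g n)" "\<And>x. x \<notin> N \<Longrightarrow> (\<lambda>n. g n x) \<longlonglongrightarrow> H x"
    unfolding measurable_on_def by auto
  have "AE x in lebesgue. (\<lambda>n. g n x) \<longlonglongrightarrow> H x"
    using N(1,3) by (auto simp: negligible_iff_null_sets intro!: AE_I'[of N])
  then have "AE x in lborel. (\<lambda>n. g n x) \<longlonglongrightarrow> H x" by (simp add: AE_completion_iff)
  then show thesis using that N(2) by blast
qed

text \<open>Truncation reduces the claim to bounded functions with compact support. For those, cut off
  continuous approximations that converge almost everywhere also converge in \<open>L\<^sup>p\<close>, being uniformly bounded.\<close>
lemma Lp_dense_continuous: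
  fixes H :: "'a::euclidean_space \<Rightarrow> real"
  assumes p: "p \<ge> 1" and H: "H \<in> borel_measurable borel" "integrable lborel (\<lambda>x. \<bar>H x\<bar> powr p)" 
    and S: "compact S" "\<And>x. x \<notin> S \<Longrightarrow> H x = 0" and e: "e > 0"
  obtains G T where "continuous_on UNIV G" "compact T" "\<And>x. x \<notin> T \<Longrightarrow> G x = 0"
    "integrable lborel (\<lambda>x. \<bar>H x - G x\<bar> powr p)" "(\<integral>x. \<bar>H x - G x\<bar> powr p \<partial>lborel) < e"
proof -
  define cl where "cl M t = max (-M) (min M t)" for M t :: real
  have p0: "p > 0" using p by simp
  have clc: "continuous_on S' (\<lambda>x. cl M (f x))" if "continuous_on S' f" for S' M and f :: "'a \<Rightarrow> real"
    unfolding cl_def by (intro continuous_intros that)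
  have clb: "\<bar>cl M t\<bar> \<le> M" if "M \<ge> 0" for M t using that by (auto simp: cl_def)
  have cl_le: "\<bar>t - cl M t\<bar> \<le> \<bar>t\<bar>" if "M \<ge> 0" for M t using that by (auto simp: cl_def max_def min_def)
  have clm: "(\<lambda>x. cl M (H x)) \<in> borel_measurable borel" for M unfolding cl_def using H(1) by measurable
  have lim1: "(\<lambda>n. \<integral>x. \<bar>H x - cl (real n) (H x)\<bar> powr p \<partial>lborel) \<longlonglongrightarrow> (\<integral>x. 0 \<partial>(lborel::'a measure))"
  proof (rule integral_dominated_convergence[where w="\<lambda>x. \<bar>H x\<bar> powr p"])
    show "AE x in lborel. (\<lambda>n. \<bar>H x - cl (real n) (H x)\<bar> powr p) \<longlonglongrightarrow> 0"
    proof (rule AE_I2)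
      fix x
      obtain N :: nat where N: "\<bar>H x\<bar> \<le> real N" using real_arch_simple by blast
      have "\<bar>H x - cl (real n) (H x)\<bar> powr p = 0" if "n \<ge> N" for n
        using N that p0 by (auto simp: cl_def max_def min_def)
      then show "(\<lambda>n. \<bar>H x - cl (real n) (H x)\<bar> powr p) \<longlonglongrightarrow> 0"
        by (intro tendsto_eventually) (auto simp: eventually_sequentially)
    qed
    show "AE x in lborel. norm (\<bar>H x - cl (real n) (H x)\<bar> powr p) \<le> \<bar>H x\<bar> powr p" for n
      using cl_le[of "real n"] p0 by (auto intro!: powr_mono2)
  qed (use H clm in auto)
  define c where "c = 2 powr p"
  have c: "c > 0" by (simp add: c_def)
  have "\<exists>n. (\<integral>x. \<bar>H x - cl (real n) (H x)\<bar> powr p \<partial>lborel) < e / (2 * c)"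
    using eventually_happens'[OF sequentially_bot order_tendstoD(2)[OF lim1, of "e / (2 * c)"]] e c by auto
  then obtain n where n: "(\<integral>x. \<bar>H x - cl (real n) (H x)\<bar> powr p \<partial>lborel) < e / (2 * c)" by blast
  define M where "M = real n"
  have M: "M \<ge> 0" by (simp add: M_def)
  obtain \<eta> :: "'a \<Rightarrow> real" and T where eta: "continuous_on UNIV \<eta>" "compact T" "\<And>x. x \<notin> T \<Longrightarrow> \<eta> x = 0"
    "\<And>x. 0 \<le> \<eta> x \<and> \<eta> x \<le> 1" "\<And>x. x \<in> S \<Longrightarrow> \<eta> x = 1"
    using cutoff_continuous[OF S(1) open_UNIV subset_UNIV] by metis
  obtain g where g: "\<And>n::nat. continuous_on UNIV (g n)" "AE x in lborel. (\<lambda>n. g n x) \<longlonglongrightarrow> H x"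
    using measurable_approx[OF H(1)] by metis
  define G where "G k x = \<eta> x * cl M (g k x)" for k x
  have Gc: "continuous_on UNIV (G k)" for k unfolding G_def by (intro continuous_intros eta clc g)
  have Gm: "G k \<in> borel_measurable borel" for k by (rule borel_measurable_continuous_onI[OF Gc])
  have GT: "G k x = 0" if "x \<notin> T" for k x using eta(3)[OF that] by (simp add: G_def)
  have ST: "S \<subseteq> T" using eta(3,5) by force
  have Gb: "\<bar>G k x\<bar> \<le> M" for k x
    using mult_mono[of "\<bar>\<eta> x\<bar>" 1 "\<bar>cl M (g k x)\<bar>" M] eta(4)[of x] clb[OF M] M by (simp add: G_def abs_mult)
  have Hb: "\<bar>cl M (H x)\<bar> \<le> M" for x by (rule clb[OF M])
  have H0: "cl M (H x) = 0" if "x \<notin> S" for x using S(2)[OF that] M by (simp add: cl_def)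
  have wint: "integrable lborel (\<lambda>x. (2 * M) powr p * indicator T x)"
    using eta(2) emeasure_compact_finite[OF eta(2)]
    by (intro integrable_mult_right integrable_real_indicator) (auto simp: compact_imp_closed borel_closed)
  have dom: "norm (\<bar>cl M (H x) - G k x\<bar> powr p) \<le> (2 * M) powr p * indicator T x" for k x
  proof (cases "x \<in> T")
    case True
    have "\<bar>cl M (H x) - G k x\<bar> \<le> 2 * M" using Gb[of k x] Hb[of x] by linarith
    then show ?thesis using True p0 by (auto intro!: powr_mono2)
  next
    case False then show ?thesis using GT[OF False] H0[of x] ST p0 by auto
  qed
  have lim2: "(\<lambda>k. \<integral>x. \<bar>cl M (H x) - G k x\<bar> powr p \<partial>lborel) \<longlonglongrightarrow> (\<integral>x. 0 \<partial>(lborel::'a measure))"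
  proof (rule integral_dominated_convergence[where w="\<lambda>x. (2 * M) powr p * indicator T x"])
    show "AE x in lborel. (\<lambda>k. \<bar>cl M (H x) - G k x\<bar> powr p) \<longlonglongrightarrow> 0"
      using g(2)
    proof eventually_elim
      case (elim x)
      have "(\<lambda>k. G k x) \<longlonglongrightarrow> \<eta> x * cl M (H x)"
        unfolding G_def cl_def by (intro tendsto_intros elim)
      moreover have "\<eta> x * cl M (H x) = cl M (H x)" using eta(5)[of x] H0[of x] by (cases "x \<in> S") auto
      ultimately have "(\<lambda>k. \<bar>cl M (H x) - G k x\<bar> powr p) \<longlonglongrightarrow> \<bar>cl M (H x) - cl M (H x)\<bar> powr p"
        using p0 by (intro tendsto_powr' tendsto_intros) (auto intro!: tendsto_eq_intros)
      then show ?case using p0 by simp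
    qed
  qed (use wint dom Gm clm in auto)
  have "\<exists>k. (\<integral>x. \<bar>cl M (H x) - G k x\<bar> powr p \<partial>lborel) < e / (2 * c)"
    using eventually_happens'[OF sequentially_bot order_tendstoD(2)[OF lim2, of "e / (2 * c)"]] e c by auto
  then obtain k where k: "(\<integral>x. \<bar>cl M (H x) - G k x\<bar> powr p \<partial>lborel) < e / (2 * c)" by blast
  have i1: "integrable lborel (\<lambda>x. \<bar>H x - cl M (H x)\<bar> powr p)"
    by (rule Bochner_Integration.integrable_bound[OF H(2)]) (use H(1) clm cl_le[OF M] p0 in \<open>auto intro!: powr_mono2\<close>)
  have i2: "integrable lborel (\<lambda>x. \<bar>cl M (H x) - G k x\<bar> powr p)"
    by (rule Bochner_Integration.integrable_bound[OF wint]) (use Gm clm dom in \<open>auto intro: order_trans[OF _ abs_ge_self]\<close>)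
  have le: "\<bar>H x - G k x\<bar> powr p \<le> c * (\<bar>H x - cl M (H x)\<bar> powr p + \<bar>cl M (H x) - G k x\<bar> powr p)" for x
    using powr_add_le[of p "H x - cl M (H x)" "cl M (H x) - G k x"] p0 by (simp add: c_def)
  have i3: "integrable lborel (\<lambda>x. \<bar>H x - G k x\<bar> powr p)"
    by (rule Bochner_Integration.integrable_bound[OF integrable_mult_right[OF Bochner_Integration.integrable_add[OF i1 i2], of c]])
      (use Gm H(1) le in \<open>auto intro: order_trans[OF _ abs_ge_self]\<close>)
  have "(\<integral>x. \<bar>H x - G k x\<bar> powr p \<partial>lborel) \<le> (\<integral>x. c * (\<bar>H x - cl M (H x)\<bar> powr p + \<bar>cl M (H x) - G k x\<bar> powr p) \<partial>lborel)"
    by (rule integral_mono[OF i3 integrable_mult_right[OF Bochner_Integration.integrable_add[OF i1 i2], of c] le])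
  also have "\<dots> = c * ((\<integral>x. \<bar>H x - cl M (H x)\<bar> powr p \<partial>lborel) + (\<integral>x. \<bar>cl M (H x) - G k x\<bar> powr p \<partial>lborel))"
    using i1 i2 by simp
  also have "\<dots> < c * (e / (2 * c) + e / (2 * c))"
    using n k c by (intro mult_strict_left_mono add_strict_mono) (auto simp: M_def)
  also have "\<dots> = e" using c by simp
  finally show thesis using that[OF Gc eta(2) GT i3] by blast
qed

lemma compact_support_uniformly_continuous:
  fixes G :: "'a::euclidean_space \<Rightarrow> real"
  assumes G: "continuous_on UNIV G" "compact T" "\<And>x. x \<notin> T \<Longrightarrow> G x = 0"
  shows "uniformly_continuous_on UNIV G"
proof -
  obtain R where R: "T \<subseteq> ball 0 R" using compact_imp_bounded[OF G(2)] bounded_subset_ballD by blast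
  have "uniformly_continuous_on (cball 0 (R + 1)) G"
    by (rule compact_uniformly_continuous[OF continuous_on_subset[OF G(1)]]) auto
  then show ?thesis unfolding uniformly_continuous_on_def
  proof (intro allI impI)
    fix e :: real assume e: "e > 0" and "\<forall>e>0. \<exists>d>0. \<forall>x\<in>cball 0 (R + 1). \<forall>x'\<in>cball 0 (R + 1). dist x' x < d \<longrightarrow> dist (G x') (G x) < e"
    then obtain d where d: "d > 0" "\<And>x x'. x \<in> cball 0 (R + 1) \<Longrightarrow> x' \<in> cball 0 (R + 1) \<Longrightarrow> dist x' x < d \<Longrightarrow> dist (G x') (G x) < e"
      by blast
    show "\<exists>d>0. \<forall>x\<in>UNIV. \<forall>x'\<in>UNIV. dist x' x < d \<longrightarrow> dist (G x') (G x) < e"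
    proof (intro exI[of _ "min d 1"] conjI ballI impI)
      fix x x' :: 'a assume c: "dist x' x < min d 1"
      show "dist (G x') (G x) < e"
      proof (cases "x \<in> T \<or> x' \<in> T")
        case True
        then have "norm x < R \<or> norm x' < R" using R by auto
        then have "x \<in> cball 0 (R + 1)" "x' \<in> cball 0 (R + 1)"
          using c norm_triangle_ineq2[of x x'] norm_triangle_ineq2[of x' x] by (auto simp: dist_norm norm_minus_commute)
        then show ?thesis using d(2) c by simp
      qed (use G(3) e in auto)
    qed (use d in auto)
  qed
qed

lemma lborel_integrable_reflect:
  fixes f :: "'a::euclidean_space \<Rightarrow> real"
  assumes "integrable lborel f"
  shows "integrable lborel (\<lambda>y. f (x - y))"
proof -
  have "lborel = distr lborel borel (\<lambda>y. x - y)"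
    using lborel_affine[of "-1" x] by (simp add: density_1)
  then have "integrable (distr lborel borel (\<lambda>y. x - y)) f" using assms by simp
  then show ?thesis using borel_measurable_integrable[OF assms] by (subst (asm) integrable_distr_eq) auto
qed

text \<open>A substitute for Hoelder's inequality: the free parameter \<open>l\<close> makes one of the two terms small
  at the expense of the other.\<close>
lemma Young_scaled:
  fixes p q a b l :: real
  assumes p: "p > 1" and q: "q = p / (p - 1)" and l: "l > 0"
  shows "\<bar>a\<bar> * \<bar>b\<bar> \<le> l powr (-q) * \<bar>a\<bar> powr q + l powr p * \<bar>b\<bar> powr p"
proof -
  have q1: "q > 1" using p by (simp add: q field_simps)
  have "1 / p + 1 / q = 1" using p by (simp add: q field_simps)
  then have "(\<bar>a\<bar> / l) * (l * \<bar>b\<bar>) \<le> (\<bar>a\<bar> / l) powr q / q + (l * \<bar>b\<bar>) powr p / p"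
    using Youngs_inequality[of q p "\<bar>a\<bar> / l" "l * \<bar>b\<bar>"] p q1 l by (simp add: add.commute)
  also have "\<dots> \<le> (\<bar>a\<bar> / l) powr q + (l * \<bar>b\<bar>) powr p"
    using p q1 by (intro add_mono) (auto simp: divide_le_eq intro: mult_right_le_one_le order_trans[OF _ mult_left_mono[of 1]])
  also have "\<dots> = l powr (-q) * \<bar>a\<bar> powr q + l powr p * \<bar>b\<bar> powr p"
    using l by (simp add: powr_divide powr_mult powr_minus field_simps)
  finally show ?thesis using l by simp
qed

lemma nn_integral_lborel_translate:
  fixes f :: "'a::euclidean_space \<Rightarrow> ennreal"
  assumes "f \<in> borel_measurable borel"
  shows "(\<integral>\<^sup>+x. f (x - z) \<partial>lborel) = (\<integral>\<^sup>+x. f x \<partial>lborel)"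
proof -
  have "(\<integral>\<^sup>+x. f x \<partial>lborel) = (\<integral>\<^sup>+x. f x \<partial>(distr lborel borel ((+) (- z))))" by (simp add: lborel_distr_plus)
  also have "\<dots> = (\<integral>\<^sup>+x. f (- z + x) \<partial>lborel)" using assms by (subst nn_integral_distr) auto
  finally show ?thesis by simp
qed

text \<open>Replace \<open>H\<close> by a continuous \<open>G\<close> with compact support that is close to it in \<open>L\<^sup>p\<close>. The three errors are at
  most \<open>e / 3\<close> each: two by the scaled Young inequality and one by uniform continuity of \<open>G\<close> against
  the integrable \<open>K\<close>.\<close>
lemma translation_continuity:
  fixes H K :: "'a::euclidean_space \<Rightarrow> real"
  assumes p: "p > 1" and q: "q = p / (p - 1)"
    and H: "H \<in> borel_measurable borel" "integrable lborel (\<lambda>x. \<bar>H x\<bar> powr p)" "compact S" "\<And>x. x \<notin> S \<Longrightarrow> H x = 0"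
    and K: "K \<in> borel_measurable borel" "integrable lborel (\<lambda>x. \<bar>K x\<bar> powr q)" "integrable lborel K"
    and e: "e > 0"
  obtains d where "d > 0" "\<And>z. norm z < d \<Longrightarrow> (\<integral>\<^sup>+x. \<bar>K x * (H (x - z) - H x)\<bar> \<partial>lborel) \<le> ennreal e"
proof -
  define k where "k = (\<integral>x. \<bar>K x\<bar> powr q \<partial>lborel)"
  define k1 where "k1 = (\<integral>x. \<bar>K x\<bar> \<partial>lborel)"
  have k: "k \<ge> 0" "k1 \<ge> 0" by (simp_all add: k_def k1_def)
  have q1: "q > 1" using p by (simp add: q field_simps)
  (* Chosen such that the term with K in the scaled Young inequality is at most e / 6; the 1 keeps
     the numerator positive. The quality of the approximation G is adjusted to this l. *)
  define l where "l = (6 * (k + 1) / e) powr (1 / q)"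
  have l: "l > 0" using k e by (simp add: l_def)
  have "l powr q = 6 * (k + 1) / e" using k e q1 by (simp add: l_def powr_powr)
  then have lq: "l powr (- q) = e / (6 * (k + 1))" by (simp add: powr_minus)
  have lk: "l powr (- q) * k \<le> e / 6" unfolding lq using k e by (simp add: field_simps)
  obtain G T where G: "continuous_on UNIV G" "compact T" "\<And>x. x \<notin> T \<Longrightarrow> G x = 0"
    "integrable lborel (\<lambda>x. \<bar>H x - G x\<bar> powr p)" "(\<integral>x. \<bar>H x - G x\<bar> powr p \<partial>lborel) < e / (6 * l powr p)"
    using Lp_dense_continuous[of p H S "e / (6 * l powr p)"] p H e l by (auto simp: zero_less_mult_iff)
  have Gm: "G \<in> borel_measurable borel" by (rule borel_measurable_continuous_onI[OF G(1)])
  have pair: "(\<integral>\<^sup>+x. \<bar>K x\<bar> * \<bar>H (x - z) - G (x - z)\<bar> \<partial>lborel) \<le> ennreal (e / 3)" for z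
  proof -
    have "(\<integral>\<^sup>+x. \<bar>K x\<bar> * \<bar>H (x - z) - G (x - z)\<bar> \<partial>lborel)
       \<le> (\<integral>\<^sup>+x. ennreal (l powr (-q)) * ennreal (\<bar>K x\<bar> powr q) + ennreal (l powr p) * ennreal (\<bar>H (x - z) - G (x - z)\<bar> powr p) \<partial>lborel)"
      using Young_scaled[OF p q l] by (intro nn_integral_mono) (auto simp flip: ennreal_mult ennreal_plus intro!: ennreal_leI)
    also have "\<dots> = ennreal (l powr (-q)) * (\<integral>\<^sup>+x. ennreal (\<bar>K x\<bar> powr q) \<partial>lborel)
       + ennreal (l powr p) * (\<integral>\<^sup>+x. ennreal (\<bar>H (x - z) - G (x - z)\<bar> powr p) \<partial>lborel)"
      using H(1) K(1) Gm by (simp add: nn_integral_add nn_integral_cmult)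
    also have "(\<integral>\<^sup>+x. ennreal (\<bar>H (x - z) - G (x - z)\<bar> powr p) \<partial>lborel) = (\<integral>\<^sup>+x. ennreal (\<bar>H x - G x\<bar> powr p) \<partial>lborel)"
      using H(1) Gm by (intro nn_integral_lborel_translate[where f="\<lambda>x. ennreal (\<bar>H x - G x\<bar> powr p)"]) measurable
    also have "\<dots> = ennreal (\<integral>x. \<bar>H x - G x\<bar> powr p \<partial>lborel)" by (rule nn_integral_eq_integral[OF G(4)]) simp
    also have "(\<integral>\<^sup>+x. ennreal (\<bar>K x\<bar> powr q) \<partial>lborel) = ennreal k" unfolding k_def by (rule nn_integral_eq_integral[OF K(2)]) simp
    also have "ennreal (l powr (-q)) * ennreal k + ennreal (l powr p) * ennreal (\<integral>x. \<bar>H x - G x\<bar> powr p \<partial>lborel)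
       = ennreal (l powr (-q) * k + l powr p * (\<integral>x. \<bar>H x - G x\<bar> powr p \<partial>lborel))"
      using k by (simp flip: ennreal_mult ennreal_plus)
    also have "\<dots> \<le> ennreal (e / 3)"
    proof (rule ennreal_leI)
      have "l powr p * (\<integral>x. \<bar>H x - G x\<bar> powr p \<partial>lborel) \<le> l powr p * (e / (6 * l powr p))"
        using G(5) by (intro mult_left_mono) auto
      also have "\<dots> = e / 6" using l by simp
      finally show "l powr (-q) * k + l powr p * (\<integral>x. \<bar>H x - G x\<bar> powr p \<partial>lborel) \<le> e / 3" using lk by simp
    qed
    finally show ?thesis .
  qed
  have "uniformly_continuous_on UNIV G" by (rule compact_support_uniformly_continuous[OF G(1-3)])
  then obtain d where d: "d > 0" "\<And>x y. dist x y < d \<Longrightarrow> dist (G x) (G y) < e / (3 * (k1 + 1))"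
    unfolding uniformly_continuous_on_def using e k by (metis UNIV_I add_nonneg_pos divide_pos_pos mult_pos_pos zero_less_numeral zero_less_one)
  show thesis
  proof (rule that[OF d(1)])
    fix z :: 'a assume z: "norm z < d"
    have "(\<integral>\<^sup>+x. \<bar>K x * (H (x - z) - H x)\<bar> \<partial>lborel)
       \<le> (\<integral>\<^sup>+x. (ennreal (\<bar>K x\<bar> * \<bar>H (x - z) - G (x - z)\<bar>) + ennreal (e / (3 * (k1 + 1))) * ennreal \<bar>K x\<bar>) + ennreal (\<bar>K x\<bar> * \<bar>H (x - 0) - G (x - 0)\<bar>) \<partial>lborel)"
    proof (rule nn_integral_mono)
      fix x
      have "\<bar>G (x - z) - G x\<bar> \<le> e / (3 * (k1 + 1))" using d(2)[of "x - z" x] z by (simp add: dist_norm)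
      then have "\<bar>K x\<bar> * \<bar>G (x - z) - G x\<bar> \<le> e / (3 * (k1 + 1)) * \<bar>K x\<bar>" by (subst mult.commute) (rule mult_right_mono; simp)
      moreover have "\<bar>K x\<bar> * \<bar>H (x - z) - H x\<bar> \<le> \<bar>K x\<bar> * (\<bar>H (x - z) - G (x - z)\<bar> + \<bar>G (x - z) - G x\<bar> + \<bar>H x - G x\<bar>)"
        by (intro mult_left_mono) auto
      ultimately have "\<bar>K x * (H (x - z) - H x)\<bar> \<le> \<bar>K x\<bar> * \<bar>H (x - z) - G (x - z)\<bar> + e / (3 * (k1 + 1)) * \<bar>K x\<bar> + \<bar>K x\<bar> * \<bar>H (x - 0) - G (x - 0)\<bar>"
        by (simp add: abs_mult distrib_left)
      then have "ennreal \<bar>K x * (H (x - z) - H x)\<bar> \<le> ennreal (\<bar>K x\<bar> * \<bar>H (x - z) - G (x - z)\<bar> + e / (3 * (k1 + 1)) * \<bar>K x\<bar> + \<bar>K x\<bar> * \<bar>H (x - 0) - G (x - 0)\<bar>)"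
        by (rule ennreal_leI)
      then show "ennreal \<bar>K x * (H (x - z) - H x)\<bar> \<le> (ennreal (\<bar>K x\<bar> * \<bar>H (x - z) - G (x - z)\<bar>) + ennreal (e / (3 * (k1 + 1))) * ennreal \<bar>K x\<bar>) + ennreal (\<bar>K x\<bar> * \<bar>H (x - 0) - G (x - 0)\<bar>)"
      proof -
        have "ennreal (a + c * b + d) = (ennreal a + ennreal c * ennreal b) + ennreal d"
          if "0 \<le> a" "0 \<le> b" "0 \<le> c" "0 \<le> d" for a b c d :: real
          using that by (simp add: ennreal_mult)
        from this[of "\<bar>K x\<bar> * \<bar>H (x - z) - G (x - z)\<bar>" "\<bar>K x\<bar>" "e / (3 * (k1 + 1))" "\<bar>K x\<bar> * \<bar>H (x - 0) - G (x - 0)\<bar>"]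
        show ?thesis using e k \<open>ennreal \<bar>K x * (H (x - z) - H x)\<bar> \<le> _\<close> by simp
      qed
    qed
    also have "\<dots> = ((\<integral>\<^sup>+x. \<bar>K x\<bar> * \<bar>H (x - z) - G (x - z)\<bar> \<partial>lborel) + ennreal (e / (3 * (k1 + 1))) * (\<integral>\<^sup>+x. ennreal \<bar>K x\<bar> \<partial>lborel))
        + (\<integral>\<^sup>+x. \<bar>K x\<bar> * \<bar>H (x - 0) - G (x - 0)\<bar> \<partial>lborel)"
      using H(1) K(1) Gm by (simp add: nn_integral_add nn_integral_cmult)
    also have "(\<integral>\<^sup>+x. ennreal \<bar>K x\<bar> \<partial>lborel) = ennreal k1"
      unfolding k1_def using K(3) by (intro nn_integral_eq_integral) auto
    also have "((\<integral>\<^sup>+x. \<bar>K x\<bar> * \<bar>H (x - z) - G (x - z)\<bar> \<partial>lborel) + ennreal (e / (3 * (k1 + 1))) * ennreal k1)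
        + (\<integral>\<^sup>+x. \<bar>K x\<bar> * \<bar>H (x - 0) - G (x - 0)\<bar> \<partial>lborel) \<le> (ennreal (e / 3) + ennreal (e / 3)) + ennreal (e / 3)"
    proof (intro add_mono pair)
      have "e / (3 * (k1 + 1)) * k1 \<le> e / 3" using e k by (simp add: field_simps)
      then show "ennreal (e / (3 * (k1 + 1))) * ennreal k1 \<le> ennreal (e / 3)"
        using e k by (simp flip: ennreal_mult add: ennreal_leI)
    qed
    also have "\<dots> = ennreal e" using e by (simp flip: ennreal_plus)
    finally show "(\<integral>\<^sup>+x. \<bar>K x * (H (x - z) - H x)\<bar> \<partial>lborel) \<le> ennreal e" .
  qed
qed

text \<open>Mollification converges in \<open>L\<^sup>p\<close>, in the weak form that is used later: only the pairing with one
  fixed \<open>K\<close> matters, and it reduces to \<open>translation_continuity\<close> by Fubini.\<close>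
proposition conv_pairing_tendsto:
  fixes H K :: "real^'n::finite \<Rightarrow> real"
  assumes p: "p > 1" and q: "q = p / (p - 1)"
    and H: "H \<in> borel_measurable borel" "integrable lborel (\<lambda>x. \<bar>H x\<bar> powr p)" "compact S" "\<And>x. x \<notin> S \<Longrightarrow> H x = 0"
    and Hi: "integrable lborel H"
    and K: "K \<in> borel_measurable borel" "integrable lborel (\<lambda>x. \<bar>K x\<bar> powr q)" "integrable lborel K"
    and r: "\<And>k. 0 < r k" "r \<longlonglongrightarrow> 0"
  shows "(\<lambda>k. \<integral>x. K x * conv H (kernel (r k)) x \<partial>lborel) \<longlonglongrightarrow> (\<integral>x. K x * H x \<partial>lborel)"
    and "integrable lborel (\<lambda>x. K x * conv H (kernel (r k)) x)"
    and "integrable lborel (\<lambda>x. K x * H x)"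
proof -
  have km: "kernel s \<in> borel_measurable borel" for s :: real
    by (rule borel_measurable_continuous_onI[OF kernel_continuous])
  have kb: "\<exists>B. \<forall>x. \<bar>kernel s (x::real^'n)\<bar> \<le> B" if "s > 0" for s
    using continuous_compact_support_bounded[OF kernel_continuous compact_cball[of 0 s], of s] kernel_compact[of s] that
    by (metis less_imp_le)
  have cb: "\<exists>B. \<forall>x. \<bar>conv H (kernel s) x\<bar> \<le> B" if s: "s > 0" for s
  proof -
    obtain B where B: "\<And>x::real^'n. \<bar>kernel s x\<bar> \<le> B" using kb[OF s] by blast
    have "\<bar>conv H (kernel s) x\<bar> \<le> (\<integral>y. B * \<bar>H y\<bar> \<partial>lborel)" for x
    proof -
      have "\<bar>conv H (kernel s) x\<bar> \<le> (\<integral>y. \<bar>H y * kernel s (x - y)\<bar> \<partial>lborel)" unfolding conv_def by (rule integral_abs_bound)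
      also have "\<dots> \<le> (\<integral>y. B * \<bar>H y\<bar> \<partial>lborel)"
      proof (rule integral_mono)
        have "integrable lborel (\<lambda>y. H y * kernel s (x - y))"
          by (rule integrable_mult_bounded[OF Hi _ AE_I2[OF B]]) (use km in measurable)
        then show "integrable lborel (\<lambda>y. \<bar>H y * kernel s (x - y)\<bar>)" by (rule integrable_abs)
        show "\<bar>H y * kernel s (x - y)\<bar> \<le> B * \<bar>H y\<bar>" for y
          using B[of "x - y"] by (simp add: abs_mult mult.commute[of B] mult_left_mono)
      qed (use Hi in auto)
      finally show ?thesis .
    qed
    then show ?thesis by blast
  qed
  have cm: "conv H (kernel s) \<in> borel_measurable borel" for s
  proof -
    have "(\<lambda>x. \<integral>y. H y * kernel s (x - y) \<partial>lborel) \<in> borel_measurable lborel"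
      by (intro sigma_finite_measure.borel_measurable_lebesgue_integral sigma_finite_lborel) (use H(1) km in measurable)
    then show ?thesis by (simp add: conv_def[abs_def])
  qed
  have i1: "integrable lborel (\<lambda>x. K x * conv H (kernel s) x)" if s: "s > 0" for s
  proof -
    obtain B where "\<And>x. \<bar>conv H (kernel s) x\<bar> \<le> B" using cb[OF s] by blast
    then show ?thesis by (intro integrable_mult_bounded[OF K(3), where B=B]) (use cm in auto)
  qed
  then show "integrable lborel (\<lambda>x. K x * conv H (kernel (r k)) x)" using r(1) by simp
  show i2: "integrable lborel (\<lambda>x. K x * H x)"
  proof (rule Bochner_Integration.integrable_bound[OF Bochner_Integration.integrable_add[OF K(2) H(2)]])
    show "AE x in lborel. norm (K x * H x) \<le> norm (\<bar>K x\<bar> powr q + \<bar>H x\<bar> powr p)"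
      using Young_scaled[OF p q, of 1] by (auto simp: abs_mult)
  qed (use H(1) K(1) in auto)
  show "(\<lambda>k. \<integral>x. K x * conv H (kernel (r k)) x \<partial>lborel) \<longlonglongrightarrow> (\<integral>x. K x * H x \<partial>lborel)"
  proof (rule LIMSEQ_I)
    fix e :: real assume e: "0 < e"
    obtain d where d: "d > 0" "\<And>z. norm z < d \<Longrightarrow> (\<integral>\<^sup>+x. \<bar>K x * (H (x - z) - H x)\<bar> \<partial>lborel) \<le> ennreal (e / 2)"
      using translation_continuity[OF p q H K, of "e / 2"] e by auto
    obtain N where N: "\<And>k. k \<ge> N \<Longrightarrow> norm (r k - 0) < d" using LIMSEQ_D[OF r(2) d(1)] by blast
    show "\<exists>no. \<forall>n\<ge>no. norm ((\<integral>x. K x * conv H (kernel (r n)) x \<partial>lborel) - (\<integral>x. K x * H x \<partial>lborel)) < e"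
    proof (intro exI[of _ N] allI impI)
      fix n assume n: "n \<ge> N"
      define s where "s = r n"
      have s: "0 < s" "s < d" using r(1)[of n] N[OF n] by (auto simp: s_def)
      obtain B where B: "\<And>x::real^'n. \<bar>kernel s x\<bar> \<le> B" using kb[OF s(1)] by blast
      note ki = kernel_integral[OF s(1), where 'n='n]
      have eq: "conv H (kernel s) x - H x = (\<integral>z. kernel s z * (H (x - z) - H x) \<partial>lborel)" for x
      proof -
        have m: "(\<lambda>y. H y * kernel s (x - y)) \<in> borel_measurable borel" using H(1) km by measurable
        have c: "conv H (kernel s) x = (\<integral>z. kernel s z * H (x - z) \<partial>lborel)"
          using lborel_integral_reflect[OF m, of x] by (simp add: conv_def mult.commute)
        have "integrable lborel (\<lambda>y. H y * kernel s (x - y))"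
          by (rule integrable_mult_bounded[OF Hi _ AE_I2[OF B]]) (use km in measurable)
        then have i: "integrable lborel (\<lambda>z. kernel s z * H (x - z))"
          using lborel_integrable_reflect[of "\<lambda>y. H y * kernel s (x - y)" x] by (simp add: mult.commute)
        have "(\<integral>z. kernel s z * (H (x - z) - H x) \<partial>lborel) = (\<integral>z. kernel s z * H (x - z) - kernel s z * H x \<partial>lborel)"
          by (simp add: right_diff_distrib)
        also have "\<dots> = (\<integral>z. kernel s z * H (x - z) \<partial>lborel) - (\<integral>z. kernel s (z::real^'n) * H x \<partial>lborel)"
          using Bochner_Integration.integral_diff[OF i integrable_mult_left[OF ki(1), of "H x"]] by simp
        finally show ?thesis using c ki by simp
      qed
      have "(\<integral>x. K x * conv H (kernel s) x \<partial>lborel) - (\<integral>x. K x * H x \<partial>lborel) = (\<integral>x. K x * conv H (kernel s) x - K x * H x \<partial>lborel)"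
        using i1[OF s(1)] i2 by simp
      then have "ennreal (norm ((\<integral>x. K x * conv H (kernel s) x \<partial>lborel) - (\<integral>x. K x * H x \<partial>lborel)))
          \<le> (\<integral>\<^sup>+x. ennreal (norm (K x * conv H (kernel s) x - K x * H x)) \<partial>lborel)"
        using integral_norm_bound_ennreal[OF Bochner_Integration.integrable_diff[OF i1[OF s(1)] i2]] by simp
      also have "\<dots> \<le> (\<integral>\<^sup>+x. \<integral>\<^sup>+z. ennreal (kernel s z * \<bar>K x * (H (x - z) - H x)\<bar>) \<partial>lborel \<partial>lborel)"
      proof (rule nn_integral_mono)
        fix x
        have "norm (K x * conv H (kernel s) x - K x * H x) = norm (\<integral>z. K x * (kernel s z * (H (x - z) - H x)) \<partial>lborel)"
          using eq[of x] by (simp add: right_diff_distrib[symmetric])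
        also have "ennreal \<dots> \<le> (\<integral>\<^sup>+z. norm (K x * (kernel s z * (H (x - z) - H x))) \<partial>lborel)"
        proof (cases "integrable lborel (\<lambda>z. K x * (kernel s z * (H (x - z) - H x)))")
          case True then show ?thesis by (rule integral_norm_bound_ennreal)
        next
          (* A non-integrable function has integral zero by convention, so the bound holds trivially. *)
          case False
          from not_integrable_integral_eq[OF this] show ?thesis by (simp only: norm_zero ennreal_0 zero_le)
        qed
        also have "\<dots> = (\<integral>\<^sup>+z. ennreal (kernel s z * \<bar>K x * (H (x - z) - H x)\<bar>) \<partial>lborel)"
          by (intro nn_integral_cong) (simp add: abs_mult kernel_nonneg ac_simps)
        finally show "ennreal (norm (K x * conv H (kernel s) x - K x * H x)) \<le> (\<integral>\<^sup>+z. ennreal (kernel s z * \<bar>K x * (H (x - z) - H x)\<bar>) \<partial>lborel)" .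
      qed
      also have "\<dots> = (\<integral>\<^sup>+z. \<integral>\<^sup>+x. ennreal (kernel s z * \<bar>K x * (H (x - z) - H x)\<bar>) \<partial>lborel \<partial>lborel)"
        by (rule lborel_pair.Fubini') (use H(1) K(1) km in measurable)
      also have "\<dots> \<le> (\<integral>\<^sup>+z. ennreal (kernel s (z::real^'n)) * ennreal (e / 2) \<partial>lborel)"
      proof (rule nn_integral_mono)
        fix z :: "real^'n"
        have "(\<integral>\<^sup>+x. ennreal (kernel s z * \<bar>K x * (H (x - z) - H x)\<bar>) \<partial>lborel)
          = ennreal (kernel s z) * (\<integral>\<^sup>+x. ennreal \<bar>K x * (H (x - z) - H x)\<bar> \<partial>lborel)"
          using H(1) K(1) by (simp add: ennreal_mult kernel_nonneg nn_integral_cmult)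
        also have "\<dots> \<le> ennreal (kernel s z) * ennreal (e / 2)"
        proof (cases "norm z < d")
          case True then show ?thesis using d(2) by (intro mult_left_mono) auto
        next
          case False then show ?thesis using kernel_support[of s z] s by simp
        qed
        finally show "(\<integral>\<^sup>+x. ennreal (kernel s z * \<bar>K x * (H (x - z) - H x)\<bar>) \<partial>lborel) \<le> ennreal (kernel s z) * ennreal (e / 2)" .
      qed
      also have "\<dots> = ennreal (e / 2)"
      proof -
        have "(\<integral>\<^sup>+z. ennreal (kernel s (z::real^'n)) \<partial>lborel) = 1"
          using nn_integral_eq_integral[OF ki(1)] ki(2) by (simp add: kernel_nonneg)
        moreover have "(\<integral>\<^sup>+z. ennreal (kernel s (z::real^'n)) * ennreal (e / 2) \<partial>lborel)
            = (\<integral>\<^sup>+z. ennreal (kernel s (z::real^'n)) \<partial>lborel) * ennreal (e / 2)"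
          by (rule nn_integral_multc) (use km in measurable)
        ultimately show ?thesis by simp
      qed
      finally have "norm ((\<integral>x. K x * conv H (kernel s) x \<partial>lborel) - (\<integral>x. K x * H x \<partial>lborel)) \<le> e / 2"
        using e by (simp add: ennreal_le_iff)
      then show "norm ((\<integral>x. K x * conv H (kernel (r n)) x \<partial>lborel) - (\<integral>x. K x * H x \<partial>lborel)) < e"
        using e by (simp add: s_def)
    qed
  qed
qed

section \<open>Weak second derivatives and the cut-off identity\<close>

text \<open>A mollified continuous cut-off function. It equals one on a whole neighbourhood of \<open>S\<close>, so that a
  product with it agrees with the other factor including derivatives.\<close>
lemma smooth_cutoff:
  fixes S U :: "(real^'n::finite) set"
  assumes "compact S" "open U" "S \<subseteq> U"
  obtains f g h T V where "C2_with f g h" "compact T" "T \<subseteq> U" "\<And>x. x \<notin> T \<Longrightarrow> f x = 0" "open V" "S \<subseteq> V" "\<And>x. x \<in> V \<Longrightarrow> f x = 1"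
proof -
  obtain r0 where r0: "r0 > 0" "\<And>r. r < r0 \<Longrightarrow> (\<Union>x\<in>S. cball x r) \<subseteq> U"
    using compact_inside_radius[OF assms] by metis
  define r where "r = r0 / 2"
  have r: "r > 0" "(\<Union>x\<in>S. cball x r) \<subseteq> U" using r0 by (auto simp: r_def)
  let ?S1 = "{x + y |x y. x \<in> S \<and> y \<in> cball 0 r}"
  have S1: "compact ?S1" by (rule compact_sums[OF assms(1) compact_cball])
  have S1U: "?S1 \<subseteq> U"
  proof
    fix z assume "z \<in> ?S1"
    then obtain x y where "z = x + y" "x \<in> S" "norm y \<le> r" by auto
    then show "z \<in> U" by (auto intro!: subsetD[OF r(2)] bexI[of _ x] simp: dist_norm)
  qed
  obtain \<eta> :: "real^'n \<Rightarrow> real" and T0 where eta: "continuous_on UNIV \<eta>" "compact T0" "T0 \<subseteq> U" "\<And>x. x \<notin> T0 \<Longrightarrow> \<eta> x = 0"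
    "\<And>x. 0 \<le> \<eta> x \<and> \<eta> x \<le> 1" "\<And>x. x \<in> ?S1 \<Longrightarrow> \<eta> x = 1"
    by (rule cutoff_continuous[OF S1 assms(2) S1U], rule that)
  obtain r1 where r1: "r1 > 0" "\<And>r. r < r1 \<Longrightarrow> (\<Union>x\<in>T0. cball x r) \<subseteq> U"
    using compact_inside_radius[OF eta(2) assms(2) eta(3)] by metis
  define s where "s = min r r1 / 2"
  have s: "0 < s" "s \<le> r / 2" "s < r1" using r(1) r1(1) by (auto simp: s_def)
  define f where "f = conv \<eta> (kernel s)"
  have tf: "test_fun U f" unfolding f_def
    by (rule test_fun_conv_kernel[OF eta(1,2,4) s(1) r1(2)[OF s(3)]])
  show thesis
  proof (rule that[of f "gradient f" "hessian f" "closure {x. f x \<noteq> 0}" "\<Union>x\<in>S. ball x (r/2)"])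
    show "C2_with f (gradient f) (hessian f)" using tf by (intro Ck_on_2_C2_with) (simp add: test_fun_def)
    show "compact (closure {x. f x \<noteq> 0})" "closure {x. f x \<noteq> 0} \<subseteq> U" using tf by (auto simp: test_fun_def)
    show "f x = 0" if "x \<notin> closure {x. f x \<noteq> 0}" for x using that closure_subset[of "{x. f x \<noteq> 0}"] by blast
    show "S \<subseteq> (\<Union>x\<in>S. ball x (r/2))" using r(1) by auto
    show "f x = 1" if xV: "x \<in> (\<Union>x\<in>S. ball x (r/2))" for x
    proof -
      obtain y where y: "y \<in> S" "dist y x < r / 2" using xV unfolding UN_iff mem_ball by blast
      have "\<bar>f x - 1\<bar> \<le> 0" unfolding f_def
      proof (rule conv_kernel_diff_bound[OF eta(1) s(1)])
        fix z :: "real^'n" assume "norm z < s"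
        then have "dist y (x - z) \<le> r" using y(2) s(2) dist_triangle[of y "x - z" x] by (simp add: dist_norm)
        then have "x - z = y + (x - z - y) \<and> y \<in> S \<and> x - z - y \<in> cball 0 r"
          using y(1) by (simp add: dist_norm norm_minus_commute)
        then have "x - z \<in> ?S1" by blast
        then show "\<bar>\<eta> (x - z) - 1\<bar> \<le> 0" using eta(6) by simp
      qed
      then show ?thesis by simp
    qed
  qed auto
qed

text \<open>Convolutions and Fubini's theorem live on the Borel measure \<open>lborel\<close>, while the functions at hand are only
  Lebesgue measurable and matter only on \<open>D\<close>.\<close>
lemma borel_version:
  fixes f :: "'a::euclidean_space \<Rightarrow> real"
  assumes D: "open D" and f: "f \<in> borel_measurable (lebesgue_on D)"
  obtains f' where "f' \<in> borel_measurable borel" "\<And>x. x \<notin> D \<Longrightarrow> f' x = 0" "AE x in lebesgue_on D. f' x = f x"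
proof -
  have "(\<lambda>x. indicator D x *\<^sub>R f x) \<in> borel_measurable lebesgue"
    using f D by (subst (asm) borel_measurable_restrict_space_iff) auto
  then obtain g where g: "g \<in> borel_measurable lborel" "AE x in lborel. indicator D x *\<^sub>R f x = g x"
    using completion_ex_borel_measurable_real by blast
  show thesis
  proof (rule that[of "\<lambda>x. indicator D x * g x"])
    show "(\<lambda>x. indicator D x * g x) \<in> borel_measurable borel" using g(1) D by simp
    have "AE x in lebesgue. indicator D x *\<^sub>R f x = g x" using g(2) by (rule AE_completion)
    then show "AE x in lebesgue_on D. indicator D x * g x = f x"
      using D by (subst AE_restrict_space_iff) (auto elim!: eventually_mono)
  qed auto
qed

lemma integral_borel_version:
  fixes f :: "'a::euclidean_space \<Rightarrow> real"
  assumes D: "open D" and f: "f \<in> borel_measurable (lebesgue_on D)"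
    and f': "f' \<in> borel_measurable borel" "\<And>x. x \<notin> D \<Longrightarrow> f' x = 0" "AE x in lebesgue_on D. f' x = f x"
  shows "integral\<^sup>L (lebesgue_on D) f = integral\<^sup>L lborel f'" "integrable (lebesgue_on D) f \<longleftrightarrow> integrable lborel f'"
proof -
  have m: "f' \<in> borel_measurable lebesgue" using f'(1) by (simp add: measurable_completion)
  then have m2: "f' \<in> borel_measurable (lebesgue_on D)" by (rule measurable_restrict_space1)
  have z: "(\<lambda>x. indicator D x * f' x) = f'" using f'(2) by (auto simp: fun_eq_iff split: split_indicator)
  have "integral\<^sup>L (lebesgue_on D) f = integral\<^sup>L (lebesgue_on D) f'"
    by (rule integral_cong_AE[OF f m2]) (use f'(3) in \<open>auto elim: eventually_mono\<close>)
  also have "\<dots> = integral\<^sup>L lebesgue f'" using D by (subst integral_restrict_space) (auto simp: z)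
  finally show "integral\<^sup>L (lebesgue_on D) f = integral\<^sup>L lborel f'" using f'(1) by (simp add: integral_completion)
  have "integrable (lebesgue_on D) f \<longleftrightarrow> integrable (lebesgue_on D) f'"
    by (rule integrable_cong_AE[OF f m2]) (use f'(3) in \<open>auto elim: eventually_mono\<close>)
  also have "\<dots> \<longleftrightarrow> integrable lebesgue f'" using D by (subst integrable_restrict_space) (auto simp: z)
  finally show "integrable (lebesgue_on D) f \<longleftrightarrow> integrable lborel f'" using f'(1) by (simp add: integrable_completion)
qed

text \<open>For fixed \<open>x\<close> the kernel centred at \<open>x\<close> is itself a test function. This is what converts a weak
  derivative of \<open>u\<close> into a derivative of the mollification of \<open>u\<close> at \<open>x\<close>. The sign comes from the
  reflection \<open>y \<mapsto> x - y\<close>.\<close>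
lemma test_fun_reflected_kernel:
  fixes x :: "real^'n::finite"
  assumes r: "0 < r" and x: "cball x r \<subseteq> D"
  shows "test_fun D (\<lambda>y. kernel r (x - y))"
    and "iter_partial ks (\<lambda>y. kernel r (x - y)) = (\<lambda>y. (-1) ^ length ks * iter_partial ks (kernel r) (x - y))"
proof -
  let ?S = "{\<lambda>y. c * F (x - y) |c F. F \<in> bump_algebra (r\<^sup>2)}"
  have step: "\<exists>g. (\<forall>i. g i \<in> bump_algebra (r\<^sup>2)) \<and> (\<forall>i. partial_deriv i F = g i) \<and> 
      (\<forall>c y. ((\<lambda>y. c * F (x - y)) has_derivative (\<lambda>h. (\<chi> i. - c * g i (x - y)) \<bullet> h)) (at y))"
    if F: "F \<in> bump_algebra (r\<^sup>2)" for F :: "real^'n \<Rightarrow> real"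
  proof -
    obtain g where g: "\<forall>i. g i \<in> bump_algebra (r\<^sup>2)" "\<And>x. (F has_derivative (\<lambda>h. (\<chi> i. g i x) \<bullet> h)) (at x)"
      using bump_algebra_deriv[OF F] by blast
    have 1: "partial_deriv i F = g i" for i using frechet_gradient[OF g(2)] by (auto simp: fun_eq_iff)
    have "((\<lambda>y. c * F (x - y)) has_derivative (\<lambda>h. (\<chi> i. - c * g i (x - y)) \<bullet> h)) (at y)" for c y
    proof -
      have "((\<lambda>y. x - y) has_derivative (\<lambda>h. - h)) (at y)" by (auto intro!: derivative_eq_intros)
      from has_derivative_mult_right[OF has_derivative_compose[OF this g(2)], of c]
      show ?thesis by (rule has_derivative_eq_rhs) (simp add: fun_eq_iff inner_vec_def sum_distrib_left sum_negf mult.assoc)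
    qed
    then show ?thesis using g(1) 1 by blast
  qed
  have Ck: "Ck_on k UNIV (\<lambda>y. kernel r (x - y))" for k
  proof (rule iter_partial_closed(2)[where S="?S"])
    fix f assume "f \<in> ?S"
    then obtain c F where f: "f = (\<lambda>y. c * F (x - y))" and F: "F \<in> bump_algebra (r\<^sup>2)" by blast
    obtain g where g: "\<forall>i. g i \<in> bump_algebra (r\<^sup>2)" 
      "\<And>c y. ((\<lambda>y. c * F (x - y)) has_derivative (\<lambda>h. (\<chi> i. - c * g i (x - y)) \<bullet> h)) (at y)"
      using step[OF F] by blast
    show "\<exists>g. (\<forall>i. g i \<in> ?S) \<and> (\<forall>x. (f has_derivative (\<lambda>h. (\<chi> i. g i x) \<bullet> h)) (at x))"
    proof (intro exI[of _ "\<lambda>i y. - c * g i (x - y)"] conjI allI)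
      fix i show "(\<lambda>y. - c * g i (x - y)) \<in> ?S" using g(1) by blast
    qed (unfold f, rule g(2))
  next
    have "(\<lambda>y. kernel r (x - y)) = (\<lambda>y. 1 * kernel r (x - y))" by simp
    then show "(\<lambda>y. kernel r (x - y)) \<in> ?S" using kernel_in_algebra by blast
  qed
  have "{y. kernel r (x - y) \<noteq> 0} \<subseteq> cball x r"
    using kernel_support[of r] r by (force simp: dist_norm)
  then have cl: "closure {y. kernel r (x - y) \<noteq> 0} \<subseteq> cball x r" by (rule closure_minimal) simp
  then have "compact (closure {y. kernel r (x - y) \<noteq> 0})"
    using bounded_subset[OF bounded_cball cl] by (simp add: compact_eq_bounded_closed)
  then show "test_fun D (\<lambda>y. kernel r (x - y))" using Ck cl x by (auto simp: test_fun_def)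
  have "iter_partial ks (kernel r) \<in> bump_algebra (r\<^sup>2) \<and>
     iter_partial ks (\<lambda>y. kernel r (x - y)) = (\<lambda>y. (-1) ^ length ks * iter_partial ks (kernel r) (x - y))" for ks
  proof (induction ks)
    case Nil show ?case using kernel_in_algebra by simp
  next
    case (Cons i ks)
    then obtain g where g: "\<forall>i. g i \<in> bump_algebra (r\<^sup>2)" "\<forall>i. partial_deriv i (iter_partial ks (kernel r)) = g i"
      "\<And>c y. ((\<lambda>y. c * iter_partial ks (kernel r) (x - y)) has_derivative (\<lambda>h. (\<chi> i. - c * g i (x - y)) \<bullet> h)) (at y)"
      using step[of "iter_partial ks (kernel r)"] by blast
    have "partial_deriv i (\<lambda>y. (-1) ^ length ks * iter_partial ks (kernel r) (x - y)) y = - ((-1) ^ length ks) * g i (x - y)" for y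
      using frechet_gradient[OF g(3)] by simp
    then have "partial_deriv i (\<lambda>y. (-1) ^ length ks * iter_partial ks (kernel r) (x - y)) = (\<lambda>y. - ((-1) ^ length ks) * g i (x - y))"
      by (rule ext)
    then show ?case using Cons g by simp
  qed
  then show "iter_partial ks (\<lambda>y. kernel r (x - y)) = (\<lambda>y. (-1) ^ length ks * iter_partial ks (kernel r) (x - y))" by blast
qed

text \<open>Extension by zero across the boundary of \<open>D\<close> is harmless since \<open>f\<close> vanishes outside a compact
  subset of \<open>D\<close>.\<close>
lemma C1_product_extended:
  fixes u :: "real^'n::finite \<Rightarrow> real"
  assumes D: "open D" and u: "C1_closure D u Du" and f: "C2_with f g h" and T: "compact T" "T \<subseteq> D" "\<And>x. x \<notin> T \<Longrightarrow> f x = 0"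
  defines "v \<equiv> \<lambda>x. if x \<in> D then f x * u x else 0"
    and "w \<equiv> \<lambda>x. if x \<in> D then f x *\<^sub>R Du x + u x *\<^sub>R g x else 0"
  shows "\<And>x. (v has_derivative (\<lambda>h. w x \<bullet> h)) (at x)" "continuous_on UNIV v" "continuous_on UNIV w"
    "\<And>x. x \<notin> T \<Longrightarrow> v x = 0" "\<And>x. x \<notin> T \<Longrightarrow> w x = 0"
proof -
  have gT: "g x = 0" if "x \<notin> T" for x
    by (rule C2_with_zero_outside(1)[OF f compact_imp_closed[OF T(1)] _ that], erule T(3))
  show v0: "v x = 0" if "x \<notin> T" for x using T(3)[OF that] by (simp add: v_def)
  show w0: "w x = 0" if "x \<notin> T" for x using T(3)[OF that] gT[OF that] by (simp add: w_def)
  have op: "open (- T)" using compact_imp_closed[OF T(1)] by auto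
  show d: "(v has_derivative (\<lambda>h. w x \<bullet> h)) (at x)" for x
  proof (cases "x \<in> D")
    case True
    have "(u has_derivative (\<lambda>h. Du x \<bullet> h)) (at x)" using u True by (auto simp: C1_closure_def)
    from has_derivative_mult[OF C2_with_deriv[OF f, of x UNIV] this]
    have "((\<lambda>x. f x * u x) has_derivative (\<lambda>h. w x \<bullet> h)) (at x)"
      by (rule has_derivative_eq_rhs) (simp add: fun_eq_iff w_def True inner_add_left)
    then show ?thesis by (rule has_derivative_transform_within_open[OF _ D True]) (simp add: v_def)
  next
    case False
    then have x: "x \<in> - T" using T(2) by auto
    have "((\<lambda>x. 0) has_derivative (\<lambda>h. w x \<bullet> h)) (at x)" using w0[of x] x by simp
    then show ?thesis by (rule has_derivative_transform_within_open[OF _ op x]) (use v0 in auto)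
  qed
  show "continuous_on UNIV v" by (rule continuous_on_of_derivative[OF d])
  have "continuous_on D w"
  proof -
    have "continuous_on D (\<lambda>x. f x *\<^sub>R Du x + u x *\<^sub>R g x)"
      using u closure_subset[of D] by (intro continuous_intros C2_with_cont[OF f]) (auto simp: C1_closure_def intro: continuous_on_subset)
    then show ?thesis by (rule continuous_on_eq) (simp add: w_def)
  qed
  moreover have "continuous_on (- T) w"
    by (rule continuous_on_eq[OF continuous_on_const[of _ 0]]) (use w0 in auto)
  ultimately have "continuous_on (D \<union> - T) w" by (rule continuous_on_open_Un[OF D op])
  moreover have "D \<union> - T = UNIV" using T(2) by auto
  ultimately show "continuous_on UNIV w" by simp
qed

lemma Lp_integrable:
  fixes f :: "real^'n::finite \<Rightarrow> real"
  assumes f: "f \<in> Lp q D" and q: "q \<ge> 1" and D: "D \<in> lmeasurable"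
  shows "integrable (lebesgue_on D) f"
proof (rule Bochner_Integration.integrable_bound)
  have "finite_measure (lebesgue_on D)" using D by (rule finite_measure_lebesgue_on)
  then show "integrable (lebesgue_on D) (\<lambda>x. 1 + \<bar>f x\<bar> powr q)"
    using f by (intro Bochner_Integration.integrable_add finite_measure.integrable_const) (auto simp: Lp_def)
  show "f \<in> borel_measurable (lebesgue_on D)" using f by (simp add: Lp_def)
  have "\<bar>t\<bar> \<le> 1 + \<bar>t\<bar> powr q" for t :: real
  proof (cases "\<bar>t\<bar> \<le> 1")
    case False
    then have "\<bar>t\<bar> powr 1 \<le> \<bar>t\<bar> powr q" using q by (intro powr_mono) auto
    then show ?thesis using False by simp
  qed (auto intro: order_trans)
  then show "AE x in lebesgue_on D. norm (f x) \<le> norm (1 + \<bar>f x\<bar> powr q)" by auto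
qed

text \<open>The equation tested with \<open>\<zeta> u\<close>, where \<open>u\<close> has only weak second derivatives. These enter through
  \<open>U k\<close>, the mollifications of an extension \<open>v\<close> of \<open>u\<close>: the equation holds for \<open>\<zeta> * U k\<close> by
  \<open>weak_equation_C2\<close>, and on the support of \<open>\<zeta>\<close> the Hessian of \<open>U k\<close> is the mollification of \<open>H\<close>, to
  which \<open>conv_pairing_tendsto\<close> applies. The functions and their gradients converge boundedly.\<close>
proposition weak_equation_cutoff:
  fixes D :: "(real^'n::finite) set"
  assumes D: "open D" "bounded D" and p: "p > 1" and q: "q = p / (p - 1)"
    and K: "\<And>i j. (\<lambda>x. K x $ i $ j) \<in> Lp q D" and sym: "\<And>x. x \<in> D \<Longrightarrow> transpose (K x) = K x"
    and \<beta>: "\<And>i. integrable (lebesgue_on D) (\<lambda>x. \<beta> x $ i)"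
    and eq: "\<And>u. test_fun D u \<Longrightarrow> integral\<^sup>L (lebesgue_on D) (L_op K \<beta> (hessian u) (gradient u)) = 0"
    and u: "C1_closure D u Du" and H: "weak_hessian D u H" "\<And>i j. (\<lambda>x. H x $ i $ j) \<in> Lp p D"
    and C: "C2_with \<zeta> g h" and S: "compact S" "S \<subseteq> D" "\<And>x. x \<notin> S \<Longrightarrow> \<zeta> x = 0"
  shows "(\<integral>x. \<zeta> x * L_op K \<beta> H Du x + u x * L_op K \<beta> h g x + 2 * ((K x *v g x) \<bullet> Du x) \<partial>lebesgue_on D) = 0"
proof -
  have q1: "q > 1" using p by (simp add: q field_simps)
  have Dm: "D \<in> sets lebesgue" "D \<in> lmeasurable" using D by (auto intro: lmeasurable_open)
  note Ki = Lp_integrable[OF K less_imp_le[OF q1] Dm(2)]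
  note Hi = Lp_integrable[OF H(2) less_imp_le[OF p] Dm(2)]
  have zero: "g x = 0" "h x = 0" if "x \<notin> S" for x
    by (rule C2_with_zero_outside[OF C compact_imp_closed[OF S(1)] _ that], erule S(3))+
  obtain f2 g2 h2 T V where f2: "C2_with f2 g2 h2" and T: "compact T" "T \<subseteq> D" "\<And>x. x \<notin> T \<Longrightarrow> f2 x = 0"
    and V: "open V" "S \<subseteq> V" "\<And>x. x \<in> V \<Longrightarrow> f2 x = 1"
    using smooth_cutoff[OF S(1) D(1) S(2)] by metis
  (* v coincides with u on V \<inter> D, a neighbourhood of the support of \<zeta>, and has compact support. *)
  define v where "v = (\<lambda>x. if x \<in> D then f2 x * u x else 0)"
  define w where "w = (\<lambda>x. if x \<in> D then f2 x *\<^sub>R Du x + u x *\<^sub>R g2 x else 0)"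
  note pe = C1_product_extended[OF D(1) u f2 T(1,2)]
  have vw1: "(v has_derivative (\<lambda>h. w x \<bullet> h)) (at x)" for x
    unfolding v_def w_def by (rule pe(1)) (rule T(3))
  have vw2: "continuous_on UNIV v" unfolding v_def by (rule pe(2)) (rule T(3))
  have vw3: "continuous_on UNIV w" unfolding w_def by (rule pe(3)) (rule T(3))
  note vw = vw1 vw2 vw3
  have vT: "v x = 0" "w x = 0" if "x \<notin> T" for x
    unfolding v_def w_def by (rule pe(4) pe(5), erule T(3), rule that)+
  have vV: "v x = u x" if "x \<in> V" "x \<in> D" for x using that V(3) by (simp add: v_def)
  have g2V: "g2 x = 0" if "x \<in> V" for x
  proof -
    have "(f2 has_derivative (\<lambda>v. g2 x \<bullet> v)) (at x)" by (rule C2_with_deriv[OF f2])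
    moreover have "((\<lambda>x. 1) has_derivative (\<lambda>v. 0)) (at x)" by simp
    then have "(f2 has_derivative (\<lambda>v. 0)) (at x)"
      by (rule has_derivative_transform_within_open[OF _ V(1) that]) (simp add: V(3))
    ultimately have "(\<lambda>v. g2 x \<bullet> v) = (\<lambda>v. 0)" by (rule has_derivative_unique)
    then show ?thesis by (metis inner_eq_zero_iff)
  qed
  have wV: "w x = Du x" if "x \<in> V" "x \<in> D" for x using that V(3) g2V by (simp add: w_def)
  obtain r0 where r0: "r0 > 0" "\<And>r. r < r0 \<Longrightarrow> (\<Union>x\<in>S. cball x r) \<subseteq> D \<inter> V"
    using compact_inside_radius[OF S(1) open_Int[OF D(1) V(1)]] S(2) V(2) by blast
  define r where "r k = r0 / (real k + 2)" for k
  have r: "0 < r k" "r k < r0" for k using r0(1) by (auto simp: r_def field_simps add_pos_nonneg)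
  have rl: "r \<longlonglongrightarrow> 0" unfolding r_def using LIMSEQ_ignore_initial_segment[OF lim_const_over_n[of r0], of 2] by (simp add: add.commute)
  define U where "U k = conv v (kernel (r k))" for k
  have UC: "C2_with (U k) (gradient (U k)) (hessian (U k))" for k
    unfolding U_def by (rule Ck_on_2_C2_with[OF conv_smooth(1)[OF vw(2) T(1) vT(1) kernel_in_algebra]])
  have wc: "continuous_on UNIV (\<lambda>x. w x $ i)" for i using vw(3) by (intro continuous_intros) simp
  have wT: "w x $ i = 0" if "x \<notin> T" for x i using vT(2)[OF that] by simp
  have gU: "gradient (U k) x $ i = conv (\<lambda>x. w x $ i) (kernel (r k)) x" for k x i
  proof -
    have d: "(v has_derivative (\<lambda>h. (\<chi> i. w x $ i) \<bullet> h)) (at x)" for x using vw(1) by simp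
    note kk = kernel_continuous compact_cball[of 0 "r k"] kernel_compact[OF less_imp_le[OF r(1)]]
    show ?thesis unfolding U_def gradient_def
      using frechet_gradient[OF conv_deriv[OF kk d wc], where i=i]
      by (simp add: conv_commute[OF vw(2) kernel_continuous] conv_commute[OF wc kernel_continuous])
  qed
  have Hm: "(\<lambda>x. H x $ i $ j) \<in> borel_measurable (lebesgue_on D)" for i j using H(2) by (simp add: Lp_def)
  let ?P = "\<lambda>i j f. f \<in> borel_measurable borel \<and> (\<forall>x. x \<notin> D \<longrightarrow> f x = 0) \<and> (AE x in lebesgue_on D. f x = H x $ i $ j)"
  define H' where "H' i j = (SOME f. ?P i j f)" for i j
  have "\<exists>f. ?P i j f" for i j by (rule borel_version[OF D(1) Hm[of i j]]) blast
  then have "?P i j (H' i j)" for i j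
    unfolding H'_def by (rule someI_ex[of "?P i j"])
  then have H': "\<And>i j. H' i j \<in> borel_measurable borel" "\<And>i j x. x \<notin> D \<Longrightarrow> H' i j x = 0"
    "\<And>i j. AE x in lebesgue_on D. H' i j x = H x $ i $ j" by auto
  (* Both derivatives are moved onto the kernel, which is a test function on D for x in S, and
     back onto u by the definition of the weak derivative; H' is a Borel version of H. *)
  have hU: "hessian (U k) x $ i $ j = conv (H' i j) (kernel (r k)) x" if x: "x \<in> S" for k x i j
  proof -
    have cb: "cball x (r k) \<subseteq> D" "cball x (r k) \<subseteq> V" using r0(2)[OF r(2)] x by blast+
    let ?f = "\<lambda>y. kernel (r k) (x - y)"
    have tf: "test_fun D ?f" by (rule test_fun_reflected_kernel(1)[OF r(1) cb(1)])
    have ip: "iter_partial [i, j] ?f = (\<lambda>y. iter_partial [i, j] (kernel (r k)) (x - y))"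
      using test_fun_reflected_kernel(2)[OF r(1) cb(1), of "[i,j]"] by simp
    have fc: "continuous_on UNIV (iter_partial ks ?f)" for ks
    proof -
      have "Ck_on (length ks) UNIV ?f" using tf by (simp add: test_fun_def)
      then show ?thesis unfolding Ck_on_def by blast
    qed
    have out: "iter_partial [i,j] ?f y = 0" if "y \<notin> cball x (r k)" for y
    proof -
      have op: "open (- cball x (r k))" by auto
      have z: "?f y = 0" if "y \<notin> cball x (r k)" for y
        using kernel_support[of "r k" "x - y"] r(1)[of k] that by (simp add: dist_norm)
      note C' = Ck_on_2_C2_with[of ?f]
      have "hessian ?f y = 0"
        by (rule C2_with_zero_outside(2)[OF C' closed_cball _ that]) (use tf z in \<open>auto simp: test_fun_def\<close>)
      then have "hessian ?f y $ i $ j = 0" by simp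
      then show ?thesis by (simp add: hessian_def)
    qed
    have "hessian (U k) x $ i $ j = conv v (iter_partial [i, j] (kernel (r k))) x"
    proof -
      have "iter_partial [i, j] (conv v (kernel (r k))) = conv v (iter_partial [i, j] (kernel (r k)))"
        by (rule conv_smooth(3)[OF vw(2) T(1) _ kernel_in_algebra], rule vT(1))
      then show ?thesis unfolding hessian_def U_def by (simp only: vec_lambda_beta)
    qed
    also have "\<dots> = (\<integral>y. v y * iter_partial [i, j] ?f y \<partial>lborel)" unfolding conv_def ip ..
    also have "\<dots> = (\<integral>y. u y * iter_partial [i, j] ?f y \<partial>lebesgue_on D)"
    proof (rule integral_borel_version(1)[OF D(1), symmetric])
      have "continuous_on D u" using u closure_subset[of D] by (auto simp: C1_closure_def intro: continuous_on_subset)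
      then have "u \<in> borel_measurable (lebesgue_on D)" by (rule continuous_imp_measurable_on_sets_lebesgue[OF _ Dm(1)])
      then show "(\<lambda>y. u y * iter_partial [i, j] ?f y) \<in> borel_measurable (lebesgue_on D)"
        using continuous_imp_measurable_lebesgue_on[OF fc Dm(1), of "[i,j]"] by (rule borel_measurable_times)
      have "continuous_on UNIV (\<lambda>y. v y * iter_partial [i, j] ?f y)" by (intro continuous_on_mult vw(2) fc)
      then show "(\<lambda>y. v y * iter_partial [i, j] ?f y) \<in> borel_measurable borel" by (rule borel_measurable_continuous_onI)
      show "v y * iter_partial [i, j] ?f y = 0" if "y \<notin> D" for y using that by (simp add: v_def)
      have "v y * iter_partial [i, j] ?f y = u y * iter_partial [i, j] ?f y" if "y \<in> D" for y
        using vV[of y] out[of y] cb(2) that by (cases "y \<in> cball x (r k)") auto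
      then show "AE y in lebesgue_on D. v y * iter_partial [i, j] ?f y = u y * iter_partial [i, j] ?f y"
        by (intro AE_I2) auto
    qed
    also have "\<dots> = (\<integral>y. H y $ i $ j * ?f y \<partial>lebesgue_on D)"
      using H(1) tf unfolding weak_hessian_def weak_deriv_def by (auto simp: power2_eq_square)
    also have "\<dots> = (\<integral>y. H' i j y * ?f y \<partial>lborel)"
    proof (rule integral_borel_version(1)[OF D(1)])
      have f0: "continuous_on UNIV ?f" using fc[of "[]"] by simp
      show "(\<lambda>y. H y $ i $ j * ?f y) \<in> borel_measurable (lebesgue_on D)"
        using Hm continuous_imp_measurable_lebesgue_on[OF f0 Dm(1)] by (rule borel_measurable_times)
      show "(\<lambda>y. H' i j y * ?f y) \<in> borel_measurable borel"
        using H'(1) borel_measurable_continuous_onI[OF f0] by (rule borel_measurable_times)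
      show "AE y in lebesgue_on D. H' i j y * ?f y = H y $ i $ j * ?f y" using H'(3)[of i j] by eventually_elim simp
    qed (simp add: H'(2))
    finally show ?thesis by (simp add: conv_def)
  qed
  let ?M = "lebesgue_on D"
  have bnd: "\<exists>B. \<forall>x. \<bar>F x\<bar> \<le> B" if "continuous_on UNIV F" "\<And>x. x \<notin> S \<Longrightarrow> F x = 0" for F :: "real^'n \<Rightarrow> real"
    using continuous_compact_support_bounded[OF that(1) S(1) that(2)] by metis
  have im: "integrable ?M (\<lambda>x. F x * G x)" if F: "integrable ?M F" and G: "continuous_on UNIV G" "\<And>x. x \<notin> S \<Longrightarrow> G x = 0" for F G :: "real^'n \<Rightarrow> real"
  proof -
    obtain B where "\<And>x. \<bar>G x\<bar> \<le> B" using bnd[OF G] by blast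
    then show ?thesis by (intro integrable_mult_bounded[OF F, where B=B] continuous_imp_measurable_lebesgue_on G(1) Dm(1)) auto
  qed
  have cg: "continuous_on UNIV (\<lambda>x. g x $ i)" and ch: "continuous_on UNIV (\<lambda>x. h x $ i $ j)" and cx: "continuous_on UNIV \<zeta>" for i j
    using C2_with_cont[OF C, of UNIV] by (auto intro!: continuous_intros)
  have zg: "g x $ i = 0" and zh: "h x $ i $ j = 0" if "x \<notin> S" for x i j using zero[OF that] by auto
  define F0 where "F0 = L_op K \<beta> h g"
  have F0: "integrable ?M F0" unfolding F0_def L_op_expand'
    by (intro Bochner_Integration.integrable_add Bochner_Integration.integrable_sum im Ki \<beta> cg ch) (auto simp: zg zh)
  have F1: "integrable ?M (\<lambda>x. K x $ i $ j * g x $ j)" for i j by (intro im Ki cg) (auto simp: zg)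
  have F2: "integrable ?M (\<lambda>x. \<beta> x $ i * \<zeta> x)" for i by (intro im \<beta> cx) (auto simp: S(3))
  have F3: "integrable ?M (\<lambda>x. K x $ i $ j * \<zeta> x)" for i j by (intro im Ki cx) (auto simp: S(3))
  have cv: "(\<lambda>k. \<integral>x. F x * conv z (kernel (r k)) x \<partial>?M) \<longlonglongrightarrow> (\<integral>x. F x * z x \<partial>?M)"
    and cvi: "\<And>k. integrable ?M (\<lambda>x. F x * conv z (kernel (r k)) x)" "integrable ?M (\<lambda>x. F x * z x)"
    if F: "integrable ?M F" and z: "continuous_on UNIV z" "\<And>x. x \<notin> T \<Longrightarrow> z x = 0" for F :: "real^'n \<Rightarrow> real" and z
  proof -
    obtain B where B: "B > 0" "\<And>x. \<bar>z x\<bar> \<le> B" using continuous_compact_support_bounded[OF z(1) T(1) z(2)] by metis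
    have cm: "continuous_on UNIV (conv z (kernel (r k)))" for k
      by (rule has_derivative_continuous_on) (rule has_derivative_at_withinI[OF conv_smooth(2)[OF z(1) T(1) z(2) kernel_in_algebra]])
    have bd: "\<bar>conv z (kernel (r k)) x\<bar> \<le> B" for k x by (rule conv_kernel_bound[OF z(1) r(1) B(2)])
    show "(\<lambda>k. \<integral>x. F x * conv z (kernel (r k)) x \<partial>?M) \<longlonglongrightarrow> (\<integral>x. F x * z x \<partial>?M)"
      by (rule integral_mult_tendsto[OF F _ _ bd conv_kernel_tendsto[OF z(1) r(1) rl]])
        (auto intro!: continuous_imp_measurable_lebesgue_on cm z Dm)
    show "integrable ?M (\<lambda>x. F x * conv z (kernel (r k)) x)" for k
      by (rule integrable_mult_bounded[OF F, where B=B]) (auto intro!: continuous_imp_measurable_lebesgue_on cm Dm bd)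
    show "integrable ?M (\<lambda>x. F x * z x)"
      by (rule integrable_mult_bounded[OF F, where B=B]) (auto intro!: continuous_imp_measurable_lebesgue_on z Dm B)
  qed
  obtain Bx where Bx: "\<And>x. \<bar>\<zeta> x\<bar> \<le> Bx" using bnd[OF cx S(3)] by blast
  have pair: "(\<lambda>k. \<integral>x. (K x $ i $ j * \<zeta> x) * hessian (U k) x $ j $ i \<partial>?M) \<longlonglongrightarrow> (\<integral>x. (K x $ i $ j * \<zeta> x) * H x $ j $ i \<partial>?M)"
    and pi: "\<And>k. integrable ?M (\<lambda>x. (K x $ i $ j * \<zeta> x) * hessian (U k) x $ j $ i)" "integrable ?M (\<lambda>x. (K x $ i $ j * \<zeta> x) * H x $ j $ i)" for i j
  proof -
    have Km: "(\<lambda>x. K x $ i $ j * \<zeta> x) \<in> borel_measurable ?M" using F3 by (rule borel_measurable_integrable)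
    obtain K1 where K1: "K1 \<in> borel_measurable borel" "\<And>x. x \<notin> D \<Longrightarrow> K1 x = 0" "AE x in ?M. K1 x = K x $ i $ j * \<zeta> x"
      by (rule borel_version[OF D(1) Km], rule that)
    define K' where "K' x = indicator S x * K1 x" for x
    have Sb: "S \<in> sets borel" using S(1) by (simp add: compact_imp_closed borel_closed)
    have K': "K' \<in> borel_measurable borel" "\<And>x. x \<notin> S \<Longrightarrow> K' x = 0" "\<And>x. x \<notin> D \<Longrightarrow> K' x = 0" "AE x in ?M. K' x = K x $ i $ j * \<zeta> x"
    proof -
      show "K' \<in> borel_measurable borel" unfolding K'_def[abs_def] using K1(1) Sb by simp
      show "AE x in ?M. K' x = K x $ i $ j * \<zeta> x" using K1(3) by eventually_elim (auto simp: K'_def S(3) indicator_def)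
    qed (use S(2) in \<open>auto simp: K'_def indicator_def\<close>)
    have K'i: "integrable lborel K'" using integral_borel_version(2)[OF D(1) Km K'(1,3,4)] F3 by simp
    have "integrable ?M (\<lambda>x. \<bar>K x $ i $ j * \<zeta> x\<bar> powr q)"
    proof (rule Bochner_Integration.integrable_bound)
      show "integrable ?M (\<lambda>x. Bx powr q * \<bar>K x $ i $ j\<bar> powr q)" using K by (simp add: Lp_def)
      show "(\<lambda>x. \<bar>K x $ i $ j * \<zeta> x\<bar> powr q) \<in> borel_measurable ?M" using Km by measurable
      have "\<bar>K x $ i $ j * \<zeta> x\<bar> powr q \<le> Bx powr q * \<bar>K x $ i $ j\<bar> powr q" for x
        using Bx[of x] q1 by (simp add: abs_mult powr_mult mult.commute) (intro mult_right_mono powr_mono2; simp)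
      then show "AE x in ?M. norm (\<bar>K x $ i $ j * \<zeta> x\<bar> powr q) \<le> norm (Bx powr q * \<bar>K x $ i $ j\<bar> powr q)" by auto
    qed
    moreover have "(\<lambda>x. \<bar>K x $ i $ j * \<zeta> x\<bar> powr q) \<in> borel_measurable ?M" using Km by measurable
    ultimately have K'q: "integrable lborel (\<lambda>x. \<bar>K' x\<bar> powr q)"
      by (subst integral_borel_version(2)[OF D(1), symmetric]) (use K' q1 in \<open>auto elim!: eventually_mono\<close>)
    have H'p: "integrable lborel (\<lambda>x. \<bar>H' j i x\<bar> powr p)"
    proof (subst integral_borel_version(2)[OF D(1), symmetric])
      show "(\<lambda>x. \<bar>H x $ j $ i\<bar> powr p) \<in> borel_measurable ?M" using Hm by measurable
      show "(\<lambda>x. \<bar>H' j i x\<bar> powr p) \<in> borel_measurable borel" using H'(1) by measurable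
      show "AE x in ?M. \<bar>H' j i x\<bar> powr p = \<bar>H x $ j $ i\<bar> powr p" by (rule eventually_mono[OF H'(3)[of j i]]) simp
    qed (use p H'(2) H(2) in \<open>auto simp: Lp_def\<close>)
    have H'i: "integrable lborel (H' j i)"
      using integral_borel_version(2)[OF D(1) Hm H'(1,2,3)] Hi by auto
    have clD: "compact (closure D)" "\<And>x. x \<notin> closure D \<Longrightarrow> H' j i x = 0"
      using D(2) H'(2) closure_subset[of D] by auto
    note cp = conv_pairing_tendsto[OF p q H'(1) H'p clD H'i K'(1) K'q K'i r(1) rl]
    have ae1: "AE x in ?M. K' x * conv (H' j i) (kernel (r k)) x = (K x $ i $ j * \<zeta> x) * hessian (U k) x $ j $ i" for k
      using K'(4)
    proof eventually_elim
      case (elim x)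
      then show ?case using K'(2)[of x] hU[of x k j i] by (cases "x \<in> S") (auto simp: S(3))
    qed
    have ae2: "AE x in ?M. K' x * H' j i x = (K x $ i $ j * \<zeta> x) * H x $ j $ i"
      using K'(4) H'(3)[of j i] by eventually_elim simp
    have m1: "(\<lambda>x. (K x $ i $ j * \<zeta> x) * hessian (U k) x $ j $ i) \<in> borel_measurable ?M" for k
    proof (rule borel_measurable_times[OF Km])
      have "continuous_on UNIV (\<lambda>x. hessian (U k) x $ j $ i)" using C2_with_cont(3)[OF UC, of UNIV] by (intro continuous_intros)
      then show "(\<lambda>x. hessian (U k) x $ j $ i) \<in> borel_measurable ?M" by (rule continuous_imp_measurable_lebesgue_on[OF _ Dm(1)])
    qed
    have m2: "(\<lambda>x. (K x $ i $ j * \<zeta> x) * H x $ j $ i) \<in> borel_measurable ?M" by (rule borel_measurable_times[OF Km Hm])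
    have b1: "(\<lambda>x. K' x * conv (H' j i) (kernel (r k)) x) \<in> borel_measurable borel" for k
      using borel_measurable_integrable[OF cp(2)] by simp
    have b2: "(\<lambda>x. K' x * H' j i x) \<in> borel_measurable borel"
      using borel_measurable_integrable[OF cp(3)] by simp
    have z1: "K' x * conv (H' j i) (kernel (r k)) x = 0" and z2: "K' x * H' j i x = 0" if "x \<notin> D" for x k
      using K'(3)[OF that] by auto
    have e1: "(\<integral>x. (K x $ i $ j * \<zeta> x) * hessian (U k) x $ j $ i \<partial>?M) = (\<integral>x. K' x * conv (H' j i) (kernel (r k)) x \<partial>lborel)" for k
      by (rule integral_borel_version(1)[OF D(1) m1 b1 z1 ae1])
    have e2: "(\<integral>x. (K x $ i $ j * \<zeta> x) * H x $ j $ i \<partial>?M) = (\<integral>x. K' x * H' j i x \<partial>lborel)"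
      by (rule integral_borel_version(1)[OF D(1) m2 b2 z2 ae2])
    show "(\<lambda>k. \<integral>x. (K x $ i $ j * \<zeta> x) * hessian (U k) x $ j $ i \<partial>?M) \<longlonglongrightarrow> (\<integral>x. (K x $ i $ j * \<zeta> x) * H x $ j $ i \<partial>?M)"
      unfolding e1 e2 by (rule cp(1))
    show "integrable ?M (\<lambda>x. (K x $ i $ j * \<zeta> x) * hessian (U k) x $ j $ i)" for k
      by (rule integral_borel_version(2)[OF D(1) m1 b1 z1 ae1, THEN iffD2]) (assumption | rule cp(2))+
    show "integrable ?M (\<lambda>x. (K x $ i $ j * \<zeta> x) * H x $ j $ i)"
      by (rule integral_borel_version(2)[OF D(1) m2 b2 z2 ae2, THEN iffD2]) (assumption | rule cp(3))+
  qed
  define I where "I k = (\<Sum>i\<in>UNIV. \<Sum>j\<in>UNIV. \<integral>x. (K x $ i $ j * \<zeta> x) * hessian (U k) x $ j $ i \<partial>?M)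
     + (\<integral>x. F0 x * U k x \<partial>?M) + 2 * (\<Sum>i\<in>UNIV. \<Sum>j\<in>UNIV. \<integral>x. (K x $ i $ j * g x $ j) * gradient (U k) x $ i \<partial>?M)
     + (\<Sum>i\<in>UNIV. \<integral>x. (\<beta> x $ i * \<zeta> x) * gradient (U k) x $ i \<partial>?M)" for k
  define J where "J = (\<Sum>i\<in>UNIV. \<Sum>j\<in>UNIV. \<integral>x. (K x $ i $ j * \<zeta> x) * H x $ j $ i \<partial>?M)
     + (\<integral>x. F0 x * v x \<partial>?M) + 2 * (\<Sum>i\<in>UNIV. \<Sum>j\<in>UNIV. \<integral>x. (K x $ i $ j * g x $ j) * w x $ i \<partial>?M)
     + (\<Sum>i\<in>UNIV. \<integral>x. (\<beta> x $ i * \<zeta> x) * w x $ i \<partial>?M)"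
  have "I \<longlonglongrightarrow> J"
    unfolding I_def J_def gU U_def[symmetric]
  proof (intro tendsto_add tendsto_mult tendsto_sum tendsto_const pair)
    show "(\<lambda>k. \<integral>x. F0 x * U k x \<partial>?M) \<longlonglongrightarrow> (\<integral>x. F0 x * v x \<partial>?M)"
      unfolding U_def by (rule cv[OF F0 vw(2) vT(1)])
    show "(\<lambda>k. \<integral>x. (K x $ i $ j * g x $ j) * conv (\<lambda>x. w x $ i) (kernel (r k)) x \<partial>?M) \<longlonglongrightarrow> (\<integral>x. (K x $ i $ j * g x $ j) * w x $ i \<partial>?M)" for i j
      by (rule cv[OF F1 wc wT])
    show "(\<lambda>k. \<integral>x. (\<beta> x $ i * \<zeta> x) * conv (\<lambda>x. w x $ i) (kernel (r k)) x \<partial>?M) \<longlonglongrightarrow> (\<integral>x. (\<beta> x $ i * \<zeta> x) * w x $ i \<partial>?M)" for i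
      by (rule cv[OF F2 wc wT])
  qed
  (* The product rule in the integrand; symmetry of K merges the two mixed terms. *)
  have point: "L_op K \<beta> (\<lambda>x. \<zeta> x *\<^sub>R P x + z x *\<^sub>R h x + outer (g x) (G x) + outer (G x) (g x)) (\<lambda>x. \<zeta> x *\<^sub>R G x + z x *\<^sub>R g x) x
      = (\<Sum>i\<in>UNIV. \<Sum>j\<in>UNIV. (K x $ i $ j * \<zeta> x) * P x $ j $ i) + F0 x * z x
        + 2 * (\<Sum>i\<in>UNIV. \<Sum>j\<in>UNIV. (K x $ i $ j * g x $ j) * G x $ i) + (\<Sum>i\<in>UNIV. (\<beta> x $ i * \<zeta> x) * G x $ i)"
    if x: "x \<in> D" for x P z and G :: "real^'n \<Rightarrow> real^'n"
  proof -
    have s: "K x $ j $ i = K x $ i $ j" for i j using sym[OF x] by (metis transpose_def vec_lambda_beta)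
    have "(\<Sum>i\<in>UNIV. \<Sum>j\<in>UNIV. K x $ i $ j * (g x $ i * G x $ j)) = (\<Sum>j\<in>UNIV. \<Sum>i\<in>UNIV. K x $ i $ j * (g x $ i * G x $ j))"
      by (rule sum.swap)
    also have "\<dots> = (\<Sum>i\<in>UNIV. \<Sum>j\<in>UNIV. (K x $ i $ j * g x $ j) * G x $ i)"
      by (intro sum.cong refl) (simp add: s)
    finally have sw: "(\<Sum>i\<in>UNIV. \<Sum>j\<in>UNIV. K x $ i $ j * (g x $ i * G x $ j)) = (\<Sum>i\<in>UNIV. \<Sum>j\<in>UNIV. (K x $ i $ j * g x $ j) * G x $ i)" .
    show ?thesis unfolding L_op_expand F0_def
      using sw by (simp add: algebra_simps sum.distrib sum_distrib_left)
  qed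
  have "I k = 0" for k
  proof -
    note C2 = C2_with_mult[OF C UC[of k]]
    have "0 = integral\<^sup>L ?M (L_op K \<beta> (\<lambda>x. \<zeta> x *\<^sub>R hessian (U k) x + U k x *\<^sub>R h x + outer (g x) (gradient (U k) x) + outer (gradient (U k) x) (g x)) (\<lambda>x. \<zeta> x *\<^sub>R gradient (U k) x + U k x *\<^sub>R g x))"
      by (rule weak_equation_C2[OF D(1) Ki \<beta> eq C2 S(1,2), symmetric]) (simp_all add: S(3))
    also have "\<dots> = (\<integral>x. (\<Sum>i\<in>UNIV. \<Sum>j\<in>UNIV. (K x $ i $ j * \<zeta> x) * hessian (U k) x $ j $ i) + F0 x * U k x
        + 2 * (\<Sum>i\<in>UNIV. \<Sum>j\<in>UNIV. (K x $ i $ j * g x $ j) * gradient (U k) x $ i) + (\<Sum>i\<in>UNIV. (\<beta> x $ i * \<zeta> x) * gradient (U k) x $ i) \<partial>?M)"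
      by (rule Bochner_Integration.integral_cong[OF refl]) (simp add: point)
    also have "\<dots> = I k"
      unfolding I_def
    proof -
      have i1: "integrable ?M (\<lambda>x. F0 x * U k x)" unfolding U_def by (rule cvi[OF F0 vw(2) vT(1)])
      have i2: "integrable ?M (\<lambda>x. (K x $ i $ j * g x $ j) * gradient (U k) x $ i)" for i j
        unfolding gU by (rule cvi[OF F1 wc wT])
      have i3: "integrable ?M (\<lambda>x. (\<beta> x $ i * \<zeta> x) * gradient (U k) x $ i)" for i
        unfolding gU by (rule cvi[OF F2 wc wT])
      show "(\<integral>x. (\<Sum>i\<in>UNIV. \<Sum>j\<in>UNIV. (K x $ i $ j * \<zeta> x) * hessian (U k) x $ j $ i) + F0 x * U k x
        + 2 * (\<Sum>i\<in>UNIV. \<Sum>j\<in>UNIV. (K x $ i $ j * g x $ j) * gradient (U k) x $ i) + (\<Sum>i\<in>UNIV. (\<beta> x $ i * \<zeta> x) * gradient (U k) x $ i) \<partial>?M)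
        = (\<Sum>i\<in>UNIV. \<Sum>j\<in>UNIV. \<integral>x. (K x $ i $ j * \<zeta> x) * hessian (U k) x $ j $ i \<partial>?M)
     + (\<integral>x. F0 x * U k x \<partial>?M) + 2 * (\<Sum>i\<in>UNIV. \<Sum>j\<in>UNIV. \<integral>x. (K x $ i $ j * g x $ j) * gradient (U k) x $ i \<partial>?M)
     + (\<Sum>i\<in>UNIV. \<integral>x. (\<beta> x $ i * \<zeta> x) * gradient (U k) x $ i \<partial>?M)"
        using i1 i2 i3 pi(1)[of _ _ k] by simp
    qed
    finally show ?thesis by simp
  qed
  then have "I = (\<lambda>k. 0)" by auto
  with \<open>I \<longlonglongrightarrow> J\<close> have "J = 0" using LIMSEQ_unique[OF tendsto_const, of 0 J] by auto
  have fin: "\<zeta> x * L_op K \<beta> H Du x + u x * L_op K \<beta> h g x + 2 * ((K x *v g x) \<bullet> Du x)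
     = (\<Sum>i\<in>UNIV. \<Sum>j\<in>UNIV. (K x $ i $ j * \<zeta> x) * H x $ j $ i) + F0 x * v x
        + 2 * (\<Sum>i\<in>UNIV. \<Sum>j\<in>UNIV. (K x $ i $ j * g x $ j) * w x $ i) + (\<Sum>i\<in>UNIV. (\<beta> x $ i * \<zeta> x) * w x $ i)" if x: "x \<in> D" for x
  proof (cases "x \<in> S")
    case True
    then have "x \<in> V" using V(2) by auto
    have a: "\<zeta> x * L_op K \<beta> H Du x = (\<Sum>i\<in>UNIV. \<Sum>j\<in>UNIV. (K x $ i $ j * \<zeta> x) * H x $ j $ i) + (\<Sum>i\<in>UNIV. (\<beta> x $ i * \<zeta> x) * Du x $ i)"
      unfolding L_op_expand by (simp add: sum_distrib_left distrib_left ac_simps)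
    have b: "(K x *v g x) \<bullet> Du x = (\<Sum>i\<in>UNIV. \<Sum>j\<in>UNIV. (K x $ i $ j * g x $ j) * Du x $ i)"
      by (simp add: inner_vec_def matrix_vector_mult_def sum_distrib_right)
    show ?thesis unfolding a b using vV[OF \<open>x \<in> V\<close> x] wV[OF \<open>x \<in> V\<close> x] by (simp add: F0_def)
  next
    case False
    then show ?thesis using zero[OF False] S(3)[OF False] by (simp add: L_op_expand F0_def)
  qed
  have "(\<integral>x. \<zeta> x * L_op K \<beta> H Du x + u x * L_op K \<beta> h g x + 2 * ((K x *v g x) \<bullet> Du x) \<partial>?M)
     = (\<integral>x. (\<Sum>i\<in>UNIV. \<Sum>j\<in>UNIV. (K x $ i $ j * \<zeta> x) * H x $ j $ i) + F0 x * v x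
        + 2 * (\<Sum>i\<in>UNIV. \<Sum>j\<in>UNIV. (K x $ i $ j * g x $ j) * w x $ i) + (\<Sum>i\<in>UNIV. (\<beta> x $ i * \<zeta> x) * w x $ i) \<partial>?M)"
    by (rule Bochner_Integration.integral_cong[OF refl]) (simp add: fin)
  also have "\<dots> = J" unfolding J_def
  proof -
    have i1: "integrable ?M (\<lambda>x. F0 x * v x)" by (rule cvi(2)[OF F0 vw(2) vT(1)])
    have i2: "integrable ?M (\<lambda>x. (K x $ i $ j * g x $ j) * w x $ i)" for i j by (rule cvi(2)[OF F1 wc wT])
    have i3: "integrable ?M (\<lambda>x. (\<beta> x $ i * \<zeta> x) * w x $ i)" for i by (rule cvi(2)[OF F2 wc wT])
    show "(\<integral>x. (\<Sum>i\<in>UNIV. \<Sum>j\<in>UNIV. (K x $ i $ j * \<zeta> x) * H x $ j $ i) + F0 x * v x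
        + 2 * (\<Sum>i\<in>UNIV. \<Sum>j\<in>UNIV. (K x $ i $ j * g x $ j) * w x $ i) + (\<Sum>i\<in>UNIV. (\<beta> x $ i * \<zeta> x) * w x $ i) \<partial>?M)
      = (\<Sum>i\<in>UNIV. \<Sum>j\<in>UNIV. \<integral>x. (K x $ i $ j * \<zeta> x) * H x $ j $ i \<partial>?M)
     + (\<integral>x. F0 x * v x \<partial>?M) + 2 * (\<Sum>i\<in>UNIV. \<Sum>j\<in>UNIV. \<integral>x. (K x $ i $ j * g x $ j) * w x $ i \<partial>?M)
     + (\<Sum>i\<in>UNIV. \<integral>x. (\<beta> x $ i * \<zeta> x) * w x $ i \<partial>?M)"
      using i1 i2 i3 pi(2) by simp
  qed
  finally show ?thesis using \<open>J = 0\<close> by simp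
qed

lemma Lp_loc_mult_integrable:
  fixes w :: "real^'n::finite \<Rightarrow> real"
  assumes D: "open D" and w: "w \<in> Lp_loc 1 D" and f: "continuous_on UNIV f" and S: "compact S" "S \<subseteq> D" "\<And>x. x \<notin> S \<Longrightarrow> f x = 0"
  shows "integrable (lebesgue_on D) (\<lambda>x. w x * f x)"
    and "integrable (lebesgue_on D) (\<lambda>x. indicator S x * w x)"
proof -
  have wS: "w \<in> Lp 1 S" using w S(1,2) by (auto simp: Lp_loc_def)
  have Sm: "S \<in> lmeasurable" using S(1) by (rule lmeasurable_compact)
  have "integrable (lebesgue_on S) w" by (rule Lp_integrable[OF wS order_refl Sm])
  then have "integrable lebesgue (\<lambda>x. indicator S x *\<^sub>R w x)"
    using Sm by (subst (asm) integrable_restrict_space) (auto simp: fmeasurableD)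
  moreover have "(\<lambda>x. indicator S x *\<^sub>R w x) = (\<lambda>x. indicator D x *\<^sub>R (indicator S x * w x))"
    using S(2) by (auto simp: fun_eq_iff split: split_indicator)
  ultimately have "integrable lebesgue (\<lambda>x. indicator D x *\<^sub>R (indicator S x * w x))" by simp
  then show i: "integrable (lebesgue_on D) (\<lambda>x. indicator S x * w x)"
    using D by (subst integrable_restrict_space) auto
  obtain B where B: "\<And>x. \<bar>f x\<bar> \<le> B" using continuous_compact_support_bounded[OF f S(1,3)] by metis
  have "integrable (lebesgue_on D) (\<lambda>x. (indicator S x * w x) * f x)"
    by (rule integrable_mult_bounded[OF i continuous_imp_measurable_lebesgue_on[OF f] AE_I2[OF B]]) (use D in simp)
  moreover have "(\<lambda>x. (indicator S x * w x) * f x) = (\<lambda>x. w x * f x)"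
    using S(3) by (auto simp: fun_eq_iff split: split_indicator)
  ultimately show "integrable (lebesgue_on D) (\<lambda>x. w x * f x)" by simp
qed

lemma vanishing_continuous_test:
  fixes w :: "real^'n::finite \<Rightarrow> real"
  assumes D: "open D" and w: "w \<in> Lp_loc 1 D" 
    and test: "\<And>f. test_fun D f \<Longrightarrow> (\<integral>x. w x * f x \<partial>lebesgue_on D) = 0"
    and f: "continuous_on UNIV f" and S: "compact S" "S \<subseteq> D" "\<And>x. x \<notin> S \<Longrightarrow> f x = 0"
  shows "(\<integral>x. w x * f x \<partial>lebesgue_on D) = 0"
proof -
  obtain r0 where r0: "r0 > 0" "\<And>r. r < r0 \<Longrightarrow> (\<Union>x\<in>S. cball x r) \<subseteq> D"
    using compact_inside_radius[OF S(1) D S(2)] by metis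
  define T where "T = {x + y |x y. x \<in> S \<and> y \<in> cball 0 (r0/2)}"
  have T: "compact T" unfolding T_def by (rule compact_sums[OF S(1) compact_cball])
  have TD: "T \<subseteq> D"
  proof
    fix z assume "z \<in> T"
    then obtain x y where "z = x + y" "x \<in> S" "norm y \<le> r0/2" by (auto simp: T_def)
    then show "z \<in> D" using r0(1) by (auto intro!: subsetD[OF r0(2)[of "r0/2"]] bexI[of _ x] simp: dist_norm)
  qed
  define r where "r k = (r0/2) / (real k + 2)" for k
  have r: "0 < r k" "r k < r0" "r k \<le> r0/2" for k using r0(1) by (auto simp: r_def field_simps add_pos_nonneg)
  have rl: "r \<longlonglongrightarrow> 0" unfolding r_def using LIMSEQ_ignore_initial_segment[OF lim_const_over_n[of "r0/2"], of 2] by (simp add: add.commute)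
  let ?f = "\<lambda>k. conv f (kernel (r k))"
  have tD: "test_fun D (?f k)" for k by (rule test_fun_conv_kernel[OF f S(1,3) r(1) r0(2)[OF r(2)]])
  have sub: "(\<Union>x\<in>S. cball x (r k)) \<subseteq> T" for k
  proof safe
    fix x y assume "x \<in> S" "y \<in> cball x (r k)"
    then have "y = x + (y - x) \<and> x \<in> S \<and> y - x \<in> cball 0 (r0/2)"
      using r(3)[of k] by (auto simp: dist_norm norm_minus_commute)
    then show "y \<in> T" unfolding T_def by blast
  qed
  have tT: "test_fun T (?f k)" for k by (rule test_fun_conv_kernel[OF f S(1,3) r(1) sub])
  have fT: "?f k x = 0" if "x \<notin> T" for k x
  proof (rule ccontr)
    assume "?f k x \<noteq> 0"
    then have "x \<in> closure {x. ?f k x \<noteq> 0}" using closure_subset[of "{x. ?f k x \<noteq> 0}"] by blast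
    then have "x \<in> T" using tT[of k] unfolding test_fun_def by blast
    with that show False by (rule notE)
  qed
  have fc: "continuous_on UNIV (?f k)" for k
  proof -
    have "Ck_on 0 UNIV (?f k)" using tD[of k] by (simp add: test_fun_def)
    then show ?thesis by (simp add: Ck_on_def)
  qed
  obtain B where B: "\<And>x. \<bar>f x\<bar> \<le> B" using continuous_compact_support_bounded[OF f S(1,3)] by metis
  have F: "integrable (lebesgue_on D) (\<lambda>x. indicator T x * w x)"
    by (rule Lp_loc_mult_integrable(2)[OF D w continuous_on_const[of UNIV 0] T TD]) simp
  have Dm: "D \<in> sets lebesgue" using D by simp
  have bd: "\<bar>?f k x\<bar> \<le> B" for k x by (rule conv_kernel_bound[OF f r(1) B])
  have "(\<lambda>k. \<integral>x. (indicator T x * w x) * ?f k x \<partial>lebesgue_on D) \<longlonglongrightarrow> (\<integral>x. (indicator T x * w x) * f x \<partial>lebesgue_on D)"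
    by (rule integral_mult_tendsto[OF F continuous_imp_measurable_lebesgue_on[OF fc Dm] continuous_imp_measurable_lebesgue_on[OF f Dm] bd conv_kernel_tendsto[OF f r(1) rl]])
  moreover have "(\<lambda>x. (indicator T x * w x) * ?f k x) = (\<lambda>x. w x * ?f k x)" for k
    using fT by (auto simp: fun_eq_iff split: split_indicator)
  moreover have "(\<lambda>x. (indicator T x * w x) * f x) = (\<lambda>x. w x * f x)"
  proof -
    have "S \<subseteq> T"
    proof
      fix x assume "x \<in> S"
      then have "x = x + 0 \<and> x \<in> S \<and> (0::real^'n) \<in> cball 0 (r0/2)" using r0(1) by simp
      then show "x \<in> T" unfolding T_def by blast
    qed
    then show ?thesis using S(3) by (auto simp: fun_eq_iff split: split_indicator)
  qed
  ultimately have "(\<lambda>k. 0) \<longlonglongrightarrow> (\<integral>x. w x * f x \<partial>lebesgue_on D)" using test[OF tD] by simp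
  then show ?thesis using LIMSEQ_unique[OF tendsto_const] by fastforce
qed

text \<open>The fundamental lemma of the calculus of variations. Testing against continuous functions that
  approximate the sign of \<open>w\<close>, clipped to values between -1 and 1 and cut off, yields the integral of
  \<open>\<bar>w\<bar>\<close> over compact subsets.\<close>
lemma vanishing_AE:
  fixes w :: "real^'n::finite \<Rightarrow> real"
  assumes D: "open D" and w: "w \<in> Lp_loc 1 D" 
    and test: "\<And>f. test_fun D f \<Longrightarrow> (\<integral>x. w x * f x \<partial>lebesgue_on D) = 0"
  shows "AE x in lebesgue_on D. w x = 0"
proof -
  have Dm: "D \<in> sets lebesgue" using D by simp
  have wm: "w \<in> borel_measurable (lebesgue_on D)" using w by (simp add: Lp_loc_def)
  have sm: "(\<lambda>x. sgn (w x)) \<in> borel_measurable (lebesgue_on D)" using wm by measurable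
  obtain s where s: "s \<in> borel_measurable borel" "\<And>x. x \<notin> D \<Longrightarrow> s x = 0" "AE x in lebesgue_on D. s x = sgn (w x)"
    by (rule borel_version[OF D sm], rule that)
  obtain g where g: "\<And>n::nat. continuous_on UNIV (g n)" "AE x in lborel. (\<lambda>n. g n x) \<longlonglongrightarrow> s x"
    by (rule measurable_approx[OF s(1)], rule that)
  have g2: "AE x in lebesgue_on D. (\<lambda>n. g n x) \<longlonglongrightarrow> s x"
    using AE_completion[OF g(2)] Dm by (subst AE_restrict_space_iff) (auto elim: eventually_mono)
  have loc: "AE x in lebesgue_on D. x \<in> S \<longrightarrow> w x = 0" if S: "compact S" "S \<subseteq> D" for S
  proof -
    obtain \<eta> :: "real^'n \<Rightarrow> real" and T where eta: "continuous_on UNIV \<eta>" "compact T" "T \<subseteq> D" "\<And>x. x \<notin> T \<Longrightarrow> \<eta> x = 0"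
      "\<And>x. 0 \<le> \<eta> x \<and> \<eta> x \<le> 1" "\<And>x. x \<in> S \<Longrightarrow> \<eta> x = 1"
      by (rule cutoff_continuous[OF S(1) D S(2)], rule that)
    define f where "f n x = max (-1) (min 1 (g n x))" for n x
    have fc: "continuous_on UNIV (f n)" for n unfolding f_def[abs_def] by (intro continuous_intros g)
    have i0: "(\<integral>x. w x * (\<eta> x * f n x) \<partial>lebesgue_on D) = 0" for n
      by (rule vanishing_continuous_test[OF D w test _ eta(2,3)]) (auto intro!: continuous_intros eta(1) fc simp: eta(4))
    have wi: "integrable (lebesgue_on D) (\<lambda>x. w x * \<eta> x)"
      by (rule Lp_loc_mult_integrable(1)[OF D w eta(1,2,3)], rule eta(4))
    have fm: "f n \<in> borel_measurable (lebesgue_on D)" for n by (rule continuous_imp_measurable_lebesgue_on[OF fc Dm])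
    have "(\<lambda>n. \<integral>x. (w x * \<eta> x) * f n x \<partial>lebesgue_on D) \<longlonglongrightarrow> (\<integral>x. (w x * \<eta> x) * sgn (w x) \<partial>lebesgue_on D)"
    proof (rule integral_dominated_convergence[where w="\<lambda>x. \<bar>w x * \<eta> x\<bar>"])
      show "AE x in lebesgue_on D. (\<lambda>n. w x * \<eta> x * f n x) \<longlonglongrightarrow> w x * \<eta> x * sgn (w x)"
        using g2 s(3)
      proof eventually_elim
        case (elim x)
        have "(\<lambda>n. f n x) \<longlonglongrightarrow> max (-1) (min 1 (s x))" unfolding f_def by (intro tendsto_intros elim)
        moreover have "max (-1) (min 1 (s x)) = sgn (w x)" using elim by (auto simp: sgn_real_def)
        ultimately show ?case by (intro tendsto_intros) simp
      qed
      show "AE x in lebesgue_on D. norm (w x * \<eta> x * f n x) \<le> \<bar>w x * \<eta> x\<bar>" for n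
      proof (rule AE_I2)
        fix x
        have "\<bar>f n x\<bar> \<le> 1" by (auto simp: f_def)
        then show "norm (w x * \<eta> x * f n x) \<le> \<bar>w x * \<eta> x\<bar>"
          using mult_left_mono[of "\<bar>f n x\<bar>" 1 "\<bar>w x * \<eta> x\<bar>"] by (simp add: abs_mult)
      qed
      show "(\<lambda>x. w x * \<eta> x * sgn (w x)) \<in> borel_measurable (lebesgue_on D)"
        by (rule borel_measurable_times[OF borel_measurable_integrable[OF wi] sm])
      show "(\<lambda>x. w x * \<eta> x * f n x) \<in> borel_measurable (lebesgue_on D)" for n
        by (rule borel_measurable_times[OF borel_measurable_integrable[OF wi] fm])
    qed (use wi in auto)
    then have "(\<lambda>n. 0) \<longlonglongrightarrow> (\<integral>x. (w x * \<eta> x) * sgn (w x) \<partial>lebesgue_on D)"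
      using i0 by (simp add: mult.assoc)
    then have "(\<integral>x. (w x * \<eta> x) * sgn (w x) \<partial>lebesgue_on D) = 0" using LIMSEQ_unique[OF tendsto_const] by fastforce
    moreover have e: "(w x * \<eta> x) * sgn (w x) = \<bar>w x * \<eta> x\<bar>" for x
      using eta(5)[of x] by (simp add: abs_mult sgn_real_def)
    ultimately have "(\<integral>x. \<bar>w x * \<eta> x\<bar> \<partial>lebesgue_on D) = 0" by simp
    then have "AE x in lebesgue_on D. \<bar>w x * \<eta> x\<bar> = 0"
      using wi by (subst (asm) integral_nonneg_eq_0_iff_AE) auto
    then show ?thesis by eventually_elim (use eta(6) in auto)
  qed
  obtain C :: "nat \<Rightarrow> (real^'n) set" where C: "\<And>n. compact (C n)" "\<And>n. C n \<subseteq> D" "\<Union>(range C) = D"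
    using open_Union_compact_subsets[OF D] by metis
  have "AE x in lebesgue_on D. \<forall>n. x \<in> C n \<longrightarrow> w x = 0"
    by (subst AE_all_countable) (intro allI loc C)
  moreover have "AE x in lebesgue_on D. x \<in> D" using Dm by (intro AE_I2) simp
  ultimately show ?thesis by eventually_elim (use C(3) in blast)
qed

text \<open>It transfers integrability from the derivatives provided by the Sobolev space to the given weak
  Hessian.\<close>
proposition weak_deriv_unique:
  fixes D :: "(real^'n::finite) set"
  assumes D: "open D" and v: "weak_deriv D ks u v1" "weak_deriv D ks u v2"
  shows "AE x in lebesgue_on D. v1 x = v2 x"
proof -
  have l: "v1 \<in> Lp_loc 1 D" "v2 \<in> Lp_loc 1 D" using v by (auto simp: weak_deriv_def)
  have "(\<lambda>x. v1 x - v2 x) \<in> Lp_loc 1 D"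
  proof -
    have "(\<lambda>x. v1 x - v2 x) \<in> Lp 1 S" if S: "compact S" "S \<subseteq> D" for S
    proof -
      have a: "v1 \<in> Lp 1 S" "v2 \<in> Lp 1 S" using l S by (auto simp: Lp_loc_def)
      then have "integrable (lebesgue_on S) v1" "integrable (lebesgue_on S) v2"
        by (auto intro!: Lp_integrable lmeasurable_compact S)
      then have "integrable (lebesgue_on S) (\<lambda>x. v1 x - v2 x)" by (rule Bochner_Integration.integrable_diff)
      then show ?thesis using a by (auto simp: Lp_def)
    qed
    then show ?thesis using l by (auto simp: Lp_loc_def)
  qed
  then have "AE x in lebesgue_on D. v1 x - v2 x = 0"
  proof (rule vanishing_AE[OF D])
    fix f :: "real^'n \<Rightarrow> real" assume f: "test_fun D f"
    let ?S = "closure {x. f x \<noteq> 0}"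
    have S: "compact ?S" "?S \<subseteq> D" using f by (auto simp: test_fun_def)
    have S0: "f x = 0" if "x \<notin> ?S" for x using that closure_subset[of "{x. f x \<noteq> 0}"] by blast
    have "Ck_on 0 UNIV f" using f by (simp add: test_fun_def)
    then have fc: "continuous_on UNIV f" by (simp add: Ck_on_def)
    have "integrable (lebesgue_on D) (\<lambda>x. v1 x * f x)" "integrable (lebesgue_on D) (\<lambda>x. v2 x * f x)"
      by (rule Lp_loc_mult_integrable(1)[OF D _ fc S S0], use l in auto)+
    moreover have "(\<integral>x. v1 x * f x \<partial>lebesgue_on D) = (\<integral>x. v2 x * f x \<partial>lebesgue_on D)"
    proof -
      have "(-1) ^ length ks * (\<integral>x. v1 x * f x \<partial>lebesgue_on D) = (-1) ^ length ks * (\<integral>x. v2 x * f x \<partial>lebesgue_on D)"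
        using v[unfolded weak_deriv_def] f by fastforce
      then show ?thesis by simp
    qed
    ultimately show "(\<integral>x. (v1 x - v2 x) * f x \<partial>lebesgue_on D) = 0"
      by (simp add: left_diff_distrib)
  qed
  then show ?thesis by eventually_elim simp
qed

section \<open>The boundary layer\<close>

lemma cube_shift_derivs:
  shows "((\<lambda>t::real. (max 0 (t - a)) ^ 3) has_real_derivative 3 * (max 0 (t - a))\<^sup>2) (at t)"
    and "((\<lambda>t::real. (max 0 (t - a))\<^sup>2) has_real_derivative 2 * max 0 (t - a)) (at t)"
proof -
  have d: "((\<lambda>t::real. t - a) has_real_derivative 1) (at t)" by (auto intro!: derivative_eq_intros)
  show "((\<lambda>t::real. (max 0 (t - a)) ^ 3) has_real_derivative 3 * (max 0 (t - a))\<^sup>2) (at t)"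
    using DERIV_chain2[OF cube_pos_derivs(1) d] by simp
  have "((\<lambda>t::real. 3 * (max 0 (t - a))\<^sup>2 / 3) has_real_derivative 6 * max 0 (t - a) / 3) (at t)"
    using DERIV_chain2[OF cube_pos_derivs(2) d] by (intro DERIV_cdivide) simp
  then show "((\<lambda>t::real. (max 0 (t - a))\<^sup>2) has_real_derivative 2 * max 0 (t - a)) (at t)" by simp
qed

text \<open>\<open>cut1\<close> is the quadratic B-spline with knots 2, 3, 4, 5, normalised to integral one; \<open>cut\<close> is its
  primitive and \<open>cut2\<close> its derivative. Thus \<open>cut\<close> rises from 0 to 1 between 2 and 5.\<close>
definition cut :: "real \<Rightarrow> real" where
  "cut t = ((max 0 (t - 2)) ^ 3 - 3 * (max 0 (t - 3)) ^ 3 + 3 * (max 0 (t - 4)) ^ 3 - (max 0 (t - 5)) ^ 3) / 6"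
definition cut1 :: "real \<Rightarrow> real" where
  "cut1 t = ((max 0 (t - 2))\<^sup>2 - 3 * (max 0 (t - 3))\<^sup>2 + 3 * (max 0 (t - 4))\<^sup>2 - (max 0 (t - 5))\<^sup>2) / 2"
definition cut2 :: "real \<Rightarrow> real" where
  "cut2 t = max 0 (t - 2) - 3 * max 0 (t - 3) + 3 * max 0 (t - 4) - max 0 (t - 5)"

text \<open>\<open>ramp2\<close> is the hat function on the interval from 1 to 6 with slopes 1 and -1, and \<open>ramp\<close>
  its second primitive. It is convex, vanishes up to 1, and its second derivative is at least 1 on the
  interval from 2 to 5 where \<open>cut\<close> varies.\<close>
definition ramp :: "real \<Rightarrow> real" where
  "ramp t = ((max 0 (t - 1)) ^ 3 - 2 * (max 0 (t - 7/2)) ^ 3 + (max 0 (t - 6)) ^ 3) / 6"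
definition ramp1 :: "real \<Rightarrow> real" where
  "ramp1 t = ((max 0 (t - 1))\<^sup>2 - 2 * (max 0 (t - 7/2))\<^sup>2 + (max 0 (t - 6))\<^sup>2) / 2"
definition ramp2 :: "real \<Rightarrow> real" where
  "ramp2 t = max 0 (t - 1) - 2 * max 0 (t - 7/2) + max 0 (t - 6)"

lemma cut_derivs:
  "(cut has_real_derivative cut1 t) (at t)" "(cut1 has_real_derivative cut2 t) (at t)" "continuous_on UNIV cut2"
proof -
  show "(cut has_real_derivative cut1 t) (at t)" unfolding cut_def[abs_def] cut1_def
    by (rule DERIV_cong[OF DERIV_cdivide[OF DERIV_diff[OF DERIV_add[OF DERIV_diff[OF cube_shift_derivs(1)[of "2" t] DERIV_cmult[OF cube_shift_derivs(1)[of "3" t], where c=3]] DERIV_cmult[OF cube_shift_derivs(1)[of "4" t], where c=3]] cube_shift_derivs(1)[of "5" t]], where c=6]]) (simp add: field_simps)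
  show "(cut1 has_real_derivative cut2 t) (at t)" unfolding cut1_def[abs_def] cut2_def
    by (rule DERIV_cong[OF DERIV_cdivide[OF DERIV_diff[OF DERIV_add[OF DERIV_diff[OF cube_shift_derivs(2)[of "2" t] DERIV_cmult[OF cube_shift_derivs(2)[of "3" t], where c=3]] DERIV_cmult[OF cube_shift_derivs(2)[of "4" t], where c=3]] cube_shift_derivs(2)[of "5" t]], where c=2]]) (simp add: field_simps)
  show "continuous_on UNIV cut2" unfolding cut2_def[abs_def] by (intro continuous_intros)
qed

lemma ramp_derivs:
  "(ramp has_real_derivative ramp1 t) (at t)" "(ramp1 has_real_derivative ramp2 t) (at t)" "continuous_on UNIV ramp2"
proof -
  show "(ramp has_real_derivative ramp1 t) (at t)" unfolding ramp_def[abs_def] ramp1_def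
    by (rule DERIV_cong[OF DERIV_cdivide[OF DERIV_add[OF DERIV_diff[OF cube_shift_derivs(1)[of "1" t] DERIV_cmult[OF cube_shift_derivs(1)[of "7/2" t], where c=2]] cube_shift_derivs(1)[of "6" t]], where c=6]]) (simp add: field_simps)
  show "(ramp1 has_real_derivative ramp2 t) (at t)" unfolding ramp1_def[abs_def] ramp2_def
    by (rule DERIV_cong[OF DERIV_cdivide[OF DERIV_add[OF DERIV_diff[OF cube_shift_derivs(2)[of "1" t] DERIV_cmult[OF cube_shift_derivs(2)[of "7/2" t], where c=2]] cube_shift_derivs(2)[of "6" t]], where c=2]]) (simp add: field_simps)
  show "continuous_on UNIV ramp2" unfolding ramp2_def[abs_def] by (intro continuous_intros)
qed

lemma cut_outside:
  "t \<le> 2 \<Longrightarrow> cut t = 0" "5 \<le> t \<Longrightarrow> cut t = 1" 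
  "t \<notin> {2..5} \<Longrightarrow> cut1 t = 0" "t \<notin> {2..5} \<Longrightarrow> cut2 t = 0"
  unfolding cut_def cut1_def cut2_def
  by (auto simp: max_def power3_eq_cube power2_eq_square algebra_simps)

lemma ramp_outside:
  "t \<le> 1 \<Longrightarrow> ramp t = 0" "t \<le> 1 \<Longrightarrow> ramp1 t = 0" "6 \<le> t \<Longrightarrow> ramp1 t = 25/4" "t \<notin> {1..6} \<Longrightarrow> ramp2 t = 0"
  unfolding ramp_def ramp1_def ramp2_def
  by (auto simp: max_def power2_eq_square algebra_simps)

lemma ramp2_bounds: "0 \<le> ramp2 t" "ramp2 t \<le> 5/2" "2 \<le> t \<Longrightarrow> t \<le> 5 \<Longrightarrow> 1 \<le> ramp2 t"
  unfolding ramp2_def by (auto simp: max_def)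

lemma cut_continuous: "continuous_on S cut" "continuous_on S cut1" "continuous_on S cut2"
  "continuous_on S ramp1" "continuous_on S ramp2"
  unfolding cut_def[abs_def] cut1_def[abs_def] cut2_def[abs_def] ramp1_def[abs_def] ramp2_def[abs_def]
  by (intro continuous_intros; simp)+

lemma cut_bound:
  obtains B where "B > 0" "\<And>t. \<bar>cut t\<bar> \<le> B" "\<And>t. \<bar>cut1 t\<bar> \<le> B" "\<And>t. \<bar>cut2 t\<bar> \<le> B" "\<And>t. \<bar>ramp1 t\<bar> \<le> B"
proof -
  have "bounded (f ` {0..7})" if "continuous_on {0..7} f" for f :: "real \<Rightarrow> real"
    using that by (intro compact_imp_bounded compact_continuous_image) auto
  then have "\<exists>B>0. \<forall>t\<in>{0..7}. \<bar>f t\<bar> \<le> B" if "continuous_on {0..7} f" for f :: "real \<Rightarrow> real"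
    using that by (fastforce simp: bounded_pos)
  then obtain B0 B1 B2 B3 where B: "B0 > 0" "\<And>t. t \<in> {0..7} \<Longrightarrow> \<bar>cut t\<bar> \<le> B0" "B1 > 0" "\<And>t. t \<in> {0..7} \<Longrightarrow> \<bar>cut1 t\<bar> \<le> B1"
    "B2 > 0" "\<And>t. t \<in> {0..7} \<Longrightarrow> \<bar>cut2 t\<bar> \<le> B2" "B3 > 0" "\<And>t. t \<in> {0..7} \<Longrightarrow> \<bar>ramp1 t\<bar> \<le> B3"
    using cut_continuous by metis
  let ?B = "B0 + B1 + B2 + B3 + 7"
  show thesis
  proof (rule that[of ?B])
    fix t :: real
    consider "t < 0" | "t \<in> {0..7}" | "t > 7" by fastforce
    then show "\<bar>cut t\<bar> \<le> ?B" "\<bar>cut1 t\<bar> \<le> ?B" "\<bar>cut2 t\<bar> \<le> ?B" "\<bar>ramp1 t\<bar> \<le> ?B"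
      by (cases; use B(1,3,5,7) B(2,4,6,8)[of t] cut_outside[of t] ramp_outside[of t] in force)+
  qed (use B(1,3,5,7) in simp)
qed

lemma C2_with_zero_open:
  assumes "C2_with f g h" "open W" "\<And>x. x \<in> W \<Longrightarrow> f x = 0" "x \<in> W"
  shows "g x = 0" "h x = 0"
  using C2_with_zero_outside[OF assms(1), of "- W" x] assms(2-4) by auto

text \<open>Profiles of \<open>\<psi>\<close> vanish near the frontier of \<open>D\<close> but perhaps not outside \<open>D\<close>, where the
  sign of \<open>\<psi>\<close> is arbitrary; therefore they are replaced by zero there.\<close>
lemma C2_with_extend:
  fixes D :: "(real^'n::finite) set"
  assumes C: "C2_with f g h" and D: "open D" and S: "closed S" "S \<subseteq> D" "\<And>x. x \<in> D \<Longrightarrow> x \<notin> S \<Longrightarrow> f x = 0"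
  shows "C2_with (\<lambda>x. if x \<in> D then f x else 0) (\<lambda>x. if x \<in> D then g x else 0) (\<lambda>x. if x \<in> D then h x else 0)"
proof -
  have op: "open (- S)" "open (D - S)" using S(1) D by auto
  have z: "g x = 0" "h x = 0" if "x \<in> D" "x \<notin> S" for x
    using C2_with_zero_open[OF C op(2), of x] S(3) that by auto
  have d: "((\<lambda>x. if x \<in> D then F x else 0) has_derivative (\<lambda>v. (if x \<in> D then G x else 0) \<bullet> v)) (at x)"
    if F: "\<And>x. (F has_derivative (\<lambda>v. G x \<bullet> v)) (at x)" and F0: "\<And>x. x \<in> D \<Longrightarrow> x \<notin> S \<Longrightarrow> F x = 0" 
    for F :: "real^'n \<Rightarrow> real" and G x
  proof (cases "x \<in> D")
    case True
    then show ?thesis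
      using has_derivative_transform_within_open[OF F D True, of "\<lambda>x. if x \<in> D then F x else 0"] by simp
  next
    case False
    then have x: "x \<in> - S" using S(2) by auto
    have "((\<lambda>x. 0::real) has_derivative (\<lambda>v. (if x \<in> D then G x else 0) \<bullet> v)) (at x)" using False by simp
    then show ?thesis by (rule has_derivative_transform_within_open[OF _ op(1) x]) (use F0 in auto)
  qed
  have "continuous_on D (\<lambda>x. if x \<in> D then h x else 0)"
    by (rule continuous_on_eq[OF C2_with_cont(3)[OF C]]) simp
  moreover have "continuous_on (- S) (\<lambda>x. if x \<in> D then h x else 0)"
    by (rule continuous_on_eq[OF continuous_on_const[of _ 0]]) (use z(2) in auto)
  ultimately have "continuous_on (D \<union> - S) (\<lambda>x. if x \<in> D then h x else 0)" by (rule continuous_on_open_Un[OF D op(1)])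
  moreover have "D \<union> - S = UNIV" using S(2) by auto
  ultimately have c: "continuous_on UNIV (\<lambda>x. if x \<in> D then h x else 0)" by simp
  have e: "(\<lambda>x. (if x \<in> D then g x else 0) $ j) = (\<lambda>x. if x \<in> D then g x $ j else 0)" for j by auto
  have e2: "(\<chi> i. (if x \<in> D then h x else 0) $ i $ j) = (if x \<in> D then (\<chi> i. h x $ i $ j) else 0)" for x j
    by (auto simp: vec_eq_iff)
  show ?thesis unfolding C2_with_def e e2
  proof (intro conjI allI c)
    fix x show "((\<lambda>x. if x \<in> D then f x else 0) has_derivative (\<lambda>v. (if x \<in> D then g x else 0) \<bullet> v)) (at x)"
      by (rule d[OF C2_with_deriv[OF C] S(3)])
    fix j show "((\<lambda>x. if x \<in> D then g x $ j else 0) has_derivative (\<lambda>v. (if x \<in> D then (\<chi> i. h x $ i $ j) else 0) \<bullet> v)) (at x)"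
      by (rule d) (use C z(1) in \<open>auto simp: C2_with_def\<close>)
  qed
qed

text \<open>The chain rule for functions of the rescaled depth. The second derivatives consist of a term of
  order \<open>1 / \<epsilon>\<close> and of a rank one matrix of order \<open>1 / \<epsilon>\<^sup>2\<close>, which is the leading one.\<close>
lemma C2_with_profile:
  fixes P :: "real \<Rightarrow> real"
  assumes C: "C2_with \<psi> g h" and P: "\<And>t. (P has_real_derivative P1 t) (at t)" "\<And>t. (P1 has_real_derivative P2 t) (at t)" "continuous_on UNIV P2"
    and e: "\<epsilon> > 0"
  shows "C2_with (\<lambda>x. P (\<psi> x / \<epsilon>)) (\<lambda>x. (P1 (\<psi> x / \<epsilon>) / \<epsilon>) *\<^sub>R g x)
     (\<lambda>x. (P1 (\<psi> x / \<epsilon>) / \<epsilon>) *\<^sub>R h x + (P2 (\<psi> x / \<epsilon>) / \<epsilon>\<^sup>2) *\<^sub>R outer (g x) (g x))"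
proof -
  have d: "((\<lambda>t. t / \<epsilon>) has_real_derivative 1 / \<epsilon>) (at t)" for t using e by (auto intro!: derivative_eq_intros)
  have 1: "((\<lambda>t. P (t / \<epsilon>)) has_real_derivative P1 (t / \<epsilon>) / \<epsilon>) (at t)" for t
    using DERIV_chain2[OF P(1) d] by simp
  have 2: "((\<lambda>t. P1 (t / \<epsilon>) / \<epsilon>) has_real_derivative P2 (t / \<epsilon>) / \<epsilon>\<^sup>2) (at t)" for t
    using DERIV_cdivide[OF DERIV_chain2[OF P(2) d], where c=\<epsilon>] by (simp add: power2_eq_square)
  have 3: "continuous_on UNIV (\<lambda>t. P2 (t / \<epsilon>) / \<epsilon>\<^sup>2)"
    using e by (intro continuous_intros continuous_on_compose2[OF P(3)]) auto
  show ?thesis using C2_with_compose[OF C 1 2 3] .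
qed

lemma quadratic_form_expand: "(K *v a) \<bullet> b = (\<Sum>i\<in>UNIV. \<Sum>j\<in>UNIV. K $ i $ j * (a $ j * b $ i))"
  for K :: "real^'n::finite^'n"
  by (simp add: inner_vec_def matrix_vector_mult_def sum_distrib_right mult.assoc)

definition entry_sum :: "real^'n::finite^'n \<Rightarrow> real" where
  "entry_sum K = (\<Sum>i\<in>UNIV. \<Sum>j\<in>UNIV. \<bar>K $ i $ j\<bar>)"

lemma entry_sum_nonneg: "0 \<le> entry_sum K" by (simp add: entry_sum_def sum_nonneg)

lemma quadratic_form_bound: "\<bar>(K *v a) \<bullet> b\<bar> \<le> entry_sum K * (norm a * norm b)"
  for K :: "real^'n::finite^'n"
proof -
  have "\<bar>(K *v a) \<bullet> b\<bar> \<le> (\<Sum>i\<in>UNIV. \<bar>\<Sum>j\<in>UNIV. K $ i $ j * (a $ j * b $ i)\<bar>)"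
    unfolding quadratic_form_expand by (rule sum_abs)
  also have "\<dots> \<le> (\<Sum>i\<in>UNIV. \<Sum>j\<in>UNIV. \<bar>K $ i $ j\<bar> * (norm a * norm b))"
  proof (rule sum_mono)
    fix i
    have "\<bar>\<Sum>j\<in>UNIV. K $ i $ j * (a $ j * b $ i)\<bar> \<le> (\<Sum>j\<in>UNIV. \<bar>K $ i $ j * (a $ j * b $ i)\<bar>)" by (rule sum_abs)
    also have "\<dots> \<le> (\<Sum>j\<in>UNIV. \<bar>K $ i $ j\<bar> * (norm a * norm b))"
      by (intro sum_mono) (auto simp: abs_mult intro!: mult_left_mono mult_mono component_le_norm_cart)
    finally show "\<bar>\<Sum>j\<in>UNIV. K $ i $ j * (a $ j * b $ i)\<bar> \<le> (\<Sum>j\<in>UNIV. \<bar>K $ i $ j\<bar> * (norm a * norm b))" .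
  qed
  also have "\<dots> = entry_sum K * (norm a * norm b)" by (simp add: entry_sum_def sum_distrib_right)
  finally show ?thesis .
qed

lemma L_op_profile:
  "L_op K \<beta> (\<lambda>x. a x *\<^sub>R h x + b x *\<^sub>R outer (g x) (g x)) (\<lambda>x. a x *\<^sub>R g x) x
     = a x * L_op K \<beta> h g x + b x * ((K x *v g x) \<bullet> g x)"
  unfolding L_op_expand quadratic_form_expand
  by (simp add: sum.distrib sum_distrib_left distrib_left ac_simps)

lemma L_op_cong: "h x = h' x \<Longrightarrow> g x = g' x \<Longrightarrow> L_op K \<beta> h g x = L_op K \<beta> h' g' x"
  by (simp add: L_op_def)

lemma integrable_mult_closure:
  fixes F c :: "real^'n::finite \<Rightarrow> real"
  assumes D: "open D" "bounded D" and F: "integrable (lebesgue_on D) F" and c: "continuous_on (closure D) c"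
  shows "integrable (lebesgue_on D) (\<lambda>x. F x * c x)"
proof -
  have "compact (closure D)" using D(2) by simp
  then have "bounded (c ` closure D)" using c by (intro compact_imp_bounded compact_continuous_image)
  then obtain B where B: "\<And>x. x \<in> closure D \<Longrightarrow> \<bar>c x\<bar> \<le> B" by (auto simp: bounded_iff)
  show ?thesis
  proof (rule integrable_mult_bounded[OF F])
    show "c \<in> borel_measurable (lebesgue_on D)"
      using D(1) closure_subset[of D] by (intro continuous_imp_measurable_on_sets_lebesgue continuous_on_subset[OF c]) auto
    show "AE x in lebesgue_on D. \<bar>c x\<bar> \<le> B" using B closure_subset[of D] by (intro AE_I2) auto
  qed
qed

lemma L_op_integrable:
  fixes D :: "(real^'n::finite) set"
  assumes D: "open D" "bounded D" and p: "p > 1" and q: "q = p / (p - 1)"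
    and K: "\<And>i j. (\<lambda>x. K x $ i $ j) \<in> Lp q D" and \<beta>: "\<And>i. integrable (lebesgue_on D) (\<lambda>x. \<beta> x $ i)"
    and H: "\<And>i j. (\<lambda>x. H x $ i $ j) \<in> Lp p D" and G: "continuous_on (closure D) G"
  shows "integrable (lebesgue_on D) (L_op K \<beta> H G)"
proof -
  have 1: "integrable (lebesgue_on D) (\<lambda>x. K x $ i $ j * H x $ j $ i)" for i j
  proof (rule Bochner_Integration.integrable_bound)
    show "integrable (lebesgue_on D) (\<lambda>x. \<bar>K x $ i $ j\<bar> powr q + \<bar>H x $ j $ i\<bar> powr p)"
      using K H by (auto simp: Lp_def)
    show "(\<lambda>x. K x $ i $ j * H x $ j $ i) \<in> borel_measurable (lebesgue_on D)"
      by (rule borel_measurable_times) (use K H in \<open>auto simp: Lp_def\<close>)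
    have "\<bar>a\<bar> * \<bar>b\<bar> \<le> \<bar>a\<bar> powr q + \<bar>b\<bar> powr p" for a b using Young_scaled[OF p q, of 1 a b] by simp
    then show "AE x in lebesgue_on D. norm (K x $ i $ j * H x $ j $ i) \<le> norm (\<bar>K x $ i $ j\<bar> powr q + \<bar>H x $ j $ i\<bar> powr p)"
      by (auto simp: abs_mult)
  qed
  have 2: "integrable (lebesgue_on D) (\<lambda>x. \<beta> x $ i * G x $ i)" for i
    using G by (intro integrable_mult_closure[OF D \<beta>] continuous_intros)
  show ?thesis unfolding L_op_expand' by (intro Bochner_Integration.integrable_add Bochner_Integration.integrable_sum 1 2)
qed

lemma L_op_integrable_continuous:
  fixes D :: "(real^'n::finite) set"
  assumes D: "open D" "bounded D"
    and K: "\<And>i j. integrable (lebesgue_on D) (\<lambda>x. K x $ i $ j)" and \<beta>: "\<And>i. integrable (lebesgue_on D) (\<lambda>x. \<beta> x $ i)"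
    and H: "continuous_on (closure D) H" and G: "continuous_on (closure D) G"
  shows "integrable (lebesgue_on D) (L_op K \<beta> H G)"
  unfolding L_op_expand'
  by (intro Bochner_Integration.integrable_add Bochner_Integration.integrable_sum integrable_mult_closure[OF D] K \<beta> continuous_intros H G)

lemma quadratic_form_integrable:
  fixes D :: "(real^'n::finite) set" and K :: "real^'n \<Rightarrow> real^'n^'n"
  assumes D: "open D" "bounded D"
    and K: "\<And>i j. integrable (lebesgue_on D) (\<lambda>x. K x $ i $ j)"
    and G: "continuous_on (closure D) G" "continuous_on (closure D) G'"
  shows "integrable (lebesgue_on D) (\<lambda>x. (K x *v G x) \<bullet> G' x)"
  unfolding quadratic_form_expand
  by (intro Bochner_Integration.integrable_sum integrable_mult_closure[OF D] K continuous_intros G)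

lemma closed_superlevel:
  assumes D: "open D" and psi: "defining_function D \<psi> g h" and "c > 0"
  shows "closed {x \<in> closure D. c \<le> \<psi> x}" "{x \<in> closure D. c \<le> \<psi> x} \<subseteq> D"
proof -
  have "continuous_on UNIV \<psi>" using psi C2_with_cont(1) by (auto simp: defining_function_def)
  then have "closed {x. c \<le> \<psi> x}" by (intro closed_Collect_le continuous_intros)
  then show "closed {x \<in> closure D. c \<le> \<psi> x}" by (simp add: closed_Collect_conj)
  show "{x \<in> closure D. c \<le> \<psi> x} \<subseteq> D"
    using psi \<open>c > 0\<close> closure_Un_frontier'[of D] by (auto simp: defining_function_def)
qed

definition in_strip :: "real \<Rightarrow> real \<Rightarrow> real" where
  "in_strip \<epsilon> s = (if 2 * \<epsilon> \<le> s \<and> s \<le> 5 * \<epsilon> then 1 else 0)"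

text \<open>The expression \<open>u L \<zeta> + 2 (K \<nabla>\<zeta>) \<bullet> \<nabla>u\<close> for \<open>\<zeta> = cut (\<psi> / \<epsilon>)\<close> and \<open>u = \<psi>\<close>, without its
  part \<open>\<psi> * cut1 (\<psi> / \<epsilon>) / \<epsilon> * L \<psi>\<close>. It is of order \<open>1 / \<epsilon>\<close> for given \<open>K\<close>, because
  \<open>\<psi> \<le> 5 \<epsilon>\<close> on the strip makes up for one of the two factors \<open>1 / \<epsilon>\<close> in the second derivatives of \<open>\<zeta>\<close>.\<close>
definition layer_density :: "(real^'n::finite \<Rightarrow> real^'n^'n) \<Rightarrow> (real^'n \<Rightarrow> real) \<Rightarrow> (real^'n \<Rightarrow> real^'n) \<Rightarrow> real \<Rightarrow> real^'n \<Rightarrow> real" where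
  "layer_density K \<psi> g \<epsilon> x = (2 * cut1 (\<psi> x / \<epsilon>) + (\<psi> x / \<epsilon>) * cut2 (\<psi> x / \<epsilon>)) / \<epsilon> * ((K x *v g x) \<bullet> g x)"

lemma profile_zero:
  assumes "\<epsilon> > 0" "in_strip \<epsilon> s = 0"
  shows "cut1 (s / \<epsilon>) = 0" "cut2 (s / \<epsilon>) = 0"
  using assms cut_outside(3,4)[of "s / \<epsilon>"] by (auto simp: in_strip_def field_simps split: if_splits)

text \<open>The cut-off identity with \<open>\<zeta> = cut (\<psi> / \<epsilon>)\<close> is split into three parts: the integral of \<open>L u\<close>
  times \<open>\<zeta>\<close>, that of \<open>Q\<close> times \<open>layer_density\<close>, and an error \<open>E\<close> in which \<open>u\<close> and \<open>Du\<close> are replaced by their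
  differences to \<open>Q \<psi>\<close> and \<open>Q g\<close>. In the strip these differences are at most \<open>\<delta> \<psi>\<close> and \<open>\<delta>\<close>,
  which makes up for the factor \<open>1 / \<epsilon>\<close> once the strip estimate for \<open>K\<close> is used.\<close>
proposition boundary_layer_limit:
  fixes D :: "(real^'n::finite) set"
  assumes D: "open D" "bounded D" "C2_boundary D" and psi: "defining_function D \<psi> g h"
    and p: "p > 1" and q: "q = p / (p - 1)"
    and K: "\<And>i j. (\<lambda>x. K x $ i $ j) \<in> Lp q D" and sym: "\<And>x. x \<in> D \<Longrightarrow> transpose (K x) = K x"
    and \<beta>: "\<And>i. integrable (lebesgue_on D) (\<lambda>x. \<beta> x $ i)"
    and eq: "\<And>u. test_fun D u \<Longrightarrow> integral\<^sup>L (lebesgue_on D) (L_op K \<beta> (hessian u) (gradient u)) = 0"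
    and u: "C1_closure D u Du" "\<And>x. x \<in> frontier D \<Longrightarrow> u x = 0"
    and H: "weak_hessian D u H" "\<And>i j. (\<lambda>x. H x $ i $ j) \<in> Lp p D"
    and Q: "continuous_on (closure D) Q" "\<And>x. x \<in> frontier D \<Longrightarrow> Du x = Q x *\<^sub>R g x"
    and \<epsilon>: "\<And>k. 0 < \<epsilon> k" "\<epsilon> \<longlonglongrightarrow> 0"
    and strip: "\<And>k. (\<integral>x. in_strip (\<epsilon> k) (\<psi> x) * entry_sum (K x) \<partial>lebesgue_on D) \<le> C0 * \<epsilon> k"
  shows "(\<lambda>k. \<integral>x. Q x * layer_density K \<psi> g (\<epsilon> k) x \<partial>lebesgue_on D) \<longlonglongrightarrow> - integral\<^sup>L (lebesgue_on D) (L_op K \<beta> H Du)"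
proof -
  let ?M = "lebesgue_on D"
  have q1: "q > 1" using p by (simp add: q field_simps)
  have Dm: "D \<in> sets lebesgue" "D \<in> lmeasurable" using D by (auto intro: lmeasurable_open)
  have spM: "space ?M = D" by simp
  note Ki = Lp_integrable[OF K less_imp_le[OF q1] Dm(2)]
  have C: "C2_with \<psi> g h" using psi by (simp add: defining_function_def)
  have psi_pos: "\<psi> x > 0" if "x \<in> D" for x using psi that by (simp add: defining_function_def)
  note cc = C2_with_cont[OF C, of "closure D"]
  have uc: "continuous_on (closure D) u" "continuous_on (closure D) Du" using u(1) by (auto simp: C1_closure_def)
  define L where "L = L_op K \<beta> H Du"
  define L0 where "L0 = L_op K \<beta> h g"
  define \<kappa> where "\<kappa> x = (K x *v g x) \<bullet> g x" for x
  define c c1 c2 where "c k x = cut (\<psi> x / \<epsilon> k)" and "c1 k x = cut1 (\<psi> x / \<epsilon> k) / \<epsilon> k" and "c2 k x = cut2 (\<psi> x / \<epsilon> k) / (\<epsilon> k)\<^sup>2" for k x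
  define E where "E k x = L0 x * (u x * c1 k x) + \<kappa> x * (c2 k x * (u x - Q x * \<psi> x)) + (K x *v ((2 * c1 k x) *\<^sub>R g x)) \<bullet> (Du x - Q x *\<^sub>R g x)" for k x
  have Li: "integrable ?M L" unfolding L_def by (rule L_op_integrable[OF D(1,2) p q K \<beta> H(2) uc(2)])
  have L0i: "integrable ?M L0" unfolding L0_def by (rule L_op_integrable_continuous[OF D(1,2) Ki \<beta> cc(3,2)])
  have \<kappa>i: "integrable ?M \<kappa>" unfolding \<kappa>_def by (rule quadratic_form_integrable[OF D(1,2) Ki cc(2) cc(2)])
  have ck: "continuous_on (closure D) (\<lambda>x. c k x)" "continuous_on (closure D) (\<lambda>x. c1 k x)" "continuous_on (closure D) (\<lambda>x. c2 k x)" for k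
  proof -
    have s: "continuous_on (closure D) (\<lambda>x. \<psi> x / \<epsilon> k)"
      using \<epsilon>(1)[of k] by (intro continuous_on_divide continuous_on_const cc(1)) auto
    note cp = continuous_on_compose2[OF cut_continuous(1)[of UNIV] s subset_UNIV] continuous_on_compose2[OF cut_continuous(2)[of UNIV] s subset_UNIV]
      continuous_on_compose2[OF cut_continuous(3)[of UNIV] s subset_UNIV]
    show "continuous_on (closure D) (\<lambda>x. c k x)" unfolding c_def by (rule cp)
    show "continuous_on (closure D) (\<lambda>x. c1 k x)" "continuous_on (closure D) (\<lambda>x. c2 k x)"
      unfolding c1_def c2_def using \<epsilon>(1)[of k] by (intro continuous_on_divide continuous_on_const cp; simp)+
  qed
  have i1: "integrable ?M (\<lambda>x. L0 x * (u x * c1 k x))" for k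
    by (intro integrable_mult_closure[OF D(1,2) L0i] continuous_intros uc ck)
  have i2: "integrable ?M (\<lambda>x. \<kappa> x * (c2 k x * (u x - Q x * \<psi> x)))" for k
    by (intro integrable_mult_closure[OF D(1,2) \<kappa>i] continuous_intros uc ck Q(1) cc)
  have i3: "integrable ?M (\<lambda>x. (K x *v ((2 * c1 k x) *\<^sub>R g x)) \<bullet> (Du x - Q x *\<^sub>R g x))" for k
    by (intro quadratic_form_integrable[OF D(1,2) Ki] continuous_intros uc ck Q(1) cc)
  have Ei: "integrable ?M (E k)" for k unfolding E_def[abs_def] by (intro Bochner_Integration.integrable_add i1 i2 i3)
  have ld: "layer_density K \<psi> g (\<epsilon> k) x = \<kappa> x * (2 * c1 k x + \<psi> x * c2 k x)" for k x
    using \<epsilon>(1)[of k] by (simp add: layer_density_def \<kappa>_def c1_def c2_def field_simps power2_eq_square)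
  have i4: "integrable ?M (\<lambda>x. Q x * layer_density K \<psi> g (\<epsilon> k) x)" for k
  proof -
    have "integrable ?M (\<lambda>x. \<kappa> x * ((2 * c1 k x + \<psi> x * c2 k x) * Q x))"
      by (intro integrable_mult_closure[OF D(1,2) \<kappa>i] continuous_intros ck Q(1) cc)
    then show ?thesis unfolding ld by (simp add: ac_simps)
  qed
  have i5: "integrable ?M (\<lambda>x. L x * c k x)" for k by (rule integrable_mult_closure[OF D(1,2) Li ck(1)])
  have ident: "(\<integral>x. L x * c k x \<partial>?M) + (\<integral>x. Q x * layer_density K \<psi> g (\<epsilon> k) x \<partial>?M) + integral\<^sup>L ?M (E k) = 0" for k
  proof -
    let ?S = "{x \<in> closure D. 2 * \<epsilon> k \<le> \<psi> x}"
    have e: "2 * \<epsilon> k > 0" using \<epsilon>(1)[of k] by simp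
    note S = closed_superlevel[OF D(1) psi e]
    have Sc: "compact ?S" using S(1) D(2) by (metis (no_types, lifting) bounded_closure bounded_subset compact_eq_bounded_closed mem_Collect_eq subsetI)
    have z: "cut (\<psi> x / \<epsilon> k) = 0" if "x \<in> D" "x \<notin> ?S" for x
      using that closure_subset[of D] \<epsilon>(1)[of k] by (intro cut_outside(1)) (auto simp: field_simps)
    note ext = C2_with_extend[OF C2_with_profile[OF C cut_derivs \<epsilon>(1)[of k]] D(1) S z]
    note id = weak_equation_cutoff[OF D(1,2) p q K sym \<beta> eq u(1) H ext Sc S(2)]
    have "0 = (\<integral>x. L x * c k x + Q x * layer_density K \<psi> g (\<epsilon> k) x + E k x \<partial>?M)"
    proof (subst id[symmetric])
      show "(if x \<in> D then cut (\<psi> x / \<epsilon> k) else 0) = 0" if "x \<notin> ?S" for x using z[of x] that by auto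
      show "(\<integral>x. (if x \<in> D then cut (\<psi> x / \<epsilon> k) else 0) * L_op K \<beta> H Du x +
           u x * L_op K \<beta> (\<lambda>x. if x \<in> D then (cut1 (\<psi> x / \<epsilon> k) / \<epsilon> k) *\<^sub>R h x + (cut2 (\<psi> x / \<epsilon> k) / (\<epsilon> k)\<^sup>2) *\<^sub>R outer (g x) (g x) else 0)
             (\<lambda>x. if x \<in> D then (cut1 (\<psi> x / \<epsilon> k) / \<epsilon> k) *\<^sub>R g x else 0) x +
           2 * ((K x *v (if x \<in> D then (cut1 (\<psi> x / \<epsilon> k) / \<epsilon> k) *\<^sub>R g x else 0)) \<bullet> Du x) \<partial>?M)
         = (\<integral>x. L x * c k x + Q x * layer_density K \<psi> g (\<epsilon> k) x + E k x \<partial>?M)"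
      proof (rule Bochner_Integration.integral_cong[OF refl])
        fix x assume "x \<in> space ?M"
        then have x: "x \<in> D" by simp
        have a: "L_op K \<beta> (\<lambda>x. if x \<in> D then (cut1 (\<psi> x / \<epsilon> k) / \<epsilon> k) *\<^sub>R h x + (cut2 (\<psi> x / \<epsilon> k) / (\<epsilon> k)\<^sup>2) *\<^sub>R outer (g x) (g x) else 0)
             (\<lambda>x. if x \<in> D then (cut1 (\<psi> x / \<epsilon> k) / \<epsilon> k) *\<^sub>R g x else 0) x = c1 k x * L0 x + c2 k x * \<kappa> x"
          unfolding L0_def \<kappa>_def using x L_op_profile[of K \<beta> "c1 k" h "c2 k" g x]
          by (subst L_op_cong[where h'="\<lambda>x. c1 k x *\<^sub>R h x + c2 k x *\<^sub>R outer (g x) (g x)" and g'="\<lambda>x. c1 k x *\<^sub>R g x"])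
            (auto simp: c1_def c2_def)
        have b: "(K x *v ((2 * c1 k x) *\<^sub>R g x)) \<bullet> (Du x - Q x *\<^sub>R g x) = 2 * c1 k x * ((K x *v g x) \<bullet> Du x) - 2 * c1 k x * Q x * \<kappa> x"
          by (simp add: matrix_vector_mult_scaleR inner_diff_right \<kappa>_def algebra_simps)
        have d: "(K x *v (if x \<in> D then (cut1 (\<psi> x / \<epsilon> k) / \<epsilon> k) *\<^sub>R g x else 0)) \<bullet> Du x = c1 k x * ((K x *v g x) \<bullet> Du x)"
          using x by (simp add: matrix_vector_mult_scaleR c1_def)
        show "(if x \<in> D then cut (\<psi> x / \<epsilon> k) else 0) * L_op K \<beta> H Du x +
           u x * L_op K \<beta> (\<lambda>x. if x \<in> D then (cut1 (\<psi> x / \<epsilon> k) / \<epsilon> k) *\<^sub>R h x + (cut2 (\<psi> x / \<epsilon> k) / (\<epsilon> k)\<^sup>2) *\<^sub>R outer (g x) (g x) else 0)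
             (\<lambda>x. if x \<in> D then (cut1 (\<psi> x / \<epsilon> k) / \<epsilon> k) *\<^sub>R g x else 0) x +
           2 * ((K x *v (if x \<in> D then (cut1 (\<psi> x / \<epsilon> k) / \<epsilon> k) *\<^sub>R g x else 0)) \<bullet> Du x)
           = L x * c k x + Q x * layer_density K \<psi> g (\<epsilon> k) x + E k x"
          unfolding a d E_def ld b using x by (simp add: L_def c_def algebra_simps)
      qed
    qed
    also have "\<dots> = (\<integral>x. L x * c k x \<partial>?M) + (\<integral>x. Q x * layer_density K \<psi> g (\<epsilon> k) x \<partial>?M) + integral\<^sup>L ?M (E k)"
      using i4 i5 Ei by simp
    finally show ?thesis by simp
  qed
  obtain B where B: "B > 0" "\<And>t. \<bar>cut t\<bar> \<le> B" "\<And>t. \<bar>cut1 t\<bar> \<le> B" "\<And>t. \<bar>cut2 t\<bar> \<le> B" by (rule cut_bound, rule that)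
  have meas: "f \<in> borel_measurable ?M" if "continuous_on (closure D) f" for f :: "real^'n \<Rightarrow> real"
    using closure_subset[of D] by (intro continuous_imp_measurable_on_sets_lebesgue continuous_on_subset[OF that] Dm)
  have small: "\<forall>\<^sub>F k in sequentially. \<epsilon> k < a" if "a > 0" for a using order_tendstoD(2)[OF \<epsilon>(2) that] .
  have limL: "(\<lambda>k. \<integral>x. L x * c k x \<partial>?M) \<longlonglongrightarrow> (\<integral>x. L x * 1 \<partial>?M)"
  proof (rule integral_mult_tendsto[OF Li meas[OF ck(1)], where B=B])
    fix x assume "x \<in> space ?M"
    then have x: "\<psi> x > 0" using psi_pos by simp
    have "\<forall>\<^sub>F k in sequentially. \<epsilon> k < \<psi> x / 5" using x by (intro small) simp
    then have "\<forall>\<^sub>F k in sequentially. c k x = 1"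
    proof eventually_elim
      case (elim k) then show ?case unfolding c_def using \<epsilon>(1)[of k] by (intro cut_outside(2)) (simp add: field_simps)
    qed
    then show "(\<lambda>k. c k x) \<longlonglongrightarrow> 1" by (rule tendsto_eventually)
  qed (auto simp: c_def B)
  have is_m: "(\<lambda>x. in_strip (\<epsilon> k) (\<psi> x)) \<in> borel_measurable ?M" for k
  proof -
    have "in_strip (\<epsilon> k) \<in> borel_measurable borel" unfolding in_strip_def[abs_def] by measurable
    then show ?thesis by (rule measurable_compose[OF meas[OF cc(1)]])
  qed
  (* The strips shrink to the empty set inside D, so an integrable function has small integral there. *)
  have lim0: "(\<lambda>k. \<integral>x. \<bar>L0 x\<bar> * in_strip (\<epsilon> k) (\<psi> x) \<partial>?M) \<longlonglongrightarrow> (\<integral>x. \<bar>L0 x\<bar> * 0 \<partial>?M)"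
  proof (rule integral_mult_tendsto[OF integrable_abs[OF L0i] is_m, where B=1])
    fix x assume "x \<in> space ?M"
    then have x: "\<psi> x > 0" using psi_pos by simp
    have "\<forall>\<^sub>F k in sequentially. \<epsilon> k < \<psi> x / 5" using x by (intro small) simp
    then have "\<forall>\<^sub>F k in sequentially. in_strip (\<epsilon> k) (\<psi> x) = 0"
      by eventually_elim (simp add: in_strip_def)
    then show "(\<lambda>k. in_strip (\<epsilon> k) (\<psi> x)) \<longlonglongrightarrow> 0" by (rule tendsto_eventually)
  qed (auto simp: in_strip_def)
  have cl: "compact (closure D)" using D(2) by simp
  have "bounded (g ` closure D)" "bounded (Q ` closure D)"
    using cl cc(2) Q(1) by (auto intro!: compact_imp_bounded compact_continuous_image)
  then obtain Bg BQ where Bg: "Bg > 0" "\<And>x. x \<in> closure D \<Longrightarrow> norm (g x) \<le> Bg" and BQ: "BQ > 0" "\<And>x. x \<in> closure D \<Longrightarrow> \<bar>Q x\<bar> \<le> BQ"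
    unfolding bounded_pos by (metis imageI real_norm_def)
  have esi: "integrable ?M (\<lambda>x. entry_sum (K x))"
    unfolding entry_sum_def by (intro Bochner_Integration.integrable_sum integrable_abs Ki)
  have esi2: "integrable ?M (\<lambda>x. in_strip (\<epsilon> k) (\<psi> x) * entry_sum (K x))" for k
    using integrable_mult_bounded[OF esi is_m[of k], of 1] by (simp add: in_strip_def mult.commute)
  have L0i2: "integrable ?M (\<lambda>x. \<bar>L0 x\<bar> * in_strip (\<epsilon> k) (\<psi> x))" for k
    by (rule integrable_mult_bounded[OF integrable_abs[OF L0i] is_m[of k], where B=1]) (simp add: in_strip_def)
  (* On the strip \<bar>u\<bar> is at most (BQ + 1) * 5 \<epsilon>, which gives A1; the two summands of A2 come from
     the second and third part of E. *)
  define A1 A2 where "A1 = 5 * B * (BQ + 1)" and "A2 = 5 * B * Bg\<^sup>2 + 2 * B * Bg"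
  have A: "A1 > 0" "A2 > 0" using B(1) BQ(1) Bg(1) by (auto simp: A1_def A2_def intro!: add_pos_pos mult_pos_pos)
  have Ebound: "\<forall>\<^sub>F k in sequentially. \<bar>integral\<^sup>L ?M (E k)\<bar> \<le> A1 * (\<integral>x. \<bar>L0 x\<bar> * in_strip (\<epsilon> k) (\<psi> x) \<partial>?M) + A2 * \<delta> * C0"
    if \<delta>: "0 < \<delta>" "\<delta> \<le> 1" for \<delta>
  proof -
    obtain e1 where e1: "e1 > 0" "\<And>x. x \<in> D \<Longrightarrow> \<psi> x < e1 \<Longrightarrow> \<bar>u x - Q x * \<psi> x\<bar> \<le> \<delta> * \<psi> x"
      by (rule boundary_expansion[OF D psi u Q \<delta>(1)], assumption, assumption, rule that)
    have cn: "continuous_on (closure D) (\<lambda>x. norm (Du x - Q x *\<^sub>R g x))" by (intro continuous_intros uc Q(1) cc)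
    obtain e2 where e2: "e2 > 0" "\<And>x. x \<in> closure D \<Longrightarrow> \<psi> x < e2 \<Longrightarrow> norm (Du x - Q x *\<^sub>R g x) < \<delta>"
      by (rule small_near_frontier[OF D(1,2) psi cn, of \<delta>]) (use Q(2) \<delta> in auto)
    have "\<forall>\<^sub>F k in sequentially. \<epsilon> k < min e1 e2 / 5" using e1 e2 by (intro small) simp
    then show ?thesis
    proof eventually_elim
      case (elim k)
      note ek = \<epsilon>(1)[of k]
      have pt: "\<bar>E k x\<bar> \<le> A1 * (\<bar>L0 x\<bar> * in_strip (\<epsilon> k) (\<psi> x)) + (A2 * \<delta> / \<epsilon> k) * (in_strip (\<epsilon> k) (\<psi> x) * entry_sum (K x))" if x: "x \<in> D" for x
      proof (cases "in_strip (\<epsilon> k) (\<psi> x) = 0")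
        case True
        then have "c1 k x = 0" "c2 k x = 0" using profile_zero[OF ek True] by (auto simp: c1_def c2_def)
        then show ?thesis using True by (simp add: E_def)
      next
        case False
        then have s: "\<psi> x \<le> 5 * \<epsilon> k" "in_strip (\<epsilon> k) (\<psi> x) = 1" by (auto simp: in_strip_def split: if_splits)
        then have ps: "\<psi> x < e1" "\<psi> x < e2" using elim by auto
        have xc: "x \<in> closure D" using x closure_subset by blast
        have px: "0 < \<psi> x" by (rule psi_pos[OF x])
        have b1: "\<bar>c1 k x\<bar> \<le> B / \<epsilon> k" unfolding c1_def using B(3) ek by (simp add: divide_right_mono)
        have b2: "\<bar>c2 k x\<bar> \<le> B / (\<epsilon> k)\<^sup>2" unfolding c2_def using B(4) ek by (simp add: divide_right_mono)
        have d1: "\<bar>u x - Q x * \<psi> x\<bar> \<le> \<delta> * (5 * \<epsilon> k)" using e1(2)[OF x ps(1)] s(1) \<delta>(1) mult_left_mono[OF s(1), of \<delta>] by linarith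
        have d2: "norm (Du x - Q x *\<^sub>R g x) \<le> \<delta>" using e2(2)[OF xc ps(2)] by simp
        have "\<bar>u x\<bar> \<le> \<bar>u x - Q x * \<psi> x\<bar> + \<bar>Q x\<bar> * \<psi> x" using px abs_triangle_ineq[of "u x - Q x * \<psi> x" "Q x * \<psi> x"] by (simp add: abs_mult)
        also have "\<dots> \<le> 1 * (5 * \<epsilon> k) + BQ * (5 * \<epsilon> k)"
          using d1 \<delta> BQ xc s(1) px ek by (intro add_mono mult_mono order_trans[OF d1] mult_right_mono) auto
        finally have d3: "\<bar>u x\<bar> \<le> (BQ + 1) * (5 * \<epsilon> k)" by (simp add: algebra_simps)
        have "\<bar>L0 x * (u x * c1 k x)\<bar> \<le> \<bar>L0 x\<bar> * (((BQ + 1) * (5 * \<epsilon> k)) * (B / \<epsilon> k))"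
          unfolding abs_mult by (intro mult_left_mono mult_mono d3 b1) (use BQ ek in auto)
        also have "\<dots> = A1 * \<bar>L0 x\<bar>" using ek by (simp add: A1_def field_simps)
        finally have t1: "\<bar>L0 x * (u x * c1 k x)\<bar> \<le> A1 * \<bar>L0 x\<bar>" .
        have "\<bar>\<kappa> x\<bar> \<le> entry_sum (K x) * (norm (g x) * norm (g x))" unfolding \<kappa>_def by (rule quadratic_form_bound)
        also have "\<dots> \<le> entry_sum (K x) * (Bg * Bg)" using Bg xc entry_sum_nonneg by (intro mult_left_mono mult_mono) auto
        finally have kb: "\<bar>\<kappa> x\<bar> \<le> entry_sum (K x) * Bg\<^sup>2" by (simp add: power2_eq_square)
        have "\<bar>\<kappa> x * (c2 k x * (u x - Q x * \<psi> x))\<bar> \<le> (entry_sum (K x) * Bg\<^sup>2) * ((B / (\<epsilon> k)\<^sup>2) * (\<delta> * (5 * \<epsilon> k)))"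
          unfolding abs_mult by (intro mult_mono kb b2 d1 mult_nonneg_nonneg entry_sum_nonneg) (use B(1) \<delta> ek in auto)
        also have "\<dots> = (5 * B * Bg\<^sup>2) * \<delta> / \<epsilon> k * entry_sum (K x)" using ek by (simp add: field_simps power2_eq_square)
        finally have t2: "\<bar>\<kappa> x * (c2 k x * (u x - Q x * \<psi> x))\<bar> \<le> (5 * B * Bg\<^sup>2) * \<delta> / \<epsilon> k * entry_sum (K x)" .
        have "\<bar>(K x *v ((2 * c1 k x) *\<^sub>R g x)) \<bullet> (Du x - Q x *\<^sub>R g x)\<bar> \<le> entry_sum (K x) * (norm ((2 * c1 k x) *\<^sub>R g x) * norm (Du x - Q x *\<^sub>R g x))"
          by (rule quadratic_form_bound)
        also have "norm ((2 * c1 k x) *\<^sub>R g x) = (2 * \<bar>c1 k x\<bar>) * norm (g x)" by (simp add: abs_mult)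
        also have "entry_sum (K x) * ((2 * \<bar>c1 k x\<bar>) * norm (g x) * norm (Du x - Q x *\<^sub>R g x)) \<le> entry_sum (K x) * ((2 * (B / \<epsilon> k)) * Bg * \<delta>)"
          using b1 Bg xc d2 entry_sum_nonneg B(1) ek by (intro mult_left_mono mult_mono) auto
        also have "\<dots> = (2 * B * Bg) * \<delta> / \<epsilon> k * entry_sum (K x)" by (simp add: field_simps)
        finally have t3: "\<bar>(K x *v ((2 * c1 k x) *\<^sub>R g x)) \<bullet> (Du x - Q x *\<^sub>R g x)\<bar> \<le> (2 * B * Bg) * \<delta> / \<epsilon> k * entry_sum (K x)" .
        have sum: "A2 * \<delta> / \<epsilon> k * entry_sum (K x) = (5 * B * Bg\<^sup>2) * \<delta> / \<epsilon> k * entry_sum (K x) + (2 * B * Bg) * \<delta> / \<epsilon> k * entry_sum (K x)"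
          by (simp add: A2_def algebra_simps add_divide_distrib)
        have "\<bar>E k x\<bar> \<le> \<bar>L0 x * (u x * c1 k x)\<bar> + \<bar>\<kappa> x * (c2 k x * (u x - Q x * \<psi> x))\<bar> + \<bar>(K x *v ((2 * c1 k x) *\<^sub>R g x)) \<bullet> (Du x - Q x *\<^sub>R g x)\<bar>"
          unfolding E_def by linarith
        then show ?thesis using t1 t2 t3 sum by (simp add: s(2))
      qed
      have "\<bar>integral\<^sup>L ?M (E k)\<bar> \<le> (\<integral>x. \<bar>E k x\<bar> \<partial>?M)" by (rule integral_abs_bound)
      also have "\<dots> \<le> (\<integral>x. A1 * (\<bar>L0 x\<bar> * in_strip (\<epsilon> k) (\<psi> x)) + (A2 * \<delta> / \<epsilon> k) * (in_strip (\<epsilon> k) (\<psi> x) * entry_sum (K x)) \<partial>?M)"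
        by (rule integral_mono[OF integrable_abs[OF Ei]]) (use pt in \<open>auto intro!: Bochner_Integration.integrable_add integrable_mult_right L0i2 esi2\<close>)
      also have "\<dots> = A1 * (\<integral>x. \<bar>L0 x\<bar> * in_strip (\<epsilon> k) (\<psi> x) \<partial>?M) + (A2 * \<delta> / \<epsilon> k) * (\<integral>x. in_strip (\<epsilon> k) (\<psi> x) * entry_sum (K x) \<partial>?M)"
        using L0i2 esi2 by simp
      also have "\<dots> \<le> A1 * (\<integral>x. \<bar>L0 x\<bar> * in_strip (\<epsilon> k) (\<psi> x) \<partial>?M) + (A2 * \<delta> / \<epsilon> k) * (C0 * \<epsilon> k)"
        using A \<delta> ek by (intro add_left_mono mult_left_mono strip) auto
      also have "(A2 * \<delta> / \<epsilon> k) * (C0 * \<epsilon> k) = A2 * \<delta> * C0" using ek by simp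
      finally show "\<bar>integral\<^sup>L ?M (E k)\<bar> \<le> A1 * (\<integral>x. \<bar>L0 x\<bar> * in_strip (\<epsilon> k) (\<psi> x) \<partial>?M) + A2 * \<delta> * C0" .
    qed
  qed
  have Elim: "(\<lambda>k. integral\<^sup>L ?M (E k)) \<longlonglongrightarrow> 0"
  proof (rule tendstoI)
    fix e :: real assume e: "e > 0"
    define \<delta> where "\<delta> = min 1 (e / (2 * A2 * (\<bar>C0\<bar> + 1)))"
    have \<delta>: "0 < \<delta>" "\<delta> \<le> 1" using e A by (auto simp: \<delta>_def intro!: divide_pos_pos mult_pos_pos add_nonneg_pos)
    have "A2 * \<delta> * C0 \<le> A2 * (e / (2 * A2 * (\<bar>C0\<bar> + 1))) * \<bar>C0\<bar>"
      using A \<delta> e by (intro order_trans[OF mult_left_mono[OF abs_ge_self[of C0]]] mult_right_mono mult_left_mono) (auto simp: \<delta>_def)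
    also have "\<dots> = (e / 2) * (\<bar>C0\<bar> / (\<bar>C0\<bar> + 1))" using A by (simp add: add_nonneg_pos)
    also have "\<dots> \<le> (e / 2) * 1" using e by (intro mult_left_mono) (auto simp: divide_le_eq_1)
    also have "\<dots> = e / 2" by simp
    finally have 1: "A2 * \<delta> * C0 \<le> e / 2" .
    have "(\<lambda>k. A1 * (\<integral>x. \<bar>L0 x\<bar> * in_strip (\<epsilon> k) (\<psi> x) \<partial>?M)) \<longlonglongrightarrow> A1 * 0"
      using lim0 by (intro tendsto_mult tendsto_const) simp
    then have "\<forall>\<^sub>F k in sequentially. A1 * (\<integral>x. \<bar>L0 x\<bar> * in_strip (\<epsilon> k) (\<psi> x) \<partial>?M) < e / 2"
      using e by (intro order_tendstoD(2)) auto
    with Ebound[OF \<delta>] show "\<forall>\<^sub>F k in sequentially. dist (integral\<^sup>L ?M (E k)) 0 < e"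
      by eventually_elim (use 1 in \<open>simp add: dist_real_def\<close>)
  qed
  have "(\<lambda>k. - (\<integral>x. L x * c k x \<partial>?M) - integral\<^sup>L ?M (E k)) \<longlonglongrightarrow> - (\<integral>x. L x * 1 \<partial>?M) - 0"
    by (intro tendsto_intros limL Elim)
  moreover have "- (\<integral>x. L x * c k x \<partial>?M) - integral\<^sup>L ?M (E k) = (\<integral>x. Q x * layer_density K \<psi> g (\<epsilon> k) x \<partial>?M)" for k
    using ident[of k] by simp
  ultimately show ?thesis by (simp add: L_def)
qed

section \<open>Weak limits of measures on a compact set\<close>

text \<open>In base three with digits 0 and 2 the first difference is not outweighed by all later ones. In base
  two it could be, as in \<open>0.0111... = 0.1000...\<close>, and the coding below would not be injective.\<close>
lemma ternary_separation:
  fixes a b :: "nat \<Rightarrow> real"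
  assumes a: "\<And>k. a k \<in> {0, 1}" and b: "\<And>k. b k \<in> {0, 1}"
    and k: "a k \<noteq> b k" "\<And>j. j < k \<Longrightarrow> a j = b j"
  shows "1 / 3 ^ Suc k \<le> \<bar>(\<Sum>j. 2 * a j / 3 ^ Suc j) - (\<Sum>j. 2 * b j / 3 ^ Suc j)\<bar>"
proof -
  have geo: "summable (\<lambda>j. 2 / 3 ^ Suc j :: real)"
    using summable_mult[OF summable_geometric[of "1/3::real"], of "2/3"] by (simp add: power_divide field_simps)
  have sm: "summable (\<lambda>j. 2 * c j / 3 ^ Suc j)" if "\<And>k. c k \<in> {0, 1::real}" for c
  proof (rule summable_comparison_test'[OF geo, of 0])
    fix n show "norm (2 * c n / 3 ^ Suc n) \<le> 2 / 3 ^ Suc n" using that[of n] by auto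
  qed
  define c where "c j = 2 * a j / 3 ^ Suc j - 2 * b j / 3 ^ Suc j" for j
  have sc: "summable c" unfolding c_def by (intro summable_diff sm a b)
  have cb: "\<bar>c j\<bar> \<le> 2 / 3 ^ Suc j" for j using a[of j] b[of j] by (auto simp: c_def)
  have "(\<Sum>j. 2 * a j / 3 ^ Suc j) - (\<Sum>j. 2 * b j / 3 ^ Suc j) = suminf c"
    unfolding c_def by (intro suminf_diff sm a b)
  also have "\<dots> = (\<Sum>j. c (j + Suc k)) + sum c {..<Suc k}"
    by (rule suminf_split_initial_segment[OF sc])
  also have "sum c {..<Suc k} = c k" using k(2) by (simp add: c_def)
  finally have eq: "(\<Sum>j. 2 * a j / 3 ^ Suc j) - (\<Sum>j. 2 * b j / 3 ^ Suc j) = (\<Sum>j. c (j + Suc k)) + c k" .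
  have "\<bar>c k\<bar> = 2 / 3 ^ Suc k" using a[of k] b[of k] k(1) by (auto simp: c_def)
  moreover have "\<bar>\<Sum>j. c (j + Suc k)\<bar> \<le> 1 / 3 ^ Suc k"
  proof -
    have g: "(\<lambda>j. 2 / 3 ^ Suc (j + Suc k) :: real) sums (1 / 3 ^ Suc k)"
      using sums_mult[OF geometric_sums[of "1/3::real"], of "2 / 3 ^ Suc (Suc k)"]
      by (simp add: power_divide power_add field_simps)
    have "norm (\<Sum>j. c (j + Suc k)) \<le> (\<Sum>j. 2 / 3 ^ Suc (j + Suc k))"
    proof (rule norm_suminf_le)
      show "norm (c (j + Suc k)) \<le> 2 / 3 ^ Suc (j + Suc k)" for j using cb[of "j + Suc k"] by simp
    qed (use g in \<open>auto simp: sums_iff\<close>)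
    then show ?thesis using g by (simp add: sums_iff)
  qed
  moreover have "2 / 3 ^ Suc k = 1 / 3 ^ Suc k + (1::real) / 3 ^ Suc k" by simp
  ultimately show ?thesis unfolding eq by linarith
qed

text \<open>Helly's selection theorem concerns measures on the line. To carry it over to \<open>K\<close>, points
  are coded by real numbers: the ternary digits of \<open>s x\<close> say to which members of a countable basis \<open>x\<close>
  belongs. The code \<open>s\<close> is merely Borel measurable, but on the compact set \<open>K\<close> its inverse is uniformly continuous,
  and only the inverse has to be continuous.\<close>
lemma compact_real_coding:
  fixes K :: "'a::euclidean_space set"
  assumes "compact K"
  obtains s :: "'a \<Rightarrow> real" and \<phi> :: "real \<Rightarrow> 'a"
  where "s \<in> borel_measurable borel" "\<And>x. s x \<in> {0..1}" "continuous_on UNIV \<phi>"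
    "\<And>x. x \<in> K \<Longrightarrow> \<phi> (s x) = x"
proof -
  obtain B :: "'a set set" where B: "countable B" "topological_basis B"
    using ex_countable_basis by blast
  have "B \<noteq> {}" using topological_basisE[OF B(2) open_UNIV UNIV_I] by blast
  define U where "U = from_nat_into B"
  have U: "open (U k)" for k
    using from_nat_into[OF \<open>B \<noteq> {}\<close>] B(2) by (auto simp: U_def topological_basis_open)
  have Ub: "\<exists>k. x \<in> U k \<and> U k \<subseteq> V" if "open V" "x \<in> V" for x V
    using topological_basisE[OF B(2) that] from_nat_into_surj[OF B(1)] unfolding U_def by metis
  define s where "s x = (\<Sum>k. 2 * indicator (U k) x / 3 ^ Suc k :: real)" for x
  have ind: "indicator (U k) x \<in> {0, 1::real}" for k x by (auto simp: indicator_def)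
  have geo: "(\<lambda>j. 2 / 3 ^ Suc j :: real) sums 1"
    using sums_mult[OF geometric_sums[of "1/3::real"], of "2/3"] by (simp add: power_divide field_simps)
  have sm: "summable (\<lambda>k. 2 * indicator (U k) x / 3 ^ Suc k :: real)" for x
  proof (rule summable_comparison_test'[OF sums_summable[OF geo], of 0])
    fix n show "norm (2 * indicator (U n) x / 3 ^ Suc n :: real) \<le> 2 / 3 ^ Suc n" by (auto simp: indicator_def)
  qed
  have meas: "s \<in> borel_measurable borel"
    unfolding s_def[abs_def] using U by (intro borel_measurable_suminf) auto
  have range: "s x \<in> {0..1}" for x
  proof -
    have "0 \<le> s x" unfolding s_def by (intro suminf_nonneg sm) auto
    moreover have "s x \<le> (\<Sum>j. 2 / 3 ^ Suc j)" unfolding s_def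
      by (intro suminf_le sm sums_summable[OF geo]) (auto simp: indicator_def)
    ultimately show ?thesis using geo by (simp add: sums_iff)
  qed
  (* Finitely many basic sets of diameter at most e cover K; codes that agree in the digits
     belonging to them put both points into a common one. *)
  have sep: "\<exists>d>0. \<forall>x\<in>K. \<forall>y\<in>K. \<bar>s x - s y\<bar> < d \<longrightarrow> dist x y < e" if "e > 0" for e
  proof -
    let ?C = "{k. \<exists>z. U k \<subseteq> ball z (e/2)}"
    have KC: "K \<subseteq> (\<Union>k\<in>?C. U k)"
    proof
      fix x assume "x \<in> K"
      then show "x \<in> (\<Union>k\<in>?C. U k)" using Ub[of "ball x (e/2)" x] that by auto
    qed
    obtain F where F: "F \<subseteq> ?C" "finite F" "K \<subseteq> (\<Union>k\<in>F. U k)"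
      by (rule compactE_image[OF assms U KC])
    define m where "m = Max (insert 0 F)"
    have m: "k \<le> m" if "k \<in> F" for k using F(2) that by (auto simp: m_def)
    show ?thesis
    proof (intro exI[of _ "1 / 3 ^ Suc m"] conjI ballI impI)
      fix x y assume xy: "x \<in> K" "y \<in> K" "\<bar>s x - s y\<bar> < 1 / 3 ^ Suc m"
      have agree: "(x \<in> U k) = (y \<in> U k)" if "k \<le> m" for k
      proof (rule ccontr)
        assume "(x \<in> U k) \<noteq> (y \<in> U k)"
        then have ex: "indicator (U k) x \<noteq> (indicator (U k) y :: real)" by (auto simp: indicator_def)
        define l where "l = (LEAST k. indicator (U k) x \<noteq> (indicator (U k) y :: real))"
        have l: "indicator (U l) x \<noteq> (indicator (U l) y :: real)" "l \<le> k"
          unfolding l_def by (rule LeastI[of _ k], rule ex) (rule Least_le, rule ex)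
        have "1 / 3 ^ Suc l \<le> \<bar>s x - s y\<bar>" unfolding s_def
          by (rule ternary_separation[of "\<lambda>k. indicator (U k) x" "\<lambda>k. indicator (U k) y", OF ind ind l(1)])
            (use not_less_Least l_def in blast)
        moreover have "(1::real) / 3 ^ Suc m \<le> 1 / 3 ^ Suc l"
          using l(2) that by (intro divide_left_mono power_increasing) auto
        ultimately show False using xy(3) by linarith
      qed
      obtain k where k: "k \<in> F" "x \<in> U k" using F(3) xy(1) by blast
      obtain z where z: "U k \<subseteq> ball z (e/2)" using F(1) k(1) by blast
      have "x \<in> ball z (e/2)" "y \<in> ball z (e/2)" using agree[OF m[OF k(1)]] k(2) z by auto
      then show "dist x y < e" using dist_triangle_half_r[of z x e y] by simp
    qed auto
  qed
  have inj: "inj_on s K"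
  proof (rule inj_onI)
    fix x y assume "x \<in> K" "y \<in> K" "s x = s y"
    then have "dist x y < e" if "e > 0" for e using sep[OF that] by fastforce
    then show "x = y" by (metis dist_pos_lt less_irrefl)
  qed
  have "uniformly_continuous_on (s ` K) (inv_into K s)"
    unfolding uniformly_continuous_on_def
  proof (intro allI impI)
    fix e :: real assume "e > 0"
    then obtain d where d: "d > 0" "\<And>x y. x\<in>K \<Longrightarrow> y\<in>K \<Longrightarrow> \<bar>s x - s y\<bar> < d \<Longrightarrow> dist x y < e" using sep by blast
    then show "\<exists>d>0. \<forall>x\<in>s ` K. \<forall>x'\<in>s ` K. dist x' x < d \<longrightarrow> dist (inv_into K s x') (inv_into K s x) < e"
      by (intro exI[of _ d]) (auto simp: inj dist_real_def)
  qed
  from uniformly_continuous_on_extension_on_closure[OF this]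
  obtain g where g: "uniformly_continuous_on (closure (s ` K)) g" "\<And>x. x \<in> s ` K \<Longrightarrow> inv_into K s x = g x"
    by metis
  obtain \<phi> :: "real \<Rightarrow> 'a" where phi: "continuous_on UNIV \<phi>" "\<And>x. x \<in> closure (s ` K) \<Longrightarrow> \<phi> x = g x"
    by (rule Tietze_unbounded[OF uniformly_continuous_imp_continuous[OF g(1)], of UNIV]) auto
  have "\<phi> (s x) = x" if "x \<in> K" for x
    using that phi(2)[of "s x"] g(2)[of "s x"] closure_subset[of "s ` K"] inj by auto
  then show thesis using that meas range phi(1) by blast
qed

text \<open>Push the measures to the unit interval by the code, take a weak limit there, and bring it back by
  the continuous decoding map. Tightness is automatic.\<close>
proposition weakly_convergent_subsequence:
  fixes K :: "'a::euclidean_space set" and \<mu> :: "nat \<Rightarrow> 'a measure"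
  assumes K: "compact K" and prob: "\<And>n. prob_space (\<mu> n)" and sets: "\<And>n. sets (\<mu> n) = sets borel"
    and supp: "\<And>n. AE x in \<mu> n. x \<in> K"
  obtains r :: "nat \<Rightarrow> nat" and M :: "'a measure" where "strict_mono r" "prob_space M" "sets M = sets borel"
    "\<And>f :: 'a \<Rightarrow> real. continuous_on UNIV f \<Longrightarrow> bounded (range f) \<Longrightarrow> (\<lambda>n. \<integral>x. f x \<partial>\<mu> (r n)) \<longlonglongrightarrow> (\<integral>x. f x \<partial>M)"
proof -
  obtain s :: "'a \<Rightarrow> real" and \<phi> where s: "s \<in> borel_measurable borel" "\<And>x. s x \<in> {0..1}" 
    and phi: "continuous_on UNIV \<phi>" and inv: "\<And>x. x \<in> K \<Longrightarrow> \<phi> (s x) = x"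
    using compact_real_coding[OF K] by metis
  have sm: "s \<in> measurable (\<mu> n) borel" for n
    using s(1) measurable_cong_sets[OF sets[of n] refl] by auto
  have phim: "\<phi> \<in> borel_measurable borel" by (rule borel_measurable_continuous_onI[OF phi])
  define \<nu> where "\<nu> n = distr (\<mu> n) borel s" for n
  have rd: "real_distribution (\<nu> n)" for n
  proof -
    interpret prob_space "\<mu> n" by (rule prob)
    show ?thesis unfolding \<nu>_def by (intro real_distribution.intro prob_space_distr sm real_distribution_axioms.intro) auto
  qed
  have tight: "tight \<nu>"
    unfolding tight_def
  proof (intro conjI allI impI rd)
    fix \<epsilon> :: real assume "\<epsilon> > 0"
    have "measure (\<nu> n) {-1<..2} = 1" for n
    proof -
      interpret prob_space "\<mu> n" by (rule prob)
      have "measure (\<nu> n) {-1<..2} = measure (\<mu> n) (s -` {-1<..2} \<inter> space (\<mu> n))"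
        unfolding \<nu>_def by (rule measure_distr[OF sm]) auto
      also have "s -` {-1<..2} \<inter> space (\<mu> n) = space (\<mu> n)"
      proof -
        have "s x \<in> {-1<..2}" for x using s(2)[of x] by auto
        then show ?thesis by auto
      qed
      finally show ?thesis by (simp add: prob_space)
    qed
    then show "\<exists>a b. a < b \<and> (\<forall>n. 1 - \<epsilon> < measure (\<nu> n) {a<..b})"
      using \<open>\<epsilon> > 0\<close> by (intro exI[of _ "-1"] exI[of _ 2]) auto
  qed
  obtain r N where r: "strict_mono r" "real_distribution N" "weak_conv_m (\<nu> \<circ> id \<circ> r) N"
    using tight_imp_convergent_subsubsequence[OF tight strict_mono_id] by blast
  interpret N: real_distribution N by fact
  have Nm: "\<phi> \<in> measurable N borel" using phim by simp
  show thesis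
  proof (rule that[OF r(1)])
    show "prob_space (distr N borel \<phi>)" by (rule N.prob_space_distr[OF Nm])
    fix f :: "'a \<Rightarrow> real" assume f: "continuous_on UNIV f" "bounded (range f)"
    then obtain B where B: "\<And>x. norm (f x) \<le> B" by (auto simp: bounded_iff)
    have fm: "f \<in> borel_measurable borel" by (rule borel_measurable_continuous_onI[OF f(1)])
    have "(\<lambda>n. integral\<^sup>L ((\<nu> \<circ> id \<circ> r) n) (\<lambda>t. f (\<phi> t))) \<longlonglongrightarrow> integral\<^sup>L N (\<lambda>t. f (\<phi> t))"
    proof (rule weak_conv_imp_integral_bdd_continuous_conv[where B=B])
      show "real_distribution ((\<nu> \<circ> id \<circ> r) n)" for n using rd by simp
      show "isCont (\<lambda>t. f (\<phi> t)) t" for t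
        using continuous_on_compose2[OF f(1) phi] by (simp add: continuous_on_eq_continuous_at)
    qed (use r B in \<open>auto simp: o_def\<close>)
    moreover have "integral\<^sup>L (\<nu> n) (\<lambda>t. f (\<phi> t)) = (\<integral>x. f x \<partial>\<mu> n)" for n
    proof -
      have "integral\<^sup>L (\<nu> n) (\<lambda>t. f (\<phi> t)) = (\<integral>x. f (\<phi> (s x)) \<partial>\<mu> n)"
        unfolding \<nu>_def using fm phim by (intro integral_distr sm) auto
      also have "\<dots> = (\<integral>x. f x \<partial>\<mu> n)"
      proof (rule integral_cong_AE)
        show "(\<lambda>x. f (\<phi> (s x))) \<in> borel_measurable (\<mu> n)" "f \<in> borel_measurable (\<mu> n)"
          using s(1) fm phim measurable_cong_sets[OF sets[of n] refl, of "borel :: real measure"] by (auto)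
        show "AE x in \<mu> n. f (\<phi> (s x)) = f x" using supp[of n] by eventually_elim (simp add: inv)
      qed
      finally show ?thesis .
    qed
    moreover have "(\<integral>x. f x \<partial>distr N borel \<phi>) = integral\<^sup>L N (\<lambda>t. f (\<phi> t))"
      by (rule integral_distr[OF Nm fm])
    ultimately show "(\<lambda>n. \<integral>x. f x \<partial>\<mu> (r n)) \<longlonglongrightarrow> (\<integral>x. f x \<partial>distr N borel \<phi>)" by simp
  qed simp
qed

section \<open>Differences of finite measures\<close>

lemma signed_measure_diff:
  assumes "finite_measure N1" "finite_measure N2" "sets N1 = sets M" "sets N2 = sets M"
  shows "signed_measure_on M (\<lambda>S. measure N1 S - measure N2 S)"
proof -
  interpret N1: finite_measure N1 by fact
  interpret N2: finite_measure N2 by fact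
  show ?thesis unfolding signed_measure_on_def
    using assms(3,4) by (auto intro!: sums_diff N1.finite_measure_UNION N2.finite_measure_UNION)
qed

text \<open>\<open>Y\<close> is the positive part of a Hahn decomposition. Discarding the part of \<open>T\<close> outside \<open>Y\<close>, and
  adding the missing part of \<open>S \<inter> Y\<close>, both increase the value of the difference; hence the supremum is attained at
  \<open>S \<inter> Y\<close>.\<close>
lemma upper_variation_diff:
  assumes f1: "finite_measure N1" and f2: "finite_measure N2" and s1: "sets N1 = sets M" and s2: "sets N2 = sets M"
    and Y: "Y \<in> sets M" "\<And>X. X \<in> sets M \<Longrightarrow> X \<subseteq> Y \<Longrightarrow> measure N2 X \<le> measure N1 X"
      "\<And>X. X \<in> sets M \<Longrightarrow> X \<inter> Y = {} \<Longrightarrow> measure N1 X \<le> measure N2 X"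
    and S: "S \<in> sets M"
  shows "emeasure (upper_variation M (\<lambda>S. measure N1 S - measure N2 S)) S
     = ennreal (measure N1 (S \<inter> Y) - measure N2 (S \<inter> Y))"
proof -
  interpret N1: finite_measure N1 by fact
  interpret N2: finite_measure N2 by fact
  let ?\<eta> = "\<lambda>S. measure N1 S - measure N2 S"
  let ?u = "\<lambda>S. SUP T \<in> {T \<in> sets M. T \<subseteq> S}. ennreal (?\<eta> T)"
  note s12[simp] = s1 s2
  have eq: "?u S = ennreal (?\<eta> (S \<inter> Y))" if S: "S \<in> sets M" for S
  proof (rule antisym)
    have SY: "S \<inter> Y \<in> sets M" using S Y(1) by auto
    show "?u S \<le> ennreal (?\<eta> (S \<inter> Y))"
    proof (rule SUP_least)
      fix T assume "T \<in> {T \<in> sets M. T \<subseteq> S}"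
      then have T: "T \<in> sets M" "T \<subseteq> S" by auto
      have "measure N1 T = measure N1 (T \<inter> Y) + measure N1 (T - Y)" "measure N2 T = measure N2 (T \<inter> Y) + measure N2 (T - Y)"
        using N1.finite_measure_Diff'[of T Y] N2.finite_measure_Diff'[of T Y] T Y(1) by auto
      moreover have "measure N1 (T - Y) \<le> measure N2 (T - Y)" by (rule Y(3)) (use T Y(1) in auto)
      moreover have "measure N1 (S \<inter> Y) = measure N1 (T \<inter> Y) + measure N1 ((S - T) \<inter> Y)"
        "measure N2 (S \<inter> Y) = measure N2 (T \<inter> Y) + measure N2 ((S - T) \<inter> Y)"
        using N1.finite_measure_Union[of "T \<inter> Y" "(S - T) \<inter> Y"] N2.finite_measure_Union[of "T \<inter> Y" "(S - T) \<inter> Y"] T S Y(1)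
        by (auto simp: Int_Un_distrib2[symmetric] Un_absorb1)
      moreover have "measure N2 ((S - T) \<inter> Y) \<le> measure N1 ((S - T) \<inter> Y)" by (rule Y(2)) (use T S Y(1) in auto)
      ultimately show "ennreal (?\<eta> T) \<le> ennreal (?\<eta> (S \<inter> Y))" by (intro ennreal_leI) linarith
    qed
    show "ennreal (?\<eta> (S \<inter> Y)) \<le> ?u S" using SY by (intro SUP_upper) auto
  qed
  have ssp: "sigma_sets (space M) (sets M) = sets M" by (rule sets.sigma_sets_eq)
  show ?thesis
    unfolding upper_variation_def
  proof (subst emeasure_measure_of_sigma)
    show "sigma_algebra (space M) (sets M)" ..
    show "S \<in> sets M" by fact
    show "?u S = ennreal (?\<eta> (S \<inter> Y))" by (rule eq[OF S])
    show "positive (sets M) ?u" by (simp add: positive_def eq)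
    show "countably_additive (sets M) ?u"
      unfolding countably_additive_def
    proof (intro allI impI)
      fix A :: "nat \<Rightarrow> _" assume A: "range A \<subseteq> sets M" "disjoint_family A" "\<Union>(range A) \<in> sets M"
      have nn: "0 \<le> ?\<eta> (A i \<inter> Y)" for i using A(1) Y by (simp add: range_subsetD sets.Int)
      have "(\<lambda>i. ?\<eta> (A i \<inter> Y)) sums ?\<eta> (\<Union>i. A i \<inter> Y)"
        using A Y(1) by (intro sums_diff N1.finite_measure_UNION N2.finite_measure_UNION) (auto simp: disjoint_family_on_def)
      then have "(\<Sum>i. ennreal (?\<eta> (A i \<inter> Y))) = ennreal (?\<eta> (\<Union>i. A i \<inter> Y))"
        using nn by (intro suminf_ennreal_eq) auto
      moreover have "(\<Union>i. A i \<inter> Y) = \<Union>(range A) \<inter> Y" by auto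
      ultimately show "(\<Sum>i. ?u (A i)) = ?u (\<Union>(range A))"
        using eq A by (simp add: range_subsetD)
    qed
  qed
qed

text \<open>Equality of sums of measures is used instead of equality of differences, which avoids subtraction of
  possibly infinite values.\<close>
lemma nn_integral_measure_sum_eq:
  assumes f: "f \<in> borel_measurable M"
    and s: "sets A = sets M" "sets B = sets M" "sets C = sets M" "sets D = sets M"
    and e: "\<And>S. S \<in> sets M \<Longrightarrow> emeasure A S + emeasure B S = emeasure C S + emeasure D S"
  shows "(\<integral>\<^sup>+x. f x \<partial>A) + (\<integral>\<^sup>+x. f x \<partial>B) = (\<integral>\<^sup>+x. f x \<partial>C) + (\<integral>\<^sup>+x. f x \<partial>D)"
proof -
  have m: "borel_measurable A = (borel_measurable M :: (_ \<Rightarrow> ennreal) set)" "borel_measurable B = (borel_measurable M :: (_ \<Rightarrow> ennreal) set)"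
     "borel_measurable C = (borel_measurable M :: (_ \<Rightarrow> ennreal) set)" "borel_measurable D = (borel_measurable M :: (_ \<Rightarrow> ennreal) set)"
    by (auto intro!: measurable_cong_sets s)
  have sp: "space A = space M" "space B = space M" "space C = space M" "space D = space M"
    using s by (auto dest: sets_eq_imp_space_eq)
  show ?thesis using f
  proof (induction rule: borel_measurable_induct)
    case (cong f g)
    then have "(\<integral>\<^sup>+x. f x \<partial>A) = (\<integral>\<^sup>+x. g x \<partial>A)" "(\<integral>\<^sup>+x. f x \<partial>B) = (\<integral>\<^sup>+x. g x \<partial>B)"
      "(\<integral>\<^sup>+x. f x \<partial>C) = (\<integral>\<^sup>+x. g x \<partial>C)" "(\<integral>\<^sup>+x. f x \<partial>D) = (\<integral>\<^sup>+x. g x \<partial>D)"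
      by (auto intro!: nn_integral_cong simp: sp)
    then show ?case using cong by simp
  next
    case (set S) then show ?case using e[of S] s by simp
  next
    case (mult u c) then show ?case by (simp add: nn_integral_cmult m distrib_left[symmetric])
  next
    case (add u v)
    have ac: "(a + b) + (c + d) = (a + c) + (b + d)" for a b c d :: ennreal by (simp add: ac_simps)
    have n: "(\<integral>\<^sup>+x. v x + u x \<partial>N) = (\<integral>\<^sup>+x. v x \<partial>N) + (\<integral>\<^sup>+x. u x \<partial>N)"
      if "borel_measurable N = (borel_measurable M :: (_ \<Rightarrow> ennreal) set)" for N
      by (rule nn_integral_add) (simp_all only: that add(1,3))
    show ?case unfolding m[THEN n]
      using add.IH by (metis (no_types) ac)
  next
    case (seq U)
    have i: "incseq (\<lambda>i. \<integral>\<^sup>+x. U i x \<partial>N)" for N using seq(3) by (auto simp: incseq_def le_fun_def intro!: nn_integral_mono)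
    have c: "(\<integral>\<^sup>+x. (SUP i. U i) x \<partial>N) = (SUP i. \<integral>\<^sup>+x. U i x \<partial>N)" if "borel_measurable N = (borel_measurable M :: (_ \<Rightarrow> ennreal) set)" for N
      using nn_integral_monotone_convergence_SUP[OF seq(3), of N] seq(1) that by (simp add: image_comp)
    have "(\<integral>\<^sup>+x. (SUP i. U i) x \<partial>A) + (\<integral>\<^sup>+x. (SUP i. U i) x \<partial>B)
        = (SUP i. (\<integral>\<^sup>+x. U i x \<partial>A) + (\<integral>\<^sup>+x. U i x \<partial>B))"
      unfolding c[OF m(1)] c[OF m(2)] by (rule ennreal_SUP_add[OF i i, symmetric])
    also have "\<dots> = (SUP i. (\<integral>\<^sup>+x. U i x \<partial>C) + (\<integral>\<^sup>+x. U i x \<partial>D))"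
      by (rule SUP_cong[OF refl]) (use seq.IH in auto)
    also have "\<dots> = (\<integral>\<^sup>+x. (SUP i. U i) x \<partial>C) + (\<integral>\<^sup>+x. (SUP i. U i) x \<partial>D)"
      unfolding c[OF m(3)] c[OF m(4)] by (rule ennreal_SUP_add[OF i i])
    finally show ?case .
  qed
qed

text \<open>The Jordan decomposition \<open>P - Q\<close> of the difference satisfies \<open>P + N2 = Q + N1\<close>, so the integrals
  agree by \<open>nn_integral_measure_sum_eq\<close> applied to both parts of \<open>f\<close>.\<close>
proposition signed_integral_diff:
  assumes f1: "finite_measure N1" and f2: "finite_measure N2" and s1: "sets N1 = sets M" and s2: "sets N2 = sets M"
    and f: "f \<in> borel_measurable M" "\<And>x. x \<in> space M \<Longrightarrow> \<bar>f x\<bar> \<le> B"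
  shows "signed_integral M (\<lambda>S. measure N1 S - measure N2 S) f = (\<integral>x. f x \<partial>N1) - (\<integral>x. f x \<partial>N2)"
proof -
  interpret N1: finite_measure N1 by fact
  interpret N2: finite_measure N2 by fact
  let ?\<eta> = "\<lambda>S. measure N1 S - measure N2 S"
  let ?P = "upper_variation M ?\<eta>" and ?Q = "upper_variation M (\<lambda>S. - ?\<eta> S)"
  obtain Y where Y: "Y \<in> sets M" "\<And>X. X \<in> sets M \<Longrightarrow> X \<subseteq> Y \<Longrightarrow> emeasure N2 X \<le> emeasure N1 X"
      "\<And>X. X \<in> sets M \<Longrightarrow> X \<inter> Y = {} \<Longrightarrow> emeasure N1 X \<le> emeasure N2 X"
    using finite_unsigned_Hahn_decomposition[OF f1 f2] s1 s2 by auto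
  then have Y': "\<And>X. X \<in> sets M \<Longrightarrow> X \<subseteq> Y \<Longrightarrow> measure N2 X \<le> measure N1 X"
      "\<And>X. X \<in> sets M \<Longrightarrow> X \<inter> Y = {} \<Longrightarrow> measure N1 X \<le> measure N2 X"
    by (simp_all add: N1.emeasure_eq_measure N2.emeasure_eq_measure)
  let ?Z = "space M - Y"
  have P: "emeasure ?P S = ennreal (?\<eta> (S \<inter> Y))" if "S \<in> sets M" for S
    by (rule upper_variation_diff[OF f1 f2 s1 s2 Y(1) Y' that])
  have Q: "emeasure ?Q S = ennreal (measure N2 (S \<inter> ?Z) - measure N1 (S \<inter> ?Z))" if S: "S \<in> sets M" for S
  proof -
    have "emeasure (upper_variation M (\<lambda>S. measure N2 S - measure N1 S)) S
       = ennreal (measure N2 (S \<inter> ?Z) - measure N1 (S \<inter> ?Z))"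
    proof (rule upper_variation_diff[OF f2 f1 s2 s1 _ _ _ S])
      show "?Z \<in> sets M" using Y(1) by auto
      show "measure N1 X \<le> measure N2 X" if "X \<in> sets M" "X \<subseteq> ?Z" for X
        by (rule Y'(2)) (use that in auto)
      show "measure N2 X \<le> measure N1 X" if X: "X \<in> sets M" "X \<inter> ?Z = {}" for X
        by (rule Y'(1)) (use X sets.sets_into_space[OF X(1)] in auto)
    qed
    then show ?thesis by simp
  qed
  have sP: "sets ?P = sets M" "sets ?Q = sets M" by (simp_all add: upper_variation_def)
  have spP: "space ?P = space M" "space ?Q = space M" "space N1 = space M" "space N2 = space M"
    using sP s1 s2 by (auto dest: sets_eq_imp_space_eq)
  have fin: "finite_measure ?P" "finite_measure ?Q"
    using P[OF sets.top] Q[OF sets.top] by (auto intro!: finite_measureI simp: spP(1) spP(2)[simplified])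
  have e: "emeasure ?P S + emeasure N2 S = emeasure ?Q S + emeasure N1 S" if S: "S \<in> sets M" for S
  proof -
    have SY: "S \<inter> Y \<in> sets M" "S \<inter> ?Z \<in> sets M" using S Y(1) by auto
    have "S \<inter> ?Z = S - Y" using sets.sets_into_space[OF S] by auto
    then have m: "measure N1 S = measure N1 (S \<inter> Y) + measure N1 (S \<inter> ?Z)" "measure N2 S = measure N2 (S \<inter> Y) + measure N2 (S \<inter> ?Z)"
      using N1.finite_measure_Diff'[of S Y] N2.finite_measure_Diff'[of S Y] S Y(1) s1 s2 by auto
    have n: "0 \<le> ?\<eta> (S \<inter> Y)" "0 \<le> measure N2 (S \<inter> ?Z) - measure N1 (S \<inter> ?Z)"
    proof -
      have "S \<inter> ?Z \<inter> Y = {}" by auto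
      then show "0 \<le> ?\<eta> (S \<inter> Y)" "0 \<le> measure N2 (S \<inter> ?Z) - measure N1 (S \<inter> ?Z)"
        using Y'(1)[OF SY(1)] Y'(2)[OF SY(2)] by simp_all
    qed
    then show ?thesis
      unfolding P[OF S] Q[OF S] by (simp add: N1.emeasure_eq_measure N2.emeasure_eq_measure m flip: ennreal_plus)
  qed
  have nn: "(\<integral>\<^sup>+x. ennreal (g x) \<partial>?P) + (\<integral>\<^sup>+x. ennreal (g x) \<partial>N2) = (\<integral>\<^sup>+x. ennreal (g x) \<partial>?Q) + (\<integral>\<^sup>+x. ennreal (g x) \<partial>N1)"
    if "g \<in> borel_measurable M" for g :: "'a \<Rightarrow> real"
    by (rule nn_integral_measure_sum_eq[OF _ sP(1) s2 sP(2) s1 e]) (use that in auto)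
  have int: "integrable N g" if N: "N \<in> {?P, ?Q, N1, N2}" and g: "g \<in> borel_measurable M" "\<And>x. x \<in> space M \<Longrightarrow> \<bar>g x\<bar> \<le> B" for N and g :: "'a \<Rightarrow> real"
  proof -
    have "finite_measure N" "sets N = sets M" "space N = space M" using N fin f1 f2 sP s1 s2 spP by auto
    then show ?thesis using g measurable_cong_sets[of N M borel borel]
      by (intro finite_measure.integrable_const_bound[where B=B]) auto
  qed
  have pos: "(\<integral>x. g x \<partial>?P) + (\<integral>x. g x \<partial>N2) = (\<integral>x. g x \<partial>?Q) + (\<integral>x. g x \<partial>N1)"
    if g: "g \<in> borel_measurable M" "\<And>x. x \<in> space M \<Longrightarrow> \<bar>g x\<bar> \<le> B" "\<And>x. 0 \<le> g x" for g :: "'a \<Rightarrow> real"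
  proof -
    have "ennreal ((\<integral>x. g x \<partial>?P) + (\<integral>x. g x \<partial>N2)) = ennreal ((\<integral>x. g x \<partial>?Q) + (\<integral>x. g x \<partial>N1))"
      using nn[OF g(1)] int[OF _ g(1,2)] g(3) by (simp add: nn_integral_eq_integral)
    then show ?thesis using g(3) by (subst (asm) ennreal_inj) (auto intro!: add_nonneg_nonneg integral_nonneg)
  qed
  let ?p = "\<lambda>x. max 0 (f x)" and ?n = "\<lambda>x. max 0 (- f x)"
  have "\<bar>max 0 t\<bar> \<le> \<bar>t\<bar>" "\<bar>max 0 (- t)\<bar> \<le> \<bar>t\<bar>" for t :: real by auto
  then have b: "\<And>x. x \<in> space M \<Longrightarrow> \<bar>?p x\<bar> \<le> B" "\<And>x. x \<in> space M \<Longrightarrow> \<bar>?n x\<bar> \<le> B"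
    using f(2) order_trans by blast+
  have m: "?p \<in> borel_measurable M" "?n \<in> borel_measurable M" using f(1) by auto
  have sp: "(\<integral>x. f x \<partial>N) = (\<integral>x. ?p x \<partial>N) - (\<integral>x. ?n x \<partial>N)" if "N \<in> {?P, ?Q, N1, N2}" for N
  proof -
    have "(\<integral>x. f x \<partial>N) = (\<integral>x. ?p x - ?n x \<partial>N)" by (intro Bochner_Integration.integral_cong) (auto simp: max_def)
    then show ?thesis using Bochner_Integration.integral_diff[OF int[OF that m(1) b(1)] int[OF that m(2) b(2)]] by simp
  qed
  show ?thesis unfolding signed_integral_def
    using pos[OF m(1) b(1)] pos[OF m(2) b(2)] sp by simp
qed

section \<open>Boundary measures as weak limits\<close>

lemma integral_density_indicator_add:
  fixes v f :: "'a::euclidean_space \<Rightarrow> real"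
  assumes v: "integrable lborel v" "\<And>x. 0 \<le> v x" and b: "0 \<le> b"
    and f: "continuous_on UNIV f" "bounded (range f)"
  shows "(\<integral>x. f x \<partial>density lborel (\<lambda>x. ennreal (v x + b * indicator (ball z 1) x)))
      = (\<integral>x. v x * f x \<partial>lborel) + b * (\<integral>x. indicator (ball z 1) x * f x \<partial>lborel)"
proof -
  have fm: "f \<in> borel_measurable borel" by (rule borel_measurable_continuous_onI[OF f(1)])
  have vm: "v \<in> borel_measurable borel" using borel_measurable_integrable[OF v(1)] by simp
  obtain B where B: "\<And>x. \<bar>f x\<bar> \<le> B" using f(2) by (auto simp: bounded_iff)
  have ib: "integrable lborel (\<lambda>x. indicator (ball z 1) x :: real)"
    using emeasure_bounded_finite[of "ball z 1"] by (intro integrable_real_indicator) auto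
  have i: "integrable lborel (\<lambda>x. v x * f x)" "integrable lborel (\<lambda>x. indicator (ball z 1) x * f x)"
    by (rule integrable_mult_bounded[OF v(1) _ AE_I2[OF B]] integrable_mult_bounded[OF ib _ AE_I2[OF B]]; use fm in simp)+
  have "(\<integral>x. f x \<partial>density lborel (\<lambda>x. ennreal (v x + b * indicator (ball z 1) x)))
      = (\<integral>x. (v x + b * indicator (ball z 1) x) *\<^sub>R f x \<partial>lborel)"
  proof (rule integral_density)
    show "(\<lambda>x. v x + b * indicator (ball z 1) x) \<in> borel_measurable lborel"
      unfolding measurable_lborel2 by (intro borel_measurable_add borel_measurable_times borel_measurable_const borel_measurable_indicator vm) simp
  qed (use fm v(2) b in auto)
  also have "\<dots> = (\<integral>x. v x * f x + b * (indicator (ball z 1) x * f x) \<partial>lborel)"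
    by (simp add: algebra_simps)
  also have "\<dots> = (\<integral>x. v x * f x \<partial>lborel) + b * (\<integral>x. indicator (ball z 1) x * f x \<partial>lborel)"
    using i by simp
  finally show ?thesis .
qed

text \<open>The compactness theorem concerns probability measures, and the masses of the densities \<open>v k\<close> need not converge.
  Therefore the missing mass is placed on a ball at a positive distance from \<open>D\<close>; continuous
  functions can be redefined to vanish there. The limit lives on the frontier and that ball, because
  the densities live where \<open>\<psi> \<le> 5 \<epsilon>\<close>.\<close>
lemma boundary_limit_nonneg:
  fixes D :: "(real^'n::finite) set" and v :: "nat \<Rightarrow> real^'n \<Rightarrow> real" and z :: "real^'n"
  assumes D: "open D" "bounded D" and psi: "defining_function D \<psi> g h"
    and z: "cball z 1 \<inter> closure D = {}"
    and v: "\<And>k. integrable lborel (v k)" "\<And>k x. 0 \<le> v k x" "\<And>k. (\<integral>x. v k x \<partial>lborel) \<le> 1"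
      "\<And>k x. v k x \<noteq> 0 \<Longrightarrow> x \<in> D \<and> \<psi> x \<le> 5 * \<epsilon> k"
    and \<epsilon>: "\<epsilon> \<longlonglongrightarrow> (0::real)"
  obtains r :: "nat \<Rightarrow> nat" and N where "strict_mono r" "finite_measure N" "sets N = sets (restrict_space borel (frontier D))"
    "\<And>f. continuous_on UNIV f \<Longrightarrow> (\<lambda>k. \<integral>x. v (r k) x * f x \<partial>lborel) \<longlonglongrightarrow> (\<integral>x. f x \<partial>N)"
proof -
  define V where "V = measure lborel (ball z 1)"
  have V: "V > 0" unfolding V_def by (simp add: content_ball_pos)
  define s where "s k = (\<integral>x. v k x \<partial>lborel)" for k
  define b where "b k = (1 - s k) / V" for k
  have b: "0 \<le> b k" for k using v(3)[of k] V by (simp add: b_def s_def)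
  define \<mu> where "\<mu> k = density lborel (\<lambda>x. ennreal (v k x + b k * indicator (ball z 1) x))" for k
  have vm: "v k \<in> borel_measurable borel" for k using borel_measurable_integrable[OF v(1)] by simp
  have ib: "integrable lborel (\<lambda>x. indicator (ball z 1) x :: real)"
    using emeasure_bounded_finite[of "ball z 1"] by (intro integrable_real_indicator) auto
  have wm: "(\<lambda>x. ennreal (v k x + b k * indicator (ball z 1) x)) \<in> borel_measurable lborel" for k
    unfolding measurable_lborel2
    by (intro measurable_compose[OF _ measurable_ennreal] borel_measurable_add borel_measurable_times borel_measurable_const borel_measurable_indicator vm) simp
  have prob: "prob_space (\<mu> k)" for k
  proof
    have "integrable lborel (\<lambda>x. v k x + b k * indicator (ball z 1) x)" using v(1) ib by auto
    then have "(\<integral>\<^sup>+x. ennreal (v k x + b k * indicator (ball z 1) x) \<partial>lborel) = ennreal (\<integral>x. v k x + b k * indicator (ball z 1) x \<partial>lborel)"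
      using v(2) b by (intro nn_integral_eq_integral) auto
    also have "(\<integral>x. v k x + b k * indicator (ball z 1) x \<partial>lborel) = s k + b k * V"
      using v(1) ib by (simp add: s_def V_def)
    also have "\<dots> = 1" using V by (simp add: b_def)
    finally show "emeasure (\<mu> k) (space (\<mu> k)) = 1"
      using wm by (simp add: \<mu>_def emeasure_density)
  qed
  let ?K = "closure D \<union> cball z 1"
  have Kc: "compact ?K" using D(2) by (intro compact_Un) auto
  have sets: "sets (\<mu> k) = sets borel" for k by (simp add: \<mu>_def)
  have supp0: "AE x in \<mu> k. (x \<in> D \<and> \<psi> x \<le> 5 * \<epsilon> k) \<or> x \<in> cball z 1" for k
    unfolding \<mu>_def AE_density[OF wm]
  proof (intro AE_I2 impI)
    fix x assume "0 < ennreal (v k x + b k * indicator (ball z 1) x)"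
    then have "v k x \<noteq> 0 \<or> x \<in> ball z 1" by (auto split: split_indicator_asm)
    then show "(x \<in> D \<and> \<psi> x \<le> 5 * \<epsilon> k) \<or> x \<in> cball z 1" using v(4)[of k x] by auto
  qed
  have supp: "AE x in \<mu> k. x \<in> ?K" for k
    using supp0[of k] by eventually_elim (use closure_subset in auto)
  obtain r M where r: "strict_mono r" and M: "prob_space M" "sets M = sets borel"
    and lim: "\<And>f :: real^'n \<Rightarrow> real. continuous_on UNIV f \<Longrightarrow> bounded (range f) \<Longrightarrow> (\<lambda>n. \<integral>x. f x \<partial>\<mu> (r n)) \<longlonglongrightarrow> (\<integral>x. f x \<partial>M)"
    by (rule weakly_convergent_subsequence[of ?K \<mu>, OF Kc prob sets supp], rule that)
  interpret M: prob_space M by fact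
  have mM: "borel_measurable M = (borel_measurable borel :: ((real^'n) \<Rightarrow> real) set)" using measurable_cong_sets[OF M(2) refl] .
  let ?F = "frontier D \<union> cball z 1"
  have Fcl: "closed ?F" "?F \<noteq> {}" by (auto intro!: closed_Un)
  have suppM: "AE x in M. x \<in> ?F"
  proof -
    define f where "f x = min 1 (infdist x ?F)" for x
    have fc: "continuous_on UNIV f" unfolding f_def[abs_def] by (intro continuous_intros)
    have fb: "0 \<le> f x" "f x \<le> 1" for x by (auto simp: f_def infdist_nonneg)
    have fbd: "bounded (range f)" unfolding bounded_iff using fb by (intro exI[of _ 1]) auto
    have f0: "f x = 0" if "x \<in> ?F" for x using that by (simp add: f_def)
    have fmu: "f \<in> borel_measurable (\<mu> k)" for k
      using borel_measurable_continuous_onI[OF fc] measurable_cong_sets[OF sets[of k] refl] by blast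
    have "(\<lambda>n. \<integral>x. f x \<partial>\<mu> n) \<longlonglongrightarrow> 0"
    proof (rule tendstoI)
      fix e :: real assume e: "e > 0"
      obtain e1 where e1: "e1 > 0" "\<And>x. x \<in> closure D \<Longrightarrow> \<psi> x < e1 \<Longrightarrow> f x < e / 2"
        by (rule small_near_frontier[OF D psi continuous_on_subset[OF fc subset_UNIV], of "e/2"]) (use f0 e in auto)
      have "\<forall>\<^sub>F n in sequentially. \<epsilon> n < e1 / 5" using order_tendstoD(2)[OF \<epsilon>, of "e1/5"] e1 by simp
      then show "\<forall>\<^sub>F n in sequentially. dist (\<integral>x. f x \<partial>\<mu> n) 0 < e"
      proof eventually_elim
        case (elim n)
        interpret mn: prob_space "\<mu> n" by (rule prob)
        have "AE x in \<mu> n. f x \<le> e / 2"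
          using supp0[of n]
        proof eventually_elim
          case (elim x)
          then show ?case
          proof
            assume "x \<in> D \<and> \<psi> x \<le> 5 * \<epsilon> n"
            then show ?thesis using e1(2)[of x] closure_subset[of D] \<open>\<epsilon> n < e1 / 5\<close> by fastforce
          qed (use f0[of x] e in auto)
        qed
        then have "(\<integral>x. f x \<partial>\<mu> n) \<le> (\<integral>x. e / 2 \<partial>\<mu> n)"
        proof (intro integral_mono_AE)
          show "integrable (\<mu> n) f" using fmu[of n] fb by (intro mn.integrable_const_bound[where B=1]) auto
        qed auto
        then have "(\<integral>x. f x \<partial>\<mu> n) \<le> e / 2" using mn.prob_space by simp
        moreover have "0 \<le> (\<integral>x. f x \<partial>\<mu> n)" using fb by simp
        ultimately show ?case using e by (simp add: dist_real_def)
      qed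
    qed
    then have "(\<lambda>n. \<integral>x. f x \<partial>\<mu> (r n)) \<longlonglongrightarrow> 0" by (rule filterlim_compose[OF _ filterlim_subseq[OF r]])
    then have "(\<integral>x. f x \<partial>M) = 0" using LIMSEQ_unique[OF lim[OF fc fbd]] by simp
    moreover have "integrable M f" using fb borel_measurable_continuous_onI[OF fc] mM by (intro M.integrable_const_bound[where B=1]) auto
    ultimately have "AE x in M. f x = 0" using fb by (subst (asm) integral_nonneg_eq_0_iff_AE) auto
    then show ?thesis
    proof eventually_elim
      case (elim x)
      then have "infdist x ?F = 0" using infdist_nonneg[of x ?F] by (simp add: f_def min_def split: if_splits)
      then show ?case using in_closed_iff_infdist_zero[OF Fcl] by blast
    qed
  qed
  have Fb: "frontier D \<in> sets M" using M(2) by (simp add: borel_closed)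
  show thesis
  proof (rule that[OF r])
    show "finite_measure (restrict_space M (frontier D))"
      using Fb by (intro finite_measure_restrict_space M.finite_measure_axioms) auto
    show "sets (restrict_space M (frontier D)) = sets (restrict_space borel (frontier D))"
      using M(2) by (rule sets_restrict_space_cong)
    fix f :: "real^'n \<Rightarrow> real" assume f: "continuous_on UNIV f"
    let ?f = "\<lambda>x. if x \<in> closure D then f x else 0"
    have fK: "continuous_on ?K ?f"
      by (rule continuous_on_cases) (use z in \<open>auto intro: continuous_on_subset[OF f]\<close>)
    have "compact (closure D)" using D(2) by simp
    then have "bounded (f ` closure D)" by (intro compact_imp_bounded compact_continuous_image continuous_on_subset[OF f]) auto
    then obtain B where B: "B > 0" "\<And>x. x \<in> closure D \<Longrightarrow> norm (f x) \<le> B" by (auto simp: bounded_pos)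
    have "closedin (top_of_set UNIV) ?K" using compact_imp_closed[OF Kc] by simp
    moreover have "norm (?f x) \<le> B" if "x \<in> ?K" for x using B by (simp add: less_imp_le)
    ultimately obtain F where F: "continuous_on UNIV F" "\<And>x. x \<in> ?K \<Longrightarrow> F x = ?f x" "\<And>x. x \<in> UNIV \<Longrightarrow> norm (F x) \<le> B"
      using Tietze[OF fK, of UNIV B] less_imp_le[OF B(1)] by metis
    have Fbd: "bounded (range F)" unfolding bounded_iff using F(3) by auto
    have "(\<integral>x. F x \<partial>\<mu> k) = (\<integral>x. v k x * f x \<partial>lborel)" for k
    proof -
      have "(\<integral>x. F x \<partial>\<mu> k) = (\<integral>x. v k x * F x \<partial>lborel) + b k * (\<integral>x. indicator (ball z 1) x * F x \<partial>lborel)"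
        unfolding \<mu>_def by (rule integral_density_indicator_add[OF v(1,2) b F(1) Fbd])
      also have "(\<lambda>x. indicator (ball z 1) x * F x) = (\<lambda>x. 0)"
      proof
        fix x show "indicator (ball z 1) x * F x = 0"
        proof (cases "x \<in> ball z 1")
          case True
          then have "x \<in> cball z 1" by simp
          moreover then have "x \<notin> closure D" using z by blast
          ultimately show ?thesis using F(2)[of x] by simp
        qed simp
      qed
      also have "(\<lambda>x. v k x * F x) = (\<lambda>x. v k x * f x)"
      proof
        fix x show "v k x * F x = v k x * f x"
        proof (cases "v k x = 0")
          case False
          then have "x \<in> closure D" using v(4)[of k x] closure_subset by blast
          then show ?thesis using F(2)[of x] by simp
        qed simp
      qed
      finally show ?thesis by simp
    qed
    moreover have "(\<integral>x. F x \<partial>M) = (\<integral>x. f x \<partial>restrict_space M (frontier D))"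
    proof -
      have fm: "f \<in> borel_measurable M" "F \<in> borel_measurable M" using borel_measurable_continuous_onI f F(1) mM by auto
      have "(\<integral>x. f x \<partial>restrict_space M (frontier D)) = (\<integral>x. indicator (frontier D) x *\<^sub>R f x \<partial>M)"
        using Fb by (intro integral_restrict_space) auto
      also have "\<dots> = (\<integral>x. F x \<partial>M)"
      proof (rule integral_cong_AE)
        show "(\<lambda>x. indicator (frontier D) x *\<^sub>R f x) \<in> borel_measurable M" using fm(1) Fb by simp
        show "AE x in M. indicator (frontier D) x *\<^sub>R f x = F x"
          using suppM
        proof eventually_elim
          case (elim x)
          have fc: "frontier D \<subseteq> closure D" by (auto simp: frontier_def)
          show ?case
          proof (cases "x \<in> frontier D")
            case True then show ?thesis using F(2)[of x] fc by auto
          next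
            case False
            then have "x \<in> cball z 1" "x \<notin> closure D" using elim z by blast+
            then show ?thesis using False F(2)[of x] by simp
          qed
        qed
      qed (use fm in simp)
      finally show ?thesis by simp
    qed
    ultimately show "(\<lambda>k. \<integral>x. v (r k) x * f x \<partial>lborel) \<longlonglongrightarrow> (\<integral>x. f x \<partial>restrict_space M (frontier D))"
      using lim[OF F(1) Fbd] by simp
  qed
qed

text \<open>Both signs are treated separately, the second one along a subsequence of the subsequence found for
  the first.\<close>
proposition boundary_limit_measures:
  fixes D :: "(real^'n::finite) set" and m :: "nat \<Rightarrow> real^'n \<Rightarrow> real" and C :: real
  assumes D: "open D" "bounded D" and psi: "defining_function D \<psi> g h"
    and m: "\<And>k. integrable (lebesgue_on D) (m k)" "\<And>k. (\<integral>x. \<bar>m k x\<bar> \<partial>lebesgue_on D) \<le> C"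
      "\<And>k x. x \<in> D \<Longrightarrow> m k x \<noteq> 0 \<Longrightarrow> \<psi> x \<le> 5 * \<epsilon> k"
    and \<epsilon>: "\<epsilon> \<longlonglongrightarrow> (0::real)"
  obtains r :: "nat \<Rightarrow> nat" and N1 N2 where "strict_mono r" "finite_measure N1" "finite_measure N2"
    "sets N1 = sets (restrict_space borel (frontier D))" "sets N2 = sets (restrict_space borel (frontier D))"
    "\<And>f. continuous_on UNIV f \<Longrightarrow> (\<lambda>k. \<integral>x. f x * m (r k) x \<partial>lebesgue_on D) \<longlonglongrightarrow> (\<integral>x. f x \<partial>N1) - (\<integral>x. f x \<partial>N2)"
proof -
  obtain R where R: "closure D \<subseteq> cball 0 R" "R > 0"
    using bounded_closure[OF D(2)] unfolding bounded_pos by (auto simp: subset_iff)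
  (* A unit ball about this point is disjoint from the closure of D. *)
  define z :: "real^'n" where "z = (R + 2) *\<^sub>R axis undefined 1"
  have nz: "norm z = R + 2" using R(2) by (simp add: z_def norm_axis_1)
  have z: "cball z 1 \<inter> closure D = {}"
  proof (rule ccontr)
    assume "cball z 1 \<inter> closure D \<noteq> {}"
    then obtain x where x: "x \<in> cball z 1" "x \<in> closure D" by blast
    then have "dist z x \<le> 1" "norm x \<le> R" using subsetD[OF R(1) x(2)] by simp_all
    then show False using norm_triangle_ineq2[of z x] nz by (simp add: dist_norm)
  qed
  (* A positive bound to divide by. *)
  define C' where "C' = \<bar>C\<bar> + 1"
  have C': "C' > 0" "C \<le> C'" by (auto simp: C'_def)
  have psc: "continuous_on UNIV \<psi>" using psi C2_with_cont(1) by (auto simp: defining_function_def)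
  let ?P = "\<lambda>k f. f \<in> borel_measurable borel \<and> (\<forall>x. x \<notin> D \<longrightarrow> f x = 0) \<and> (AE x in lebesgue_on D. f x = m k x)"
  have "\<exists>f. ?P k f" for k by (rule borel_version[OF D(1) borel_measurable_integrable[OF m(1)[of k]]]) blast
  then have "\<exists>m'. \<forall>k. ?P k (m' k)" by (intro choice allI)
  then obtain m' where m': "\<And>k. m' k \<in> borel_measurable borel" "\<And>k x. x \<notin> D \<Longrightarrow> m' k x = 0" "\<And>k. AE x in lebesgue_on D. m' k x = m k x" by blast
  define w where "w k x = indicator {x. \<psi> x \<le> 5 * \<epsilon> k} x * m' k x" for k x
  have cl: "closed {x. \<psi> x \<le> 5 * \<epsilon> k}" for k by (intro closed_Collect_le continuous_intros psc)
  have w: "w k \<in> borel_measurable borel" "\<And>x. x \<notin> D \<Longrightarrow> w k x = 0" "AE x in lebesgue_on D. w k x = m k x" for k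
  proof -
    show "w k \<in> borel_measurable borel" unfolding w_def[abs_def]
      by (intro borel_measurable_times borel_measurable_indicator borel_closed cl m'(1))
    show "w k x = 0" if "x \<notin> D" for x using m'(2)[OF that] by (simp add: w_def)
    have "AE x in lebesgue_on D. x \<in> D" using D(1) by (intro AE_I2) simp
    with m'(3)[of k] show "AE x in lebesgue_on D. w k x = m k x"
      by eventually_elim (use m(3)[of _ k] in \<open>auto simp: w_def indicator_def\<close>)
  qed
  have ws: "x \<in> D \<and> \<psi> x \<le> 5 * \<epsilon> k" if "w k x \<noteq> 0" for k x
    using that w(2)[of x k] by (auto simp: w_def split: split_indicator_asm)
  have wi: "integrable lborel (w k)" for k
    using integral_borel_version(2)[OF D(1) borel_measurable_integrable[OF m(1)[of k]] w(1) _ w(3)] w(2) m(1) by blast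
  have wabs: "(\<integral>x. \<bar>w k x\<bar> \<partial>lborel) \<le> C'" for k
  proof -
    have "(\<integral>x. \<bar>m k x\<bar> \<partial>lebesgue_on D) = (\<integral>x. \<bar>w k x\<bar> \<partial>lborel)"
    proof (rule integral_borel_version(1)[OF D(1)])
      show "(\<lambda>x. \<bar>m k x\<bar>) \<in> borel_measurable (lebesgue_on D)" using borel_measurable_integrable[OF m(1)[of k]] by simp
      show "(\<lambda>x. \<bar>w k x\<bar>) \<in> borel_measurable borel" using w(1) by simp
      show "AE x in lebesgue_on D. \<bar>w k x\<bar> = \<bar>m k x\<bar>" using w(3)[of k] by eventually_elim simp
    qed (simp add: w(2))
    then show ?thesis using m(2)[of k] C'(2) by simp
  qed
  define vp vn where "vp k x = max 0 (w k x) / C'" and "vn k x = max 0 (- w k x) / C'" for k x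
  have vpi: "integrable lborel (vp k)" "integrable lborel (vn k)" for k
    unfolding vp_def[abs_def] vn_def[abs_def] using wi[of k] by (auto intro!: integrable_max)
  have le1: "(\<integral>x. vp k x \<partial>lborel) \<le> 1" "(\<integral>x. vn k x \<partial>lborel) \<le> 1" for k
  proof -
    have i: "integrable lborel (\<lambda>x. \<bar>w k x\<bar> / C')" using wi[of k] by auto
    have e: "(\<integral>x. \<bar>w k x\<bar> / C' \<partial>lborel) \<le> 1" using wabs[of k] C' by simp
    have "(\<integral>x. vp k x \<partial>lborel) \<le> (\<integral>x. \<bar>w k x\<bar> / C' \<partial>lborel)"
      using C' by (intro integral_mono vpi i) (auto simp: vp_def intro!: divide_right_mono)
    then show "(\<integral>x. vp k x \<partial>lborel) \<le> 1" using e by linarith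
    have "(\<integral>x. vn k x \<partial>lborel) \<le> (\<integral>x. \<bar>w k x\<bar> / C' \<partial>lborel)"
      using C' by (intro integral_mono vpi i) (auto simp: vn_def intro!: divide_right_mono)
    then show "(\<integral>x. vn k x \<partial>lborel) \<le> 1" using e by linarith
  qed
  have nn: "0 \<le> vp k x" "0 \<le> vn k x" for k x using C' by (auto simp: vp_def vn_def)
  have sp: "x \<in> D \<and> \<psi> x \<le> 5 * \<epsilon> k" if "vp k x \<noteq> 0" for k x by (rule ws) (use that in \<open>auto simp: vp_def\<close>)
  have sn: "x \<in> D \<and> \<psi> x \<le> 5 * \<epsilon> k" if "vn k x \<noteq> 0" for k x by (rule ws) (use that in \<open>auto simp: vn_def\<close>)
  obtain r1 N1 where r1: "strict_mono r1" and N1: "finite_measure N1" "sets N1 = sets (restrict_space borel (frontier D))"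
    "\<And>f. continuous_on UNIV f \<Longrightarrow> (\<lambda>k. \<integral>x. vp (r1 k) x * f x \<partial>lborel) \<longlonglongrightarrow> (\<integral>x. f x \<partial>N1)"
    by (rule boundary_limit_nonneg[OF D psi z vpi(1) nn(1) le1(1) sp \<epsilon>], assumption, rule that)
  have \<epsilon>1: "(\<lambda>k. \<epsilon> (r1 k)) \<longlonglongrightarrow> 0" by (rule filterlim_compose[OF \<epsilon> filterlim_subseq[OF r1]])
  obtain r2 N2 where r2: "strict_mono r2" and N2: "finite_measure N2" "sets N2 = sets (restrict_space borel (frontier D))"
    "\<And>f. continuous_on UNIV f \<Longrightarrow> (\<lambda>k. \<integral>x. vn (r1 (r2 k)) x * f x \<partial>lborel) \<longlonglongrightarrow> (\<integral>x. f x \<partial>N2)"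
    by (rule boundary_limit_nonneg[OF D psi z vpi(2) nn(2) le1(2) sn \<epsilon>1], assumption, rule that)
  let ?N = "\<lambda>N. density N (\<lambda>_. ennreal C')"
  have fin: "finite_measure (?N N)" if "finite_measure N" for N :: "(real^'n) measure"
  proof -
    interpret finite_measure N by fact
    show ?thesis by (rule finite_measureI) (simp add: emeasure_density ennreal_mult_eq_top_iff emeasure_eq_measure)
  qed
  have int: "(\<integral>x. f x \<partial>?N N) = C' * (\<integral>x. f x \<partial>N)" if "continuous_on UNIV f" "sets N = sets (restrict_space borel (frontier D))" for N :: "(real^'n) measure" and f :: "real^'n \<Rightarrow> real"
  proof -
    have "f \<in> borel_measurable (restrict_space borel (frontier D))"
      using borel_measurable_continuous_onI[OF that(1)] by (rule measurable_restrict_space1)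
    then have "f \<in> borel_measurable N" using measurable_cong_sets[OF that(2) refl] by blast
    then show ?thesis using C' by (subst integral_density) auto
  qed
  show thesis
  proof (rule that[of "r1 \<circ> r2" "?N N1" "?N N2"])
    show "strict_mono (r1 \<circ> r2)" using r1 r2 by (rule strict_mono_o)
    fix f :: "real^'n \<Rightarrow> real" assume f: "continuous_on UNIV f"
    have "(\<lambda>k. \<integral>x. vp (r1 (r2 k)) x * f x \<partial>lborel) \<longlonglongrightarrow> (\<integral>x. f x \<partial>N1)"
      by (rule filterlim_compose[OF N1(3)[OF f] filterlim_subseq[OF r2]])
    then have lim: "(\<lambda>k. C' * (\<integral>x. vp (r1 (r2 k)) x * f x \<partial>lborel) - C' * (\<integral>x. vn (r1 (r2 k)) x * f x \<partial>lborel)) \<longlonglongrightarrow> C' * (\<integral>x. f x \<partial>N1) - C' * (\<integral>x. f x \<partial>N2)"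
      by (intro tendsto_intros N2(3)[OF f])
    have "(\<integral>x. f x * m k x \<partial>lebesgue_on D) = C' * (\<integral>x. vp k x * f x \<partial>lborel) - C' * (\<integral>x. vn k x * f x \<partial>lborel)" for k
    proof -
      have fm: "f \<in> borel_measurable borel" by (rule borel_measurable_continuous_onI[OF f])
      have "compact (closure D)" using D(2) by simp
      then have "bounded (f ` closure D)" by (intro compact_imp_bounded compact_continuous_image continuous_on_subset[OF f]) auto
      then obtain B where B: "\<And>x. x \<in> closure D \<Longrightarrow> \<bar>f x\<bar> \<le> B" by (auto simp: bounded_iff)
      define f' where "f' x = indicator D x * f x" for x
      have f'b: "\<bar>f' x\<bar> \<le> \<bar>B\<bar>" for x using B[of x] closure_subset[of D] by (auto simp: f'_def split: split_indicator)
      have f'm: "f' \<in> borel_measurable borel" unfolding f'_def[abs_def] using fm D(1) by simp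
      have i: "integrable lborel (\<lambda>x. v x * f' x)" if "integrable lborel v" for v
        by (rule integrable_mult_bounded[OF that _ AE_I2[OF f'b]]) (use f'm in simp)
      have eqv: "vp k x * f x = vp k x * f' x" "vn k x * f x = vn k x * f' x" for x
        using sp[of k x] sn[of k x] by (auto simp: f'_def split: split_indicator)
      have "(\<integral>x. f x * m k x \<partial>lebesgue_on D) = (\<integral>x. w k x * f' x \<partial>lborel)"
      proof (rule integral_borel_version(1)[OF D(1)])
        show "(\<lambda>x. f x * m k x) \<in> borel_measurable (lebesgue_on D)"
          using D(1) by (intro borel_measurable_times continuous_imp_measurable_lebesgue_on[OF f] borel_measurable_integrable[OF m(1)]) simp
        show "(\<lambda>x. w k x * f' x) \<in> borel_measurable borel" using w(1) f'm by simp
        have "AE x in lebesgue_on D. x \<in> D" using D(1) by (intro AE_I2) simp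
        with w(3)[of k] show "AE x in lebesgue_on D. w k x * f' x = f x * m k x"
          by eventually_elim (simp add: f'_def)
      qed (simp add: w(2))
      also have "\<dots> = (\<integral>x. C' * (vp k x * f' x) - C' * (vn k x * f' x) \<partial>lborel)"
      proof (rule Bochner_Integration.integral_cong[OF refl])
        fix x
        have eq: "w k x = C' * vp k x - C' * vn k x" using C' by (auto simp: vp_def vn_def max_def)
        show "w k x * f' x = C' * (vp k x * f' x) - C' * (vn k x * f' x)" unfolding eq by (simp add: algebra_simps)
      qed
      also have "\<dots> = C' * (\<integral>x. vp k x * f' x \<partial>lborel) - C' * (\<integral>x. vn k x * f' x \<partial>lborel)"
        using i[OF vpi(1)] i[OF vpi(2)] by simp
      finally show ?thesis unfolding eqv .
    qed
    then show "(\<lambda>k. \<integral>x. f x * m ((r1 \<circ> r2) k) x \<partial>lebesgue_on D) \<longlonglongrightarrow> (\<integral>x. f x \<partial>?N N1) - (\<integral>x. f x \<partial>?N N2)"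
      using lim by (simp add: int[OF f N1(2)] int[OF f N2(2)])
  qed (use N1 N2 fin in auto)
qed

section \<open>The Dirichlet problem\<close>

lemma gradient_lower_bound:
  fixes D :: "(real^'n::finite) set"
  assumes D: "open D" "bounded D" and psi: "defining_function D \<psi> g h"
  obtains c e where "c > 0" "e > 0" "\<And>x. x \<in> closure D \<Longrightarrow> \<psi> x < e \<Longrightarrow> c \<le> norm (g x)"
proof -
  have C: "C2_with \<psi> g h" using psi by (simp add: defining_function_def)
  have cn: "continuous_on S (\<lambda>x. norm (g x))" for S by (intro continuous_intros C2_with_cont[OF C])
  obtain c where c: "c > 0" "\<And>x. x \<in> frontier D \<Longrightarrow> c < norm (g x)"
  proof (cases "frontier D = {}")
    case False
    have "compact (frontier D)" using D(2) by (rule compact_frontier_bounded)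
    then obtain y where y: "y \<in> frontier D" "\<And>x. x \<in> frontier D \<Longrightarrow> norm (g y) \<le> norm (g x)"
      using continuous_attains_inf[OF _ False cn] by metis
    have "0 < norm (g y)" using psi y(1) by (simp add: defining_function_def)
    then have "norm (g y) / 2 < norm (g x)" if "x \<in> frontier D" for x using y(2)[OF that] by linarith
    then show thesis by (rule that[OF half_gt_zero[OF \<open>0 < norm (g y)\<close>]])
  qed (use that[of 1] in auto)
  have cm: "continuous_on (closure D) (\<lambda>x. - norm (g x))" by (intro continuous_intros cn)
  (* The lemma on small values bounds continuous functions from above, hence the minus signs. *)
  obtain e where "e > 0" "\<And>x. x \<in> closure D \<Longrightarrow> \<psi> x < e \<Longrightarrow> - norm (g x) < - c"
    by (rule small_near_frontier[OF D psi cm, of "- c"]) (use c(2) in auto)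
  then show thesis using that[OF c(1)] by (meson less_imp_le neg_less_iff_less)
qed

lemma strip_integral:
  fixes D :: "(real^'n::finite) set"
  assumes D: "open D" "bounded D" and psi: "defining_function D \<psi> g h"
  obtains C where "C \<ge> 0" "\<And>\<epsilon>. 0 < \<epsilon> \<Longrightarrow> (\<integral>x. indicator {x. \<psi> x < \<epsilon>} x \<partial>lebesgue_on D) \<le> C * \<epsilon>"
    "\<And>\<epsilon>. integrable (lebesgue_on D) (\<lambda>x. indicator {x. \<psi> x < \<epsilon>} x :: real)"
proof -
  obtain C where C: "\<And>\<epsilon>. 0 < \<epsilon> \<Longrightarrow> measure lebesgue {x\<in>D. \<psi> x < \<epsilon>} \<le> C * \<epsilon>" by (rule strip_volume[OF D psi], rule that)
  have psc: "continuous_on UNIV \<psi>" using psi C2_with_cont(1) by (auto simp: defining_function_def)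
  have op: "open {x. \<psi> x < \<epsilon>}" for \<epsilon> by (intro open_Collect_less continuous_intros psc)
  have m: "{x\<in>D. \<psi> x < \<epsilon>} \<in> lmeasurable" for \<epsilon>
  proof (rule lmeasurable_open)
    show "bounded {x\<in>D. \<psi> x < \<epsilon>}" using D(2) by (rule bounded_subset) auto
    have "{x\<in>D. \<psi> x < \<epsilon>} = D \<inter> {x. \<psi> x < \<epsilon>}" by auto
    then show "open {x\<in>D. \<psi> x < \<epsilon>}" using op D(1) by auto
  qed
  have e: "(\<lambda>x. indicator D x *\<^sub>R (indicator {x. \<psi> x < \<epsilon>} x :: real)) = indicator {x\<in>D. \<psi> x < \<epsilon>}" for \<epsilon>
    by (auto simp: fun_eq_iff split: split_indicator)
  have Dl: "D \<inter> space lebesgue \<in> sets lebesgue" using D(1) by simp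
  show thesis
  proof (rule that[of "\<bar>C\<bar>"])
    fix \<epsilon> :: real
    show "integrable (lebesgue_on D) (\<lambda>x. indicator {x. \<psi> x < \<epsilon>} x :: real)"
      unfolding integrable_restrict_space[OF Dl] e
      using fmeasurableD2[OF m[of \<epsilon>]]
      by (intro integrable_real_indicator[OF fmeasurableD[OF m]]) (simp only: less_top infinity_ennreal_def)
    assume \<epsilon>: "0 < \<epsilon>"
    have "(\<integral>x. indicator {x. \<psi> x < \<epsilon>} x \<partial>lebesgue_on D) = (\<integral>x. (indicator {x\<in>D. \<psi> x < \<epsilon>} x :: real) \<partial>lebesgue)"
      unfolding integral_restrict_space[OF Dl] e ..
    also have "\<dots> = measure lebesgue {x\<in>D. \<psi> x < \<epsilon>}" 
      by (simp only: Bochner_Integration.integral_indicator space_completion space_lborel space_borel Int_UNIV_right)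
    also have "\<dots> \<le> C * \<epsilon>" by (rule C[OF \<epsilon>])
    also have "\<dots> \<le> \<bar>C\<bar> * \<epsilon>" using \<epsilon> by (intro mult_right_mono) auto
    finally show "(\<integral>x. indicator {x. \<psi> x < \<epsilon>} x \<partial>lebesgue_on D) \<le> \<bar>C\<bar> * \<epsilon>" .
  qed simp
qed

lemma entry_sum_closure_bound:
  fixes A :: "real^'n::finite \<Rightarrow> real^'n^'n"
  assumes "bounded D" "continuous_on (closure D) A"
  obtains a where "a > 0" "\<And>x. x \<in> closure D \<Longrightarrow> entry_sum (A x) \<le> a"
proof -
  have "continuous_on (closure D) (\<lambda>x. entry_sum (A x))" unfolding entry_sum_def by (intro continuous_intros assms(2))
  then have "bounded ((\<lambda>x. entry_sum (A x)) ` closure D)"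
    using assms(1) by (intro compact_imp_bounded compact_continuous_image) auto
  then show thesis using that by (auto simp: bounded_pos abs_le_iff)
qed

lemma entry_sum_diff_scale: "entry_sum (r *\<^sub>R A - G) \<le> \<bar>r\<bar> * entry_sum A + entry_sum G"
  unfolding entry_sum_def sum_distrib_left sum.distrib[symmetric]
  by (intro sum_mono) (simp add: abs_mult[symmetric] abs_triangle_ineq4)

text \<open>The hypotheses in the form in which the argument uses them, with a defining function fixed. The
  equation involves the data only through \<open>K\<close> and \<open>\<beta>\<close>.\<close>
locale dirichlet_data =
  fixes D :: "(real^'n::finite) set" and A G :: "real^'n \<Rightarrow> real^'n^'n" and b h :: "real^'n \<Rightarrow> real^'n"
    and p q \<theta> :: real and \<rho> :: "real^'n \<Rightarrow> real"
    and \<psi> :: "real^'n \<Rightarrow> real" and d\<psi> :: "real^'n \<Rightarrow> real^'n" and dd\<psi> :: "real^'n \<Rightarrow> real^'n^'n"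
  assumes D: "open D" "bounded D" "C2_boundary D"
    and psi: "defining_function D \<psi> d\<psi> dd\<psi>"
    and p: "p > 1" and q: "q = p / (p - 1)"
    and A_cont: "continuous_on (closure D) A" and G_cont: "continuous_on (closure D) G"
    and A_sym: "\<And>x. x \<in> closure D \<Longrightarrow> transpose (A x) = A x" and G_sym: "\<And>x. x \<in> closure D \<Longrightarrow> transpose (G x) = G x"
    and ell: "0 < \<theta>" "\<And>x v. x \<in> closure D \<Longrightarrow> \<theta> * (v \<bullet> v) \<le> (A x *v v) \<bullet> v"
    and \<rho>: "\<rho> \<in> Lp q D" and b: "\<And>i. (\<lambda>x. b x $ i) \<in> Lp p D" and h: "\<And>i. integrable (lebesgue_on D) (\<lambda>x. h x $ i)"
    and equation: "\<And>u. test_fun D u \<Longrightarrow>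
        integral\<^sup>L (lebesgue_on D) (\<lambda>x. L_op A b (hessian u) (gradient u) x * \<rho> x)
          = integral\<^sup>L (lebesgue_on D) (L_op G h (hessian u) (gradient u))"
begin

abbreviation "K x \<equiv> \<rho> x *\<^sub>R A x - G x"
abbreviation "\<beta> x \<equiv> \<rho> x *\<^sub>R b x - h x"

lemma q1: "q > 1" using p by (simp add: q field_simps)

lemma Dm: "D \<in> sets lebesgue" "D \<in> lmeasurable" using D by (auto intro: lmeasurable_open)

lemma \<rho>_integrable: "integrable (lebesgue_on D) \<rho>"
  by (rule Lp_integrable[OF \<rho> less_imp_le[OF q1] Dm(2)])

lemma one_integrable: "integrable (lebesgue_on D) (\<lambda>x. 1 :: real)"
  using finite_measure_lebesgue_on[OF Dm(2)] by (intro finite_measure.integrable_const)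

lemma closure_measurable: "continuous_on (closure D) f \<Longrightarrow> f \<in> borel_measurable (lebesgue_on D)" for f :: "real^'n \<Rightarrow> real"
  using closure_subset[of D] by (intro continuous_imp_measurable_on_sets_lebesgue Dm(1)) (auto intro: continuous_on_subset)

lemma A_entry: "continuous_on (closure D) (\<lambda>x. A x $ i $ j)" by (intro continuous_intros A_cont)
lemma G_entry: "continuous_on (closure D) (\<lambda>x. G x $ i $ j)" by (intro continuous_intros G_cont)

lemma mult_Lp:
  assumes f: "f \<in> Lp s D" and "s > 0" and c: "continuous_on (closure D) c"
  shows "(\<lambda>x. f x * c x) \<in> Lp s D"
proof -
  have "continuous_on (closure D) (\<lambda>x. \<bar>c x\<bar> powr s)" using c \<open>s > 0\<close> by (intro continuous_on_powr' continuous_intros) auto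
  then have "integrable (lebesgue_on D) (\<lambda>x. \<bar>f x\<bar> powr s * \<bar>c x\<bar> powr s)"
    using f by (intro integrable_mult_closure[OF D(1,2)]) (auto simp: Lp_def)
  moreover have "(\<lambda>x. f x * c x) \<in> borel_measurable (lebesgue_on D)"
    using f closure_measurable[OF c] by (intro borel_measurable_times) (auto simp: Lp_def)
  ultimately show ?thesis by (simp add: Lp_def abs_mult powr_mult)
qed

lemma \<rho>A_Lp: "(\<lambda>x. (\<rho> x *\<^sub>R A x) $ i $ j) \<in> Lp q D"
  using mult_Lp[OF \<rho> _ A_entry] q1 by simp

lemma G_Lp: "(\<lambda>x. G x $ i $ j) \<in> Lp q D"
proof -
  have "(\<lambda>x. 1) \<in> Lp q D" using one_integrable by (simp add: Lp_def)
  from mult_Lp[OF this _ G_entry] show ?thesis using q1 by simp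
qed

lemma K_Lp: "(\<lambda>x. K x $ i $ j) \<in> Lp q D"
proof -
  note l = \<rho>A_Lp[of i j] G_Lp[of i j]
  have lm: "(\<lambda>x. (\<rho> x *\<^sub>R A x) $ i $ j) \<in> borel_measurable (lebesgue_on D)" "(\<lambda>x. G x $ i $ j) \<in> borel_measurable (lebesgue_on D)"
    using l by (simp_all only: Lp_def mem_Collect_eq)
  have m: "(\<lambda>x. K x $ i $ j) \<in> borel_measurable (lebesgue_on D)"
    using borel_measurable_diff[OF lm] by simp
  moreover have "integrable (lebesgue_on D) (\<lambda>x. \<bar>K x $ i $ j\<bar> powr q)"
  proof (rule Bochner_Integration.integrable_bound)
    show "integrable (lebesgue_on D) (\<lambda>x. 2 powr q * (\<bar>(\<rho> x *\<^sub>R A x) $ i $ j\<bar> powr q + \<bar>G x $ i $ j\<bar> powr q))"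
      using l by (auto simp: Lp_def)
    have "\<bar>K x $ i $ j\<bar> powr q \<le> 2 powr q * (\<bar>(\<rho> x *\<^sub>R A x) $ i $ j\<bar> powr q + \<bar>G x $ i $ j\<bar> powr q)" for x
      using powr_add_le[of q "(\<rho> x *\<^sub>R A x) $ i $ j" "- G x $ i $ j"] q1 by simp
    then show "AE x in lebesgue_on D. norm (\<bar>K x $ i $ j\<bar> powr q) \<le> norm (2 powr q * (\<bar>(\<rho> x *\<^sub>R A x) $ i $ j\<bar> powr q + \<bar>G x $ i $ j\<bar> powr q))"
      by auto
  qed (use m in measurable)
  ultimately show ?thesis by (simp add: Lp_def)
qed

lemma \<rho>b_integrable: "integrable (lebesgue_on D) (\<lambda>x. (\<rho> x *\<^sub>R b x) $ i)"
proof (rule Bochner_Integration.integrable_bound)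
  show "integrable (lebesgue_on D) (\<lambda>x. \<bar>\<rho> x\<bar> powr q + \<bar>b x $ i\<bar> powr p)" using \<rho> b by (auto simp: Lp_def)
  show "(\<lambda>x. (\<rho> x *\<^sub>R b x) $ i) \<in> borel_measurable (lebesgue_on D)"
    unfolding vector_scaleR_component real_scaleR_def
    using \<rho> b[of i] by (intro borel_measurable_times) (simp_all only: Lp_def mem_Collect_eq)
  have "\<bar>s\<bar> * \<bar>t\<bar> \<le> \<bar>s\<bar> powr q + \<bar>t\<bar> powr p" for s t using Young_scaled[OF p q, of 1 s t] by simp
  then show "AE x in lebesgue_on D. norm ((\<rho> x *\<^sub>R b x) $ i) \<le> norm (\<bar>\<rho> x\<bar> powr q + \<bar>b x $ i\<bar> powr p)"
    by (auto simp: abs_mult)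
qed

lemma \<beta>_integrable: "integrable (lebesgue_on D) (\<lambda>x. \<beta> x $ i)"
  using Bochner_Integration.integrable_diff[OF \<rho>b_integrable h] by simp

lemma K_sym: "x \<in> D \<Longrightarrow> transpose (K x) = K x"
  using A_sym[of x] G_sym[of x] closure_subset[of D] by (auto simp: transpose_def vec_eq_iff)

lemma L_op_K: "L_op K \<beta> H v x = L_op A b H v x * \<rho> x - L_op G h H v x"
  unfolding L_op_expand by (simp add: algebra_simps sum.distrib sum_subtractf sum_distrib_left sum_distrib_right)

lemma L_op_\<rho>: "L_op A b H v x * \<rho> x = L_op (\<lambda>x. \<rho> x *\<^sub>R A x) (\<lambda>x. \<rho> x *\<^sub>R b x) H v x"
  unfolding L_op_expand by (simp add: algebra_simps sum.distrib sum_distrib_left sum_distrib_right)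

lemma entry_integrable:
  "integrable (lebesgue_on D) (\<lambda>x. (\<rho> x *\<^sub>R A x) $ i $ j)" "integrable (lebesgue_on D) (\<lambda>x. G x $ i $ j)"
  "integrable (lebesgue_on D) (\<lambda>x. K x $ i $ j)"
  by (rule Lp_integrable[OF \<rho>A_Lp less_imp_le[OF q1] Dm(2)] Lp_integrable[OF G_Lp less_imp_le[OF q1] Dm(2)]
      Lp_integrable[OF K_Lp less_imp_le[OF q1] Dm(2)])+

text \<open>The combination into one integral requires each side of the equation to be integrable separately; otherwise
  a side might be zero by convention.\<close>
lemma equation_K:
  assumes u: "test_fun D u"
  shows "integral\<^sup>L (lebesgue_on D) (L_op K \<beta> (hessian u) (gradient u)) = 0"
proof -
  have "Ck_on 2 UNIV u" using u by (simp add: test_fun_def)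
  note C = C2_with_cont[OF Ck_on_2_C2_with[OF this], of "closure D"]
  have 1: "integrable (lebesgue_on D) (\<lambda>x. L_op A b (hessian u) (gradient u) x * \<rho> x)"
    unfolding L_op_\<rho> by (rule L_op_integrable_continuous[OF D(1,2) entry_integrable(1) \<rho>b_integrable C(3,2)])
  have 2: "integrable (lebesgue_on D) (L_op G h (hessian u) (gradient u))"
    by (rule L_op_integrable_continuous[OF D(1,2) entry_integrable(2) h C(3,2)])
  have "integral\<^sup>L (lebesgue_on D) (L_op K \<beta> (hessian u) (gradient u))
    = (\<integral>x. L_op A b (hessian u) (gradient u) x * \<rho> x - L_op G h (hessian u) (gradient u) x \<partial>lebesgue_on D)"
    by (rule Bochner_Integration.integral_cong[OF refl]) (rule L_op_K)
  also have "\<dots> = 0" using equation[OF u] 1 2 by simp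
  finally show ?thesis .
qed

lemma in_strip_measurable: "(\<lambda>x. in_strip \<epsilon> (\<psi> x)) \<in> borel_measurable (lebesgue_on D)"
proof -
  have "C2_with \<psi> d\<psi> dd\<psi>" using psi by (simp add: defining_function_def)
  then have "\<psi> \<in> borel_measurable (lebesgue_on D)" by (intro closure_measurable C2_with_cont(1))
  moreover have "in_strip \<epsilon> \<in> borel_measurable borel" unfolding in_strip_def[abs_def] by measurable
  ultimately show ?thesis by (rule measurable_compose)
qed

lemma in_strip_integrable: "integrable (lebesgue_on D) F \<Longrightarrow> integrable (lebesgue_on D) (\<lambda>x. in_strip \<epsilon> (\<psi> x) * F x)"
  using integrable_mult_bounded[OF _ in_strip_measurable[of \<epsilon>], of F 1] by (simp add: in_strip_def mult.commute)

text \<open>The 7 is a convenient number larger than 6, so that the bound also covers the support of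
  \<open>ramp2\<close>.\<close>
lemma in_strip_le: "0 < \<epsilon> \<Longrightarrow> in_strip \<epsilon> (\<psi> x) \<le> indicator {x. \<psi> x < 7 * \<epsilon>} x"
  by (auto simp: in_strip_def split: split_indicator)

lemma strip_bounded_density:
  assumes M: "AE x in lebesgue_on D. \<bar>\<rho> x\<bar> \<le> M"
  shows "\<exists>C. \<forall>\<epsilon>>0. (\<integral>x. in_strip \<epsilon> (\<psi> x) * \<bar>\<rho> x\<bar> \<partial>lebesgue_on D) \<le> C * \<epsilon>"
proof -
  obtain C where C: "C \<ge> 0" "\<And>\<epsilon>. 0 < \<epsilon> \<Longrightarrow> (\<integral>x. indicator {x. \<psi> x < \<epsilon>} x \<partial>lebesgue_on D) \<le> C * \<epsilon>"
    "\<And>\<epsilon>. integrable (lebesgue_on D) (\<lambda>x. indicator {x. \<psi> x < \<epsilon>} x :: real)" by (rule strip_integral[OF D(1,2) psi], rule that)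
  show ?thesis
  proof (intro exI[of _ "\<bar>M\<bar> * C * 7"] allI impI)
    fix \<epsilon> :: real assume \<epsilon>: "0 < \<epsilon>"
    have "(\<integral>x. in_strip \<epsilon> (\<psi> x) * \<bar>\<rho> x\<bar> \<partial>lebesgue_on D) \<le> (\<integral>x. \<bar>M\<bar> * indicator {x. \<psi> x < 7 * \<epsilon>} x \<partial>lebesgue_on D)"
    proof (rule integral_mono_AE[OF in_strip_integrable[OF integrable_abs[OF \<rho>_integrable]]])
      show "AE x in lebesgue_on D. in_strip \<epsilon> (\<psi> x) * \<bar>\<rho> x\<bar> \<le> \<bar>M\<bar> * indicator {x. \<psi> x < 7 * \<epsilon>} x"
        using M
      proof eventually_elim
        case (elim x)
        have "in_strip \<epsilon> (\<psi> x) * \<bar>\<rho> x\<bar> \<le> indicator {x. \<psi> x < 7 * \<epsilon>} x * \<bar>M\<bar>"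
          using elim by (intro mult_mono in_strip_le[OF \<epsilon>]) auto
        then show ?case by (simp add: mult.commute)
      qed
    qed (use C(3) in auto)
    also have "\<dots> = \<bar>M\<bar> * (\<integral>x. indicator {x. \<psi> x < 7 * \<epsilon>} x \<partial>lebesgue_on D)" by simp
    also have "\<dots> \<le> \<bar>M\<bar> * (C * (7 * \<epsilon>))" using C(2)[of "7 * \<epsilon>"] \<epsilon> by (intro mult_left_mono) auto
    finally show "(\<integral>x. in_strip \<epsilon> (\<psi> x) * \<bar>\<rho> x\<bar> \<partial>lebesgue_on D) \<le> \<bar>M\<bar> * C * 7 * \<epsilon>" by (simp add: ac_simps)
  qed
qed

text \<open>The equation is tested with \<open>ramp (\<psi> / \<epsilon>)\<close> and multiplied by \<open>\<epsilon>\<close>. Its leading term is the integral of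
  \<open>(\<rho> a - \<gamma>) * ramp2 (\<psi> / \<epsilon>) / \<epsilon>\<close>, where \<open>a\<close> and \<open>\<gamma>\<close> are the quadratic forms of \<open>A\<close> and \<open>G\<close> at the gradient
  of \<open>\<psi>\<close>. The other term is bounded since \<open>ramp1\<close> is, and so is the one with \<open>\<gamma>\<close>, since the strip has volume \<open>O(\<epsilon>)\<close>.
  As \<open>\<rho>\<close> is nonnegative and \<open>a\<close> is at least \<open>c2\<close> in the strip, no cancellation can occur in the
  term with \<open>\<rho>\<close>.\<close>
lemma strip_nonneg_density:
  assumes pos: "AE x in lebesgue_on D. 0 \<le> \<rho> x"
  shows "\<exists>C e0. 0 < e0 \<and> (\<forall>\<epsilon>. 0 < \<epsilon> \<longrightarrow> \<epsilon> < e0 \<longrightarrow> (\<integral>x. in_strip \<epsilon> (\<psi> x) * \<bar>\<rho> x\<bar> \<partial>lebesgue_on D) \<le> C * \<epsilon>)"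
proof -
  let ?M = "lebesgue_on D"
  obtain Cv where Cv: "Cv \<ge> 0" "\<And>\<epsilon>. 0 < \<epsilon> \<Longrightarrow> (\<integral>x. indicator {x. \<psi> x < \<epsilon>} x \<partial>?M) \<le> Cv * \<epsilon>"
    "\<And>\<epsilon>. integrable ?M (\<lambda>x. indicator {x. \<psi> x < \<epsilon>} x :: real)" by (rule strip_integral[OF D(1,2) psi], rule that)
  obtain c e1 where c: "c > 0" "e1 > 0" "\<And>x. x \<in> closure D \<Longrightarrow> \<psi> x < e1 \<Longrightarrow> c \<le> norm (d\<psi> x)"
    by (rule gradient_lower_bound[OF D(1,2) psi], rule that)
  obtain B where B: "B > 0" "\<And>t. \<bar>ramp1 t\<bar> \<le> B" by (rule cut_bound, rule that)
  have C: "C2_with \<psi> d\<psi> dd\<psi>" using psi by (simp add: defining_function_def)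
  note cc = C2_with_cont[OF C, of "closure D"]
  have psi_pos: "\<psi> x > 0" if "x \<in> D" for x using psi that by (simp add: defining_function_def)
  define L0 where "L0 = L_op K \<beta> dd\<psi> d\<psi>"
  define \<kappa> where "\<kappa> x = (K x *v d\<psi> x) \<bullet> d\<psi> x" for x
  define a where "a x = (A x *v d\<psi> x) \<bullet> d\<psi> x" for x
  define \<gamma> where "\<gamma> x = (G x *v d\<psi> x) \<bullet> d\<psi> x" for x
  have L0i: "integrable ?M L0" unfolding L0_def by (rule L_op_integrable_continuous[OF D(1,2) entry_integrable(3) \<beta>_integrable cc(3,2)])
  have ac: "continuous_on (closure D) a" "continuous_on (closure D) \<gamma>"
    unfolding a_def[abs_def] \<gamma>_def[abs_def] quadratic_form_expand by (intro continuous_intros A_cont G_cont cc)+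
  have \<kappa>: "\<kappa> x = \<rho> x * a x - \<gamma> x" for x
    by (simp add: \<kappa>_def a_def \<gamma>_def matrix_vector_mult_diff_rdistrib scaleR_matrix_vector_assoc[symmetric] inner_diff_left)
  have "bounded (\<gamma> ` closure D)" using D(2) ac(2) by (intro compact_imp_bounded compact_continuous_image) auto
  then obtain \<Gamma> where \<Gamma>: "\<Gamma> > 0" "\<And>x. x \<in> closure D \<Longrightarrow> \<bar>\<gamma> x\<bar> \<le> \<Gamma>" by (auto simp: bounded_pos)
  (* 35/2 is the maximum 5/2 of ramp2 times the width 7 of the strip. *)
  define C1 where "C1 = B * (\<integral>x. \<bar>L0 x\<bar> \<partial>?M) + 35/2 * \<Gamma> * Cv"
  define c2 where "c2 = \<theta> * c\<^sup>2"
  have c2: "c2 > 0" using ell(1) c(1) by (simp add: c2_def)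
  have rc: "continuous_on (closure D) (\<lambda>x. ramp1 (\<psi> x / \<epsilon>))" "continuous_on (closure D) (\<lambda>x. ramp2 (\<psi> x / \<epsilon>))" if "\<epsilon> > 0" for \<epsilon>
  proof -
    have s: "continuous_on (closure D) (\<lambda>x. \<psi> x / \<epsilon>)"
      using that by (intro continuous_on_divide continuous_on_const cc(1)) auto
    show "continuous_on (closure D) (\<lambda>x. ramp1 (\<psi> x / \<epsilon>))" "continuous_on (closure D) (\<lambda>x. ramp2 (\<psi> x / \<epsilon>))"
      by (rule continuous_on_compose2[OF cut_continuous(4)[of UNIV] s subset_UNIV] continuous_on_compose2[OF cut_continuous(5)[of UNIV] s subset_UNIV])+
  qed
  have est: "(\<integral>x. in_strip \<epsilon> (\<psi> x) * \<bar>\<rho> x\<bar> \<partial>?M) \<le> (C1 / c2) * \<epsilon>" if \<epsilon>: "0 < \<epsilon>" "\<epsilon> < e1 / 7" for \<epsilon>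
  proof -
    let ?S = "{x \<in> closure D. \<epsilon> \<le> \<psi> x}"
    note S = closed_superlevel[OF D(1) psi \<epsilon>(1)]
    have Sc: "compact ?S" using S(1) D(2) by (metis (no_types, lifting) bounded_closure bounded_subset compact_eq_bounded_closed mem_Collect_eq subsetI)
    have z: "ramp (\<psi> x / \<epsilon>) = 0" if "x \<in> D" "x \<notin> ?S" for x
      using that closure_subset[of D] \<epsilon>(1) by (intro ramp_outside(1)) (auto simp: field_simps)
    note ext = C2_with_extend[OF C2_with_profile[OF C ramp_derivs \<epsilon>(1)] D(1) S z]
    have "0 = integral\<^sup>L ?M (L_op K \<beta> (\<lambda>x. if x \<in> D then (ramp1 (\<psi> x / \<epsilon>) / \<epsilon>) *\<^sub>R dd\<psi> x + (ramp2 (\<psi> x / \<epsilon>) / \<epsilon>\<^sup>2) *\<^sub>R outer (d\<psi> x) (d\<psi> x) else 0)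
          (\<lambda>x. if x \<in> D then (ramp1 (\<psi> x / \<epsilon>) / \<epsilon>) *\<^sub>R d\<psi> x else 0))"
      by (rule weak_equation_C2[OF D(1) entry_integrable(3) \<beta>_integrable equation_K ext Sc S(2), symmetric]) (use z in auto)
    also have "\<dots> = (\<integral>x. (1 / \<epsilon>) * (L0 x * ramp1 (\<psi> x / \<epsilon>) + \<kappa> x * (ramp2 (\<psi> x / \<epsilon>) / \<epsilon>)) \<partial>?M)"
    proof (rule Bochner_Integration.integral_cong[OF refl])
      fix x assume "x \<in> space ?M"
      then have x: "x \<in> D" by simp
      have "L_op K \<beta> (\<lambda>x. if x \<in> D then (ramp1 (\<psi> x / \<epsilon>) / \<epsilon>) *\<^sub>R dd\<psi> x + (ramp2 (\<psi> x / \<epsilon>) / \<epsilon>\<^sup>2) *\<^sub>R outer (d\<psi> x) (d\<psi> x) else 0)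
          (\<lambda>x. if x \<in> D then (ramp1 (\<psi> x / \<epsilon>) / \<epsilon>) *\<^sub>R d\<psi> x else 0) x
        = L_op K \<beta> (\<lambda>x. (ramp1 (\<psi> x / \<epsilon>) / \<epsilon>) *\<^sub>R dd\<psi> x + (ramp2 (\<psi> x / \<epsilon>) / \<epsilon>\<^sup>2) *\<^sub>R outer (d\<psi> x) (d\<psi> x))
          (\<lambda>x. (ramp1 (\<psi> x / \<epsilon>) / \<epsilon>) *\<^sub>R d\<psi> x) x"
        by (rule L_op_cong) (simp_all add: x)
      also have "\<dots> = (ramp1 (\<psi> x / \<epsilon>) / \<epsilon>) * L0 x + (ramp2 (\<psi> x / \<epsilon>) / \<epsilon>\<^sup>2) * \<kappa> x"
        unfolding L0_def \<kappa>_def by (rule L_op_profile)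
      also have "\<dots> = (1 / \<epsilon>) * (L0 x * ramp1 (\<psi> x / \<epsilon>) + \<kappa> x * (ramp2 (\<psi> x / \<epsilon>) / \<epsilon>))"
        by (simp add: add_divide_distrib power2_eq_square algebra_simps)
      finally show "L_op K \<beta> (\<lambda>x. if x \<in> D then (ramp1 (\<psi> x / \<epsilon>) / \<epsilon>) *\<^sub>R dd\<psi> x + (ramp2 (\<psi> x / \<epsilon>) / \<epsilon>\<^sup>2) *\<^sub>R outer (d\<psi> x) (d\<psi> x) else 0)
          (\<lambda>x. if x \<in> D then (ramp1 (\<psi> x / \<epsilon>) / \<epsilon>) *\<^sub>R d\<psi> x else 0) x = (1 / \<epsilon>) * (L0 x * ramp1 (\<psi> x / \<epsilon>) + \<kappa> x * (ramp2 (\<psi> x / \<epsilon>) / \<epsilon>))" .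
    qed
    also have "\<dots> = (1 / \<epsilon>) * (\<integral>x. L0 x * ramp1 (\<psi> x / \<epsilon>) + \<kappa> x * (ramp2 (\<psi> x / \<epsilon>) / \<epsilon>) \<partial>?M)" by simp
    finally have zero: "(\<integral>x. L0 x * ramp1 (\<psi> x / \<epsilon>) + \<kappa> x * (ramp2 (\<psi> x / \<epsilon>) / \<epsilon>) \<partial>?M) = 0" using \<epsilon>(1) by simp
    have i1: "integrable ?M (\<lambda>x. L0 x * ramp1 (\<psi> x / \<epsilon>))" by (rule integrable_mult_closure[OF D(1,2) L0i rc(1)[OF \<epsilon>(1)]])
    have i2: "integrable ?M (\<lambda>x. \<rho> x * (a x * (ramp2 (\<psi> x / \<epsilon>) / \<epsilon>)))"
      using \<epsilon>(1) by (intro integrable_mult_closure[OF D(1,2) \<rho>_integrable] continuous_on_mult continuous_on_divide ac rc continuous_on_const) auto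
    have i3: "integrable ?M (\<lambda>x. 1 * (\<gamma> x * (ramp2 (\<psi> x / \<epsilon>) / \<epsilon>)))"
      using \<epsilon>(1) by (intro integrable_mult_closure[OF D(1,2) one_integrable] continuous_on_mult continuous_on_divide ac rc continuous_on_const) auto
    have "(\<integral>x. L0 x * ramp1 (\<psi> x / \<epsilon>) + \<kappa> x * (ramp2 (\<psi> x / \<epsilon>) / \<epsilon>) \<partial>?M)
      = (\<integral>x. (L0 x * ramp1 (\<psi> x / \<epsilon>) + \<rho> x * (a x * (ramp2 (\<psi> x / \<epsilon>) / \<epsilon>))) - 1 * (\<gamma> x * (ramp2 (\<psi> x / \<epsilon>) / \<epsilon>)) \<partial>?M)"
      by (rule Bochner_Integration.integral_cong[OF refl]) (simp add: \<kappa> algebra_simps)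
    also have "\<dots> = (\<integral>x. L0 x * ramp1 (\<psi> x / \<epsilon>) \<partial>?M) + (\<integral>x. \<rho> x * (a x * (ramp2 (\<psi> x / \<epsilon>) / \<epsilon>)) \<partial>?M) - (\<integral>x. 1 * (\<gamma> x * (ramp2 (\<psi> x / \<epsilon>) / \<epsilon>)) \<partial>?M)"
      by (simp only: Bochner_Integration.integral_diff[OF Bochner_Integration.integrable_add[OF i1 i2] i3] Bochner_Integration.integral_add[OF i1 i2])
    finally have bal: "(\<integral>x. \<rho> x * (a x * (ramp2 (\<psi> x / \<epsilon>) / \<epsilon>)) \<partial>?M) = (\<integral>x. 1 * (\<gamma> x * (ramp2 (\<psi> x / \<epsilon>) / \<epsilon>)) \<partial>?M) - (\<integral>x. L0 x * ramp1 (\<psi> x / \<epsilon>) \<partial>?M)"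
      using zero by simp
    have u1: "- (\<integral>x. L0 x * ramp1 (\<psi> x / \<epsilon>) \<partial>?M) \<le> B * (\<integral>x. \<bar>L0 x\<bar> \<partial>?M)"
    proof -
      have "- (\<integral>x. L0 x * ramp1 (\<psi> x / \<epsilon>) \<partial>?M) \<le> \<bar>\<integral>x. L0 x * ramp1 (\<psi> x / \<epsilon>) \<partial>?M\<bar>" by simp
      also have "\<dots> \<le> (\<integral>x. \<bar>L0 x * ramp1 (\<psi> x / \<epsilon>)\<bar> \<partial>?M)" by (rule integral_abs_bound)
      also have "\<dots> \<le> (\<integral>x. B * \<bar>L0 x\<bar> \<partial>?M)"
      proof (rule integral_mono[OF integrable_abs[OF i1]])
        show "\<bar>L0 x * ramp1 (\<psi> x / \<epsilon>)\<bar> \<le> B * \<bar>L0 x\<bar>" for x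
          using B(2)[of "\<psi> x / \<epsilon>"] by (simp add: abs_mult mult.commute[of B] mult_left_mono)
      qed (use L0i in auto)
      finally show ?thesis by simp
    qed
    have u2: "(\<integral>x. 1 * (\<gamma> x * (ramp2 (\<psi> x / \<epsilon>) / \<epsilon>)) \<partial>?M) \<le> 35/2 * \<Gamma> * Cv"
    proof -
      have "(\<integral>x. 1 * (\<gamma> x * (ramp2 (\<psi> x / \<epsilon>) / \<epsilon>)) \<partial>?M) \<le> (\<integral>x. (\<Gamma> * (5/2) / \<epsilon>) * indicator {x. \<psi> x < 7 * \<epsilon>} x \<partial>?M)"
      proof (rule integral_mono[OF i3])
        show "integrable ?M (\<lambda>x. (\<Gamma> * (5/2) / \<epsilon>) * indicator {x. \<psi> x < 7 * \<epsilon>} x)" using Cv(3) by auto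
        fix x assume "x \<in> space ?M"
        then have x: "x \<in> D" "x \<in> closure D" using closure_subset by auto
        show "1 * (\<gamma> x * (ramp2 (\<psi> x / \<epsilon>) / \<epsilon>)) \<le> (\<Gamma> * (5/2) / \<epsilon>) * indicator {x. \<psi> x < 7 * \<epsilon>} x"
        proof (cases "\<psi> x < 7 * \<epsilon>")
          case True
          have "\<gamma> x * ramp2 (\<psi> x / \<epsilon>) \<le> \<Gamma> * (5/2)"
            using \<Gamma> x(2) ramp2_bounds[of "\<psi> x / \<epsilon>"] by (intro mult_mono) (auto dest: abs_le_D1)
          from divide_right_mono[OF this less_imp_le[OF \<epsilon>(1)]] show ?thesis using True by simp
        next
          case False
          then have "ramp2 (\<psi> x / \<epsilon>) = 0" using \<epsilon>(1) by (intro ramp_outside(4)) (auto simp: field_simps)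
          then show ?thesis using False by simp
        qed
      qed
      also have "\<dots> = (\<Gamma> * (5/2) / \<epsilon>) * (\<integral>x. indicator {x. \<psi> x < 7 * \<epsilon>} x \<partial>?M)" by simp
      also have "\<dots> \<le> (\<Gamma> * (5/2) / \<epsilon>) * (Cv * (7 * \<epsilon>))" using Cv(2)[of "7 * \<epsilon>"] \<Gamma>(1) \<epsilon>(1) by (intro mult_left_mono) auto
      also have "\<dots> = 35/2 * \<Gamma> * Cv" using \<epsilon>(1) by simp
      finally show ?thesis .
    qed
    have "(\<integral>x. (c2 / \<epsilon>) * (in_strip \<epsilon> (\<psi> x) * \<bar>\<rho> x\<bar>) \<partial>?M) \<le> (\<integral>x. \<rho> x * (a x * (ramp2 (\<psi> x / \<epsilon>) / \<epsilon>)) \<partial>?M)"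
    proof (rule integral_mono_AE[OF integrable_mult_right[OF in_strip_integrable[OF integrable_abs[OF \<rho>_integrable]]] i2])
      have "AE x in ?M. x \<in> D" using D(1) by (intro AE_I2) simp
      with pos show "AE x in ?M. (c2 / \<epsilon>) * (in_strip \<epsilon> (\<psi> x) * \<bar>\<rho> x\<bar>) \<le> \<rho> x * (a x * (ramp2 (\<psi> x / \<epsilon>) / \<epsilon>))"
      proof eventually_elim
        case (elim x)
        then have xc: "x \<in> closure D" using closure_subset by auto
        have an: "\<theta> * (norm (d\<psi> x))\<^sup>2 \<le> a x" using ell(2)[OF xc, of "d\<psi> x"] by (simp add: a_def power2_norm_eq_inner)
        then have a0: "0 \<le> a x" using ell(1) by (smt (verit) mult_nonneg_nonneg zero_le_power2)
        show ?case
        proof (cases "in_strip \<epsilon> (\<psi> x) = 0")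
          case True
          then show ?thesis using elim a0 ramp2_bounds(1)[of "\<psi> x / \<epsilon>"] \<epsilon>(1) by simp
        next
          case False
          then have s: "2 * \<epsilon> \<le> \<psi> x" "\<psi> x \<le> 5 * \<epsilon>" "in_strip \<epsilon> (\<psi> x) = 1" by (auto simp: in_strip_def split: if_splits)
          have "c \<le> norm (d\<psi> x)" using c(3)[OF xc] s(2) \<epsilon> by simp
          then have "c\<^sup>2 \<le> (norm (d\<psi> x))\<^sup>2" using c(1) by (intro power_mono) auto
          from mult_left_mono[OF this less_imp_le[OF ell(1)]] have "c2 \<le> a x" using an unfolding c2_def by linarith
          moreover have "1 \<le> ramp2 (\<psi> x / \<epsilon>)" using s \<epsilon>(1) by (intro ramp2_bounds(3)) (auto simp: field_simps)
          ultimately have "c2 * 1 \<le> a x * ramp2 (\<psi> x / \<epsilon>)" using c2 a0 by (intro mult_mono) auto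
          then have "c2 / \<epsilon> \<le> a x * (ramp2 (\<psi> x / \<epsilon>) / \<epsilon>)" using \<epsilon>(1) by (simp add: divide_right_mono)
          then have "\<rho> x * (c2 / \<epsilon>) \<le> \<rho> x * (a x * (ramp2 (\<psi> x / \<epsilon>) / \<epsilon>))" using elim by (intro mult_left_mono) auto
          then show ?thesis using elim by (simp add: s(3) mult.commute)
        qed
      qed
    qed
    then have "(c2 / \<epsilon>) * (\<integral>x. in_strip \<epsilon> (\<psi> x) * \<bar>\<rho> x\<bar> \<partial>?M) \<le> (\<integral>x. \<rho> x * (a x * (ramp2 (\<psi> x / \<epsilon>) / \<epsilon>)) \<partial>?M)"
      by (simp only: integral_mult_right_zero)
    then have "(c2 / \<epsilon>) * (\<integral>x. in_strip \<epsilon> (\<psi> x) * \<bar>\<rho> x\<bar> \<partial>?M) \<le> C1"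
      using bal u1 u2 unfolding C1_def by linarith
    then show ?thesis using c2 \<epsilon>(1) by (simp add: field_simps)
  qed
  show ?thesis using est c(2) by (intro exI[of _ "C1 / c2"] exI[of _ "e1 / 7"]) simp
qed

text \<open>The measures \<open>N1\<close> and \<open>N2\<close> are weak limits of the positive and negative parts of the layer density; they are
  found before \<open>u\<close> is chosen. For a given \<open>u\<close> the function \<open>Q\<close> is extended continuously from the
  frontier, so that both the layer limit and the weak limit apply to it. The density \<open>1 / a\<close> converts \<open>Q\<close>
  into the conormal derivative.\<close>
proposition dirichlet_solution:
  assumes e0: "0 < e0" and strip: "\<And>\<epsilon>. 0 < \<epsilon> \<Longrightarrow> \<epsilon> < e0 \<Longrightarrow> (\<integral>x. in_strip \<epsilon> (\<psi> x) * \<bar>\<rho> x\<bar> \<partial>lebesgue_on D) \<le> C1 * \<epsilon>"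
  shows "\<exists>\<eta>. signed_measure_on (restrict_space borel (frontier D)) \<eta> \<and> solves_dirichlet p D A b G h \<eta> \<rho>"
proof -
  let ?M = "lebesgue_on D"
  let ?R = "restrict_space borel (frontier D)"
  have C: "C2_with \<psi> d\<psi> dd\<psi>" using psi by (simp add: defining_function_def)
  note cc = C2_with_cont[OF C, of "closure D"]
  have fsub: "frontier D \<subseteq> closure D" by (auto simp: frontier_def)
  define \<epsilon> where "\<epsilon> k = e0 / (real k + 2)" for k
  have \<epsilon>: "0 < \<epsilon> k" "\<epsilon> k < e0" for k using e0 by (auto simp: \<epsilon>_def field_simps add_pos_nonneg)
  have \<epsilon>l: "\<epsilon> \<longlonglongrightarrow> 0" unfolding \<epsilon>_def using LIMSEQ_ignore_initial_segment[OF lim_const_over_n[of e0], of 2] by (simp add: add.commute)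
  obtain a0 where a0: "a0 > 0" "\<And>x. x \<in> closure D \<Longrightarrow> entry_sum (A x) \<le> a0" by (rule entry_sum_closure_bound[OF D(2) A_cont], rule that)
  obtain g0 where g0: "g0 > 0" "\<And>x. x \<in> closure D \<Longrightarrow> entry_sum (G x) \<le> g0" by (rule entry_sum_closure_bound[OF D(2) G_cont], rule that)
  obtain Cv where Cv: "Cv \<ge> 0" "\<And>\<epsilon>. 0 < \<epsilon> \<Longrightarrow> (\<integral>x. indicator {x. \<psi> x < \<epsilon>} x \<partial>?M) \<le> Cv * \<epsilon>"
    "\<And>\<epsilon>. integrable ?M (\<lambda>x. indicator {x. \<psi> x < \<epsilon>} x :: real)" by (rule strip_integral[OF D(1,2) psi], rule that)
  define C0 where "C0 = a0 * C1 + g0 * Cv * 7"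
  have esi: "integrable ?M (\<lambda>x. entry_sum (K x))"
    unfolding entry_sum_def by (intro Bochner_Integration.integrable_sum integrable_abs entry_integrable)
  have stripK: "(\<integral>x. in_strip (\<epsilon> k) (\<psi> x) * entry_sum (K x) \<partial>?M) \<le> C0 * \<epsilon> k" for k
  proof -
    note ri = in_strip_integrable[OF integrable_abs[OF \<rho>_integrable]]
    have "(\<integral>x. in_strip (\<epsilon> k) (\<psi> x) * entry_sum (K x) \<partial>?M)
       \<le> (\<integral>x. a0 * (in_strip (\<epsilon> k) (\<psi> x) * \<bar>\<rho> x\<bar>) + g0 * indicator {x. \<psi> x < 7 * \<epsilon> k} x \<partial>?M)"
    proof (rule integral_mono[OF in_strip_integrable[OF esi]])
      show "integrable ?M (\<lambda>x. a0 * (in_strip (\<epsilon> k) (\<psi> x) * \<bar>\<rho> x\<bar>) + g0 * indicator {x. \<psi> x < 7 * \<epsilon> k} x)"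
        using ri[of "\<epsilon> k"] Cv(3)[of "7 * \<epsilon> k"] by auto
      fix x assume "x \<in> space ?M"
      then have x: "x \<in> closure D" using closure_subset by auto
      have "entry_sum (K x) \<le> \<bar>\<rho> x\<bar> * a0 + g0"
        using entry_sum_diff_scale[of "\<rho> x" "A x" "G x"] a0(2)[OF x] g0(2)[OF x] mult_left_mono[of "entry_sum (A x)" a0 "\<bar>\<rho> x\<bar>"] by linarith
      then have "in_strip (\<epsilon> k) (\<psi> x) * entry_sum (K x) \<le> in_strip (\<epsilon> k) (\<psi> x) * (\<bar>\<rho> x\<bar> * a0 + g0)"
        by (intro mult_left_mono) (auto simp: in_strip_def)
      also have "\<dots> \<le> a0 * (in_strip (\<epsilon> k) (\<psi> x) * \<bar>\<rho> x\<bar>) + g0 * indicator {x. \<psi> x < 7 * \<epsilon> k} x"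
        using in_strip_le[OF \<epsilon>(1), of k x] g0(1) mult_left_mono[OF in_strip_le[OF \<epsilon>(1), of k x], of g0] by (simp add: algebra_simps)
      finally show "in_strip (\<epsilon> k) (\<psi> x) * entry_sum (K x) \<le> a0 * (in_strip (\<epsilon> k) (\<psi> x) * \<bar>\<rho> x\<bar>) + g0 * indicator {x. \<psi> x < 7 * \<epsilon> k} x" .
    qed
    also have "\<dots> = a0 * (\<integral>x. in_strip (\<epsilon> k) (\<psi> x) * \<bar>\<rho> x\<bar> \<partial>?M) + g0 * (\<integral>x. indicator {x. \<psi> x < 7 * \<epsilon> k} x \<partial>?M)"
      using ri[of "\<epsilon> k"] Cv(3)[of "7 * \<epsilon> k"] by simp
    also have "\<dots> \<le> a0 * (C1 * \<epsilon> k) + g0 * (Cv * (7 * \<epsilon> k))"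
      using a0 g0 \<epsilon>[of k] Cv(2)[of "7 * \<epsilon> k"] by (intro add_mono mult_left_mono strip) auto
    finally show ?thesis by (simp add: C0_def algebra_simps)
  qed
  obtain B where B: "B > 0" "\<And>t. \<bar>cut1 t\<bar> \<le> B" "\<And>t. \<bar>cut2 t\<bar> \<le> B" by (rule cut_bound, rule that)
  have "bounded (d\<psi> ` closure D)" using cc(2) D(2) by (intro compact_imp_bounded compact_continuous_image) auto
  then obtain Bg where Bg: "Bg > 0" "\<And>x. x \<in> closure D \<Longrightarrow> norm (d\<psi> x) \<le> Bg" by (auto simp: bounded_pos)
  (* Its L1 norm is bounded: the strip estimate for K compensates the factor 1 / \<epsilon>. *)
  define m where "m k = layer_density K \<psi> d\<psi> (\<epsilon> k)" for k
  have m_zero: "m k x = 0" if "in_strip (\<epsilon> k) (\<psi> x) = 0" for k x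
    using profile_zero[OF \<epsilon>(1) that] by (simp add: m_def layer_density_def)
  have m_int: "integrable ?M (m k)" for k
  proof -
    have \<kappa>i: "integrable ?M (\<lambda>x. (K x *v d\<psi> x) \<bullet> d\<psi> x)" by (rule quadratic_form_integrable[OF D(1,2) entry_integrable(3) cc(2) cc(2)])
    have s: "continuous_on (closure D) (\<lambda>x. \<psi> x / \<epsilon> k)"
      using \<epsilon>(1)[of k] by (intro continuous_on_divide continuous_on_const cc(1)) auto
    have "continuous_on (closure D) (\<lambda>x. (2 * cut1 (\<psi> x / \<epsilon> k) + (\<psi> x / \<epsilon> k) * cut2 (\<psi> x / \<epsilon> k)) / \<epsilon> k)"
      using \<epsilon>(1)[of k]
      by (intro continuous_on_divide[OF _ continuous_on_const] continuous_on_add continuous_on_mult continuous_on_const s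
          continuous_on_compose2[OF cut_continuous(2)[of UNIV] s subset_UNIV] continuous_on_compose2[OF cut_continuous(3)[of UNIV] s subset_UNIV]) auto
    from integrable_mult_closure[OF D(1,2) \<kappa>i this] show ?thesis unfolding m_def layer_density_def[abs_def] by (simp add: mult.commute)
  qed
  have m_bound: "(\<integral>x. \<bar>m k x\<bar> \<partial>?M) \<le> 7 * B * Bg\<^sup>2 * C0" for k
  proof -
    have "(\<integral>x. \<bar>m k x\<bar> \<partial>?M) \<le> (\<integral>x. (7 * B * Bg\<^sup>2 / \<epsilon> k) * (in_strip (\<epsilon> k) (\<psi> x) * entry_sum (K x)) \<partial>?M)"
    proof (rule integral_mono[OF integrable_abs[OF m_int]])
      show "integrable ?M (\<lambda>x. (7 * B * Bg\<^sup>2 / \<epsilon> k) * (in_strip (\<epsilon> k) (\<psi> x) * entry_sum (K x)))"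
        using in_strip_integrable[OF esi, of "\<epsilon> k"] by auto
      fix x assume "x \<in> space ?M"
      then have x: "x \<in> closure D" using closure_subset by auto
      show "\<bar>m k x\<bar> \<le> (7 * B * Bg\<^sup>2 / \<epsilon> k) * (in_strip (\<epsilon> k) (\<psi> x) * entry_sum (K x))"
      proof (cases "in_strip (\<epsilon> k) (\<psi> x) = 0")
        case True then show ?thesis using m_zero[OF True] by simp
      next
        case False
        then have s: "2 * \<epsilon> k \<le> \<psi> x" "\<psi> x \<le> 5 * \<epsilon> k" "in_strip (\<epsilon> k) (\<psi> x) = 1" by (auto simp: in_strip_def split: if_splits)
        let ?t = "\<psi> x / \<epsilon> k"
        have t: "0 \<le> ?t" "?t \<le> 5" using s \<epsilon>(1)[of k] by (auto simp: field_simps)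
        have tc: "\<bar>?t * cut2 ?t\<bar> = ?t * \<bar>cut2 ?t\<bar>" by (simp only: abs_mult abs_of_nonneg[OF t(1)])
        have "\<bar>2 * cut1 ?t + ?t * cut2 ?t\<bar> \<le> 2 * \<bar>cut1 ?t\<bar> + ?t * \<bar>cut2 ?t\<bar>"
          using abs_triangle_ineq[of "2 * cut1 ?t" "?t * cut2 ?t"] unfolding tc abs_mult[of 2 "cut1 ?t"] abs_numeral .
        also have "\<dots> \<le> 2 * B + 5 * B" using B t by (intro add_mono mult_left_mono mult_mono) auto
        finally have 1: "\<bar>2 * cut1 ?t + ?t * cut2 ?t\<bar> \<le> 7 * B" by simp
        have "\<bar>(K x *v d\<psi> x) \<bullet> d\<psi> x\<bar> \<le> entry_sum (K x) * (norm (d\<psi> x) * norm (d\<psi> x))" by (rule quadratic_form_bound)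
        also have "\<dots> \<le> entry_sum (K x) * (Bg * Bg)" using Bg x entry_sum_nonneg by (intro mult_left_mono mult_mono) auto
        finally have 2: "\<bar>(K x *v d\<psi> x) \<bullet> d\<psi> x\<bar> \<le> entry_sum (K x) * Bg\<^sup>2" by (simp add: power2_eq_square)
        have "\<bar>m k x\<bar> = \<bar>2 * cut1 ?t + ?t * cut2 ?t\<bar> / \<epsilon> k * \<bar>(K x *v d\<psi> x) \<bullet> d\<psi> x\<bar>"
          using \<epsilon>(1)[of k] by (simp add: m_def layer_density_def abs_mult)
        also have "\<dots> \<le> (7 * B) / \<epsilon> k * (entry_sum (K x) * Bg\<^sup>2)"
          using 1 2 \<epsilon>(1)[of k] B(1) by (intro mult_mono divide_right_mono) auto
        finally show ?thesis by (simp add: s(3) ac_simps)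
      qed
    qed
    also have "\<dots> = (7 * B * Bg\<^sup>2 / \<epsilon> k) * (\<integral>x. in_strip (\<epsilon> k) (\<psi> x) * entry_sum (K x) \<partial>?M)" by simp
    also have "\<dots> \<le> (7 * B * Bg\<^sup>2 / \<epsilon> k) * (C0 * \<epsilon> k)" using B(1) \<epsilon>(1)[of k] by (intro mult_left_mono stripK) auto
    also have "\<dots> = 7 * B * Bg\<^sup>2 * C0" using \<epsilon>(1)[of k] by simp
    finally show ?thesis .
  qed
  have m_supp: "\<psi> x \<le> 5 * \<epsilon> k" if "x \<in> D" "m k x \<noteq> 0" for k x
  proof (rule ccontr)
    assume "\<not> \<psi> x \<le> 5 * \<epsilon> k"
    then have "in_strip (\<epsilon> k) (\<psi> x) = 0" by (simp add: in_strip_def)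
    then show False using m_zero that(2) by blast
  qed
  obtain r N1 N2 where r: "strict_mono r" and N: "finite_measure N1" "finite_measure N2" "sets N1 = sets ?R" "sets N2 = sets ?R"
    and Nlim: "\<And>f. continuous_on UNIV f \<Longrightarrow> (\<lambda>k. \<integral>x. f x * m (r k) x \<partial>?M) \<longlonglongrightarrow> (\<integral>x. f x \<partial>N1) - (\<integral>x. f x \<partial>N2)"
    by (rule boundary_limit_measures[OF D(1,2) psi m_int m_bound m_supp \<epsilon>l], assumption, assumption, rule that)
  have fc: "compact (frontier D)" using D(2) by (rule compact_frontier_bounded)
  define a where "a x = (A x *v d\<psi> x) \<bullet> d\<psi> x / norm (d\<psi> x)" for x
  have dn: "d\<psi> x \<noteq> 0" if "x \<in> frontier D" for x using psi that by (simp add: defining_function_def)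
  have a_pos: "0 < a x" if "x \<in> frontier D" for x
  proof -
    have "0 < \<theta> * (d\<psi> x \<bullet> d\<psi> x)" using ell(1) dn[OF that] by simp
    then have "0 < (A x *v d\<psi> x) \<bullet> d\<psi> x" using ell(2)[of x "d\<psi> x"] that fsub by (meson order_less_le_trans subsetD)
    then show ?thesis using dn[OF that] by (simp add: a_def)
  qed
  have cF: "continuous_on (frontier D) A" "continuous_on (frontier D) d\<psi>"
    using A_cont cc(2) fsub by (auto intro: continuous_on_subset)
  have qc: "continuous_on S (\<lambda>x. (A x *v u x) \<bullet> v x)" if "continuous_on S A" "continuous_on S u" "continuous_on S v" for S u v
    unfolding quadratic_form_expand by (intro continuous_intros that)
  have ac: "continuous_on (frontier D) a" unfolding a_def[abs_def]
    using dn by (intro continuous_on_divide qc cF continuous_on_norm) auto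
  have spN: "space N1 = frontier D" "space N2 = frontier D"
    using sets_eq_imp_space_eq[OF N(3)] sets_eq_imp_space_eq[OF N(4)] by (auto simp: space_restrict_space)
  have measR: "f \<in> borel_measurable ?R" if "continuous_on (frontier D) f" for f :: "real^'n \<Rightarrow> real"
    using that by (rule borel_measurable_continuous_on_restrict)
  have ia_m: "(\<lambda>x. 1 / a x) \<in> borel_measurable ?R"
    using a_pos by (intro measR continuous_on_divide continuous_on_const ac) force
  define W where "W N = density N (\<lambda>x. ennreal (1 / a x))" for N :: "(real^'n) measure"
  have W: "finite_measure (W N)" "sets (W N) = sets ?R" if NN: "finite_measure N" "sets N = sets ?R" for N
  proof -
    interpret finite_measure N by fact
    have sp: "space N = frontier D" using sets_eq_imp_space_eq[OF NN(2)] by (simp add: space_restrict_space)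
    have mN: "(\<lambda>x. 1 / a x) \<in> borel_measurable N" using ia_m measurable_cong_sets[OF NN(2) refl] by blast
    have "continuous_on (frontier D) (\<lambda>x. 1 / a x)" using a_pos by (intro continuous_on_divide continuous_on_const ac) force
    then have "bounded ((\<lambda>x. 1 / a x) ` frontier D)" by (intro compact_imp_bounded compact_continuous_image fc)
    then obtain b0 where "\<And>x. x \<in> frontier D \<Longrightarrow> \<bar>1 / a x\<bar> \<le> b0" by (auto simp: bounded_iff)
    then have "integrable N (\<lambda>x. 1 / a x)" using mN sp by (intro integrable_const_bound[where B=b0]) auto
    then have "(\<integral>\<^sup>+x. ennreal (1 / a x) \<partial>N) < \<infinity>"
      using a_pos sp by (subst nn_integral_eq_integral) (auto simp: less_imp_le)
    then show "finite_measure (W N)"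
      unfolding W_def using mN by (intro finite_measureI) (simp add: emeasure_density nn_integral_set_ennreal[symmetric] cong: nn_integral_cong_simp)
    show "sets (W N) = sets ?R" using NN(2) by (simp add: W_def)
  qed
  let ?\<eta> = "\<lambda>S. measure (W N1) S - measure (W N2) S"
  have "signed_measure_on ?R ?\<eta>" by (rule signed_measure_diff[OF W(1)[OF N(1,3)] W(1)[OF N(2,4)] W(2)[OF N(1,3)] W(2)[OF N(2,4)]])
  moreover have "solves_dirichlet p D A b G h ?\<eta> \<rho>"
    unfolding solves_dirichlet_def
  proof (intro conjI allI impI)
    show "\<rho> \<in> Lp (p / (p - 1)) D" using \<rho> q by simp
    fix u Du H
    assume as: "u \<in> sobolev_Wp2 p D \<and> weak_hessian D u H \<and> C1_closure D u Du \<and> (\<forall>x\<in>frontier D. u x = 0)"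
    then have u: "C1_closure D u Du" "\<And>x. x \<in> frontier D \<Longrightarrow> u x = 0" and H: "weak_hessian D u H" by auto
    have Du_c: "continuous_on (closure D) Du" using u(1) by (simp add: C1_closure_def)
    (* H is an arbitrary weak Hessian, while the Sobolev space only provides some weak derivatives in
       the space; the two agree almost everywhere. *)
    have HL: "(\<lambda>x. H x $ i $ j) \<in> Lp p D" for i j
    proof -
      have w1: "weak_deriv D [i, j] u (\<lambda>x. H x $ i $ j)" using H by (simp add: weak_hessian_def)
      have "length [i, j] = 1 \<or> length [i, j] = 2" by simp
      then obtain v where v: "v \<in> Lp p D" "weak_deriv D [i, j] u v" using as unfolding sobolev_Wp2_def by blast
      have vm: "v \<in> borel_measurable ?M" "integrable ?M (\<lambda>x. \<bar>v x\<bar> powr p)" using v(1) unfolding Lp_def by blast+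
      have ae: "AE x in ?M. H x $ i $ j = v x" by (rule weak_deriv_unique[OF D(1) w1 v(2)])
      have Hm: "(\<lambda>x. H x $ i $ j) \<in> borel_measurable ?M" using w1 by (simp add: weak_deriv_def Lp_loc_def)
      have "integrable ?M (\<lambda>x. \<bar>H x $ i $ j\<bar> powr p) \<longleftrightarrow> integrable ?M (\<lambda>x. \<bar>v x\<bar> powr p)"
      proof (rule integrable_cong_AE)
        show "(\<lambda>x. \<bar>H x $ i $ j\<bar> powr p) \<in> borel_measurable ?M" by (rule measurable_abs_powr[OF Hm])
        show "(\<lambda>x. \<bar>v x\<bar> powr p) \<in> borel_measurable ?M" by (rule measurable_abs_powr[OF vm(1)])
        show "AE x in ?M. \<bar>H x $ i $ j\<bar> powr p = \<bar>v x\<bar> powr p" using ae by eventually_elim simp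
      qed
      then show ?thesis using Hm vm(2) unfolding Lp_def by blast
    qed
    (* The normal derivative in units of d\<psi>, first on the frontier only. *)
    define Q0 where "Q0 x = (Du x \<bullet> d\<psi> x) / (d\<psi> x \<bullet> d\<psi> x)" for x
    have "continuous_on (frontier D) Q0" unfolding Q0_def[abs_def]
      using dn by (intro continuous_on_divide continuous_on_inner cF(2) continuous_on_subset[OF Du_c fsub]) auto
    then obtain Q where Q: "continuous_on UNIV Q" "\<And>x. x \<in> frontier D \<Longrightarrow> Q x = Q0 x"
      by (rule Tietze_unbounded[of "frontier D" Q0 UNIV]) (auto intro: that)
    have DuQ: "Du x = Q x *\<^sub>R d\<psi> x" if "x \<in> frontier D" for x
      using boundary_gradient_parallel[OF D(1,3) that psi u] Q(2)[OF that] by (simp add: Q0_def)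
    have "(\<lambda>k. \<integral>x. Q x * m k x \<partial>?M) \<longlonglongrightarrow> - integral\<^sup>L ?M (L_op K \<beta> H Du)"
      unfolding m_def
      by (rule boundary_layer_limit[OF D psi p q K_Lp K_sym \<beta>_integrable equation_K u H HL continuous_on_subset[OF Q(1) subset_UNIV] DuQ \<epsilon>(1) \<epsilon>l stripK])
    then have "(\<lambda>k. \<integral>x. Q x * m (r k) x \<partial>?M) \<longlonglongrightarrow> - integral\<^sup>L ?M (L_op K \<beta> H Du)"
      by (rule filterlim_compose[OF _ filterlim_subseq[OF r]])
    from LIMSEQ_unique[OF this Nlim[OF Q(1)]] have F: "integral\<^sup>L ?M (L_op K \<beta> H Du) = - ((\<integral>x. Q x \<partial>N1) - (\<integral>x. Q x \<partial>N2))" by simp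
    let ?g = "\<lambda>x. (A x *v Du x) \<bullet> outer_unit_normal D x"
    have g_eq: "?g x = - Q x * a x" if x: "x \<in> frontier D" for x
    proof -
      have "outer_unit_normal D x = - ((1 / norm (d\<psi> x)) *\<^sub>R d\<psi> x)"
        using outer_unit_normal_eq[OF D(1,3) x psi] by (simp add: sgn_div_norm divide_inverse)
      then show ?thesis by (simp add: DuQ[OF x] a_def matrix_vector_mult_scaleR)
    qed
    have gc: "continuous_on (frontier D) ?g"
    proof (rule continuous_on_eq)
      show "continuous_on (frontier D) (\<lambda>x. - Q x * a x)" by (intro continuous_intros ac continuous_on_subset[OF Q(1)]) auto
    qed (use g_eq in simp)
    have "bounded (?g ` frontier D)" by (intro compact_imp_bounded compact_continuous_image gc fc)
    then obtain Bb where Bb: "\<And>x. x \<in> frontier D \<Longrightarrow> \<bar>?g x\<bar> \<le> Bb" by (auto simp: bounded_iff)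
    have "signed_integral ?R ?\<eta> ?g = (\<integral>x. ?g x \<partial>W N1) - (\<integral>x. ?g x \<partial>W N2)"
      by (rule signed_integral_diff[OF W(1)[OF N(1,3)] W(1)[OF N(2,4)] W(2)[OF N(1,3)] W(2)[OF N(2,4)] measR[OF gc], of Bb])
        (use Bb in \<open>simp add: space_restrict_space\<close>)
    moreover have "(\<integral>x. ?g x \<partial>W N) = - (\<integral>x. Q x \<partial>N)" if NN: "sets N = sets ?R" for N
    proof -
      have sp: "space N = frontier D" using sets_eq_imp_space_eq[OF NN] by (simp add: space_restrict_space)
      have mN: "borel_measurable N = (borel_measurable ?R :: (real^'n \<Rightarrow> real) set)" by (rule measurable_cong_sets[OF NN refl])
      have "(\<integral>x. ?g x \<partial>W N) = (\<integral>x. (1 / a x) *\<^sub>R ?g x \<partial>N)"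
        unfolding W_def using measR[OF gc] ia_m mN a_pos sp by (intro integral_density AE_I2) (auto intro: less_imp_le)
      also have "\<dots> = (\<integral>x. - Q x \<partial>N)"
      proof (rule Bochner_Integration.integral_cong[OF refl])
        fix x assume "x \<in> space N"
        then have x: "x \<in> frontier D" using sp by simp
        then show "(1 / a x) *\<^sub>R ?g x = - Q x" using a_pos[OF x] unfolding g_eq[OF x] by simp
      qed
      finally show ?thesis by simp
    qed
    ultimately have sg: "signed_integral ?R ?\<eta> ?g = integral\<^sup>L ?M (L_op K \<beta> H Du)" using F N by simp
    have 1: "integrable ?M (\<lambda>x. L_op A b H Du x * \<rho> x)"
      unfolding L_op_\<rho> by (rule L_op_integrable[OF D(1,2) p q \<rho>A_Lp \<rho>b_integrable HL Du_c])
    have 2: "integrable ?M (L_op G h H Du)" by (rule L_op_integrable[OF D(1,2) p q G_Lp h HL Du_c])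
    have "integral\<^sup>L ?M (L_op K \<beta> H Du) = (\<integral>x. L_op A b H Du x * \<rho> x - L_op G h H Du x \<partial>?M)"
      by (rule Bochner_Integration.integral_cong[OF refl]) (rule L_op_K)
    also have "\<dots> = (\<integral>x. L_op A b H Du x * \<rho> x \<partial>?M) - integral\<^sup>L ?M (L_op G h H Du)" using 1 2 by simp
    finally show "(\<integral>x. L_op A b H Du x * \<rho> x \<partial>?M) = integral\<^sup>L ?M (L_op G h H Du) + signed_integral ?R ?\<eta> ?g"
      using sg by simp
  qed
  ultimately show ?thesis by blast
qed

end

lemma Lp_subset:
  assumes f: "f \<in> Lp s S" and "D \<subseteq> S" "D \<in> sets lebesgue" "S \<in> sets lebesgue"
  shows "f \<in> Lp s D"
proof -
  have fm: "f \<in> borel_measurable (lebesgue_on S)" "integrable (lebesgue_on S) (\<lambda>x. \<bar>f x\<bar> powr s)"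
    using f unfolding Lp_def by blast+
  have "f \<in> borel_measurable (lebesgue_on D)" by (rule measurable_restrict_mono[OF fm(1) assms(2)])
  moreover have "set_integrable lebesgue S (\<lambda>x. \<bar>f x\<bar> powr s)"
    using fm(2) assms(4) by (simp add: set_integrable_def integrable_restrict_space)
  then have "set_integrable lebesgue D (\<lambda>x. \<bar>f x\<bar> powr s)" by (rule set_integrable_subset) (use assms in auto)
  then have "integrable (lebesgue_on D) (\<lambda>x. \<bar>f x\<bar> powr s)"
    using assms(3) by (simp add: set_integrable_def integrable_restrict_space)
  ultimately show ?thesis by (simp add: Lp_def)
qed

lemma matrix_le_mat_quadratic: "matrix_le (mat t) S \<Longrightarrow> t * (v \<bullet> v) \<le> (S *v v) \<bullet> v"
proof -
  assume "matrix_le (mat t) S"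
  then have "v \<bullet> (mat t *v v) \<le> v \<bullet> (S *v v)" by (simp add: matrix_le_def)
  moreover have "mat t *v v = t *\<^sub>R v"
    by (simp add: matrix_vector_mult_def mat_def vec_eq_iff if_distrib[where f="\<lambda>x. x * _"] cong: if_cong)
  ultimately show ?thesis by (simp add: inner_commute)
qed

theorem theorem2p3:
  fixes \<Omega> D :: "(real^'n::finite) set"
    and A G :: "real^'n \<Rightarrow> real^'n^'n"
    and b h :: "real^'n \<Rightarrow> real^'n"
    and p :: real
    and \<rho> :: "real^'n \<Rightarrow> real"
  assumes "open \<Omega>" and "\<Omega> \<noteq> {}"
    and "admissible_coeffs \<Omega> A b" and "admissible_coeffs \<Omega> G h"
    and "cond_H1 \<Omega> A"
    and "cond_H2 \<Omega> A"
    and "p > real CARD('n)" and "cond_H3 p \<Omega> b G h"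
    and "\<forall>i j. continuous_on \<Omega> (\<lambda>x. G x $ i $ j)"
    and "open D" and "connected D" and "D \<noteq> {}" and "bounded D"
    and "C2_boundary D" and "closure D \<subseteq> \<Omega>"
    and "\<rho> \<in> Lp (p / (p - 1)) D"
    and "solves_equation D A b G h \<rho>"
  shows "((AE x in lebesgue_on D. \<rho> x \<ge> 0) \<longrightarrow>
            (\<exists>\<eta>. signed_measure_on (restrict_space borel (frontier D)) \<eta> \<and>
                 solves_dirichlet p D A b G h \<eta> \<rho>))
       \<and> (\<rho> \<in> Linfty D \<longrightarrow>
            (\<exists>\<eta>. signed_measure_on (restrict_space borel (frontier D)) \<eta> \<and>
                 solves_dirichlet p D A b G h \<eta> \<rho>))"
proof -
  have "1 \<le> real CARD('n)" by (simp add: Suc_leI)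
  then have p1: "p > 1" using \<open>p > real CARD('n)\<close> by linarith
  obtain \<psi> g dd where psi: "defining_function D \<psi> g dd"
    by (rule defining_function_exists[OF \<open>open D\<close> \<open>bounded D\<close> \<open>C2_boundary D\<close>], rule that)
  obtain \<theta> where \<theta>: "\<theta> > 0" "\<And>x. x \<in> \<Omega> \<Longrightarrow> matrix_le (mat \<theta>) (A x)"
    using \<open>cond_H2 \<Omega> A\<close> by (auto simp: cond_H2_def)
  have clc: "compact (closure D)" using \<open>bounded D\<close> by simp
  have meas: "D \<in> sets lebesgue" "closure D \<in> sets lebesgue" using \<open>open D\<close> by auto
  have mc: "continuous_on (closure D) M" if "\<forall>i j. continuous_on \<Omega> (\<lambda>x. M x $ i $ j)" for M :: "real^'n \<Rightarrow> real^'n^'n"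
  proof -
    have "continuous_on \<Omega> (\<lambda>x. \<chi> i. \<chi> j. M x $ i $ j)" using that by (intro continuous_on_vec_lambda) auto
    then show ?thesis using \<open>closure D \<subseteq> \<Omega>\<close> by (simp add: continuous_on_subset)
  qed
  have loc: "f \<in> Lp s D" if "f \<in> Lp_loc s \<Omega>" for f s
    by (rule Lp_subset[OF _ closure_subset meas]) (use that clc \<open>closure D \<subseteq> \<Omega>\<close> in \<open>auto simp: Lp_loc_def\<close>)
  interpret dirichlet_data D A G b h p "p / (p - 1)" \<theta> \<rho> \<psi> g dd
  proof
    show "continuous_on (closure D) A" "continuous_on (closure D) G"
      using \<open>cond_H1 \<Omega> A\<close> \<open>\<forall>i j. continuous_on \<Omega> (\<lambda>x. G x $ i $ j)\<close> by (auto intro!: mc simp: cond_H1_def)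
    show "transpose (A x) = A x" "transpose (G x) = G x" if "x \<in> closure D" for x
      using that \<open>closure D \<subseteq> \<Omega>\<close> \<open>admissible_coeffs \<Omega> A b\<close> \<open>admissible_coeffs \<Omega> G h\<close> by (auto simp: admissible_coeffs_def)
    show "\<theta> * (v \<bullet> v) \<le> (A x *v v) \<bullet> v" if "x \<in> closure D" for x v
      using that \<open>closure D \<subseteq> \<Omega>\<close> by (intro matrix_le_mat_quadratic \<theta>(2)) auto
    show "(\<lambda>x. b x $ i) \<in> Lp p D" for i using \<open>cond_H3 p \<Omega> b G h\<close> by (intro loc) (simp add: cond_H3_def)
    show "integrable (lebesgue_on D) (\<lambda>x. h x $ i)" for i
      using \<open>cond_H3 p \<Omega> b G h\<close> \<open>open D\<close> \<open>bounded D\<close> by (intro Lp_integrable[of _ 1] loc lmeasurable_open) (simp_all add: cond_H3_def)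
    show "integral\<^sup>L (lebesgue_on D) (\<lambda>x. L_op A b (hessian u) (gradient u) x * \<rho> x)
          = integral\<^sup>L (lebesgue_on D) (L_op G h (hessian u) (gradient u))" if "test_fun D u" for u
      using that \<open>solves_equation D A b G h \<rho>\<close> by (simp add: solves_equation_def)
  qed (use assms p1 psi \<theta> in auto)
  show ?thesis
  proof (intro conjI impI)
    assume "AE x in lebesgue_on D. \<rho> x \<ge> 0"
    from strip_nonneg_density[OF this] obtain C e0 where "0 < e0"
      "\<And>\<epsilon>. 0 < \<epsilon> \<Longrightarrow> \<epsilon> < e0 \<Longrightarrow> (\<integral>x. in_strip \<epsilon> (\<psi> x) * \<bar>\<rho> x\<bar> \<partial>lebesgue_on D) \<le> C * \<epsilon>" by blast
    then show "\<exists>\<eta>. signed_measure_on (restrict_space borel (frontier D)) \<eta> \<and> solves_dirichlet p D A b G h \<eta> \<rho>"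
      by (rule dirichlet_solution)
  next
    assume "\<rho> \<in> Linfty D"
    then obtain M where "AE x in lebesgue_on D. \<bar>\<rho> x\<bar> \<le> M" by (auto simp: Linfty_def)
    from strip_bounded_density[OF this] obtain C where
      "\<And>\<epsilon>. 0 < \<epsilon> \<Longrightarrow> (\<integral>x. in_strip \<epsilon> (\<psi> x) * \<bar>\<rho> x\<bar> \<partial>lebesgue_on D) \<le> C * \<epsilon>" by blast
    then show "\<exists>\<eta>. signed_measure_on (restrict_space borel (frontier D)) \<eta> \<and> solves_dirichlet p D A b G h \<eta> \<rho>"
      by (intro dirichlet_solution[of 1 C]) auto
  qed
qed

end
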